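(* Assume the hard constraint, drift and source assumption, the initial data assumption, the hard constraint restriction, and the congestion condition described in the context. Let $(\varrho_\infty,p_\infty)$ be the limit of $(\varrho_k,p_k)$ in $L^1(Q_T)$ as $k\to\infty$. Then the limiting normalized density $v_\infty=\varrho_\infty/m$ is non-decreasing along streamlines for $t>0$: for a.e. $x_0\in\mathbb{R}^d$ and a.e. $t_1,t_2$ with $0<t_1<t_2<T$, $$v_\infty(X(t_1,x_0),t_1)\le v_\infty(X(t_2,x_0),t_2).$$
   Context: Fix $d\ge 1$, $T>0$, and let $Q_T=\mathbb{R}^d\times(0,T)$. The operators $\nabla$, $\nabla\cdot$ act in the space variables only. Hard constraint, drift and source assumption: $m,f:Q_T\to\mathbb{R}$ and $\vec b:Q_T\to\mathbb{R}^d$ are in $C^\infty(Q_T)$ with bounded derivatives of all orders (order zero included), so that they extend smoothly to $\mathbb{R}^d\times[0,T]$, and there is $\delta>0$ with $m(x,t)\ge\delta$. Initial data assumption: for each $k>1$, $\varrho_k^{(0)}\in W^{1,1}(\mathbb{R}^d)$, $\varrho_k^{(0)}\ge 0$ a.e.; put $p_k^{(0)}=\frac{k}{k-1}\left(\varrho_k^{(0)}/m(\cdot,0)\right)^{k-1}$. There are a compact $K\subset\mathbb{R}^d$ and a constant $C$ with $\operatorname{supp}\varrho_k^{(0)}\subset K$, $\|\varrho_k^{(0)}\|_{L^\infty}\le C$, $\|\varrho_k^{(0)}\|_{W^{1,1}}\le C$, $\|p_k^{(0)}\|_{L^\infty}\le C$ for all $k>1$. There is $\varrho_\infty^{(0)}$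 with $\varrho_k^{(0)}\to\varrho_\infty^{(0)}$ in $L^1(\mathbb{R}^d)$ as $k\to\infty$. Hard constraint restriction: at least one of the following holds: $m$ is radial in space, $m(x,t)=m(|x|,t)$; or $d=1$; or there is $R>0$ such that $|\nabla m(x,t)|\le\varepsilon/|x|$ for $|x|\ge R$, where $\varepsilon=\varepsilon(\delta)>0$ is a sufficiently small constant depending on $\delta$ (the result asserts that such an $\varepsilon(\delta)$ exists). Congestion condition: $\partial_t m<mf+\nabla\cdot(m\vec b)$ in $Q_T$. For $k>1$, $\varrho_k$ is the (nonnegative) weak solution of $\partial_t\varrho_k=\nabla\cdot(\varrho_k(\nabla p_k+\vec b))+f\varrho_k$ in $Q_T$ with initial data $\varrho_k^{(0)}$, where $p_k=\frac{k}{k-1}(\varrho_k/m)^{k-1}$: with $v_k=\varrho_k/m$, one has $\varrho_k\in L^2(Q_T)$, $v_k^k\in H^1(Q_T)$ and for all $\varphi\in C_c^\infty(\mathbb{R}^d\times[0,T))$ $$\iint_{Q_T}-\varrho_k\partial_t\varphi=\int_{\mathbb{R}^d}\varphi(x,0)\varrho_k^{(0)}(x)\,dx+\iint_{Q_T}-m\nabla\varphi\cdot\nabla v_k^k-\varrho_k\nabla\varphi\cdot\vec b+f\varphi\varrho_k.$$ It is known that under the first three assumptions $(\varrho_k,p_k)$ converges in $L^1(Q_T)$ as $k\to\infty$ to a pair $(\varrho_\infty,p_\infty)$. Streamlines: for $x_0\in\mathbb{R}^d$, $X(\cdot,x_0)$ is the unique solution of $\frac{d}{dt}X(t,x_0)=-\vec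 b(X(t,x_0),t)$, $X(0,x_0)=x_0$. *)

theory Defs
  imports "HOL-Analysis.Analysis"
begin

section \<open>Smooth functions\<close>

primrec iter_partial ::
  "'a::euclidean_space list \<Rightarrow> ('a \<Rightarrow> 'b::real_normed_vector) \<Rightarrow> 'a \<Rightarrow> 'b" where
  "iter_partial [] u = u"
| "iter_partial (e # es) u = (\<lambda>x. frechet_derivative (iter_partial es u) (at x) e)"

text \<open>Intended for open \<open>S\<close>. Differentiability of all iterated partial derivatives makes them
  all continuous, so this is \<open>C\<^sup>\<infinity>\<close> on \<open>S\<close>.\<close>

definition smooth_on :: "'a::euclidean_space set \<Rightarrow> ('a \<Rightarrow> 'b::real_normed_vector) \<Rightarrow> bool" where
  "smooth_on S u \<longleftrightarrow>
     (\<forall>es. set es \<subseteq> Basis \<longrightarrow> (\<forall>x\<in>S. iter_partial es u differentiable (at x)))"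

definition bounded_derivs_on :: "'a::euclidean_space set \<Rightarrow> ('a \<Rightarrow> 'b::real_normed_vector) \<Rightarrow> bool"
  where "bounded_derivs_on S u \<longleftrightarrow> (\<forall>es. set es \<subseteq> Basis \<longrightarrow> bounded (iter_partial es u ` S))"

text \<open>\<open>C\<^sub>c\<^sup>\<infinity>(S)\<close> for open \<open>S\<close>, its elements being extended by zero to the whole space.\<close>

definition test_functions :: "'a::euclidean_space set \<Rightarrow> ('a \<Rightarrow> real) set" where
  "test_functions S =
     {\<phi>. smooth_on UNIV \<phi> \<and> compact (closure {x. \<phi> x \<noteq> 0}) \<and> closure {x. \<phi> x \<noteq> 0} \<subseteq> S}"


section \<open>Lebesgue and Sobolev spaces\<close>

definition Lp_on :: "real \<Rightarrow> 'a::euclidean_space set \<Rightarrow> ('a \<Rightarrow> 'b::euclidean_space) \<Rightarrow> bool" where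
  "Lp_on p S u \<longleftrightarrow> u \<in> borel_measurable (lebesgue_on S) \<and>
     integrable (lebesgue_on S) (\<lambda>x. norm (u x) powr p)"

definition locally_integrable_on :: "'a::euclidean_space set \<Rightarrow> ('a \<Rightarrow> 'b::euclidean_space) \<Rightarrow> bool"
  where "locally_integrable_on S u \<longleftrightarrow>
     (\<forall>K. compact K \<and> K \<subseteq> S \<longrightarrow> integrable (lebesgue_on K) u)"

definition weak_gradient_on ::
  "'a::euclidean_space set \<Rightarrow> ('a \<Rightarrow> real) \<Rightarrow> ('a \<Rightarrow> 'a) \<Rightarrow> bool" where
  "weak_gradient_on S u G \<longleftrightarrow> locally_integrable_on S u \<and> locally_integrable_on S G \<and>
     (\<forall>\<phi>\<in>test_functions S. \<forall>e\<in>Basis.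
        (LINT x|lebesgue_on S. u x * frechet_derivative \<phi> (at x) e) =
        - (LINT x|lebesgue_on S. (G x \<bullet> e) * \<phi> x))"

text \<open>\<open>u \<in> W\<^sup>1\<^sup>,\<^sup>p(S)\<close>, where \<open>G\<close> is its (a.e. unique) weak gradient.\<close>

definition sobolev_W1_on ::
  "real \<Rightarrow> 'a::euclidean_space set \<Rightarrow> ('a \<Rightarrow> real) \<Rightarrow> ('a \<Rightarrow> 'a) \<Rightarrow> bool" where
  "sobolev_W1_on p S u G \<longleftrightarrow> Lp_on p S u \<and> Lp_on p S G \<and> weak_gradient_on S u G"

definition L1_limit_on ::
  "'a::euclidean_space set \<Rightarrow> (real \<Rightarrow> 'a \<Rightarrow> real) \<Rightarrow> ('a \<Rightarrow> real) \<Rightarrow> bool" where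
  "L1_limit_on S u l \<longleftrightarrow> Lp_on 1 S l \<and> eventually (\<lambda>k. Lp_on 1 S (u k)) at_top \<and>
     ((\<lambda>k. LINT x|lebesgue_on S. \<bar>u k x - l x\<bar>) \<longlongrightarrow> 0) at_top"


section \<open>Space-time domain and differential operators\<close>

definition QT :: "real \<Rightarrow> ((real^'n) \<times> real) set" where
  "QT T = UNIV \<times> {0<..<T}"

definition time_deriv :: "((real^'n) \<times> real \<Rightarrow> real) \<Rightarrow> (real^'n) \<times> real \<Rightarrow> real" where
  "time_deriv u = (\<lambda>(x, t). deriv (\<lambda>s. u (x, s)) t)"

definition space_grad :: "((real^'n) \<times> real \<Rightarrow> real) \<Rightarrow> (real^'n) \<times> real \<Rightarrow> real^'n" where
  "space_grad u = (\<lambda>(x, t). \<chi> i. frechet_derivative (\<lambda>y. u (y, t)) (at x) (axis i 1))"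

definition space_div :: "((real^'n) \<times> real \<Rightarrow> real^'n) \<Rightarrow> (real^'n) \<times> real \<Rightarrow> real" where
  "space_div F = (\<lambda>(x, t). \<Sum>i\<in>UNIV. frechet_derivative (\<lambda>y. F (y, t)) (at x) (axis i 1) $ i)"


section \<open>Standing assumptions\<close>

text \<open>A function that is smooth on \<open>QT T\<close> with bounded derivatives has a unique continuous
  extension to the closed slab, and this extension is smooth up to the boundary. The
  coefficients are identified with these extensions: their values at \<open>t = 0\<close> enter the initial
  pressure and the streamlines.\<close>

definition smooth_coefficient :: "real \<Rightarrow> ((real^'n) \<times> real \<Rightarrow> 'b::real_normed_vector) \<Rightarrow> bool" where
  "smooth_coefficient T u \<longleftrightarrow> smooth_on (QT T) u \<and> bounded_derivs_on (QT T) u \<and>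
     continuous_on (UNIV \<times> {0..T}) u"

definition coefficient_assumption ::
  "real \<Rightarrow> real \<Rightarrow> ((real^'n) \<times> real \<Rightarrow> real) \<Rightarrow> ((real^'n) \<times> real \<Rightarrow> real) \<Rightarrow>
   ((real^'n) \<times> real \<Rightarrow> real^'n) \<Rightarrow> bool" where
  "coefficient_assumption T \<delta> m f b \<longleftrightarrow>
     smooth_coefficient T m \<and> smooth_coefficient T f \<and> smooth_coefficient T b \<and>
     \<delta> > 0 \<and> (\<forall>z\<in>QT T. m z \<ge> \<delta>)"

definition pressure :: "real \<Rightarrow> real \<Rightarrow> real" where
  "pressure k v = k / (k - 1) * v powr (k - 1)"

definition initial_data_assumption ::
  "((real^'n) \<times> real \<Rightarrow> real) \<Rightarrow> (real \<Rightarrow> real^'n \<Rightarrow> real) \<Rightarrow> bool" where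
  "initial_data_assumption m \<rho>0 \<longleftrightarrow>
     (\<exists>K C. compact K \<and> (\<forall>k>1.
        (AE x in lebesgue. \<rho>0 k x \<ge> 0) \<and>
        (AE x in lebesgue. x \<notin> K \<longrightarrow> \<rho>0 k x = 0) \<and>
        (AE x in lebesgue. \<bar>\<rho>0 k x\<bar> \<le> C) \<and>
        (\<exists>G. sobolev_W1_on 1 UNIV (\<rho>0 k) G \<and>
             (LINT x|lebesgue. \<bar>\<rho>0 k x\<bar>) + (LINT x|lebesgue. norm (G x)) \<le> C) \<and>
        (AE x in lebesgue. \<bar>pressure k (\<rho>0 k x / m (x, 0))\<bar> \<le> C))) \<and>
     (\<exists>\<rho>0lim. L1_limit_on UNIV \<rho>0 \<rho>0lim)"

definition hard_constraint_restriction ::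
  "real \<Rightarrow> real \<Rightarrow> ((real^'n) \<times> real \<Rightarrow> real) \<Rightarrow> bool" where
  "hard_constraint_restriction T \<epsilon> m \<longleftrightarrow>
     (\<exists>\<mu>. \<forall>(x, t)\<in>QT T. m (x, t) = \<mu> (norm x) t) \<or>
     CARD('n) = 1 \<or>
     (\<exists>R>0. \<forall>(x, t)\<in>QT T. norm x \<ge> R \<longrightarrow> norm (space_grad m (x, t)) \<le> \<epsilon> / norm x)"

definition congestion_condition ::
  "real \<Rightarrow> ((real^'n) \<times> real \<Rightarrow> real) \<Rightarrow> ((real^'n) \<times> real \<Rightarrow> real) \<Rightarrow>
   ((real^'n) \<times> real \<Rightarrow> real^'n) \<Rightarrow> bool" where
  "congestion_condition T m f b \<longleftrightarrow>
     (\<forall>z\<in>QT T. time_deriv m z < m z * f z + space_div (\<lambda>w. m w *\<^sub>R b w) z)"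


section \<open>Weak solutions and streamlines\<close>

text \<open>\<open>G\<close> is the full space-time weak gradient of \<open>v\<^sup>k\<close>, so \<open>fst \<circ> G\<close> is its spatial part.
  The test functions in \<open>C\<^sub>c\<^sup>\<infinity>(\<real>\<^sup>d \<times> [0,T))\<close> need not vanish at \<open>t = 0\<close>; they are the
  restrictions to \<open>t \<ge> 0\<close> of the elements of \<open>C\<^sub>c\<^sup>\<infinity>(\<real>\<^sup>d \<times> (-\<infinity>,T))\<close>.\<close>

definition weak_solution ::
  "real \<Rightarrow> ((real^'n) \<times> real \<Rightarrow> real) \<Rightarrow> ((real^'n) \<times> real \<Rightarrow> real) \<Rightarrow>
   ((real^'n) \<times> real \<Rightarrow> real^'n) \<Rightarrow> real \<Rightarrow> (real^'n \<Rightarrow> real) \<Rightarrow>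
   ((real^'n) \<times> real \<Rightarrow> real) \<Rightarrow> bool" where
  "weak_solution T m f b k \<rho>0 \<rho> \<longleftrightarrow>
     (AE z in lebesgue_on (QT T). \<rho> z \<ge> 0) \<and>
     Lp_on 2 (QT T) \<rho> \<and>
     (\<exists>G. sobolev_W1_on 2 (QT T) (\<lambda>z. (\<rho> z / m z) powr k) G \<and>
        (\<forall>\<phi>\<in>test_functions (UNIV \<times> {..<T}).
           (LINT z|lebesgue_on (QT T). - (\<rho> z * time_deriv \<phi> z)) =
           (LINT x|lebesgue. \<phi> (x, 0) * \<rho>0 x) +
           (LINT z|lebesgue_on (QT T).
              - (m z * (space_grad \<phi> z \<bullet> fst (G z)))
              - \<rho> z * (space_grad \<phi> z \<bullet> b z)
              + f z * \<phi> z * \<rho> z)))"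

definition streamlines ::
  "real \<Rightarrow> ((real^'n) \<times> real \<Rightarrow> real^'n) \<Rightarrow> (real \<Rightarrow> real^'n \<Rightarrow> real^'n) \<Rightarrow> bool" where
  "streamlines T b X \<longleftrightarrow> (\<forall>x0. X 0 x0 = x0 \<and>
     (\<forall>t\<in>{0..<T}. ((\<lambda>s. X s x0) has_vector_derivative - b (X t x0, t)) (at t within {0..<T})))"

end

theory Submission
  imports Defs
begin

text \<open>
  With \<open>u = v\<^sup>k\<close> the equation for \<open>\<rho> = m v\<close> reads
  \<open>\<partial>\<^sub>t(m v) - \<nabla>\<cdot>(m v b) = \<nabla>\<cdot>(m \<nabla>u) + m f v\<close>. Testing it with \<open>\<epsilon>/(u + \<epsilon>) \<phi>\<close>, \<open>\<phi> \<ge> 0\<close>, makes the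
  diffusive term \<open>m \<epsilon> |\<nabla>u|\<^sup>2/(u + \<epsilon>)\<^sup>2 \<phi>\<close> of good sign, and what is left of the diffusion falls on
  \<open>\<phi>\<close> with the weight \<open>\<epsilon> ln (1 + u/\<epsilon>)\<close>. Since \<open>k ln v \<le> p\<close> where \<open>v > 1\<close>, this weight is at most
  \<open>\<epsilon> ln (1 + 1/\<epsilon>) + \<epsilon> p\<close>, which vanishes in \<open>L\<^sup>1\<close> on bounded sets as \<open>\<epsilon> \<rightarrow> 0\<close>, uniformly in \<open>k\<close>. The congestion
  condition discards the zero-order terms, and \<open>k \<rightarrow> \<infinity>\<close> followed by \<open>\<epsilon> \<rightarrow> 0\<close> gives
  \<open>\<partial>\<^sub>t v - b \<cdot> \<nabla>v \<ge> 0\<close> in the sense of distributions for the limit \<open>v\<close>.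

  Mollification turns this into a pointwise inequality up to a commutator error tending to \<open>0\<close>
  in \<open>L\<^sup>1\<close>. The flow has a Lipschitz inverse, so it pulls null sets back to null sets and
  distorts integrals by a bounded factor. Hence the mollified functions converge along almost
  every streamline, on which they are non-decreasing up to a vanishing error.
\<close>

text \<open>The obstacle is that \<open>v\<close> has no weak derivatives; only
  \<open>u = v^k\<close> has a space-time gradient. Write \<kappa> = 1/k and g(s) = \<epsilon>/(s +
  \<epsilon>). Testing with g(u) \<phi> lets the time and drift derivatives fall on g(u), which
  gives u^\<kappa> g'(u) times derivatives of \<open>u\<close>. This is integrated back as B(u) with
  B'(s) = - s^\<kappa> g'(s), so that v is replaced by A(u) = B(u) + u^\<kappa> g(u). The derivative
  of s^\<kappa> - A(s) is \<kappa> s^\<kappa>/(s + \<epsilon>), so the replacement costs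
  \<kappa>/\<epsilon> plus the excess of v over 1: small for fixed \<epsilon> as k grows, which
  forces the order of the two limits. The diffusion needs no gradient bound uniform in k, because g
  is decreasing and its antiderivative \<epsilon> ln (1 + s/\<epsilon>) grows slowly enough to be
  paid for by the pressure. Since g(u) \<phi> is not smooth, \<open>u\<close> is first mollified
  inside g only; the equation itself keeps the original \<open>u\<close>. Time and space form one
  Euclidean space throughout, with transport field (-b, 1); the weight m is removed at the end by
  testing with \<psi>/m.\<close>

abbreviation pd :: "'a::euclidean_space \<Rightarrow> ('a \<Rightarrow> 'b::real_normed_vector) \<Rightarrow> 'a \<Rightarrow> 'b" where
  "pd e u x \<equiv> frechet_derivative u (at x) e"

section \<open>Calculus of smooth functions\<close>

text \<open>\<open>iter_partial\<close> has the last derivative taken outermost, whereas this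
  recursion strips the first one. It suits rules that rewrite a first derivative as an expression of
  the same kind, such as those for sums, products and compositions, by induction on \<open>n\<close>
  with the function generalized.\<close>

primrec Cdiff :: "nat \<Rightarrow> 'a::euclidean_space set \<Rightarrow> ('a \<Rightarrow> 'b::real_normed_vector) \<Rightarrow> bool" where
  "Cdiff 0 S u = True"
| "Cdiff (Suc n) S u = ((\<forall>x\<in>S. u differentiable at x) \<and> (\<forall>e\<in>Basis. Cdiff n S (pd e u)))"

lemma iter_partial_append: "iter_partial (es @ [e]) u = iter_partial es (pd e u)"
  by (induction es) auto

lemma Cdiff_iff_iter_partial:
  "Cdiff n S u \<longleftrightarrow> (\<forall>es. set es \<subseteq> Basis \<longrightarrow> length es < n \<longrightarrow> (\<forall>x\<in>S. iter_partial es u differentiable (at x)))"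
proof (induction n arbitrary: u)
  case (Suc n)
  show ?case
  proof
    assume L: "Cdiff (Suc n) S u"
    show "\<forall>es. set es \<subseteq> Basis \<longrightarrow> length es < Suc n \<longrightarrow> (\<forall>x\<in>S. iter_partial es u differentiable (at x))"
    proof (intro allI impI ballI)
      fix es :: "'a list" and x
      assume es: "set es \<subseteq> Basis" "length es < Suc n" "x \<in> S"
      show "iter_partial es u differentiable (at x)"
      proof (cases es rule: rev_cases)
        case Nil
        then show ?thesis using L es by auto
      next
        case (snoc ys e)
        then show ?thesis using L es Suc.IH[of "pd e u"] by (auto simp: iter_partial_append)
      qed
    qed
  next
    assume R: "\<forall>es. set es \<subseteq> Basis \<longrightarrow> length es < Suc n \<longrightarrow> (\<forall>x\<in>S. iter_partial es u differentiable (at x))"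
    have "u differentiable at x" if "x \<in> S" for x
      using R[rule_format, of "[]" x] that by simp
    moreover have "Cdiff n S (pd e u)" if "e \<in> Basis" for e
      unfolding Suc.IH
    proof (intro allI impI ballI)
      fix es :: "'a list" and x
      assume es: "set es \<subseteq> Basis" "length es < n" "x \<in> S"
      then show "iter_partial es (pd e u) differentiable (at x)"
        using R[rule_format, of "es @ [e]" x] that by (simp add: iter_partial_append)
    qed
    ultimately show "Cdiff (Suc n) S u" by simp
  qed
qed simp

lemma smooth_on_iff_Cdiff: "smooth_on S u \<longleftrightarrow> (\<forall>n. Cdiff n S u)"
  unfolding smooth_on_def Cdiff_iff_iter_partial by (meson lessI)

lemma smooth_on_differentiable: "smooth_on S u \<Longrightarrow> x \<in> S \<Longrightarrow> u differentiable at x"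
  unfolding smooth_on_iff_Cdiff by (drule spec[of _ "Suc 0"]) simp

lemma smooth_on_pd: "smooth_on S u \<Longrightarrow> e \<in> Basis \<Longrightarrow> smooth_on S (pd e u)"
  unfolding smooth_on_iff_Cdiff
proof (rule allI)
  fix n assume "\<forall>n. Cdiff n S u" "e \<in> Basis"
  then have "Cdiff (Suc n) S u" by blast
  then show "Cdiff n S (pd e u)" using \<open>e \<in> Basis\<close> by simp
qed

lemma smooth_on_subset: "smooth_on S u \<Longrightarrow> T \<subseteq> S \<Longrightarrow> smooth_on T u"
  by (auto simp: smooth_on_def)

lemma Cdiff_mono: "Cdiff (Suc n) S u \<Longrightarrow> Cdiff n S u"
  by (auto simp: Cdiff_iff_iter_partial)

section \<open>Locality and algebra of partial derivatives\<close>

lemma frechet_derivative_cong_open: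
  assumes "open S" "x \<in> S" "\<And>y. y \<in> S \<Longrightarrow> u y = w y"
  shows "frechet_derivative u (at x) = frechet_derivative w (at x)"
proof -
  have "(u has_derivative D) (at x) \<longleftrightarrow> (w has_derivative D) (at x)" for D
    using assms by (metis has_derivative_transform_within_open)
  then show ?thesis unfolding frechet_derivative_def by simp
qed

lemma differentiable_cong_open:
  assumes "open S" "x \<in> S" "\<And>y. y \<in> S \<Longrightarrow> u y = w y"
  shows "u differentiable at x \<longleftrightarrow> w differentiable at x"
  using assms unfolding differentiable_def by (metis has_derivative_transform_within_open)

lemma Cdiff_cong:
  assumes "open S" "\<And>y. y \<in> S \<Longrightarrow> u y = w y"
  shows "Cdiff n S u \<longleftrightarrow> Cdiff n S w"
  using assms(2)
proof (induction n arbitrary: u w)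
  case (Suc n)
  have "Cdiff n S (pd e u) = Cdiff n S (pd e w)" for e
    by (rule Suc.IH) (use frechet_derivative_cong_open[OF assms(1)] Suc.prems in metis)
  moreover have "u differentiable at x \<longleftrightarrow> w differentiable at x" if "x \<in> S" for x
    by (rule differentiable_cong_open[OF assms(1) that Suc.prems])
  ultimately show ?case by simp
qed simp

lemma smooth_on_cong:
  assumes "open S" "\<And>y. y \<in> S \<Longrightarrow> u y = w y"
  shows "smooth_on S u \<longleftrightarrow> smooth_on S w"
  using Cdiff_cong[OF assms] by (simp add: smooth_on_iff_Cdiff)

lemma pd_eqI: "(u has_derivative D) (at x) \<Longrightarrow> pd e u x = D e"
  by (metis frechet_derivative_at)

lemma differentiable_has_derivative:
  "u differentiable at x \<Longrightarrow> (u has_derivative (\<lambda>e. pd e u x)) (at x)"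
  by (simp add: frechet_derivative_works)

lemma pd_add:
  "u differentiable at x \<Longrightarrow> w differentiable at x \<Longrightarrow> pd e (\<lambda>y. u y + w y) x = pd e u x + pd e w x"
  by (rule pd_eqI) (auto intro!: derivative_eq_intros differentiable_has_derivative)

lemma pd_mult:
  fixes u w :: "'a::euclidean_space \<Rightarrow> real"
  shows "u differentiable at x \<Longrightarrow> w differentiable at x \<Longrightarrow>
    pd e (\<lambda>y. u y * w y) x = u x * pd e w x + pd e u x * w x"
  by (rule pd_eqI) (auto intro!: derivative_eq_intros differentiable_has_derivative)

lemma pd_const [simp]: "pd e (\<lambda>y. c) x = 0"
  by (rule pd_eqI) (auto intro!: derivative_eq_intros)

lemma Cdiff_const [simp]: "Cdiff n S (\<lambda>x. c)"
proof (induction n arbitrary: c)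
  case (Suc n)
  then show ?case by (simp add: pd_const[abs_def])
qed simp

lemma Cdiff_add:
  assumes "open S"
  shows "Cdiff n S u \<Longrightarrow> Cdiff n S w \<Longrightarrow> Cdiff n S (\<lambda>x. u x + w x)"
proof (induction n arbitrary: u w)
  case (Suc n)
  have "Cdiff n S (pd e (\<lambda>x. u x + w x))" if "e \<in> Basis" for e
    by (subst Cdiff_cong[OF assms, of _ "\<lambda>x. pd e u x + pd e w x"])
       (use Suc that in \<open>auto intro!: pd_add\<close>)
  with Suc.prems show ?case by auto
qed simp

lemma Cdiff_mult:
  fixes u w :: "'a::euclidean_space \<Rightarrow> real"
  assumes "open S"
  shows "Cdiff n S u \<Longrightarrow> Cdiff n S w \<Longrightarrow> Cdiff n S (\<lambda>x. u x * w x)"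
proof (induction n arbitrary: u w)
  case (Suc n)
  have "Cdiff n S (pd e (\<lambda>x. u x * w x))" if "e \<in> Basis" for e
  proof (subst Cdiff_cong[OF assms])
    show "pd e (\<lambda>x. u x * w x) x = u x * pd e w x + pd e u x * w x" if "x \<in> S" for x
      using Suc.prems that by (intro pd_mult) auto
    have "Cdiff n S u" "Cdiff n S w" using Suc.prems Cdiff_mono by blast+
    then show "Cdiff n S (\<lambda>x. u x * pd e w x + pd e u x * w x)"
      using Suc.prems that by (intro Cdiff_add[OF assms] Suc.IH) auto
  qed
  with Suc.prems show ?case by auto
qed simp

lemma pd_compose_real:
  fixes u :: "'a::euclidean_space \<Rightarrow> real" and g :: "real \<Rightarrow> real"
  assumes "u differentiable at x" "(g has_real_derivative g') (at (u x))"
  shows "pd e (\<lambda>x. g (u x)) x = g' * pd e u x"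
proof -
  have "((\<lambda>x. g (u x)) has_derivative (\<lambda>e. g' * pd e u x)) (at x)"
    using has_derivative_compose[OF differentiable_has_derivative[OF assms(1)] assms(2)[unfolded has_field_derivative_def]]
    by simp
  then show ?thesis by (rule pd_eqI)
qed

lemma differentiable_has_real_derivative_pd:
  fixes g :: "real \<Rightarrow> real"
  assumes "g differentiable at x"
  shows "(g has_real_derivative pd 1 g x) (at x)"
proof -
  obtain D where D: "(g has_real_derivative D) (at x)"
    using assms real_differentiable_def by blast
  then have "pd 1 g x = D" by (subst pd_eqI[of _ "(*) D"]) (auto simp: has_field_derivative_def)
  with D show ?thesis by simp
qed

text \<open>The chain rule replaces the outer function by its derivative and keeps the inner one, so
  the induction generalizes over \<open>g\<close> with \<open>u\<close> fixed.\<close>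

lemma Cdiff_compose_real:
  fixes u :: "'a::euclidean_space \<Rightarrow> real" and g :: "real \<Rightarrow> real"
  assumes "open S" "u ` S \<subseteq> T"
  shows "Cdiff n S u \<Longrightarrow> Cdiff n T g \<Longrightarrow> Cdiff n S (\<lambda>x. g (u x))"
proof (induction n arbitrary: g)
  case (Suc n)
  have d: "(g has_real_derivative pd 1 g (u x)) (at (u x))" if "x \<in> S" for x
    using that assms(2) Suc.prems by (intro differentiable_has_real_derivative_pd) auto
  have "Cdiff n S (pd e (\<lambda>x. g (u x)))" if "e \<in> Basis" for e
  proof (subst Cdiff_cong[OF assms(1)])
    show "pd e (\<lambda>x. g (u x)) x = pd 1 g (u x) * pd e u x" if "x \<in> S" for x
      using d that Suc.prems by (intro pd_compose_real) auto
    show "Cdiff n S (\<lambda>x. pd 1 g (u x) * pd e u x)"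
    proof (rule Cdiff_mult[OF assms(1)])
      show "Cdiff n S (\<lambda>x. pd 1 g (u x))"
        by (rule Suc.IH[OF Cdiff_mono[OF Suc.prems(1)]]) (use Suc.prems in auto)
      show "Cdiff n S (pd e u)" using Suc.prems that by simp
    qed
  qed
  moreover have "(\<lambda>x. g (u x)) differentiable at x" if "x \<in> S" for x
    using differentiable_chain_at[of u x g] d[OF that] Suc.prems that
    by (auto simp: o_def real_differentiable_def)
  ultimately show ?case by simp
qed simp

lemma smooth_on_const [simp]: "smooth_on S (\<lambda>x. c)"
  by (simp add: smooth_on_iff_Cdiff)

lemma smooth_on_add: "open S \<Longrightarrow> smooth_on S u \<Longrightarrow> smooth_on S w \<Longrightarrow> smooth_on S (\<lambda>x. u x + w x)"
  by (simp add: smooth_on_iff_Cdiff Cdiff_add)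

lemma smooth_on_mult:
  fixes u w :: "'a::euclidean_space \<Rightarrow> real"
  shows "open S \<Longrightarrow> smooth_on S u \<Longrightarrow> smooth_on S w \<Longrightarrow> smooth_on S (\<lambda>x. u x * w x)"
  by (simp add: smooth_on_iff_Cdiff Cdiff_mult)

lemma smooth_on_compose_real:
  fixes u :: "'a::euclidean_space \<Rightarrow> real" and g :: "real \<Rightarrow> real"
  assumes "open S" "smooth_on S u" "smooth_on T g" "u ` S \<subseteq> T"
  shows "smooth_on S (\<lambda>x. g (u x))"
  using assms by (simp add: smooth_on_iff_Cdiff Cdiff_compose_real)

lemma smooth_on_sum:
  assumes "open S" "finite I" "\<And>i. i \<in> I \<Longrightarrow> smooth_on S (u i)"
  shows "smooth_on S (\<lambda>x. \<Sum>i\<in>I. u i x)"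
  using assms(2,3) by (induction I rule: finite_induct) (auto intro: smooth_on_add[OF assms(1)])

lemma bounded_linear_smooth_on:
  assumes "bounded_linear L"
  shows "smooth_on S L"
  unfolding smooth_on_iff_Cdiff
proof
  fix n
  have "pd e L x = L e" for e x
    by (rule pd_eqI) (rule bounded_linear_imp_has_derivative[OF assms])
  then have "pd e L = (\<lambda>x. L e)" for e by auto
  then show "Cdiff n S L"
    using bounded_linear_imp_differentiable[OF assms] by (cases n) auto
qed

text \<open>The derivative is minus a product of two copies of \<open>inverse\<close>, so the
  induction hypothesis applies to its factors.\<close>

lemma smooth_on_inverse: "smooth_on {0<..} (inverse :: real \<Rightarrow> real)"
  unfolding smooth_on_iff_Cdiff
proof
  fix n show "Cdiff n {0<..} (inverse :: real \<Rightarrow> real)"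
  proof (induction n)
    case (Suc n)
    have *: "(inverse has_derivative (\<lambda>h. - (inverse x * h * inverse x))) (at x)" if "x > 0" for x :: real
      using that by (intro has_derivative_inverse') auto
    have "Cdiff n {0<..} (pd 1 (inverse :: real \<Rightarrow> real))"
    proof (subst Cdiff_cong)
      show "pd 1 inverse x = (-1) * (inverse x * inverse x)" if "x \<in> {0<..}" for x :: real
        using pd_eqI[OF *] that by auto
      show "Cdiff n {0<..} (\<lambda>x::real. (-1) * (inverse x * inverse x))"
        by (intro Cdiff_mult Suc Cdiff_const) auto
    qed auto
    then show ?case using * by (auto simp: differentiable_def)
  qed simp
qed

lemma smooth_on_affine:
  fixes u :: "'a::euclidean_space \<Rightarrow> 'b::real_normed_vector"
  assumes "smooth_on UNIV u"
  shows "smooth_on UNIV (\<lambda>y. u (x + c *\<^sub>R y))"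
    and "pd e (\<lambda>y. u (x + c *\<^sub>R y)) y = c *\<^sub>R pd e u (x + c *\<^sub>R y)"
proof -
  have d: "((\<lambda>y. u (x + c *\<^sub>R y)) has_derivative (\<lambda>h. c *\<^sub>R pd h u (x + c *\<^sub>R y))) (at y)"
    if "u differentiable at (x + c *\<^sub>R y)" for y and u :: "'a::euclidean_space \<Rightarrow> 'b::real_normed_vector"
  proof -
    have "((\<lambda>y. x + c *\<^sub>R y) has_derivative (\<lambda>h. c *\<^sub>R h)) (at y)"
      by (auto intro!: derivative_eq_intros)
    from has_derivative_compose[OF this differentiable_has_derivative[OF that]]
    show ?thesis
      by (simp add: linear_cmul[OF linear_frechet_derivative[OF that]])
  qed
  \<comment> \<open>The factor \<open>d\<close> is part of the induction because every
    differentiation brings out another factor \<open>c\<close>.\<close>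
  have "Cdiff n UNIV u \<Longrightarrow> Cdiff n UNIV (\<lambda>y. d *\<^sub>R u (x + c *\<^sub>R y))" for n d
    and u :: "'a::euclidean_space \<Rightarrow> 'b::real_normed_vector"
  proof (induction n arbitrary: u d)
    case (Suc n)
    have hd: "((\<lambda>y. d *\<^sub>R u (x + c *\<^sub>R y)) has_derivative (\<lambda>h. d *\<^sub>R (c *\<^sub>R pd h u (x + c *\<^sub>R y)))) (at y)" for y
      using Suc.prems by (intro has_derivative_scaleR_right d) auto
    have "pd e (\<lambda>y. d *\<^sub>R u (x + c *\<^sub>R y)) = (\<lambda>y. (d * c) *\<^sub>R pd e u (x + c *\<^sub>R y))" for e
      using pd_eqI[OF hd] by auto
    moreover have "Cdiff n UNIV (\<lambda>y. (d * c) *\<^sub>R pd e u (x + c *\<^sub>R y))" if "e \<in> Basis" for e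
      using Suc.prems that by (intro Suc.IH) simp
    moreover have "(\<lambda>y. d *\<^sub>R u (x + c *\<^sub>R y)) differentiable at y" for y
      using hd unfolding differentiable_def by blast
    ultimately show ?case by simp
  qed simp
  from this[of _ u 1] assms show "smooth_on UNIV (\<lambda>y. u (x + c *\<^sub>R y))"
    by (simp add: smooth_on_iff_Cdiff)
  show "pd e (\<lambda>y. u (x + c *\<^sub>R y)) y = c *\<^sub>R pd e u (x + c *\<^sub>R y)"
    by (rule pd_eqI, rule d, rule smooth_on_differentiable[OF assms]) simp
qed

lemma smooth_on_continuous: "smooth_on S u \<Longrightarrow> continuous_on S u"
  by (meson continuous_at_imp_continuous_on differentiable_imp_continuous_within smooth_on_differentiable)

section \<open>Bump functions\<close>

text \<open>The family \<open>s\<^sup>-\<^sup>j exp (-1/s)\<close> is closed under differentiation up to linear combinations.\<close>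

definition flat :: "nat \<Rightarrow> real \<Rightarrow> real" where
  "flat j s = (if s > 0 then exp (- inverse s) * inverse s ^ j else 0)"

lemma flat_0: "((\<lambda>s. flat j s) \<longlongrightarrow> 0) (at_right 0)"
proof -
  have "((\<lambda>s. s ^ j / exp s) \<longlongrightarrow> (0::real)) at_top"
    by (rule tendsto_power_div_exp_0)
  then have "((\<lambda>s. inverse s ^ j / exp (inverse s)) \<longlongrightarrow> (0::real)) (at_right 0)"
    by (rule filterlim_compose[OF _ filterlim_inverse_at_top_right])
  then show ?thesis
    by (rule tendsto_cong[THEN iffD1, rotated])
       (auto simp: flat_def eventually_at_filter exp_minus field_simps)
qed

lemma flat_deriv: "(flat j has_real_derivative (- real j * flat (j+1) s + flat (j+2) s)) (at s)"
proof -
  consider "s < 0" | "s > 0" | "s = 0" by linarith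
  then show ?thesis
  proof cases
    case 1
    have "((\<lambda>_. 0) has_real_derivative 0) (at s)" by simp
    then have "(flat j has_real_derivative 0) (at s)"
      by (rule DERIV_cong_ev[THEN iffD1, rotated -1])
         (use 1 in \<open>auto simp: flat_def intro!: eventually_mono[OF eventually_nhds_in_open[of "{..<0}"]]\<close>)
    then show ?thesis using 1 by (simp add: flat_def)
  next
    case 2
    have "((\<lambda>s. exp (- inverse s) * inverse s ^ j) has_real_derivative
       (- real j * flat (j+1) s + flat (j+2) s)) (at s)"
      using 2
      apply (auto intro!: derivative_eq_intros simp: flat_def)
      apply (cases j)
      apply (auto simp: field_simps power2_eq_square)
      done
    then show ?thesis
      by (rule DERIV_cong_ev[THEN iffD1, rotated -1])
         (use 2 in \<open>auto simp: flat_def intro!: eventually_mono[OF eventually_nhds_in_open[of "{0<..}"]]\<close>)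
  next
    case 3
    have "((\<lambda>h. (flat j (0 + h) - flat j 0) / h) \<longlongrightarrow> 0) (at 0)"
      unfolding filterlim_at_split
    proof
      show "((\<lambda>h. (flat j (0 + h) - flat j 0) / h) \<longlongrightarrow> 0) (at_left 0)"
        by (rule tendsto_eventually) (auto simp: eventually_at_filter flat_def)
      \<comment> \<open>To the right of 0 the difference quotient is \<open>flat (j+1) h\<close>
        itself, whose limit is already known.\<close>
      show "((\<lambda>h. (flat j (0 + h) - flat j 0) / h) \<longlongrightarrow> 0) (at_right 0)"
        by (rule tendsto_cong[THEN iffD1, OF _ flat_0[of "j+1"]])
           (auto simp: eventually_at_filter flat_def field_simps)
    qed
    then show ?thesis using 3 by (simp add: has_field_derivative_def[symmetric] DERIV_def flat_def)
  qed
qed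

lemma smooth_on_flat: "smooth_on UNIV (flat j)"
  unfolding smooth_on_iff_Cdiff
proof
  fix n show "Cdiff n UNIV (flat j)"
  proof (induction n arbitrary: j)
    case (Suc n)
    have "pd 1 (flat j) s = (- real j) * flat (j+1) s + flat (j+2) s" for s
      using pd_eqI[OF flat_deriv[unfolded has_field_derivative_def]] by simp
    then have "pd 1 (flat j) = (\<lambda>s. (- real j) * flat (j+1) s + flat (j+2) s)" by auto
    moreover have "flat j differentiable at s" for s
      using flat_deriv real_differentiable_def by blast
    moreover have "Cdiff n UNIV (\<lambda>s. (- real j) * flat (j+1) s + flat (j+2) s)"
      by (intro Cdiff_add Cdiff_mult Cdiff_const Suc) auto
    ultimately show ?case by simp
  qed simp
qed

text \<open>The standard bump exp (-1/(1 - |x|^2)) of the unit ball; the squared norm keeps it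
  smooth at the origin.\<close>

definition bump :: "'a::euclidean_space \<Rightarrow> real" where
  "bump x = flat 0 (1 - x \<bullet> x)"

lemma smooth_on_bump: "smooth_on UNIV (bump :: 'a::euclidean_space \<Rightarrow> real)"
proof -
  have "smooth_on UNIV (\<lambda>x::'a. 1 + (-1) * (\<Sum>i\<in>Basis. (x \<bullet> i) * (x \<bullet> i)))"
    by (intro smooth_on_add smooth_on_mult smooth_on_sum smooth_on_const
        bounded_linear_smooth_on bounded_linear_inner_left) auto
  then have "smooth_on UNIV (\<lambda>x::'a. flat 0 (1 + (-1) * (\<Sum>i\<in>Basis. (x \<bullet> i) * (x \<bullet> i))))"
    by (rule smooth_on_compose_real[OF open_UNIV _ smooth_on_flat]) auto
  moreover have "bump = (\<lambda>x::'a. flat 0 (1 + (-1) * (\<Sum>i\<in>Basis. (x \<bullet> i) * (x \<bullet> i))))"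
    by (auto simp: bump_def euclidean_inner[symmetric])
  ultimately show ?thesis by simp
qed

lemma bump_nonneg: "bump x \<ge> 0"
  by (auto simp: bump_def flat_def)

lemma bump_pos: "norm x < 1 \<Longrightarrow> bump x > 0"
  by (auto simp: bump_def flat_def dot_square_norm power_less_one_iff)

lemma bump_zero: "norm x \<ge> 1 \<Longrightarrow> bump x = 0"
  by (auto simp: bump_def flat_def dot_square_norm power_less_one_iff abs_square_less_1)

section \<open>Test functions\<close>

lemma test_functionsD:
  assumes "\<phi> \<in> test_functions S"
  shows "smooth_on UNIV \<phi>"
    and "\<exists>K. compact K \<and> K \<subseteq> S \<and> (\<forall>x. x \<notin> K \<longrightarrow> \<phi> x = 0)"
  using assms closure_subset[of "{x. \<phi> x \<noteq> 0}"]
  by (auto simp: test_functions_def intro!: exI[of _ "closure {x. \<phi> x \<noteq> 0}"])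

lemma test_functionsI:
  assumes "smooth_on UNIV \<phi>" "compact K" "K \<subseteq> S" "\<And>x. x \<notin> K \<Longrightarrow> \<phi> x = 0"
  shows "\<phi> \<in> test_functions S"
proof -
  have "closure {x. \<phi> x \<noteq> 0} \<subseteq> K"
    using assms by (intro closure_minimal) (auto intro: compact_imp_closed)
  moreover then have "compact (closure {x. \<phi> x \<noteq> 0})"
    using assms(2) by (meson closed_closure compact_closure bounded_subset compact_imp_bounded compact_eq_bounded_closed)
  ultimately show ?thesis using assms by (auto simp: test_functions_def)
qed

lemma Cdiff_Un:
  "Cdiff n S u \<Longrightarrow> Cdiff n T u \<Longrightarrow> Cdiff n (S \<union> T) u"
  by (auto simp: Cdiff_iff_iter_partial)

text \<open>\<open>S\<close> and the complement of the support are open, cover the space, and the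
  product is smooth on each. This admits factors that are smooth on \<open>S\<close> only, as the
  coefficients of the equation are.\<close>

lemma test_functions_mult:
  assumes \<phi>: "\<phi> \<in> test_functions S" and "open S" "smooth_on S w"
  shows "(\<lambda>x. if x \<in> S then w x * \<phi> x else 0) \<in> test_functions S"
proof -
  obtain K where K: "compact K" "K \<subseteq> S" "\<forall>x. x \<notin> K \<longrightarrow> \<phi> x = 0"
    using test_functionsD[OF \<phi>] by blast
  let ?f = "\<lambda>x. if x \<in> S then w x * \<phi> x else 0"
  have o: "open (- K)" using K compact_imp_closed by blast
  have "smooth_on S ?f"
    by (subst smooth_on_cong[OF assms(2), of _ "\<lambda>x. w x * \<phi> x"])
       (auto intro!: smooth_on_mult assms smooth_on_subset[OF test_functionsD(1)[OF \<phi>]])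
  moreover have "smooth_on (- K) ?f"
    by (subst smooth_on_cong[OF o, of _ "\<lambda>x. 0"]) (use K in auto)
  ultimately have "smooth_on (S \<union> (- K)) ?f"
    by (simp add: smooth_on_iff_Cdiff Cdiff_Un)
  then have "smooth_on UNIV ?f" using K by (rule_tac smooth_on_subset) auto
  then show ?thesis using K by (rule_tac test_functionsI[of _ K]) auto
qed

section \<open>Integration by parts\<close>

lemma pd_linear_expand:
  assumes "u differentiable at x"
  shows "pd h u x = (\<Sum>e\<in>Basis. (h \<bullet> e) *\<^sub>R pd e u x)"
proof -
  have "linear (\<lambda>h. pd h u x)" by (rule linear_frechet_derivative[OF assms])
  then have "pd (\<Sum>e\<in>Basis. (h \<bullet> e) *\<^sub>R e) u x = (\<Sum>e\<in>Basis. (h \<bullet> e) *\<^sub>R pd e u x)"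
    by (simp add: linear_sum linear_cmul)
  then show ?thesis by (simp add: euclidean_representation)
qed

lemma norm_pd_le:
  fixes u :: "'a::euclidean_space \<Rightarrow> 'b::real_normed_vector"
  assumes "u differentiable at x" "\<And>e. e \<in> Basis \<Longrightarrow> norm (pd e u x) \<le> M"
  shows "norm (pd h u x) \<le> real DIM('a) * M * norm h"
proof -
  have "norm (pd h u x) \<le> (\<Sum>e\<in>(Basis::'a set). norm ((h \<bullet> e) *\<^sub>R pd e u x))"
    unfolding pd_linear_expand[OF assms(1), of h] by (rule norm_sum)
  also have "\<dots> \<le> (\<Sum>e\<in>(Basis::'a set). norm h * M)"
    by (intro sum_mono) (auto intro!: mult_mono assms(2) Basis_le_norm)
  finally show ?thesis by (simp add: algebra_simps)
qed

lemma lipschitz_of_pd_bound: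
  fixes u :: "'a::euclidean_space \<Rightarrow> 'b::real_normed_vector"
  assumes "convex S" "\<And>x. x \<in> S \<Longrightarrow> u differentiable at x"
    and "\<And>x e. x \<in> S \<Longrightarrow> e \<in> Basis \<Longrightarrow> norm (pd e u x) \<le> M"
    and "x \<in> S" "y \<in> S"
  shows "norm (u x - u y) \<le> real DIM('a) * M * norm (x - y)"
  using assms(1) _ _ assms(4,5)
proof (rule differentiable_bound[where f' = "\<lambda>x h. pd h u x"])
  show "(u has_derivative (\<lambda>h. pd h u x)) (at x within S)" if "x \<in> S" for x
    using differentiable_has_derivative[OF assms(2)[OF that]] has_derivative_at_withinI by blast
  show "onorm (\<lambda>h. pd h u x) \<le> real DIM('a) * M" if "x \<in> S" for x
    using that assms by (intro onorm_le norm_pd_le) auto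
qed

section \<open>Compactly supported continuous functions\<close>

lemma continuous_on_zero_extend:
  fixes f :: "'a::t2_space \<Rightarrow> 'b::real_normed_vector"
  assumes "open S" "compact K" "K \<subseteq> S" "continuous_on S f" "\<And>x. x \<notin> K \<Longrightarrow> f x = 0"
  shows "continuous_on UNIV f"
proof -
  have o: "open (- K)" using assms compact_imp_closed by blast
  have "continuous_on (- K) f"
    by (subst continuous_on_cong[of _ "- K" f "\<lambda>_. 0"]) (use assms in auto)
  then have "continuous_on (S \<union> - K) f"
    using assms o by (intro continuous_on_open_Un) auto
  moreover have "S \<union> - K = UNIV" using assms by auto
  ultimately show ?thesis by simp
qed

lemma compact_support_bounded:
  fixes f :: "'a::metric_space \<Rightarrow> real"
  assumes "continuous_on UNIV f" "compact K" "\<And>x. x \<notin> K \<Longrightarrow> f x = 0"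
  obtains M where "M > 0" "\<And>x. \<bar>f x\<bar> \<le> M"
proof -
  have "compact (f ` K)"
    using assms by (meson compact_continuous_image continuous_on_subset top_greatest)
  then obtain M where M: "\<And>x. x \<in> K \<Longrightarrow> \<bar>f x\<bar> \<le> M"
    using compact_imp_bounded[of "f ` K"] by (auto simp: bounded_iff)
  show ?thesis
  proof (rule that[of "\<bar>M\<bar> + 1"])
    show "\<bar>f x\<bar> \<le> \<bar>M\<bar> + 1" for x
      using M[of x] assms(3)[of x] by (cases "x \<in> K") auto
  qed auto
qed

lemma compact_support_integrable:
  fixes f :: "'a::euclidean_space \<Rightarrow> real"
  assumes "continuous_on UNIV f" "compact K" "\<And>x. x \<notin> K \<Longrightarrow> f x = 0"
  shows "integrable lborel f"
proof -
  have "integrable lborel (\<lambda>x. indicator K x *\<^sub>R f x)"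
    using assms by (intro borel_integrable_compact) (auto intro: continuous_on_subset)
  moreover have "(\<lambda>x. indicator K x *\<^sub>R f x) = f"
    using assms by (auto simp: indicator_def fun_eq_iff)
  ultimately show ?thesis by simp
qed

lemma pd_eq_0_outside:
  assumes "compact K" "\<And>x. x \<notin> K \<Longrightarrow> f x = 0" "x \<notin> K"
  shows "pd e f x = 0" "f differentiable at x"
proof -
  have o: "open (- K)" using assms compact_imp_closed by blast
  have "pd e f x = pd e (\<lambda>_. 0) x"
    using frechet_derivative_cong_open[OF o, of x f "\<lambda>_. 0"] assms by auto
  then show "pd e f x = 0" by simp
  show "f differentiable at x"
    using differentiable_cong_open[OF o, of x f "\<lambda>_. 0"] assms by auto
qed

section \<open>Invariance of Lebesgue measure under translation and reflection\<close>

lemma lborel_integral_translate: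
  fixes f :: "'a::euclidean_space \<Rightarrow> real"
  assumes "f \<in> borel_measurable borel"
  shows "integral\<^sup>L lborel (\<lambda>x. f (c + x)) = integral\<^sup>L lborel f"
  by (subst (2) lborel_distr_plus[of c, symmetric]) (subst integral_distr, use assms in auto)

lemma lborel_distr_reflect: "distr lborel borel (\<lambda>y. x - y) = (lborel :: 'a::euclidean_space measure)"
  by (subst (2) lborel_affine[of "-1" x]) (auto simp: density_1)

lemma lborel_integral_reflect:
  fixes f :: "'a::euclidean_space \<Rightarrow> real"
  assumes "f \<in> borel_measurable borel"
  shows "integral\<^sup>L lborel (\<lambda>y. f (x - y)) = integral\<^sup>L lborel f"
  by (subst (2) lborel_distr_reflect[of x, symmetric]) (subst integral_distr, use assms in auto)

lemma nn_integral_reflect: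
  fixes f :: "'a::euclidean_space \<Rightarrow> ennreal"
  assumes "f \<in> borel_measurable borel"
  shows "(\<integral>\<^sup>+y. f (x - y) \<partial>lborel) = (\<integral>\<^sup>+y. f y \<partial>lborel)"
  by (subst (2) lborel_distr_reflect[of x, symmetric]) (subst nn_integral_distr, use assms in auto)

lemma lborel_integrable_reflect:
  fixes f :: "'a::euclidean_space \<Rightarrow> real"
  assumes "integrable lborel f"
  shows "integrable lborel (\<lambda>y. f (x - y))"
proof -
  have "integrable (distr lborel borel (\<lambda>y. x - y)) f" using assms by (simp add: lborel_distr_reflect)
  then show ?thesis by (subst (asm) integrable_distr_eq) (use assms in auto)
qed

text \<open>The difference quotients have vanishing integral by translation invariance.\<close>

lemma integral_pd_eq_0:
  fixes g :: "'a::euclidean_space \<Rightarrow> real"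
  assumes d: "\<And>x. g differentiable at x" and c: "\<And>e. e \<in> Basis \<Longrightarrow> continuous_on UNIV (pd e g)"
    and K: "compact K" "\<And>x. x \<notin> K \<Longrightarrow> g x = 0" and e: "e \<in> Basis"
  shows "integral\<^sup>L lborel (pd e g) = 0"
proof -
  have gc: "continuous_on UNIV g"
    by (simp add: continuous_at_imp_continuous_on d differentiable_imp_continuous_within)
  then have [measurable]: "g \<in> borel_measurable borel"
    by (rule borel_measurable_continuous_onI)
  have gi: "integrable lborel g" by (rule compact_support_integrable[OF gc K])
  have "\<exists>M. \<forall>x. \<bar>pd i g x\<bar> \<le> M" if "i \<in> Basis" for i
    by (rule compact_support_bounded[OF c[OF that] K(1)]) (auto simp: pd_eq_0_outside[OF K])
  then obtain M0 where M0: "\<And>i x. i \<in> Basis \<Longrightarrow> \<bar>pd i g x\<bar> \<le> M0 i" by metis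
  define M where "M = (\<Sum>i\<in>Basis. M0 i)"
  have M: "norm (pd i g x) \<le> M" if "i \<in> Basis" for i x
  proof -
    have "0 \<le> M0 j" if "j \<in> Basis" for j using M0[OF that, of undefined] by linarith
    then have "M0 i \<le> M" unfolding M_def using that by (intro member_le_sum) auto
    then show ?thesis using M0[OF that, of x] by simp
  qed
  have lip: "\<bar>g x - g y\<bar> \<le> real DIM('a) * M * norm (x - y)" for x y
    using lipschitz_of_pd_bound[of UNIV g M x y] d M by auto
  define C where "C = real DIM('a) * M"
  obtain R where R: "\<And>x. x \<in> K \<Longrightarrow> norm x \<le> R"
    using compact_imp_bounded[OF K(1)] by (auto simp: bounded_iff)
  define t where "t n = 1 / real (Suc n)" for n
  have t: "0 < t n" "t n \<le> 1" for n by (auto simp: t_def)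
  have t0: "t \<longlonglongrightarrow> 0" unfolding t_def by (rule LIMSEQ_Suc[OF lim_1_over_n])
  define q where "q n x = (g (t n *\<^sub>R e + x) - g x) / t n" for n x
  have "(\<lambda>n. integral\<^sup>L lborel (q n)) \<longlonglongrightarrow> integral\<^sup>L lborel (pd e g)"
  \<comment> \<open>Increments \<open>t n \<le> 1\<close> move the support by at most 1, hence the
    radius \<open>R + 1\<close>; on that ball the Lipschitz constant bounds the difference
    quotients.\<close>
  proof (rule integral_dominated_convergence[where w = "\<lambda>x. C * indicator (cball 0 (R + 1)) x"])
    show "pd e g \<in> borel_measurable lborel"
      using borel_measurable_continuous_onI[OF c[OF e]] by simp
    show "q n \<in> borel_measurable lborel" for n unfolding q_def by measurable
    show "integrable lborel (\<lambda>x. C * indicator (cball (0::'a) (R + 1)) x)"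
      by (intro integrable_mult_right integrable_real_indicator)
        (use emeasure_bounded_finite[OF bounded_cball] in auto)
    show "AE x in lborel. (\<lambda>n. q n x) \<longlonglongrightarrow> pd e g x"
    proof (rule AE_I2)
      fix x
      have "((\<lambda>s. s *\<^sub>R e + x) has_derivative (\<lambda>s. s *\<^sub>R e)) (at 0)"
        by (auto intro!: derivative_eq_intros)
      moreover have "(g has_derivative (\<lambda>h. pd h g x)) (at (0 *\<^sub>R e + x))"
        using differentiable_has_derivative[OF d] by simp
      ultimately have "((\<lambda>s. g (s *\<^sub>R e + x)) has_derivative (\<lambda>s. pd (s *\<^sub>R e) g x)) (at 0)"
        by (rule has_derivative_compose)
      then have "((\<lambda>s. g (s *\<^sub>R e + x)) has_real_derivative pd e g x) (at 0)"
        by (simp add: has_field_derivative_def linear_cmul[OF linear_frechet_derivative[OF d]] mult.commute[of _ "pd e g x"])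
      then have *: "((\<lambda>h. (g (h *\<^sub>R e + x) - g x) / h) \<longlongrightarrow> pd e g x) (at 0)"
        by (simp add: DERIV_def)
      show "(\<lambda>n. q n x) \<longlonglongrightarrow> pd e g x" unfolding q_def
        by (rule filterlim_compose[OF *]) (use t0 t in \<open>auto simp: filterlim_at less_imp_neq[symmetric]\<close>)
    qed
    show "AE x in lborel. norm (q n x) \<le> C * indicator (cball 0 (R + 1)) x" for n
    proof (rule AE_I2)
      fix x :: 'a
      show "norm (q n x) \<le> C * indicator (cball 0 (R + 1)) x"
      proof (cases "norm x \<le> R + 1")
        case True
        have "\<bar>g (t n *\<^sub>R e + x) - g x\<bar> \<le> C * t n"
          using lip[of "t n *\<^sub>R e + x" x] e t[of n] by (simp add: C_def)
        then show ?thesis using True t[of n] by (simp add: q_def field_simps)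
      next
        case False
        have "norm x \<le> norm (t n *\<^sub>R e + x) + norm (t n *\<^sub>R e)"
          using norm_triangle_ineq4[of "t n *\<^sub>R e + x" "t n *\<^sub>R e"] by simp
        then have "norm (t n *\<^sub>R e + x) > R" using False e t[of n] by simp
        then have "t n *\<^sub>R e + x \<notin> K" "x \<notin> K" using R False by force+
        then show ?thesis using K False by (simp add: q_def)
      qed
    qed
  qed
  moreover have "integral\<^sup>L lborel (q n) = 0" for n
  proof -
    have "integrable lborel (\<lambda>x. g (t n *\<^sub>R e + x))"
    proof (rule compact_support_integrable)
      show "continuous_on UNIV (\<lambda>x. g (t n *\<^sub>R e + x))"
        by (rule continuous_on_compose2[OF gc]) (auto intro!: continuous_intros)
      show "compact ((\<lambda>x. x - t n *\<^sub>R e) ` K)"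
        by (intro compact_continuous_image K) (auto intro!: continuous_intros)
      show "g (t n *\<^sub>R e + x) = 0" if "x \<notin> (\<lambda>x. x - t n *\<^sub>R e) ` K" for x
        using that K(2)[of "t n *\<^sub>R e + x"] by (force simp: image_iff algebra_simps)
    qed
    then have "integral\<^sup>L lborel (q n) = (integral\<^sup>L lborel (\<lambda>x. g (t n *\<^sub>R e + x)) - integral\<^sup>L lborel g) / t n"
      unfolding q_def using gi by simp
    then show ?thesis by (simp add: lborel_integral_translate)
  qed
  ultimately show ?thesis by (simp add: LIMSEQ_const_iff)
qed

text \<open>The derivative of the product has integral zero. Continuity of first derivatives on
  \<open>S\<close> is all that is asked, since \<open>u\<close> will be a merely C^1 function of a
  smooth one and \<open>w\<close> may involve coefficients defined on \<open>S\<close>.\<close>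

lemma integration_by_parts:
  fixes u w :: "'a::euclidean_space \<Rightarrow> real"
  assumes S: "open S" "compact K" "K \<subseteq> S"
    and w0: "\<And>x. x \<notin> K \<Longrightarrow> w x = 0"
    and du: "\<And>x. x \<in> S \<Longrightarrow> u differentiable at x" and dw: "\<And>x. x \<in> S \<Longrightarrow> w differentiable at x"
    and cu: "\<And>e. e \<in> Basis \<Longrightarrow> continuous_on S (pd e u)" and cw: "\<And>e. e \<in> Basis \<Longrightarrow> continuous_on S (pd e w)"
    and e: "e \<in> Basis"
  shows "(\<integral>x. u x * pd e w x \<partial>lborel) = - (\<integral>x. pd e u x * w x \<partial>lborel)"
    and "integrable lborel (\<lambda>x. u x * pd e w x)" "integrable lborel (\<lambda>x. pd e u x * w x)"
proof -
  have uc: "continuous_on S u" and wc: "continuous_on S w"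
    using du dw by (auto simp: continuous_at_imp_continuous_on differentiable_imp_continuous_within)
  have "continuous_on UNIV (\<lambda>x. u x * pd i w x)" if "i \<in> Basis" for i
    using pd_eq_0_outside[OF S(2) w0]
    by (intro continuous_on_zero_extend[OF S] continuous_intros uc cw that) auto
  note c1 = this
  have c2: "continuous_on UNIV (\<lambda>x. pd i u x * w x)" if "i \<in> Basis" for i
    using w0 by (intro continuous_on_zero_extend[OF S] continuous_intros wc cu that) auto
  show i1: "integrable lborel (\<lambda>x. u x * pd e w x)"
    by (rule compact_support_integrable[OF c1[OF e] S(2)]) (simp add: pd_eq_0_outside[OF S(2) w0])
  show i2: "integrable lborel (\<lambda>x. pd e u x * w x)"
    by (rule compact_support_integrable[OF c2[OF e] S(2)]) (simp add: w0)
  let ?g = "\<lambda>x. u x * w x"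
  have pdg: "pd i ?g x = u x * pd i w x + pd i u x * w x" for i x
  proof (cases "x \<in> S")
    case True
    then show ?thesis by (intro pd_mult du dw)
  next
    case False
    then have "x \<notin> K" using S by auto
    then show ?thesis using pd_eq_0_outside(1)[OF S(2), of ?g x i] pd_eq_0_outside(1)[OF S(2) w0] w0 by auto
  qed
  have "integral\<^sup>L lborel (pd e ?g) = 0"
  proof (rule integral_pd_eq_0[where K = K])
    show "?g differentiable at x" for x
      using du[of x] dw[of x] pd_eq_0_outside(2)[OF S(2), of ?g x] w0 S(3)
      by (cases "x \<in> S") (auto intro: differentiable_mult)
    show "continuous_on UNIV (pd i ?g)" if "i \<in> Basis" for i
      unfolding pdg[abs_def] by (intro continuous_intros c1 c2 that)
  qed (use S w0 e in auto)
  then show "(\<integral>x. u x * pd e w x \<partial>lborel) = - (\<integral>x. pd e u x * w x \<partial>lborel)"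
    using i1 i2 by (simp add: pdg[abs_def])
qed

section \<open>Mollification\<close>

text \<open>Convolution with the kernel as first argument, because derivatives act on the
  kernel.\<close>

definition moll :: "('a::euclidean_space \<Rightarrow> real) \<Rightarrow> ('a \<Rightarrow> real) \<Rightarrow> 'a \<Rightarrow> real" where
  "moll \<rho> u x = (\<integral>y. u y * \<rho> (x - y) \<partial>lborel)"

definition mollifier :: "real \<Rightarrow> ('a::euclidean_space \<Rightarrow> real) \<Rightarrow> bool" where
  "mollifier r \<rho> \<longleftrightarrow> smooth_on UNIV \<rho> \<and> (\<forall>x. \<rho> x \<ge> 0) \<and> (\<forall>x. x \<notin> cball 0 r \<longrightarrow> \<rho> x = 0) \<and>
     integral\<^sup>L lborel \<rho> = 1"

lemma integrable_mult_continuous_bounded: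
  fixes u k :: "'a::euclidean_space \<Rightarrow> real"
  assumes "integrable lborel u" "continuous_on UNIV k" "\<And>x. \<bar>k x\<bar> \<le> M"
  shows "integrable lborel (\<lambda>y. u y * k y)"
proof (rule Bochner_Integration.integrable_bound)
  show "integrable lborel (\<lambda>y. M * u y)" using assms by simp
  show "(\<lambda>y. u y * k y) \<in> borel_measurable lborel"
    using assms(1) borel_measurable_continuous_onI[OF assms(2)] by measurable
  show "AE y in lborel. norm (u y * k y) \<le> norm (M * u y)"
  proof (rule AE_I2)
    fix y
    have "\<bar>k y\<bar> \<le> \<bar>M\<bar>" using assms(3)[of y] by linarith
    then show "norm (u y * k y) \<le> norm (M * u y)"
      by (simp add: abs_mult mult.commute mult_right_mono)
  qed
qed

lemma smooth_compact_support_bounds: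
  fixes \<rho> :: "'a::euclidean_space \<Rightarrow> real"
  assumes "smooth_on UNIV \<rho>" "compact K" "\<And>x. x \<notin> K \<Longrightarrow> \<rho> x = 0"
  obtains M where "M > 0" "\<And>x. \<bar>\<rho> x\<bar> \<le> M" "\<And>x e. e \<in> Basis \<Longrightarrow> \<bar>pd e \<rho> x\<bar> \<le> M"
    "\<And>x h. \<bar>pd h \<rho> x\<bar> \<le> M * norm h" "\<And>x y. \<bar>\<rho> x - \<rho> y\<bar> \<le> M * norm (x - y)"
proof -
  have d: "\<rho> differentiable at x" for x using assms(1) smooth_on_differentiable by blast
  obtain M1 where M1: "M1 > 0" "\<And>x. \<bar>\<rho> x\<bar> \<le> M1"
    using compact_support_bounded[OF smooth_on_continuous[OF assms(1)] assms(2,3)] by metis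
  have "\<exists>M. \<forall>x. \<bar>pd i \<rho> x\<bar> \<le> M" if "i \<in> Basis" for i
    by (rule compact_support_bounded[OF smooth_on_continuous[OF smooth_on_pd[OF assms(1) that]] assms(2)])
      (auto simp: pd_eq_0_outside[OF assms(2,3)])
  then obtain M0 where M0: "\<And>i x. i \<in> Basis \<Longrightarrow> \<bar>pd i \<rho> x\<bar> \<le> M0 i" by metis
  have M00: "0 \<le> M0 j" if "j \<in> Basis" for j using M0[OF that, of undefined] by linarith
  define M where "M = M1 + (\<Sum>i\<in>Basis. M0 i)"
  have s0: "0 \<le> (\<Sum>i\<in>Basis. M0 i)" using M00 by (intro sum_nonneg) auto
  have M: "\<bar>pd i \<rho> x\<bar> \<le> M" if "i \<in> Basis" for i x
  proof -
    have "M0 i \<le> (\<Sum>i\<in>Basis. M0 i)" using that M00 by (intro member_le_sum) auto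
    then show ?thesis using M0[OF that, of x] M1 by (simp add: M_def)
  qed
  have M': "M \<le> real DIM('a) * M" using M1 s0 by (simp add: M_def)
  have Mp: "M > 0" using M1 s0 by (simp add: M_def)
  show ?thesis
  proof (rule that[of "real DIM('a) * M"])
    show "real DIM('a) * M > 0" using Mp by simp
    show "\<bar>\<rho> x\<bar> \<le> real DIM('a) * M" for x using M1(2)[of x] s0 M' by (simp add: M_def)
    show "\<bar>pd e \<rho> x\<bar> \<le> real DIM('a) * M" if "e \<in> Basis" for e x using M[OF that, of x] M' by simp
    show "\<bar>pd h \<rho> x\<bar> \<le> real DIM('a) * M * norm h" for x h
      using norm_pd_le[of \<rho> x M h] d M by auto
    show "\<bar>\<rho> x - \<rho> y\<bar> \<le> real DIM('a) * M * norm (x - y)" for x y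
      using lipschitz_of_pd_bound[of UNIV \<rho> M x y] d M by auto
  qed
qed

text \<open>Differentiation under the integral sign. The derivative is tested along sequences so
  that dominated convergence applies; the remainder quotient of the kernel is at most
  \<open>2 * M\<close>, one \<open>M\<close> from its Lipschitz bound and one from its
  derivative.\<close>

lemma moll_has_derivative:
  fixes \<rho> u :: "'a::euclidean_space \<Rightarrow> real"
  assumes u: "integrable lborel u" and \<rho>: "smooth_on UNIV \<rho>" "compact K" "\<And>x. x \<notin> K \<Longrightarrow> \<rho> x = 0"
  shows "(moll \<rho> u has_derivative (\<lambda>h. moll (pd h \<rho>) u x)) (at x)"
proof -
  obtain M where M: "M > 0" "\<And>x. \<bar>\<rho> x\<bar> \<le> M" "\<And>x e. e \<in> Basis \<Longrightarrow> \<bar>pd e \<rho> x\<bar> \<le> M"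
    "\<And>x h. \<bar>pd h \<rho> x\<bar> \<le> M * norm h" "\<And>x y. \<bar>\<rho> x - \<rho> y\<bar> \<le> M * norm (x - y)"
    using smooth_compact_support_bounds[OF \<rho>] by metis
  have d: "\<rho> differentiable at x" for x using \<rho>(1) smooth_on_differentiable by blast
  have [measurable]: "u \<in> borel_measurable lborel" using u by simp
  have c\<rho>: "continuous_on UNIV \<rho>" using \<rho>(1) smooth_on_continuous by blast
  have cp: "continuous_on UNIV (pd h \<rho>)" for h
  proof -
    have "continuous_on UNIV (\<lambda>x. \<Sum>e\<in>Basis. (h \<bullet> e) *\<^sub>R pd e \<rho> x)"
      using smooth_on_continuous[OF smooth_on_pd[OF \<rho>(1)]] by (intro continuous_intros) auto
    moreover have "pd h \<rho> = (\<lambda>x. \<Sum>e\<in>Basis. (h \<bullet> e) *\<^sub>R pd e \<rho> x)"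
      by (rule ext) (rule pd_linear_expand[OF d])
    ultimately show ?thesis by (simp only:)
  qed
  have cr: "continuous_on UNIV (\<lambda>y. k (x - y))" if "continuous_on UNIV k" for k :: "'a \<Rightarrow> real" and x
    by (rule continuous_on_compose2[OF that]) (auto intro!: continuous_intros)
  have i1: "integrable lborel (\<lambda>y. u y * \<rho> (x - y))" for x
    by (rule integrable_mult_continuous_bounded[OF u cr[OF c\<rho>]]) (rule M)
  have i2: "integrable lborel (\<lambda>y. u y * pd h \<rho> (x - y))" for x h
    by (rule integrable_mult_continuous_bounded[OF u cr[OF cp]]) (rule M)
  have lin: "linear (\<lambda>h. moll (pd h \<rho>) u x)"
  proof (rule linearI)
    have l: "linear (\<lambda>h. pd h \<rho> z)" for z by (rule linear_frechet_derivative[OF d])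
    show "moll (pd (a + b) \<rho>) u x = moll (pd a \<rho>) u x + moll (pd b \<rho>) u x" for a b
      unfolding moll_def using i2 by (simp add: linear_add[OF l] distrib_left)
    show "moll (pd (c *\<^sub>R a) \<rho>) u x = c *\<^sub>R moll (pd a \<rho>) u x" for c a
      unfolding moll_def by (simp add: linear_cmul[OF l] mult.left_commute)
  qed
  show ?thesis
    unfolding has_derivative_iff_norm tendsto_at_iff_sequentially
  proof (intro conjI allI impI)
    show "bounded_linear (\<lambda>h. moll (pd h \<rho>) u x)" using lin by (simp add: linear_conv_bounded_linear)
    fix X assume X: "\<forall>i. X i \<in> UNIV - {x}" "X \<longlonglongrightarrow> x"
    define q where "q i y = u y * ((\<rho> (X i - y) - \<rho> (x - y) - pd (X i - x) \<rho> (x - y)) / norm (X i - x))" for i y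
    have eq: "(moll \<rho> u (X i) - moll \<rho> u x - moll (pd (X i - x) \<rho>) u x) / norm (X i - x) = integral\<^sup>L lborel (q i)" for i
    proof -
      have "integral\<^sup>L lborel (q i) = (\<integral>y. (u y * \<rho> (X i - y) - u y * \<rho> (x - y) - u y * pd (X i - x) \<rho> (x - y)) / norm (X i - x) \<partial>lborel)"
        unfolding q_def by (intro Bochner_Integration.integral_cong) (auto simp: algebra_simps)
      also have "\<dots> = (\<integral>y. (u y * \<rho> (X i - y) - u y * \<rho> (x - y) - u y * pd (X i - x) \<rho> (x - y)) \<partial>lborel) / norm (X i - x)"
        by (rule integral_divide_zero)
      finally show ?thesis
        unfolding moll_def using i1 i2 by simp
    qed
    have "(\<lambda>i. integral\<^sup>L lborel (q i)) \<longlonglongrightarrow> integral\<^sup>L lborel (\<lambda>y::'a. 0 :: real)"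
    proof (rule integral_dominated_convergence[where w = "\<lambda>y. 2 * M * \<bar>u y\<bar>"])
      have [measurable]: "(\<lambda>y. \<rho> (z - y)) \<in> borel_measurable borel" "(\<lambda>y. pd h \<rho> (z - y)) \<in> borel_measurable borel" for z h
        by (auto intro!: borel_measurable_continuous_onI cr cp c\<rho>)
      show "q i \<in> borel_measurable lborel" for i unfolding q_def by measurable
      show "integrable lborel (\<lambda>y. 2 * M * \<bar>u y\<bar>)" using u by simp
      show "AE y in lborel. norm (q i y) \<le> 2 * M * \<bar>u y\<bar>" for i
      proof (rule AE_I2)
        fix y
        have n: "norm (X i - x) > 0" using X by auto
        have "\<bar>\<rho> (X i - y) - \<rho> (x - y) - pd (X i - x) \<rho> (x - y)\<bar> \<le> 2 * M * norm (X i - x)"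
          using M(5)[of "X i - y" "x - y"] M(4)[of "x - y" "X i - x"] by (simp add: algebra_simps)
        then have "\<bar>\<rho> (X i - y) - \<rho> (x - y) - pd (X i - x) \<rho> (x - y)\<bar> / norm (X i - x) \<le> 2 * M"
          using n by (simp add: pos_divide_le_eq)
        then have "\<bar>u y\<bar> * (\<bar>\<rho> (X i - y) - \<rho> (x - y) - pd (X i - x) \<rho> (x - y)\<bar> / norm (X i - x)) \<le> \<bar>u y\<bar> * (2 * M)"
          by (intro mult_left_mono) auto
        then show "norm (q i y) \<le> 2 * M * \<bar>u y\<bar>" by (simp add: q_def abs_mult mult_ac)
      qed
      show "AE y in lborel. (\<lambda>i. q i y) \<longlonglongrightarrow> 0"
      proof (rule AE_I2)
        fix y
        have "((\<lambda>x'. norm (\<rho> x' - \<rho> (x - y) - pd (x' - (x - y)) \<rho> (x - y)) / norm (x' - (x - y))) \<longlongrightarrow> 0) (at (x - y))"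
          using differentiable_has_derivative[OF d[of "x - y"]] unfolding has_derivative_iff_norm by blast
        moreover have "filterlim (\<lambda>i. X i - y) (at (x - y)) sequentially"
          using X by (auto simp: filterlim_at intro!: tendsto_intros)
        ultimately have "(\<lambda>i. norm (\<rho> (X i - y) - \<rho> (x - y) - pd (X i - y - (x - y)) \<rho> (x - y)) / norm (X i - y - (x - y))) \<longlonglongrightarrow> 0"
          by (rule filterlim_compose)
        then have "(\<lambda>i. \<bar>(\<rho> (X i - y) - \<rho> (x - y) - pd (X i - x) \<rho> (x - y)) / norm (X i - x)\<bar>) \<longlonglongrightarrow> 0"
          by simp
        then have "(\<lambda>i. (\<rho> (X i - y) - \<rho> (x - y) - pd (X i - x) \<rho> (x - y)) / norm (X i - x)) \<longlonglongrightarrow> 0"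
          by (rule tendsto_rabs_zero_cancel)
        then have "(\<lambda>i. u y * ((\<rho> (X i - y) - \<rho> (x - y) - pd (X i - x) \<rho> (x - y)) / norm (X i - x))) \<longlonglongrightarrow> u y * 0"
          by (rule tendsto_mult_left)
        then show "(\<lambda>i. q i y) \<longlonglongrightarrow> 0" by (simp add: q_def)
      qed
    qed auto
    then have "(\<lambda>i. \<bar>integral\<^sup>L lborel (q i)\<bar>) \<longlonglongrightarrow> 0" by (simp add: tendsto_rabs_zero)
    then show "((\<lambda>y. norm (moll \<rho> u y - moll \<rho> u x - moll (pd (y - x) \<rho>) u x) / norm (y - x)) \<circ> X) \<longlonglongrightarrow> 0"
      unfolding o_def by (simp add: eq[symmetric])
  qed
qed

text \<open>All derivatives fall on the kernel, so the induction generalizes over kernels supported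
  in the same \<open>K\<close>.\<close>

lemma smooth_on_moll:
  fixes \<rho> u :: "'a::euclidean_space \<Rightarrow> real"
  assumes u: "integrable lborel u" and \<rho>: "smooth_on UNIV \<rho>" "compact K" "\<And>x. x \<notin> K \<Longrightarrow> \<rho> x = 0"
  shows "smooth_on UNIV (moll \<rho> u)"
proof -
  have "Cdiff n UNIV (moll \<rho> u)" if "smooth_on UNIV \<rho>" "\<And>x. x \<notin> K \<Longrightarrow> \<rho> x = 0" for n and \<rho> :: "'a \<Rightarrow> real"
    using that
  proof (induction n arbitrary: \<rho>)
    case (Suc n)
    note hd = moll_has_derivative[OF u Suc.prems(1) \<rho>(2) Suc.prems(2)]
    have "pd e (moll \<rho> u) = moll (pd e \<rho>) u" for e using pd_eqI[OF hd] by auto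
    moreover have "Cdiff n UNIV (moll (pd e \<rho>) u)" if "e \<in> Basis" for e
      by (rule Suc.IH) (use Suc.prems that smooth_on_pd pd_eq_0_outside[OF \<rho>(2) Suc.prems(2)] in auto)
    moreover have "moll \<rho> u differentiable at x" for x
      using hd unfolding differentiable_def by blast
    ultimately show ?case by simp
  qed simp
  then show ?thesis using \<rho> by (simp add: smooth_on_iff_Cdiff)
qed

text \<open>Rescaling the bump multiplies the L^1 norm of its derivatives by 1/r, so
  \<open>C\<close> does not depend on \<open>r\<close>. In the commutator estimate this 1/r is
  compensated by the oscillation of the field over a ball of radius r.\<close>

lemma mollifier_exists:
  "\<exists>C. \<forall>r>0. \<exists>\<rho>::'a::euclidean_space \<Rightarrow> real. mollifier r \<rho> \<and> (\<forall>e\<in>Basis. (\<integral>x. \<bar>pd e \<rho> x\<bar> \<partial>lborel) \<le> C / r)"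
proof -
  let ?b = "bump :: 'a \<Rightarrow> real"
  have bz: "?b x = 0" if "x \<notin> cball 0 1" for x using that by (auto intro!: bump_zero)
  have bc: "continuous_on UNIV ?b" by (rule smooth_on_continuous[OF smooth_on_bump])
  have bi: "integrable lborel ?b" by (rule compact_support_integrable[OF bc compact_cball bz])
  define c where "c = integral\<^sup>L lborel ?b"
  have c: "c > 0"
  proof -
    have "c \<noteq> 0"
    proof
      assume "c = 0"
      then have "AE x in lborel. ?b x = 0"
        using integral_nonneg_eq_0_iff_AE[OF bi] by (simp add: c_def bump_nonneg)
      then have "AE x in lborel. x \<notin> ball (0::'a) 1"
        by (rule eventually_mono) (use bump_pos in \<open>auto simp: less_le\<close>)
      then have "emeasure lborel (ball (0::'a) 1) = 0"
        by (subst (asm) AE_iff_measurable[OF _ refl]) (auto simp: ball_def)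
      moreover have "emeasure lborel (ball (0::'a) 1) \<noteq> 0"
        using open_not_negligible[of "ball (0::'a) 1"]
        by (auto simp: negligible_iff_null_sets null_sets_def)
      ultimately show False by simp
    qed
    moreover have "c \<ge> 0" unfolding c_def by (simp add: bump_nonneg)
    ultimately show ?thesis by simp
  qed
  define C where "C = (\<Sum>e\<in>Basis. integral\<^sup>L lborel (\<lambda>x. \<bar>pd e ?b x\<bar>)) / c"
  have "\<exists>\<rho>::'a \<Rightarrow> real. mollifier r \<rho> \<and> (\<forall>e\<in>Basis. (\<integral>x. \<bar>pd e \<rho> x\<bar> \<partial>lborel) \<le> C / r)" if r: "r > 0" for r
  proof -
    define a where "a = inverse r ^ DIM('a) / c"
    define \<rho> where "\<rho> x = a * ?b (0 + inverse r *\<^sub>R x)" for x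
    have a: "a > 0" using r c by (simp add: a_def)
    note aff = smooth_on_affine[OF smooth_on_bump, where x = "0::'a" and c = "inverse r"]
    have sm: "smooth_on UNIV \<rho>"
      unfolding \<rho>_def[abs_def] by (intro smooth_on_mult aff(1)) auto
    have pd\<rho>: "pd e \<rho> x = a * (inverse r * pd e ?b (0 + inverse r *\<^sub>R x))" for e x
      unfolding \<rho>_def using smooth_on_differentiable[OF aff(1), of x]
      by (subst pd_mult) (auto simp: aff(2)[simplified])
    have cov: "integral\<^sup>L lborel (\<lambda>x::'a. f (0 + inverse r *\<^sub>R x)) = integral\<^sup>L lborel f * r ^ DIM('a)"
      if f: "f \<in> borel_measurable borel" for f :: "'a \<Rightarrow> real"
    proof -
      have "integral\<^sup>L lborel f = integral\<^sup>L (density (distr lborel borel (\<lambda>x. 0 + inverse r *\<^sub>R x)) (\<lambda>_. ennreal (\<bar>inverse r\<bar> ^ DIM('a)))) f"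
        by (subst lborel_affine[of "inverse r" "0::'a"]) (use r in \<open>auto simp: ennreal_power\<close>)
      also have "\<dots> = (\<integral>x. \<bar>inverse r\<bar> ^ DIM('a) *\<^sub>R f (0 + inverse r *\<^sub>R x) \<partial>lborel)"
        by (subst integral_density) (use f r in \<open>auto simp: integral_distr\<close>)
      finally show ?thesis using r by (simp add: power_inverse field_simps)
    qed
    have [measurable]: "?b \<in> borel_measurable borel" by (rule borel_measurable_continuous_onI[OF bc])
    have "integral\<^sup>L lborel \<rho> = 1"
      unfolding \<rho>_def using r c by (simp add: cov[simplified] c_def[symmetric] a_def power_inverse)
    then have "mollifier r \<rho>"
      unfolding mollifier_def using sm a r
      by (auto simp: \<rho>_def bump_nonneg field_simps intro!: bump_zero)
    moreover have "(\<integral>x. \<bar>pd e \<rho> x\<bar> \<partial>lborel) \<le> C / r" if e: "e \<in> Basis" for e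
    proof -
      have [measurable]: "(\<lambda>x. \<bar>pd e ?b x\<bar>) \<in> borel_measurable borel"
        using borel_measurable_continuous_onI[OF smooth_on_continuous[OF smooth_on_pd[OF smooth_on_bump e]]] by measurable
      have "(\<integral>x. \<bar>pd e \<rho> x\<bar> \<partial>lborel) = (\<integral>x. \<bar>pd e ?b (0 + inverse r *\<^sub>R x)\<bar> \<partial>lborel) * (a / r)"
        unfolding pd\<rho> using a r by (simp add: abs_mult field_simps flip: integral_mult_right_zero integral_divide_zero)
      also have "\<dots> = (\<integral>x. \<bar>pd e ?b x\<bar> \<partial>lborel) / c / r"
        by (subst cov) (use r c in \<open>auto simp: a_def power_inverse\<close>)
      also have "\<dots> \<le> C / r"
        unfolding C_def using r c e by (intro divide_right_mono member_le_sum) auto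
      finally show ?thesis .
    qed
    ultimately show ?thesis by blast
  qed
  then show ?thesis by blast
qed

section \<open>Approximation in \<open>L\<^sup>p\<close>\<close>

lemma integral_power_tendsto_0:
  fixes s :: "nat \<Rightarrow> 'a::euclidean_space \<Rightarrow> real"
  assumes [measurable]: "\<And>n. s n \<in> borel_measurable lborel" and w: "integrable lborel w"
    and lim: "AE x in lborel. (\<lambda>n. s n x) \<longlonglongrightarrow> 0" and b: "\<And>n. AE x in lborel. \<bar>s n x\<bar> ^ p \<le> w x"
    and p: "p > 0"
  shows "(\<lambda>n. \<integral>x. \<bar>s n x\<bar> ^ p \<partial>lborel) \<longlonglongrightarrow> 0"
proof -
  have "(\<lambda>n. \<integral>x. \<bar>s n x\<bar> ^ p \<partial>lborel) \<longlonglongrightarrow> integral\<^sup>L lborel (\<lambda>x::'a. 0::real)"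
  proof (rule integral_dominated_convergence[where w = w])
    show "AE x in lborel. (\<lambda>n. \<bar>s n x\<bar> ^ p) \<longlonglongrightarrow> 0"
      using lim
    proof eventually_elim
      case (elim x)
      have "(\<lambda>n. \<bar>s n x\<bar> ^ p) \<longlonglongrightarrow> \<bar>0\<bar> ^ p" by (intro tendsto_intros elim)
      then show ?case using p by (simp add: zero_power)
    qed
  qed (use w b in \<open>auto simp: power_abs\<close>)
  then show ?thesis by simp
qed

text \<open>Each term is at most the largest one. Three terms are what the splitting of a
  translation error produces.\<close>

lemma power_add3_le:
  fixes a b c :: real
  assumes "a \<ge> 0" "b \<ge> 0" "c \<ge> 0"
  shows "(a + b + c) ^ p \<le> 3 ^ p * (a ^ p + b ^ p + c ^ p)"
proof -
  define m where "m = max a (max b c)"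
  have "(a + b + c) ^ p \<le> (3 * m) ^ p" using assms by (intro power_mono) (auto simp: m_def)
  also have "\<dots> = 3 ^ p * m ^ p" by (rule power_mult_distrib)
  also have "m ^ p \<le> a ^ p + b ^ p + c ^ p"
    using assms by (auto simp: m_def max_def)
  finally show ?thesis by simp
qed

lemma clip_le: "\<bar>max (- M) (min M t)\<bar> \<le> M" if "M \<ge> 0" for M t :: real
  using that by (auto simp: max_def min_def)

lemma Lp_bounded_approx:
  fixes u :: "'a::euclidean_space \<Rightarrow> real"
  assumes [measurable]: "u \<in> borel_measurable lborel" and i: "integrable lborel (\<lambda>x. \<bar>u x\<bar> ^ p)"
    and p: "p > 0" and "\<epsilon> > 0"
  obtains w n where "w \<in> borel_measurable lborel" "\<And>x. \<bar>w x\<bar> \<le> real n" "\<And>x. norm x > n \<Longrightarrow> w x = 0"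
    "integrable lborel (\<lambda>x. \<bar>u x - w x\<bar> ^ p)" "(\<integral>x. \<bar>u x - w x\<bar> ^ p \<partial>lborel) < \<epsilon>"
proof -
  define w where "w n x = (if norm x \<le> real n then max (- real n) (min (real n) (u x)) else 0)" for n and x :: 'a
  have [measurable]: "w n \<in> borel_measurable lborel" for n unfolding w_def by measurable
  have le: "\<bar>u x - w n x\<bar> \<le> \<bar>u x\<bar>" for x n by (auto simp: w_def max_def min_def)
  have le': "\<bar>u x - w n x\<bar> ^ p \<le> \<bar>u x\<bar> ^ p" for x n using le by (intro power_mono) auto
  have "(\<lambda>n. u x - w n x) \<longlonglongrightarrow> 0" for x
  proof (rule tendsto_eventually, rule eventually_sequentiallyI)
    fix n assume "n \<ge> nat \<lceil>max \<bar>u x\<bar> (norm x)\<rceil>"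
    then show "u x - w n x = 0" by (auto simp: w_def max_def min_def split: if_splits)
  qed
  then have "(\<lambda>n. \<integral>x. \<bar>u x - w n x\<bar> ^ p \<partial>lborel) \<longlonglongrightarrow> 0"
    by (intro integral_power_tendsto_0[OF _ i _ _ p]) (use le' in auto)
  from order_tendstoD(2)[OF this \<open>\<epsilon> > 0\<close>] obtain n where n: "(\<integral>x. \<bar>u x - w n x\<bar> ^ p \<partial>lborel) < \<epsilon>"
    by (auto simp: eventually_sequentially)
  show ?thesis
  proof (rule that[of "w n" n])
    show "integrable lborel (\<lambda>x. \<bar>u x - w n x\<bar> ^ p)"
      by (rule Bochner_Integration.integrable_bound[OF i]) (use le' in \<open>auto simp: power_abs\<close>)
  qed (use n in \<open>auto simp: w_def clip_le\<close>)
qed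

text \<open>Measurability in the sense of \<open>measurable_on\<close> supplies continuous functions
  converging almost everywhere. Clipping them at height \<open>n\<close> and cutting them off in
  space leaves the limit unchanged and makes the convergence dominated.\<close>

lemma Lp_continuous_approx_bounded:
  fixes w :: "'a::euclidean_space \<Rightarrow> real"
  assumes [measurable]: "w \<in> borel_measurable lborel" and b: "\<And>x. \<bar>w x\<bar> \<le> real n"
    and z: "\<And>x. norm x > n \<Longrightarrow> w x = 0" and p: "p > 0" and "\<epsilon> > 0"
  obtains g where "continuous_on UNIV g" "\<And>x. norm x > real n + 1 \<Longrightarrow> g x = 0"
    "integrable lborel (\<lambda>x. \<bar>w x - g x\<bar> ^ p)" "(\<integral>x. \<bar>w x - g x\<bar> ^ p \<partial>lborel) < \<epsilon>"
proof -
  have "w measurable_on UNIV"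
    by (rule lebesgue_measurable_imp_measurable_on_real)
      (auto intro: measurable_completion)
  then obtain N h where N: "negligible N" and h: "\<And>i. continuous_on UNIV (h i)"
    and lim: "\<And>x. x \<notin> N \<Longrightarrow> (\<lambda>i. h i x) \<longlonglongrightarrow> w x"
    unfolding measurable_on_def by auto
  define cut where "cut x = max 0 (min 1 (real n + 1 - norm x))" for x :: 'a
  have cut: "0 \<le> cut x" "cut x \<le> 1" "norm x > real n + 1 \<Longrightarrow> cut x = 0" "norm x \<le> n \<Longrightarrow> cut x = 1" for x
    by (auto simp: cut_def)
  define g where "g i x = max (- real n) (min (real n) (h i x)) * cut x" for i x
  have gc: "continuous_on UNIV (g i)" for i
    unfolding g_def cut_def by (intro continuous_intros h)
  have [measurable]: "g i \<in> borel_measurable lborel" for i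
    using borel_measurable_continuous_onI[OF gc] by simp
  have gb: "\<bar>g i x\<bar> \<le> n" for i x
  proof -
    have "\<bar>g i x\<bar> \<le> real n * 1"
      unfolding g_def abs_mult using cut[of x] by (intro mult_mono clip_le) auto
    then show ?thesis by simp
  qed
  define W where "W x = (2 * real n) ^ p * indicator (cball 0 (real n + 1)) x" for x :: 'a
  have Wi: "integrable lborel W"
    unfolding W_def by (intro integrable_mult_right integrable_real_indicator)
        (use emeasure_bounded_finite[OF bounded_cball] in auto)
  have le: "\<bar>w x - g i x\<bar> ^ p \<le> W x" for i x
  proof (cases "norm x \<le> real n + 1")
    case True
    have "\<bar>w x - g i x\<bar> \<le> 2 * real n" using b[of x] gb[of i x] by linarith
    then have "\<bar>w x - g i x\<bar> ^ p \<le> (2 * real n) ^ p" by (intro power_mono) auto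
    then show ?thesis using True by (simp add: W_def)
  next
    case False
    then show ?thesis using z[of x] cut[of x] p by (simp add: W_def g_def zero_power)
  qed
  have "AE x in lebesgue. x \<notin> N"
    using N unfolding negligible_iff_null_sets by (rule AE_not_in)
  then have "AE x in lborel. x \<notin> N" by (simp add: AE_completion_iff)
  then have "AE x in lborel. (\<lambda>i. w x - g i x) \<longlonglongrightarrow> 0"
  proof eventually_elim
    case (elim x)
    have "(\<lambda>i. w x - g i x) \<longlonglongrightarrow> w x - max (- real n) (min (real n) (w x)) * cut x"
      unfolding g_def by (intro tendsto_intros lim elim)
    moreover have "w x - max (- real n) (min (real n) (w x)) * cut x = 0"
      using b[of x] z[of x] cut(4)[of x] by (cases "norm x \<le> n") (auto simp: max_def min_def)
    ultimately show ?case by simp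
  qed
  then have "(\<lambda>i. \<integral>x. \<bar>w x - g i x\<bar> ^ p \<partial>lborel) \<longlonglongrightarrow> 0"
    by (intro integral_power_tendsto_0[OF _ Wi _ _ p]) (use le in auto)
  from order_tendstoD(2)[OF this \<open>\<epsilon> > 0\<close>] obtain i where i: "(\<integral>x. \<bar>w x - g i x\<bar> ^ p \<partial>lborel) < \<epsilon>"
    by (auto simp: eventually_sequentially)
  show ?thesis
  proof (rule that[of "g i"])
    show "integrable lborel (\<lambda>x. \<bar>w x - g i x\<bar> ^ p)"
      by (rule Bochner_Integration.integrable_bound[OF Wi])
        (use le in \<open>auto simp: power_abs W_def intro: order_trans[OF _ abs_ge_self]\<close>)
  qed (use i gc cut in \<open>auto simp: g_def\<close>)
qed

lemma Lp_continuous_approx: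
  fixes u :: "'a::euclidean_space \<Rightarrow> real"
  assumes m [measurable]: "u \<in> borel_measurable lborel" and i: "integrable lborel (\<lambda>x. \<bar>u x\<bar> ^ p)"
    and p: "p > 0" and "\<epsilon> > 0"
  obtains g R where "continuous_on UNIV g" "\<And>x. norm x > R \<Longrightarrow> g x = 0" "R > 0"
    "integrable lborel (\<lambda>x. \<bar>u x - g x\<bar> ^ p)" "(\<integral>x. \<bar>u x - g x\<bar> ^ p \<partial>lborel) < \<epsilon>"
proof -
  define \<epsilon>' where "\<epsilon>' = \<epsilon> / (2 * 3 ^ p)"
  have e: "\<epsilon>' > 0" using \<open>\<epsilon> > 0\<close> by (simp add: \<epsilon>'_def)
  obtain w n where w: "w \<in> borel_measurable lborel" "\<And>x. \<bar>w x\<bar> \<le> real n" "\<And>x. norm x > n \<Longrightarrow> w x = 0"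
    "integrable lborel (\<lambda>x. \<bar>u x - w x\<bar> ^ p)" "(\<integral>x. \<bar>u x - w x\<bar> ^ p \<partial>lborel) < \<epsilon>'"
    by (rule Lp_bounded_approx[OF m i p e]) (rule that; assumption)
  obtain g where g: "continuous_on UNIV g" "\<And>x. norm x > real n + 1 \<Longrightarrow> g x = 0"
    "integrable lborel (\<lambda>x. \<bar>w x - g x\<bar> ^ p)" "(\<integral>x. \<bar>w x - g x\<bar> ^ p \<partial>lborel) < \<epsilon>'"
    by (rule Lp_continuous_approx_bounded[OF w(1) w(2) _ p e], erule w(3)) (rule that; assumption)
  note [measurable] = w(1)
  have [measurable]: "g \<in> borel_measurable lborel"
    using borel_measurable_continuous_onI[OF g(1)] by simp
  have le: "\<bar>u x - g x\<bar> ^ p \<le> 3 ^ p * (\<bar>u x - w x\<bar> ^ p + \<bar>w x - g x\<bar> ^ p)" for x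
  proof -
    have "\<bar>u x - g x\<bar> ^ p \<le> (\<bar>u x - w x\<bar> + \<bar>w x - g x\<bar> + 0) ^ p" by (intro power_mono) auto
    also have "\<dots> \<le> 3 ^ p * (\<bar>u x - w x\<bar> ^ p + \<bar>w x - g x\<bar> ^ p + 0 ^ p)" by (rule power_add3_le) auto
    finally show ?thesis using p by (simp add: zero_power)
  qed
  have I: "integrable lborel (\<lambda>x. 3 ^ p * (\<bar>u x - w x\<bar> ^ p + \<bar>w x - g x\<bar> ^ p))"
    using w g by simp
  have I2: "integrable lborel (\<lambda>x. \<bar>u x - g x\<bar> ^ p)"
    by (rule Bochner_Integration.integrable_bound[OF I])
       (use le in \<open>auto simp: power_abs intro: order_trans[OF _ abs_ge_self]\<close>)
  have "(\<integral>x. \<bar>u x - g x\<bar> ^ p \<partial>lborel) \<le> (\<integral>x. 3 ^ p * (\<bar>u x - w x\<bar> ^ p + \<bar>w x - g x\<bar> ^ p) \<partial>lborel)"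
    by (intro integral_mono I I2 le)
  also have "\<dots> = 3 ^ p * ((\<integral>x. \<bar>u x - w x\<bar> ^ p \<partial>lborel) + (\<integral>x. \<bar>w x - g x\<bar> ^ p \<partial>lborel))"
    using w g by simp
  also have "\<dots> < 3 ^ p * (\<epsilon>' + \<epsilon>')" using w g by (intro mult_strict_left_mono add_strict_mono) auto
  also have "\<dots> = \<epsilon>" by (simp add: \<epsilon>'_def)
  finally show ?thesis using that[of g "real n + 1"] g I2 by auto
qed

section \<open>Continuity of translations in L^p\<close>

lemma nn_integral_translate:
  fixes f :: "'a::euclidean_space \<Rightarrow> ennreal"
  assumes "f \<in> borel_measurable borel"
  shows "(\<integral>\<^sup>+x. f (x - y) \<partial>lborel) = (\<integral>\<^sup>+x. f x \<partial>lborel)"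
proof -
  have "(\<integral>\<^sup>+x. f x \<partial>lborel) = (\<integral>\<^sup>+x. f x \<partial>(distr lborel borel ((+) (- y))))"
    by (simp add: lborel_distr_plus)
  also have "\<dots> = (\<integral>\<^sup>+x. f (- y + x) \<partial>lborel)"
    using assms by (subst nn_integral_distr) auto
  finally show ?thesis by simp
qed

text \<open>With \<open>g\<close> continuous, compactly supported and close to \<open>u\<close>, the
  increment of \<open>u\<close> splits into the increment of \<open>g\<close> and two copies of
  \<open>u - g\<close>, one translated. The copies have equal norm by translation invariance; the
  increment of \<open>g\<close> is small by uniform continuity.\<close>

lemma Lp_translation_continuous:
  fixes u :: "'a::euclidean_space \<Rightarrow> real"
  assumes m [measurable]: "u \<in> borel_measurable borel" and i: "integrable lborel (\<lambda>x. \<bar>u x\<bar> ^ p)"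
    and p: "p > 0" and \<epsilon>: "\<epsilon> > 0"
  obtains r where "r > 0" "\<And>y. norm y \<le> r \<Longrightarrow> (\<integral>\<^sup>+x. \<bar>u (x - y) - u x\<bar> ^ p \<partial>lborel) \<le> ennreal \<epsilon>"
proof -
  define \<epsilon>' where "\<epsilon>' = \<epsilon> / (3 * 3 ^ p)"
  have e: "\<epsilon>' > 0" using \<open>\<epsilon> > 0\<close> by (simp add: \<epsilon>'_def)
  have m': "u \<in> borel_measurable lborel" by simp
  obtain g R where g: "continuous_on UNIV g" "\<And>x. norm x > R \<Longrightarrow> g x = 0" "R > 0"
    "integrable lborel (\<lambda>x. \<bar>u x - g x\<bar> ^ p)" "(\<integral>x. \<bar>u x - g x\<bar> ^ p \<partial>lborel) < \<epsilon>'"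
    by (rule Lp_continuous_approx[OF m' i p e]) (rule that; assumption)
  have [measurable]: "g \<in> borel_measurable borel"
    using borel_measurable_continuous_onI[OF g(1)] by simp
  define V where "V = measure lborel (cball (0::'a) (R + 1))"
  have V: "emeasure lborel (cball (0::'a) (R + 1)) = ennreal V" "V \<ge> 0"
    unfolding V_def using emeasure_bounded_finite[OF bounded_cball, of "0::'a" "R+1"]
    by (auto intro!: emeasure_eq_ennreal_measure)
  \<comment> \<open>The cap at 1 gives \<open>\<omega> ^ p \<le> \<omega>\<close>, which avoids p-th
    roots; \<open>V + 1\<close> covers the case of volume 0.\<close>
  define \<omega> where "\<omega> = min 1 (\<epsilon>' / (V + 1))"
  have \<omega>: "\<omega> > 0" "\<omega> \<le> 1" using e V by (auto simp: \<omega>_def)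
  have \<omega>p: "\<omega> ^ p * V \<le> \<epsilon>'"
  proof -
    have "\<omega> ^ p \<le> \<omega> ^ 1" using \<omega> p by (intro power_decreasing) auto
    then have "\<omega> ^ p * V \<le> \<epsilon>' / (V + 1) * (V + 1)"
      using V by (intro mult_mono) (auto simp: \<omega>_def e less_imp_le)
    then show ?thesis using V by simp
  qed
  have gz: "g x = 0" if "x \<notin> cball 0 R" for x using g(2) that by auto
  have "uniformly_continuous_on (cball 0 (R + 1)) g"
    by (rule compact_uniformly_continuous) (auto intro: continuous_on_subset[OF g(1)])
  then obtain d where d: "d > 0" "\<And>x x'. x \<in> cball 0 (R+1) \<Longrightarrow> x' \<in> cball 0 (R+1) \<Longrightarrow> dist x' x < d \<Longrightarrow> dist (g x') (g x) < \<omega>"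
    using \<omega> unfolding uniformly_continuous_on_def by metis
  show ?thesis
  proof (rule that[of "min (d / 2) 1"])
    show "min (d / 2) 1 > 0" using d by auto
    fix y :: 'a assume y: "norm y \<le> min (d / 2) 1"
    have gl: "\<bar>g (x - y) - g x\<bar> ^ p \<le> \<omega> ^ p * indicator (cball 0 (R + 1)) x" for x
    proof (cases "norm x \<le> R + 1")
      case True
      have "\<bar>g (x - y) - g x\<bar> \<le> \<omega>"
      proof (cases "norm (x - y) \<le> R + 1")
        case t: True
        then show ?thesis using d(2)[of x "x - y"] True y d(1) by (auto simp: dist_norm norm_minus_commute)
      next
        case f: False
        then have "norm x > R" using y norm_triangle_ineq4[of x y] by linarith
        then show ?thesis using f g(2) \<omega> by simp
      qed
      then show ?thesis using True by (auto intro!: power_mono)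
    next
      case False
      have "norm x \<le> norm (x - y) + norm y" using norm_triangle_ineq[of "x - y" y] by simp
      then have "norm (x - y) > R" using y False by auto
      then show ?thesis using False g(2) p by (simp add: zero_power)
    qed
    let ?h = "\<lambda>x. u x - g x"
    have "(\<integral>\<^sup>+x. \<bar>u (x - y) - u x\<bar> ^ p \<partial>lborel) \<le>
       (\<integral>\<^sup>+x. ennreal (3 ^ p) * (ennreal (\<bar>?h (x - y)\<bar> ^ p) + ennreal (\<omega> ^ p) * indicator (cball 0 (R + 1)) x + ennreal (\<bar>?h x\<bar> ^ p)) \<partial>lborel)"
    proof (rule nn_integral_mono)
      fix x
      have "\<bar>u (x - y) - u x\<bar> ^ p \<le> (\<bar>?h (x - y)\<bar> + \<bar>g (x - y) - g x\<bar> + \<bar>?h x\<bar>) ^ p"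
        by (intro power_mono) auto
      also have "\<dots> \<le> 3 ^ p * (\<bar>?h (x - y)\<bar> ^ p + \<bar>g (x - y) - g x\<bar> ^ p + \<bar>?h x\<bar> ^ p)"
        by (intro power_add3_le) auto
      also have "\<dots> \<le> 3 ^ p * (\<bar>?h (x - y)\<bar> ^ p + \<omega> ^ p * indicator (cball 0 (R + 1)) x + \<bar>?h x\<bar> ^ p)"
        using gl[of x] by simp
      finally have "ennreal (\<bar>u (x - y) - u x\<bar> ^ p) \<le> ennreal \<dots>" by (rule ennreal_leI)
      also have "\<dots> = ennreal (3 ^ p) * (ennreal (\<bar>?h (x - y)\<bar> ^ p) + ennreal (\<omega> ^ p) * indicator (cball 0 (R + 1)) x + ennreal (\<bar>?h x\<bar> ^ p))"
        using \<omega> by (auto simp: ennreal_mult ennreal_plus indicator_def simp del: ennreal_power)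
      finally show "ennreal (\<bar>u (x - y) - u x\<bar> ^ p) \<le> \<dots>" .
    qed
    also have "\<dots> = ennreal (3 ^ p) * ((\<integral>\<^sup>+x. ennreal (\<bar>?h (x - y)\<bar> ^ p) \<partial>lborel) +
        ennreal (\<omega> ^ p) * emeasure lborel (cball (0::'a) (R + 1)) + (\<integral>\<^sup>+x. ennreal (\<bar>?h x\<bar> ^ p) \<partial>lborel))"
    proof -
      have m1: "(\<lambda>x. ennreal (\<bar>?h (x - y)\<bar> ^ p)) \<in> borel_measurable lborel"
        and m2: "(\<lambda>x. ennreal (\<bar>?h x\<bar> ^ p)) \<in> borel_measurable lborel"
        by measurable
      have [measurable]: "cball (0::'a) (R + 1) \<in> sets borel" by auto
      have m3: "(\<lambda>x::'a. ennreal (\<omega> ^ p) * indicator (cball 0 (R + 1)) x) \<in> borel_measurable lborel"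
        by measurable
      show ?thesis
        by (subst nn_integral_cmult, intro borel_measurable_add m1 m2 m3,
            subst nn_integral_add[OF borel_measurable_add[OF m1 m3] m2], subst nn_integral_add[OF m1 m3],
            subst nn_integral_cmult_indicator, auto)
    qed
    also have "(\<integral>\<^sup>+x. ennreal (\<bar>?h (x - y)\<bar> ^ p) \<partial>lborel) = (\<integral>\<^sup>+x. ennreal (\<bar>?h x\<bar> ^ p) \<partial>lborel)"
      by (rule nn_integral_translate[where f = "\<lambda>x. ennreal (\<bar>?h x\<bar> ^ p)"]) measurable
    also have "(\<integral>\<^sup>+x. ennreal (\<bar>?h x\<bar> ^ p) \<partial>lborel) = ennreal (\<integral>x. \<bar>?h x\<bar> ^ p \<partial>lborel)"
      by (rule nn_integral_eq_integral[OF g(4)]) auto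
    also have "ennreal (3 ^ p) * (ennreal (\<integral>x. \<bar>?h x\<bar> ^ p \<partial>lborel) + ennreal (\<omega> ^ p) * emeasure lborel (cball (0::'a) (R + 1)) + ennreal (\<integral>x. \<bar>?h x\<bar> ^ p \<partial>lborel))
       = ennreal (3 ^ p * ((\<integral>x. \<bar>?h x\<bar> ^ p \<partial>lborel) + \<omega> ^ p * V + (\<integral>x. \<bar>?h x\<bar> ^ p \<partial>lborel)))"
    proof -
      have "ennreal (3 ^ p) * (ennreal a + ennreal (\<omega> ^ p) * ennreal V + ennreal c)
          = ennreal (3 ^ p * (a + \<omega> ^ p * V + c))" if "a \<ge> 0" "c \<ge> 0" for a c
        using \<omega> V that by (simp add: ennreal_mult ennreal_plus del: ennreal_power)
      from this[of "\<integral>x. \<bar>?h x\<bar> ^ p \<partial>lborel" "\<integral>x. \<bar>?h x\<bar> ^ p \<partial>lborel"] show ?thesis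
        unfolding V by simp
    qed
    also have "\<dots> \<le> ennreal (3 ^ p * (\<epsilon>' + \<epsilon>' + \<epsilon>'))"
      using g(5) \<omega>p by (intro ennreal_leI mult_left_mono add_mono) auto
    also have "3 ^ p * (\<epsilon>' + \<epsilon>' + \<epsilon>') = \<epsilon>" by (simp add: \<epsilon>'_def)
    finally show "(\<integral>\<^sup>+x. \<bar>u (x - y) - u x\<bar> ^ p \<partial>lborel) \<le> ennreal \<epsilon>" .
  qed
qed

section \<open>Jensen's inequality and the error of mollification\<close>

lemma mollifierD:
  assumes "mollifier r \<rho>"
  shows "smooth_on UNIV \<rho>" "\<rho> x \<ge> 0" "x \<notin> cball 0 r \<Longrightarrow> \<rho> x = 0" "integral\<^sup>L lborel \<rho> = 1"
    "continuous_on UNIV \<rho>" "\<rho> \<in> borel_measurable borel" "integrable lborel \<rho>"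
proof -
  show "smooth_on UNIV \<rho>" "\<rho> x \<ge> 0" "x \<notin> cball 0 r \<Longrightarrow> \<rho> x = 0" "integral\<^sup>L lborel \<rho> = 1"
    using assms by (auto simp: mollifier_def)
  show c: "continuous_on UNIV \<rho>"
    using assms smooth_on_continuous by (auto simp: mollifier_def)
  show "\<rho> \<in> borel_measurable borel" by (rule borel_measurable_continuous_onI[OF c])
  show "integrable lborel \<rho>"
    by (rule compact_support_integrable[OF c compact_cball[of 0 r]]) (use assms in \<open>auto simp: mollifier_def\<close>)
qed

text \<open>Jensen's inequality for the probability density \<open>\<rho>\<close>: for
  \<open>p = 1\<close> the triangle inequality, for \<open>p = 2\<close> nonnegativity of the
  variance.\<close>

lemma weighted_power_le:
  fixes f \<rho> :: "'a \<Rightarrow> real"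
  assumes r: "\<And>x. \<rho> x \<ge> 0" "integrable M \<rho>" "integral\<^sup>L M \<rho> = 1"
    and f1: "integrable M (\<lambda>x. f x * \<rho> x)" and fp: "integrable M (\<lambda>x. \<bar>f x\<bar> ^ p * \<rho> x)" and p: "p = 1 \<or> p = 2"
  shows "\<bar>\<integral>x. f x * \<rho> x \<partial>M\<bar> ^ p \<le> (\<integral>x. \<bar>f x\<bar> ^ p * \<rho> x \<partial>M)"
  using p
proof
  assume "p = 1"
  then show ?thesis using integral_abs_bound[of M "\<lambda>x. f x * \<rho> x"] r(1) by (simp add: abs_mult)
next
  assume p: "p = 2"
  define c where "c = (\<integral>x. f x * \<rho> x \<partial>M)"
  have "0 \<le> (\<integral>x. (f x - c)\<^sup>2 * \<rho> x \<partial>M)" using r by (intro integral_nonneg_AE) auto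
  also have "(\<integral>x. (f x - c)\<^sup>2 * \<rho> x \<partial>M) = (\<integral>x. \<bar>f x\<bar>^p * \<rho> x - 2 * c * (f x * \<rho> x) + c\<^sup>2 * \<rho> x \<partial>M)"
    by (intro Bochner_Integration.integral_cong) (auto simp: p power2_eq_square algebra_simps)
  also have "\<dots> = (\<integral>x. \<bar>f x\<bar>^p * \<rho> x \<partial>M) - c\<^sup>2"
    using f1 fp r(2,3) by (simp add: c_def[symmetric] power2_eq_square)
  finally show ?thesis by (simp add: p c_def)
qed

text \<open>The error at a point is the mean of the increments of \<open>u\<close> under the kernel.
  Jensen moves the power inside, Tonelli exchanges the integrals, and only translations with
  \<open>norm y \<le> r\<close> carry weight.\<close>

lemma moll_Lp_estimate:
  fixes u \<rho> :: "'a::euclidean_space \<Rightarrow> real"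
  assumes u [measurable]: "u \<in> borel_measurable borel" and ui: "integrable lborel u"
    and up: "integrable lborel (\<lambda>x. \<bar>u x\<bar> ^ p)"
    and \<rho>: "mollifier r \<rho>" and p: "p = 1 \<or> p = 2"
    and tr: "\<And>y. norm y \<le> r \<Longrightarrow> (\<integral>\<^sup>+x. \<bar>u (x - y) - u x\<bar> ^ p \<partial>lborel) \<le> ennreal \<epsilon>"
  shows "(\<integral>\<^sup>+x. \<bar>moll \<rho> u x - u x\<bar> ^ p \<partial>lborel) \<le> ennreal \<epsilon>"
proof -
  note \<rho>D = mollifierD[OF \<rho>]
  note [measurable] = \<rho>D(6)
  obtain M where M: "M > 0" "\<And>x. \<bar>\<rho> x\<bar> \<le> M"
    using compact_support_bounded[OF \<rho>D(5) compact_cball[of 0 r] \<rho>D(3)] by metis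
  have bi: "integrable lborel (\<lambda>y. f y * \<rho> y)" if "integrable lborel f" for f
    by (rule integrable_mult_continuous_bounded[OF that \<rho>D(5) M(2)])
  have pw: "ennreal (\<bar>moll \<rho> u x - u x\<bar> ^ p) \<le> (\<integral>\<^sup>+y. ennreal (\<bar>u (x - y) - u x\<bar> ^ p * \<rho> y) \<partial>lborel)" for x
  proof -
    let ?f = "\<lambda>y. u (x - y) - u x"
    have m1: "moll \<rho> u x = (\<integral>y. u (x - y) * \<rho> y \<partial>lborel)"
      using lborel_integral_reflect[of "\<lambda>y. u (x - y) * \<rho> y" x] by (simp add: moll_def)
    have i1: "integrable lborel (\<lambda>y. u (x - y) * \<rho> y)"
      by (rule bi[OF lborel_integrable_reflect[OF ui]])
    have i2: "integrable lborel (\<lambda>y. ?f y * \<rho> y)"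
      using i1 \<rho>D(7) by (simp add: left_diff_distrib)
    have m2: "moll \<rho> u x - u x = (\<integral>y. ?f y * \<rho> y \<partial>lborel)"
      using i1 \<rho>D(7) by (simp add: left_diff_distrib m1 \<rho>D(4))
    have i3: "integrable lborel (\<lambda>y. \<bar>?f y\<bar> ^ p * \<rho> y)"
    proof (rule Bochner_Integration.integrable_bound)
      show "integrable lborel (\<lambda>y. 3 ^ p * (\<bar>u (x - y)\<bar> ^ p * \<rho> y + \<bar>u x\<bar> ^ p * \<rho> y))"
        using bi[OF lborel_integrable_reflect[OF up]] \<rho>D(7) by simp
      show "AE y in lborel. norm (\<bar>?f y\<bar> ^ p * \<rho> y) \<le> norm (3 ^ p * (\<bar>u (x - y)\<bar> ^ p * \<rho> y + \<bar>u x\<bar> ^ p * \<rho> y))"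
      proof (rule AE_I2)
        fix y
        have "\<bar>?f y\<bar> ^ p \<le> (\<bar>u (x - y)\<bar> + \<bar>u x\<bar> + 0) ^ p" by (intro power_mono) auto
        also have "\<dots> \<le> 3 ^ p * (\<bar>u (x - y)\<bar> ^ p + \<bar>u x\<bar> ^ p + 0 ^ p)" by (intro power_add3_le) auto
        finally have "\<bar>?f y\<bar> ^ p * \<rho> y \<le> 3 ^ p * (\<bar>u (x - y)\<bar> ^ p + \<bar>u x\<bar> ^ p) * \<rho> y"
          using p \<rho>D(2) by (intro mult_right_mono) auto
        then show "norm (\<bar>?f y\<bar> ^ p * \<rho> y) \<le> norm (3 ^ p * (\<bar>u (x - y)\<bar> ^ p * \<rho> y + \<bar>u x\<bar> ^ p * \<rho> y))"
          using \<rho>D(2) by (simp add: algebra_simps abs_mult power_abs)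
      qed
    qed measurable
    have "\<bar>moll \<rho> u x - u x\<bar> ^ p \<le> (\<integral>y. \<bar>?f y\<bar> ^ p * \<rho> y \<partial>lborel)"
      unfolding m2 by (rule weighted_power_le[OF \<rho>D(2) \<rho>D(7) \<rho>D(4) i2 i3 p])
    then have "ennreal (\<bar>moll \<rho> u x - u x\<bar> ^ p) \<le> ennreal (\<integral>y. \<bar>?f y\<bar> ^ p * \<rho> y \<partial>lborel)"
      by (rule ennreal_leI)
    also have "\<dots> = (\<integral>\<^sup>+y. ennreal (\<bar>?f y\<bar> ^ p * \<rho> y) \<partial>lborel)"
      using i3 \<rho>D(2) by (intro nn_integral_eq_integral[symmetric]) auto
    finally show ?thesis .
  qed
  have "(\<integral>\<^sup>+x. \<bar>moll \<rho> u x - u x\<bar> ^ p \<partial>lborel) \<le> (\<integral>\<^sup>+x. \<integral>\<^sup>+y. ennreal (\<bar>u (x - y) - u x\<bar> ^ p * \<rho> y) \<partial>lborel \<partial>lborel)"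
    by (rule nn_integral_mono) (rule pw)
  also have "\<dots> = (\<integral>\<^sup>+y. \<integral>\<^sup>+x. ennreal (\<bar>u (x - y) - u x\<bar> ^ p * \<rho> y) \<partial>lborel \<partial>lborel)"
    by (rule lborel_pair.Fubini') measurable
  also have "\<dots> \<le> (\<integral>\<^sup>+y. ennreal \<epsilon> * ennreal (\<rho> y) \<partial>lborel)"
  proof (rule nn_integral_mono)
    fix y
    have "(\<integral>\<^sup>+x. ennreal (\<bar>u (x - y) - u x\<bar> ^ p * \<rho> y) \<partial>lborel) = (\<integral>\<^sup>+x. \<bar>u (x - y) - u x\<bar> ^ p \<partial>lborel) * ennreal (\<rho> y)"
      using \<rho>D(2) by (simp add: ennreal_mult nn_integral_multc)
    also have "\<dots> \<le> ennreal \<epsilon> * ennreal (\<rho> y)"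
    proof (cases "norm y \<le> r")
      case True
      then show ?thesis by (intro mult_right_mono tr) auto
    next
      case False
      then show ?thesis using \<rho>D(3)[of y] by simp
    qed
    finally show "(\<integral>\<^sup>+x. ennreal (\<bar>u (x - y) - u x\<bar> ^ p * \<rho> y) \<partial>lborel) \<le> ennreal \<epsilon> * ennreal (\<rho> y)" .
  qed
  also have "\<dots> = ennreal \<epsilon> * (\<integral>\<^sup>+y. ennreal (\<rho> y) \<partial>lborel)" by (simp add: nn_integral_cmult)
  also have "(\<integral>\<^sup>+y. ennreal (\<rho> y) \<partial>lborel) = 1"
    using \<rho>D by (subst nn_integral_eq_integral) auto
  finally show ?thesis by simp
qed

text \<open>The reflected kernel is itself a test function, and reflection changes the sign of its
  derivative. The indicator makes \<open>u\<close> and \<open>G\<close> globally integrable later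
  on; it is invisible at \<open>x\<close> because the ball around \<open>x\<close> lies in
  \<open>K\<close>.\<close>

lemma moll_pd_weak:
  fixes u G \<rho> :: "'a::euclidean_space \<Rightarrow> real"
  assumes wg: "\<And>\<phi>. \<phi> \<in> test_functions S \<Longrightarrow> (\<integral>y. u y * pd e \<phi> y \<partial>lborel) = - (\<integral>y. G y * \<phi> y \<partial>lborel)"
    and \<rho>: "mollifier r \<rho>" and e: "e \<in> Basis" and c: "cball x r \<subseteq> S" "cball x r \<subseteq> K"
  shows "moll (pd e \<rho>) (\<lambda>y. indicator K y * u y) x = moll \<rho> (\<lambda>y. indicator K y * G y) x"
proof -
  note \<rho>D = mollifierD[OF \<rho>]
  let ?\<phi> = "\<lambda>y. \<rho> (x - y)"
  note aff = smooth_on_affine[OF \<rho>D(1), where x = x and c = "-1", simplified]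
  have out: "x - y \<notin> cball 0 r" if "y \<notin> cball x r" for y using that by (simp add: dist_norm norm_minus_commute)
  have tf: "?\<phi> \<in> test_functions S"
    by (rule test_functionsI[OF aff(1) compact_cball c(1)]) (rule \<rho>D(3)[OF out])
  have p: "pd e ?\<phi> y = - pd e \<rho> (x - y)" for y by (rule aff(2))
  have z: "pd e \<rho> (x - y) = 0" "\<rho> (x - y) = 0" if "y \<notin> K" for y
  proof -
    have "x - y \<notin> cball 0 r" using out[of y] that c(2) by blast
    then show "pd e \<rho> (x - y) = 0" "\<rho> (x - y) = 0"
      using pd_eq_0_outside(1)[OF compact_cball[of 0 r] \<rho>D(3)] \<rho>D(3) by simp_all
  qed
  have "moll (pd e \<rho>) (\<lambda>y. indicator K y * u y) x = (\<integral>y. - (u y * pd e ?\<phi> y) \<partial>lborel)"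
    unfolding moll_def p by (intro Bochner_Integration.integral_cong) (use z in \<open>auto simp: indicator_def\<close>)
  also have "\<dots> = (\<integral>y. G y * ?\<phi> y \<partial>lborel)" using wg[OF tf] by simp
  also have "\<dots> = moll \<rho> (\<lambda>y. indicator K y * G y) x"
    unfolding moll_def by (intro Bochner_Integration.integral_cong) (use z in \<open>auto simp: indicator_def\<close>)
  finally show ?thesis .
qed

section \<open>Square-integrable functions\<close>

text \<open>Borel functions on the whole space rather than classes on a domain: everything is cut
  off or extended by zero beforehand, so that all integrals run over \<open>lborel\<close>.\<close>

definition L2 :: "('a::euclidean_space \<Rightarrow> real) \<Rightarrow> bool" where
  "L2 f \<longleftrightarrow> f \<in> borel_measurable borel \<and> integrable lborel (\<lambda>x. (f x)\<^sup>2)"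

lemma L2_measurable: "L2 f \<Longrightarrow> f \<in> borel_measurable borel"
  and L2_integrable: "L2 f \<Longrightarrow> integrable lborel (\<lambda>x. (f x)\<^sup>2)"
  by (auto simp: L2_def)

lemma L2_bound:
  assumes "L2 f" "g \<in> borel_measurable borel" "\<And>x. \<bar>g x\<bar> \<le> C * \<bar>f x\<bar>"
  shows "L2 g"
  unfolding L2_def
proof
  show "integrable lborel (\<lambda>x. (g x)\<^sup>2)"
  proof (rule Bochner_Integration.integrable_bound)
    show "integrable lborel (\<lambda>x. C\<^sup>2 * (f x)\<^sup>2)" using assms by (simp add: L2_def)
    show "(\<lambda>x. (g x)\<^sup>2) \<in> borel_measurable lborel" using assms(2) by measurable
    show "AE x in lborel. norm ((g x)\<^sup>2) \<le> norm (C\<^sup>2 * (f x)\<^sup>2)"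
    proof (rule AE_I2)
      fix x
      have "\<bar>g x\<bar>\<^sup>2 \<le> (C * \<bar>f x\<bar>)\<^sup>2" using assms(3) by (intro power_mono) auto
      then show "norm ((g x)\<^sup>2) \<le> norm (C\<^sup>2 * (f x)\<^sup>2)" by (simp add: power_mult_distrib)
    qed
  qed
qed fact

lemma L2_mult_bounded:
  assumes "L2 f" "k \<in> borel_measurable borel" "\<And>x. \<bar>k x\<bar> \<le> C"
  shows "L2 (\<lambda>x. k x * f x)" "L2 (\<lambda>x. f x * k x)"
proof -
  have [measurable]: "f \<in> borel_measurable borel" "k \<in> borel_measurable borel" using assms by (auto simp: L2_def)
  show "L2 (\<lambda>x. k x * f x)"
    by (rule L2_bound[OF assms(1), where C = C]) (use assms(3) in \<open>auto simp: abs_mult intro!: mult_right_mono\<close>)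
  then show "L2 (\<lambda>x. f x * k x)" by (simp add: mult.commute)
qed

lemma L2_add: assumes "L2 f" "L2 g" shows "L2 (\<lambda>x. f x + g x)"
  unfolding L2_def
proof
  have [measurable]: "f \<in> borel_measurable borel" "g \<in> borel_measurable borel" using assms by (auto simp: L2_def)
  show "(\<lambda>x. f x + g x) \<in> borel_measurable borel" by measurable
  show "integrable lborel (\<lambda>x. (f x + g x)\<^sup>2)"
  proof (rule Bochner_Integration.integrable_bound)
    show "integrable lborel (\<lambda>x. 2 * (f x)\<^sup>2 + 2 * (g x)\<^sup>2)" using assms by (simp add: L2_def)
    show "AE x in lborel. norm ((f x + g x)\<^sup>2) \<le> norm (2 * (f x)\<^sup>2 + 2 * (g x)\<^sup>2)"
    proof (rule AE_I2)
      fix x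
      have "0 \<le> (f x - g x)\<^sup>2" by simp
      then have "(f x + g x)\<^sup>2 \<le> 2 * (f x)\<^sup>2 + 2 * (g x)\<^sup>2"
        by (simp add: power2_eq_square algebra_simps)
      then show "norm ((f x + g x)\<^sup>2) \<le> norm (2 * (f x)\<^sup>2 + 2 * (g x)\<^sup>2)"
        by simp
    qed
  qed measurable
qed

lemma L2_minus: "L2 f \<Longrightarrow> L2 (\<lambda>x. - f x)"
  using L2_mult_bounded(1)[of f "\<lambda>_. -1" 1] by simp

lemma L2_diff: "L2 f \<Longrightarrow> L2 g \<Longrightarrow> L2 (\<lambda>x. f x - g x)"
  using L2_add[of f "\<lambda>x. - g x"] L2_minus[of g] by simp

lemma L2_mult_integrable:
  assumes "L2 f" "L2 g" shows "integrable lborel (\<lambda>x. f x * g x)"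
proof (rule Bochner_Integration.integrable_bound)
  have [measurable]: "f \<in> borel_measurable borel" "g \<in> borel_measurable borel" using assms by (auto simp: L2_def)
  show "(\<lambda>x. f x * g x) \<in> borel_measurable lborel" by measurable
  show "integrable lborel (\<lambda>x. (f x)\<^sup>2 + (g x)\<^sup>2)" using assms by (simp add: L2_def)
  show "AE x in lborel. norm (f x * g x) \<le> norm ((f x)\<^sup>2 + (g x)\<^sup>2)"
  proof (rule AE_I2)
    fix x
    have "0 \<le> (\<bar>f x\<bar> - \<bar>g x\<bar>)\<^sup>2" "0 \<le> \<bar>f x\<bar> * \<bar>g x\<bar>" by auto
    moreover from this have "2 * (\<bar>f x\<bar> * \<bar>g x\<bar>) \<le> (f x)\<^sup>2 + (g x)\<^sup>2"
      by (simp add: power2_diff)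
    ultimately have "\<bar>f x\<bar> * \<bar>g x\<bar> \<le> (f x)\<^sup>2 + (g x)\<^sup>2" by linarith
    then show "norm (f x * g x) \<le> norm ((f x)\<^sup>2 + (g x)\<^sup>2)"
      by (simp add: abs_mult)
  qed
qed

lemma L2_continuous:
  assumes "continuous_on UNIV f" "compact K" "\<And>x. x \<notin> K \<Longrightarrow> f x = 0"
  shows "L2 f"
  unfolding L2_def
proof
  show "f \<in> borel_measurable borel" by (rule borel_measurable_continuous_onI[OF assms(1)])
  show "integrable lborel (\<lambda>x. (f x)\<^sup>2)"
    by (rule compact_support_integrable[OF _ assms(2)]) (use assms in \<open>auto intro!: continuous_intros\<close>)
qed

lemma L2_indicator:
  assumes "L2 f" "bounded K" "K \<in> sets borel"
  shows "L2 (\<lambda>x. indicator K x * f x)" "integrable lborel (\<lambda>x. indicator K x * f x)"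
proof -
  have [measurable]: "K \<in> sets borel" by fact
  show "L2 (\<lambda>x. indicator K x * f x)"
    by (rule L2_mult_bounded(1)[OF assms(1), of _ 1]) (auto simp: indicator_def)
  have "emeasure lborel K < \<infinity>" using assms(2) by (rule emeasure_bounded_finite)
  then have "L2 (indicator K)"
    unfolding L2_def by (auto simp: power2_eq_square indicator_inter_arith[symmetric] assms)
  then show "integrable lborel (\<lambda>x. indicator K x * f x)" by (rule L2_mult_integrable) fact
qed

text \<open>Strong L^2 convergence tested against \<open>w\<close>, with a bounded factor that may
  change along the sequence. Young's inequality with weight \<open>\<tau>\<close> takes the place of
  Cauchy-Schwarz.\<close>

lemma L2_weak_limit:
  assumes w: "L2 w" and f: "L2 f" "\<And>j. L2 (F j)"
    and lim: "(\<lambda>j. \<integral>x. (F j x - f x)\<^sup>2 \<partial>lborel) \<longlonglongrightarrow> 0"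
    and q: "\<And>j. Q j \<in> borel_measurable borel" "\<And>j x. \<bar>Q j x\<bar> \<le> C"
  shows "(\<lambda>j. \<integral>x. w x * Q j x * (F j x - f x) \<partial>lborel) \<longlonglongrightarrow> 0"
proof (rule LIMSEQ_I)
  fix e :: real assume e: "e > 0"
  define W where "W = (\<integral>x. (w x)\<^sup>2 \<partial>lborel)"
  have W: "W \<ge> 0" unfolding W_def by simp
  have C: "C \<ge> 0" using q(2)[of undefined undefined] by linarith
  \<comment> \<open>Chosen so that the part \<open>C * \<tau> * W\<close> coming from
    \<open>w\<close> is at most \<open>e / 2\<close>; the convergent part, multiplied by
    \<open>inverse \<tau>\<close>, is then made small by \<open>N\<close>.\<close>
  define \<tau> where "\<tau> = e / (2 * (C + 1) * (W + 1))"
  have \<tau>: "\<tau> > 0" using e C W by (simp add: \<tau>_def)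
  have "\<tau> * W \<le> \<tau> * (W + 1)" using \<tau> by simp
  also have "\<dots> = e / (2 * (C + 1))" 
  proof -
    have "W + 1 \<noteq> 0" using W by linarith
    then show ?thesis unfolding \<tau>_def by simp
  qed
  finally have "C * (\<tau> * W) \<le> (C + 1) * (e / (2 * (C + 1)))" using C \<tau> W e by (intro mult_mono) auto
  also have "\<dots> = e / 2" using C by (simp add: field_simps)
  finally have t1: "C * (\<tau> * W) \<le> e / 2" .
  have "e * \<tau> / (2 * (C + 1)) > 0" using e \<tau> C by simp
  from order_tendstoD(2)[OF lim this] obtain N where
    N: "\<And>j. j \<ge> N \<Longrightarrow> (\<integral>x. (F j x - f x)\<^sup>2 \<partial>lborel) < e * \<tau> / (2 * (C + 1))"
    by (auto simp: eventually_sequentially)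
  have "norm ((\<integral>x. w x * Q j x * (F j x - f x) \<partial>lborel) - 0) < e" if "j \<ge> N" for j
  proof -
    have d: "L2 (\<lambda>x. F j x - f x)" by (intro L2_diff f)
    have I: "integrable lborel (\<lambda>x. C * (\<tau> * (w x)\<^sup>2 + inverse \<tau> * (F j x - f x)\<^sup>2))"
      using w d by (simp add: L2_def)
    have "norm (\<integral>x. w x * Q j x * (F j x - f x) \<partial>lborel) \<le> (\<integral>x. norm (w x * Q j x * (F j x - f x)) \<partial>lborel)"
      by (rule integral_norm_bound)
    also have "\<dots> \<le> (\<integral>x. C * (\<tau> * (w x)\<^sup>2 + inverse \<tau> * (F j x - f x)\<^sup>2) \<partial>lborel)"
    proof (rule integral_mono[OF _ I])
      show "integrable lborel (\<lambda>x. norm (w x * Q j x * (F j x - f x)))"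
        by (intro integrable_norm L2_mult_integrable L2_mult_bounded(2)[OF w q(1) q(2)] d)
      fix x
      define a b where "a = sqrt \<tau> * \<bar>w x\<bar>" and "b = \<bar>F j x - f x\<bar> / sqrt \<tau>"
      have "0 \<le> (a - b)\<^sup>2" "0 \<le> a * b" using \<tau> by (auto simp: a_def b_def)
      then have "a * b \<le> a\<^sup>2 + b\<^sup>2" unfolding power2_diff by simp
      then have "\<bar>w x\<bar> * \<bar>F j x - f x\<bar> \<le> \<tau> * (w x)\<^sup>2 + inverse \<tau> * (F j x - f x)\<^sup>2"
        using \<tau> by (simp add: a_def b_def power_mult_distrib power_divide field_simps)
      then have "\<bar>Q j x\<bar> * (\<bar>w x\<bar> * \<bar>F j x - f x\<bar>) \<le> C * (\<tau> * (w x)\<^sup>2 + inverse \<tau> * (F j x - f x)\<^sup>2)"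
        using q(2) C by (intro mult_mono) auto
      then show "norm (w x * Q j x * (F j x - f x)) \<le> C * (\<tau> * (w x)\<^sup>2 + inverse \<tau> * (F j x - f x)\<^sup>2)"
        by (simp add: abs_mult mult_ac)
    qed
    also have "\<dots> = C * (\<tau> * W) + C * inverse \<tau> * (\<integral>x. (F j x - f x)\<^sup>2 \<partial>lborel)"
      using w d by (simp add: L2_def W_def algebra_simps)
    also have "\<dots> < e"
    proof -
      have "C * inverse \<tau> * (\<integral>x. (F j x - f x)\<^sup>2 \<partial>lborel) \<le> C * inverse \<tau> * (e * \<tau> / (2 * (C + 1)))"
        using N[OF that] C \<tau> by (intro mult_left_mono) auto
      also have "\<dots> = e / 2 * (C / (C + 1))" using \<tau> C by (simp add: field_simps)
      also have "\<dots> < e / 2 * 1" using e C by (intro mult_strict_left_mono) auto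
      finally show ?thesis using t1 by linarith
    qed
    finally show ?thesis by simp
  qed
  then show "\<exists>no. \<forall>n\<ge>no. norm ((\<integral>x. w x * Q n x * (F n x - f x) \<partial>lborel) - 0) < e" by blast
qed

section \<open>Passage to the limit in nonlinear integrands\<close>

lemma integral_compose_limit:
  assumes c: "integrable lborel c" and u: "\<And>j. u j \<in> borel_measurable borel" "u0 \<in> borel_measurable borel"
    and ae: "AE x in lborel. (\<lambda>j. u j x) \<longlonglongrightarrow> (u0 x :: real)"
    and q: "continuous_on UNIV q" "\<And>s. \<bar>q s\<bar> \<le> (C::real)"
  shows "(\<lambda>j. \<integral>x. c x * q (u j x) \<partial>lborel) \<longlonglongrightarrow> (\<integral>x. c x * q (u0 x) \<partial>lborel)"
proof (rule integral_dominated_convergence[where w = "\<lambda>x. C * \<bar>c x\<bar>"])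
  have [measurable]: "q \<in> borel_measurable borel" by (rule borel_measurable_continuous_onI[OF q(1)])
  note [measurable] = u borel_measurable_integrable[OF c]
  show "(\<lambda>x. c x * q (u0 x)) \<in> borel_measurable lborel" "(\<lambda>x. c x * q (u j x)) \<in> borel_measurable lborel" for j
    by measurable
  show "integrable lborel (\<lambda>x. C * \<bar>c x\<bar>)" using c by simp
  show "AE x in lborel. (\<lambda>j. c x * q (u j x)) \<longlonglongrightarrow> c x * q (u0 x)"
    using ae
  proof eventually_elim
    case (elim x)
    then show ?case
      using continuous_on_tendsto_compose[OF q(1) elim] by (intro tendsto_intros) auto
  qed
  show "AE x in lborel. norm (c x * q (u j x)) \<le> C * \<bar>c x\<bar>" for j
    using q(2) by (auto simp: abs_mult mult.commute[of C] intro!: mult_left_mono)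
qed

text \<open>One factor converges strongly in L^2, the other only almost everywhere but boundedly.
  Replacing \<open>F j\<close> by its limit is harmless because \<open>q\<close> is bounded; what
  remains is dominated by a multiple of \<open>c * f\<close>.\<close>

lemma integral_product_limit:
  assumes c: "L2 c" and f: "L2 f" "\<And>j. L2 (F j)"
    and lim: "(\<lambda>j. \<integral>x. (F j x - f x)\<^sup>2 \<partial>lborel) \<longlonglongrightarrow> 0"
    and u: "\<And>j. u j \<in> borel_measurable borel" "u0 \<in> borel_measurable borel"
    and ae: "AE x in lborel. (\<lambda>j. u j x) \<longlonglongrightarrow> (u0 x :: real)"
    and q: "continuous_on UNIV q" "\<And>s. \<bar>q s\<bar> \<le> (C::real)"
  shows "(\<lambda>j. \<integral>x. c x * q (u j x) * F j x \<partial>lborel) \<longlonglongrightarrow> (\<integral>x. c x * q (u0 x) * f x \<partial>lborel)"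
proof -
  have [measurable]: "q \<in> borel_measurable borel" by (rule borel_measurable_continuous_onI[OF q(1)])
  note [measurable] = u
  have cq: "L2 (\<lambda>x. c x * q (u j x))" for j by (rule L2_mult_bounded(2)[OF c _ q(2)]) measurable
  have "(\<lambda>j. \<integral>x. c x * q (u j x) * (F j x - f x) \<partial>lborel) \<longlonglongrightarrow> 0"
    by (rule L2_weak_limit[OF c f lim, where C = C]) (auto intro: q)
  moreover have "(\<lambda>j. \<integral>x. (c x * f x) * q (u j x) \<partial>lborel) \<longlonglongrightarrow> (\<integral>x. (c x * f x) * q (u0 x) \<partial>lborel)"
    by (rule integral_compose_limit[OF L2_mult_integrable[OF c f(1)] u ae q])
  ultimately have "(\<lambda>j. (\<integral>x. c x * q (u j x) * (F j x - f x) \<partial>lborel) + (\<integral>x. (c x * f x) * q (u j x) \<partial>lborel))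
     \<longlonglongrightarrow> 0 + (\<integral>x. (c x * f x) * q (u0 x) \<partial>lborel)" by (rule tendsto_add)
  moreover have "(\<integral>x. c x * q (u j x) * (F j x - f x) \<partial>lborel) + (\<integral>x. (c x * f x) * q (u j x) \<partial>lborel)
      = (\<integral>x. c x * q (u j x) * F j x \<partial>lborel)" for j
    using L2_mult_integrable[OF cq L2_diff[OF f(2) f(1)]] L2_mult_integrable[OF cq f(1), of j]
    by (subst Bochner_Integration.integral_add[symmetric]) (auto simp: algebra_simps)
  ultimately show ?thesis by (simp add: mult_ac)
qed

section \<open>A good sequence of mollifiers\<close>

text \<open>One radius per \<open>n\<close> serves finitely many functions. A function and all
  components of its weak gradient can then share a kernel, so that derivatives of the mollification
  are mollified derivatives.\<close>

lemma mollifier_sequence: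
  fixes F :: "'i \<Rightarrow> 'a::euclidean_space \<Rightarrow> real"
  assumes "finite I" and F: "\<And>i. i \<in> I \<Longrightarrow> F i \<in> borel_measurable borel"
      "\<And>i. i \<in> I \<Longrightarrow> integrable lborel (\<lambda>x. \<bar>F i x\<bar> ^ p)" and p: "p > 0" and d: "d > 0"
  obtains C \<rho> r where "\<And>n. 0 < r n" "\<And>n. r n \<le> d" "\<And>n. mollifier (r n) (\<rho> n :: 'a \<Rightarrow> real)"
    "\<And>n e. e \<in> Basis \<Longrightarrow> (\<integral>x. \<bar>pd e (\<rho> n) x\<bar> \<partial>lborel) \<le> C / r n"
    "\<And>n i y. i \<in> I \<Longrightarrow> norm y \<le> r n \<Longrightarrow> (\<integral>\<^sup>+x. \<bar>F i (x - y) - F i x\<bar> ^ p \<partial>lborel) \<le> ennreal (1 / real (Suc n))"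
proof -
  obtain C where C: "\<forall>r>0. \<exists>\<rho>::'a \<Rightarrow> real. mollifier r \<rho> \<and> (\<forall>e\<in>Basis. (\<integral>x. \<bar>pd e \<rho> x\<bar> \<partial>lborel) \<le> C / r)"
    using mollifier_exists by blast
  have "\<exists>r. 0 < r \<and> r \<le> d \<and> (\<forall>i\<in>I. \<forall>y. norm y \<le> r \<longrightarrow> (\<integral>\<^sup>+x. \<bar>F i (x - y) - F i x\<bar> ^ p \<partial>lborel) \<le> ennreal (1 / real (Suc n)))" for n
    using assms(1) F
  proof (induction I rule: finite_induct)
    case empty
    then show ?case using d by auto
  next
    case (insert i I)
    then obtain r where r: "0 < r" "r \<le> d"
      "\<And>i y. i\<in>I \<Longrightarrow> norm y \<le> r \<Longrightarrow> (\<integral>\<^sup>+x. \<bar>F i (x - y) - F i x\<bar> ^ p \<partial>lborel) \<le> ennreal (1 / real (Suc n))"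
      by auto
    have "0 < 1 / real (Suc n)" by simp
    then obtain r' where r': "r' > 0"
      "\<And>y. norm y \<le> r' \<Longrightarrow> (\<integral>\<^sup>+x. \<bar>F i (x - y) - F i x\<bar> ^ p \<partial>lborel) \<le> ennreal (1 / real (Suc n))"
      by (rule Lp_translation_continuous[OF insert.prems(1)[OF insertI1] insert.prems(2)[OF insertI1] p]) (rule that; assumption)
    show ?case
      by (rule exI[of _ "min r r'"]) (use r r' in auto)
  qed
  then obtain r where r: "\<And>n. 0 < r n" "\<And>n. r n \<le> d"
    "\<And>n i y. i \<in> I \<Longrightarrow> norm y \<le> r n \<Longrightarrow> (\<integral>\<^sup>+x. \<bar>F i (x - y) - F i x\<bar> ^ p \<partial>lborel) \<le> ennreal (1 / real (Suc n))"
    by metis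
  have "\<forall>n. \<exists>\<rho>::'a \<Rightarrow> real. mollifier (r n) \<rho> \<and> (\<forall>e\<in>Basis. (\<integral>x. \<bar>pd e \<rho> x\<bar> \<partial>lborel) \<le> C / r n)"
    using C r(1) by blast
  then obtain \<rho> :: "nat \<Rightarrow> 'a \<Rightarrow> real" where "\<forall>n. mollifier (r n) (\<rho> n) \<and> (\<forall>e\<in>Basis. (\<integral>x. \<bar>pd e (\<rho> n) x\<bar> \<partial>lborel) \<le> C / r n)"
    by (rule choice[THEN exE])
  then show ?thesis using that[of r \<rho> C] r by blast
qed

lemma mollifier_sequence_converges:
  fixes F :: "'a::euclidean_space \<Rightarrow> real"
  assumes m: "F \<in> borel_measurable borel" and i: "integrable lborel F" "integrable lborel (\<lambda>x. \<bar>F x\<bar> ^ p)"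
    and p: "p = 1 \<or> p = 2" and \<rho>: "\<And>n. mollifier (r n) (\<rho> n)"
    and tr: "\<And>n y. norm y \<le> r n \<Longrightarrow> (\<integral>\<^sup>+x. \<bar>F (x - y) - F x\<bar> ^ p \<partial>lborel) \<le> ennreal (1 / real (Suc n))"
  shows "integrable lborel (\<lambda>x. \<bar>moll (\<rho> n) F x - F x\<bar> ^ p)" "moll (\<rho> n) F \<in> borel_measurable borel"
    "(\<lambda>n. \<integral>x. \<bar>moll (\<rho> n) F x - F x\<bar> ^ p \<partial>lborel) \<longlonglongrightarrow> 0"
proof -
  note est = moll_Lp_estimate[OF m i \<rho> p tr]
  have [measurable]: "moll (\<rho> n) F \<in> borel_measurable borel" for n
    using smooth_on_continuous[OF smooth_on_moll[OF i(1) mollifierD(1)[OF \<rho>] compact_cball mollifierD(3)[OF \<rho>]]]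
    by (rule borel_measurable_continuous_onI)
  then show "moll (\<rho> n) F \<in> borel_measurable borel" .
  note [measurable] = m
  show I: "integrable lborel (\<lambda>x. \<bar>moll (\<rho> n) F x - F x\<bar> ^ p)" for n
    unfolding integrable_iff_bounded
    using order_le_less_trans[OF est[of n] ennreal_less_top] by (simp add: power_abs)
  have le: "(\<integral>x. \<bar>moll (\<rho> n) F x - F x\<bar> ^ p \<partial>lborel) \<le> 1 / real (Suc n)" for n
    using est[of n] nn_integral_eq_integral[OF I[of n]] by (simp add: ennreal_le_iff)
  show "(\<lambda>n. \<integral>x. \<bar>moll (\<rho> n) F x - F x\<bar> ^ p \<partial>lborel) \<longlonglongrightarrow> 0"
    by (rule tendsto_sandwich[OF always_eventually always_eventually tendsto_const LIMSEQ_Suc[OF lim_1_over_n]])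
      (auto simp del: of_nat_Suc intro: le)
qed

section \<open>Functions with a weak gradient\<close>

text \<open>The weak gradient is tested inside \<open>S\<close> only, so derivatives of the
  approximants can be identified on \<open>K\<close> alone. For this \<open>u\<close> and
  \<open>G\<close> are cut off to a thickening \<open>K'\<close> of \<open>K\<close>, and the radii
  stay below its width \<open>d\<close>. This is why the limits \<open>u1\<close> and
  \<open>G1\<close> agree with \<open>u\<close> and \<open>G\<close> just on
  \<open>K\<close>.\<close>

lemma Sobolev_approximation:
  fixes S :: "'a::euclidean_space set" and u :: "'a \<Rightarrow> real" and G :: "'a \<Rightarrow> 'a"
  assumes S: "open S" and K: "compact K" "K \<subseteq> S"
    and u: "L2 u" "\<And>z. u z \<ge> 0" and G: "\<And>e. e \<in> Basis \<Longrightarrow> L2 (\<lambda>z. G z \<bullet> e)"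
    and wg: "\<And>\<phi> e. \<phi> \<in> test_functions S \<Longrightarrow> e \<in> Basis \<Longrightarrow>
       (\<integral>z. u z * pd e \<phi> z \<partial>lborel) = - (\<integral>z. (G z \<bullet> e) * \<phi> z \<partial>lborel)"
  obtains U u1 and H :: "nat \<Rightarrow> 'a \<Rightarrow> 'a \<Rightarrow> real" and G1 where
    "\<And>n. smooth_on UNIV (U n)" "\<And>n z. U n z \<ge> 0" "\<And>n. L2 (U n)"
    "L2 u1" "\<And>z. z \<in> K \<Longrightarrow> u1 z = u z" "\<And>z. u1 z \<ge> 0"
    "(\<lambda>n. \<integral>z. (U n z - u1 z)\<^sup>2 \<partial>lborel) \<longlonglongrightarrow> 0"
    "AE z in lborel. (\<lambda>n. U n z) \<longlonglongrightarrow> u1 z"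
    "\<And>e n. e \<in> Basis \<Longrightarrow> L2 (H n e)" "\<And>e. e \<in> Basis \<Longrightarrow> L2 (G1 e)"
    "\<And>e z. e \<in> Basis \<Longrightarrow> z \<in> K \<Longrightarrow> G1 e z = G z \<bullet> e"
    "\<And>e. e \<in> Basis \<Longrightarrow> (\<lambda>n. \<integral>z. (H n e z - G1 e z)\<^sup>2 \<partial>lborel) \<longlonglongrightarrow> 0"
    "\<And>e n z. e \<in> Basis \<Longrightarrow> z \<in> K \<Longrightarrow> pd e (U n) z = H n e z"
proof -
  obtain d where d: "d > 0" "(\<Union>x\<in>K. cball x d) \<subseteq> S"
    using compact_subset_open_imp_ball_epsilon_subset[OF K(1) S K(2)]
    by (metis compact_subset_open_imp_cball_epsilon_subset[OF K(1) S K(2)])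
  define K' where "K' = (\<Union>x\<in>K. \<Union>y\<in>cball 0 d. {x + y})"
  have K': "compact K'" unfolding K'_def by (rule compact_sums'[OF K(1) compact_cball])
  have cb: "cball x d \<subseteq> K'" if "x \<in> K" for x
  proof
    fix z assume "z \<in> cball x d"
    then have "z - x \<in> cball 0 d" by (simp add: dist_norm norm_minus_commute)
    then show "z \<in> K'" unfolding K'_def using that by (intro UN_I[of x] UN_I[of "z - x"]) auto
  qed
  have KK': "K \<subseteq> K'" using cb d(1) by force
  have [measurable]: "K' \<in> sets borel" using K' by (simp add: compact_imp_closed borel_closed)
  \<comment> \<open>\<open>None\<close> indexes the function and \<open>Some e\<close> its
    derivative in direction \<open>e\<close>, so that one mollifier sequence treats them
    together.\<close>
  define F where "F i = (case i of None \<Rightarrow> (\<lambda>z. indicator K' z * u z) | Some e \<Rightarrow> (\<lambda>z. indicator K' z * (G z \<bullet> e)))" for i :: "'a option"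
  define I where "I = insert None (Some ` (Basis :: 'a set))"
  have FI: "L2 (F i)" "integrable lborel (F i)" if "i \<in> I" for i
    using that L2_indicator[OF u(1) compact_imp_bounded[OF K']] L2_indicator[OF G compact_imp_bounded[OF K']]
    by (auto simp: F_def I_def)
  have Fm: "F i \<in> borel_measurable borel" "integrable lborel (\<lambda>x. \<bar>F i x\<bar>\<^sup>2)" if "i \<in> I" for i
    using FI[OF that] by (auto simp: L2_def)
  have "finite I" by (simp add: I_def)
  obtain C \<rho> r where \<rho>: "\<And>n. 0 < r n" "\<And>n. r n \<le> d" "\<And>n. mollifier (r n) (\<rho> n :: 'a \<Rightarrow> real)"
    "\<And>n e. e \<in> Basis \<Longrightarrow> (\<integral>x. \<bar>pd e (\<rho> n) x\<bar> \<partial>lborel) \<le> C / r n"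
    "\<And>n i y. i \<in> I \<Longrightarrow> norm y \<le> r n \<Longrightarrow> (\<integral>\<^sup>+x. \<bar>F i (x - y) - F i x\<bar>\<^sup>2 \<partial>lborel) \<le> ennreal (1 / real (Suc n))"
    by (rule mollifier_sequence[OF \<open>finite I\<close> Fm zero_less_numeral d(1)]) (assumption+, (rule that; assumption))
  have conv: "L2 (moll (\<rho> n) (F i))" "(\<lambda>n. \<integral>x. (moll (\<rho> n) (F i) x - F i x)\<^sup>2 \<partial>lborel) \<longlonglongrightarrow> 0" if "i \<in> I" for n i
  proof -
    note c = mollifier_sequence_converges[where r = r and \<rho> = \<rho>, OF Fm(1)[OF that] FI(2)[OF that] Fm(2)[OF that] _ \<rho>(3) \<rho>(5)[OF that], simplified]
    show "(\<lambda>n. \<integral>x. (moll (\<rho> n) (F i) x - F i x)\<^sup>2 \<partial>lborel) \<longlonglongrightarrow> 0"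
      using c(3) by simp
    have [measurable]: "moll (\<rho> n) (F i) \<in> borel_measurable borel" "F i \<in> borel_measurable borel"
      using c(2)[of n] Fm(1)[OF that] by simp_all
    have "L2 (\<lambda>x. moll (\<rho> n) (F i) x - F i x)" using c(1)[of n] by (simp add: L2_def)
    from L2_add[OF this FI(1)[OF that]] show "L2 (moll (\<rho> n) (F i))" by simp
  qed
  have N: "None \<in> I" and Sm: "e \<in> Basis \<Longrightarrow> Some e \<in> I" for e by (auto simp: I_def)
  \<comment> \<open>The squared errors converge to 0 in L^1, hence almost everywhere along a
    subsequence. The derivatives follow the same subsequence.\<close>
  have "\<exists>s::nat\<Rightarrow>nat. strict_mono s \<and> (AE x in lborel. (\<lambda>n. (moll (\<rho> (s n)) (F None) x - F None x)\<^sup>2) \<longlonglongrightarrow> 0)"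
    by (rule tendsto_L1_AE_subseq)
       (use conv(2)[OF N] L2_integrable[OF L2_diff[OF conv(1)[OF N] FI(1)[OF N]]] in simp_all)
  then obtain s :: "nat \<Rightarrow> nat" where s: "strict_mono s"
    "AE x in lborel. (\<lambda>n. (moll (\<rho> (s n)) (F None) x - F None x)\<^sup>2) \<longlonglongrightarrow> 0" by blast
  show ?thesis
  proof (rule that[of "\<lambda>n. moll (\<rho> (s n)) (F None)" "F None" "\<lambda>n e. moll (\<rho> (s n)) (F (Some e))" "\<lambda>e. F (Some e)"])
    show "smooth_on UNIV (moll (\<rho> (s n)) (F None))" for n
      by (rule smooth_on_moll[OF FI(2)[OF N] mollifierD(1)[OF \<rho>(3)] compact_cball mollifierD(3)[OF \<rho>(3)]])
    show "moll (\<rho> (s n)) (F None) z \<ge> 0" for n z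
      unfolding moll_def by (intro integral_nonneg_AE AE_I2 mult_nonneg_nonneg mollifierD(2)[OF \<rho>(3)]) (simp add: F_def u)
    show "(\<lambda>n. \<integral>z. (moll (\<rho> (s n)) (F None) z - F None z)\<^sup>2 \<partial>lborel) \<longlonglongrightarrow> 0"
      using LIMSEQ_subseq_LIMSEQ[OF conv(2)[OF N] s(1)] by (simp add: o_def)
    show "(\<lambda>n. \<integral>z. (moll (\<rho> (s n)) (F (Some e)) z - F (Some e) z)\<^sup>2 \<partial>lborel) \<longlonglongrightarrow> 0" if "e \<in> Basis" for e
      using LIMSEQ_subseq_LIMSEQ[OF conv(2)[OF Sm[OF that]] s(1)] by (simp add: o_def)
    show "AE z in lborel. (\<lambda>n. moll (\<rho> (s n)) (F None) z) \<longlonglongrightarrow> F None z"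
      using s(2)
    proof eventually_elim
      case (elim x)
      then have "(\<lambda>n. sqrt ((moll (\<rho> (s n)) (F None) x - F None x)\<^sup>2)) \<longlonglongrightarrow> sqrt 0" by (rule tendsto_real_sqrt)
      then have "(\<lambda>n. moll (\<rho> (s n)) (F None) x - F None x) \<longlonglongrightarrow> 0"
        by (simp add: tendsto_rabs_zero_iff)
      then show ?case by (rule LIM_zero_cancel)
    qed
    show "pd e (moll (\<rho> (s n)) (F None)) z = moll (\<rho> (s n)) (F (Some e)) z" if e: "e \<in> Basis" and z: "z \<in> K" for e n z
    proof -
      have "cball z (r (s n)) \<subseteq> cball z d" by (rule subset_cball[OF \<rho>(2)])
      then have c: "cball z (r (s n)) \<subseteq> S" "cball z (r (s n)) \<subseteq> K'" using cb[OF z] d(2) z by blast+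
      have "pd e (moll (\<rho> (s n)) (F None)) z = moll (pd e (\<rho> (s n))) (F None) z"
        by (rule pd_eqI[OF moll_has_derivative[OF FI(2)[OF N] mollifierD(1)[OF \<rho>(3)] compact_cball mollifierD(3)[OF \<rho>(3)]]])
      also have "\<dots> = moll (\<rho> (s n)) (F (Some e)) z"
        using moll_pd_weak[OF wg[OF _ e] \<rho>(3)[of "s n"] e c] by (simp add: F_def)
      finally show ?thesis .
    qed
    show "F None z = u z" if "z \<in> K" for z using KK' that by (auto simp: F_def indicator_def)
    show "F None z \<ge> 0" for z by (simp add: F_def u)
    show "F (Some e) z = G z \<bullet> e" if "z \<in> K" for e z using KK' that by (auto simp: F_def indicator_def)
  qed (auto simp: conv[OF N] conv[OF Sm] FI[OF N] FI[OF Sm])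
qed

lemma lipschitz_of_real_derivative:
  fixes Q q :: "real \<Rightarrow> real"
  assumes "\<And>s. s \<ge> 0 \<Longrightarrow> (Q has_real_derivative q s) (at s)" "\<And>s. \<bar>q s\<bar> \<le> C" "s \<ge> 0" "t \<ge> 0"
  shows "\<bar>Q s - Q t\<bar> \<le> C * \<bar>s - t\<bar>"
proof -
  have "norm (Q s - Q t) \<le> C * norm (s - t)"
    by (rule field_differentiable_bound[of "{0..}" Q q])
       (use assms in \<open>auto intro!: has_field_derivative_at_within[OF assms(1)]\<close>)
  then show ?thesis by simp
qed

text \<open>For smooth approximants this is integration by parts. In the limit,
  \<open>q (U n)\<close> is bounded and converges almost everywhere against strongly convergent
  derivatives, while \<open>Q\<close> is \<open>C\<close>-Lipschitz on the half line and carries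
  over the L^2 convergence of \<open>U n\<close>.\<close>

lemma weak_chain_rule:
  fixes S :: "'a::euclidean_space set" and u :: "'a \<Rightarrow> real" and G :: "'a \<Rightarrow> 'a"
  assumes S: "open S" and K: "compact K" "K \<subseteq> S"
    and u: "L2 u" "\<And>z. u z \<ge> 0" and G: "\<And>e. e \<in> Basis \<Longrightarrow> L2 (\<lambda>z. G z \<bullet> e)"
    and wg: "\<And>\<phi> e. \<phi> \<in> test_functions S \<Longrightarrow> e \<in> Basis \<Longrightarrow>
       (\<integral>z. u z * pd e \<phi> z \<partial>lborel) = - (\<integral>z. (G z \<bullet> e) * \<phi> z \<partial>lborel)"
    and Q: "\<And>s. s \<ge> 0 \<Longrightarrow> (Q has_real_derivative q s) (at s)" "Q 0 = 0"
    and q: "continuous_on UNIV q" "\<And>s. \<bar>q s\<bar> \<le> C"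
    and w: "smooth_on S w" "\<And>z. z \<notin> K \<Longrightarrow> w z = 0" and e: "e \<in> Basis"
  shows "(\<integral>z. w z * q (u z) * (G z \<bullet> e) \<partial>lborel) = - (\<integral>z. Q (u z) * pd e w z \<partial>lborel)"
    and "integrable lborel (\<lambda>z. w z * q (u z) * (G z \<bullet> e))" and "integrable lborel (\<lambda>z. Q (u z) * pd e w z)"
proof -
  obtain U u1 and H :: "nat \<Rightarrow> 'a \<Rightarrow> 'a \<Rightarrow> real" and G1 where
    U: "\<And>n. smooth_on UNIV (U n)" "\<And>n z. U n z \<ge> 0" "\<And>n. L2 (U n)"
    and u1: "L2 u1" "\<And>z. z \<in> K \<Longrightarrow> u1 z = u z" "\<And>z. u1 z \<ge> 0"
    and limU: "(\<lambda>n. \<integral>z. (U n z - u1 z)\<^sup>2 \<partial>lborel) \<longlonglongrightarrow> 0" "AE z in lborel. (\<lambda>n. U n z) \<longlonglongrightarrow> u1 z"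
    and H: "\<And>e n. e \<in> Basis \<Longrightarrow> L2 (H n e)" and G1: "\<And>e. e \<in> Basis \<Longrightarrow> L2 (G1 e)"
    "\<And>e z. e \<in> Basis \<Longrightarrow> z \<in> K \<Longrightarrow> G1 e z = G z \<bullet> e"
    and limH: "\<And>e. e \<in> Basis \<Longrightarrow> (\<lambda>n. \<integral>z. (H n e z - G1 e z)\<^sup>2 \<partial>lborel) \<longlonglongrightarrow> 0"
    and pdU: "\<And>e n z. e \<in> Basis \<Longrightarrow> z \<in> K \<Longrightarrow> pd e (U n) z = H n e z"
    by (rule Sobolev_approximation[OF S K u G wg]) (assumption+, (rule that; assumption))
  have dU: "U n differentiable at z" for n z using smooth_on_differentiable[OF U(1)] by blast
  have wc: "continuous_on UNIV w" by (rule continuous_on_zero_extend[OF S K smooth_on_continuous[OF w(1)] w(2)])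
  have pwc: "continuous_on UNIV (pd e w)"
    by (rule continuous_on_zero_extend[OF S K smooth_on_continuous[OF smooth_on_pd[OF w(1) e]] pd_eq_0_outside(1)[OF K(1) w(2)]])
  have wL: "L2 w" by (rule L2_continuous[OF wc K(1) w(2)])
  have pwL: "L2 (pd e w)" by (rule L2_continuous[OF pwc K(1) pd_eq_0_outside(1)[OF K(1) w(2)]])
  have lip: "\<bar>Q s - Q t\<bar> \<le> C * \<bar>s - t\<bar>" if "s \<ge> 0" "t \<ge> 0" for s t
    by (rule lipschitz_of_real_derivative[OF Q(1) q(2) that])
  \<comment> \<open>\<open>Q\<close> is controlled for \<open>s \<ge> 0\<close> only; composing with
    the absolute value gives a globally continuous function that agrees with it on the values
    taken.\<close>
  have Qm: "(\<lambda>s. Q \<bar>s\<bar>) \<in> borel_measurable borel"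
  proof (rule borel_measurable_continuous_onI)
    have "continuous_on {0..} Q"
      by (rule continuous_at_imp_continuous_on) (use DERIV_isCont[OF Q(1)] in auto)
    then show "continuous_on UNIV (\<lambda>s. Q \<bar>s\<bar>)"
      by (rule continuous_on_compose2) (auto intro!: continuous_intros)
  qed
  have QL: "L2 (\<lambda>z. Q (f z))" if f: "L2 f" "\<And>z. f z \<ge> 0" for f
  proof (rule L2_bound[OF f(1)])
    show "\<bar>Q (f z)\<bar> \<le> C * \<bar>f z\<bar>" for z using lip[OF f(2), of 0 z] Q(2) by simp
    show "(\<lambda>z. Q (f z)) \<in> borel_measurable borel"
      using measurable_compose[OF L2_measurable[OF f(1)] Qm] f(2) by simp
  qed
  have ibp: "(\<integral>z. w z * q (U n z) * H n e z \<partial>lborel) = - (\<integral>z. Q (U n z) * pd e w z \<partial>lborel)" for n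
  proof -
    have pdQ: "pd i (\<lambda>z. Q (U n z)) z = q (U n z) * pd i (U n) z" for i z
      by (rule pd_compose_real[OF dU Q(1)[OF U(2)]])
    have "(\<integral>z. Q (U n z) * pd e w z \<partial>lborel) = - (\<integral>z. pd e (\<lambda>z. Q (U n z)) z * w z \<partial>lborel)"
    proof (rule integration_by_parts(1)[OF S K w(2)])
      show "(\<lambda>z. Q (U n z)) differentiable at x" for x
        using differentiable_chain_at[OF dU[of n x], of Q] Q(1)[OF U(2)[of n x]]
        by (auto simp: o_def real_differentiable_def)
      show "w differentiable at x" if "x \<in> S" for x by (rule smooth_on_differentiable[OF w(1) that])
      show "continuous_on S (pd i w)" if "i \<in> Basis" for i
        by (rule smooth_on_continuous[OF smooth_on_pd[OF w(1) that]])
      show "continuous_on S (pd i (\<lambda>z. Q (U n z)))" if "i \<in> Basis" for i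
        unfolding pdQ[abs_def]
        by (intro continuous_intros continuous_on_compose2[OF q(1)] continuous_on_subset[OF smooth_on_continuous[OF U(1)]]
             continuous_on_subset[OF smooth_on_continuous[OF smooth_on_pd[OF U(1) that]]]) auto
    qed (use e in auto)
    moreover have "pd e (\<lambda>z. Q (U n z)) z * w z = w z * q (U n z) * H n e z" for z
      using w(2)[of z] pdU[OF e, of z n] by (cases "z \<in> K") (auto simp: pdQ)
    ultimately show ?thesis by simp
  qed
  have l1: "(\<lambda>n. \<integral>z. w z * q (U n z) * H n e z \<partial>lborel) \<longlonglongrightarrow> (\<integral>z. w z * q (u1 z) * G1 e z \<partial>lborel)"
    by (rule integral_product_limit[OF wL G1(1)[OF e] H[OF e] limH[OF e] L2_measurable[OF U(3)] L2_measurable[OF u1(1)] limU(2) q])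
  have "(\<lambda>n. \<integral>z. (Q (U n z) - Q (u1 z))\<^sup>2 \<partial>lborel) \<longlonglongrightarrow> 0"
  proof (rule tendsto_sandwich[OF always_eventually always_eventually tendsto_const])
    show "(\<lambda>n. C\<^sup>2 * (\<integral>z. (U n z - u1 z)\<^sup>2 \<partial>lborel)) \<longlonglongrightarrow> 0"
      using tendsto_mult_left[OF limU(1), of "C\<^sup>2"] by simp
    show "\<forall>n. (\<integral>z. (Q (U n z) - Q (u1 z))\<^sup>2 \<partial>lborel) \<le> C\<^sup>2 * (\<integral>z. (U n z - u1 z)\<^sup>2 \<partial>lborel)"
    proof
      fix n
      have "(\<integral>z. (Q (U n z) - Q (u1 z))\<^sup>2 \<partial>lborel) \<le> (\<integral>z. C\<^sup>2 * (U n z - u1 z)\<^sup>2 \<partial>lborel)"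
      proof (rule integral_mono)
        show "integrable lborel (\<lambda>z. (Q (U n z) - Q (u1 z))\<^sup>2)"
          by (intro L2_integrable L2_diff QL U u1)
        show "integrable lborel (\<lambda>z. C\<^sup>2 * (U n z - u1 z)\<^sup>2)"
          using L2_integrable[OF L2_diff[OF U(3)[of n] u1(1)]] by simp
        fix z
        have "\<bar>Q (U n z) - Q (u1 z)\<bar>\<^sup>2 \<le> (C * \<bar>U n z - u1 z\<bar>)\<^sup>2"
          by (intro power_mono lip U u1) auto
        then show "(Q (U n z) - Q (u1 z))\<^sup>2 \<le> C\<^sup>2 * (U n z - u1 z)\<^sup>2"
          by (simp add: power_mult_distrib)
      qed
      then show "(\<integral>z. (Q (U n z) - Q (u1 z))\<^sup>2 \<partial>lborel) \<le> C\<^sup>2 * (\<integral>z. (U n z - u1 z)\<^sup>2 \<partial>lborel)" by simp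
    qed
  qed auto
  then have "(\<lambda>n. \<integral>z. pd e w z * 1 * (Q (U n z) - Q (u1 z)) \<partial>lborel) \<longlonglongrightarrow> 0"
    by (intro L2_weak_limit[where C = 1 and Q = "\<lambda>_ _. 1"] pwL QL U u1) auto
  moreover have "(\<integral>z. pd e w z * 1 * (Q (U n z) - Q (u1 z)) \<partial>lborel) =
      (\<integral>z. Q (U n z) * pd e w z \<partial>lborel) - (\<integral>z. Q (u1 z) * pd e w z \<partial>lborel)" for n
    using L2_mult_integrable[OF QL[OF U(3) U(2)] pwL, of n] L2_mult_integrable[OF QL[OF u1(1) u1(3)] pwL]
    by (subst Bochner_Integration.integral_diff[symmetric]) (auto simp: algebra_simps)
  ultimately have "(\<lambda>n. \<integral>z. Q (U n z) * pd e w z \<partial>lborel) \<longlonglongrightarrow> (\<integral>z. Q (u1 z) * pd e w z \<partial>lborel)"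
    by (simp add: LIM_zero_iff)
  then have "(\<lambda>n. \<integral>z. w z * q (U n z) * H n e z \<partial>lborel) \<longlonglongrightarrow> - (\<integral>z. Q (u1 z) * pd e w z \<partial>lborel)"
    unfolding ibp by (rule tendsto_minus)
  with l1 have "(\<integral>z. w z * q (u1 z) * G1 e z \<partial>lborel) = - (\<integral>z. Q (u1 z) * pd e w z \<partial>lborel)"
    by (rule LIMSEQ_unique)
  moreover have "w z * q (u1 z) * G1 e z = w z * q (u z) * (G z \<bullet> e)" for z
    using w(2)[of z] u1(2)[of z] G1(2)[OF e, of z] by (cases "z \<in> K") auto
  moreover have "Q (u1 z) * pd e w z = Q (u z) * pd e w z" for z
    using pd_eq_0_outside(1)[OF K(1) w(2)] u1(2)[of z] by (cases "z \<in> K") auto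
  ultimately show "(\<integral>z. w z * q (u z) * (G z \<bullet> e) \<partial>lborel) = - (\<integral>z. Q (u z) * pd e w z \<partial>lborel)" by simp
  have "q \<in> borel_measurable borel" by (rule borel_measurable_continuous_onI[OF q(1)])
  then have "(\<lambda>z. q (u z)) \<in> borel_measurable borel" by (rule measurable_compose[OF L2_measurable[OF u(1)]])
  then show "integrable lborel (\<lambda>z. w z * q (u z) * (G z \<bullet> e))"
    by (intro L2_mult_integrable L2_mult_bounded(2)[OF wL _ q(2)] G e)
  show "integrable lborel (\<lambda>z. Q (u z) * pd e w z)"
    by (intro L2_mult_integrable QL u pwL)
qed

section \<open>The inequality at a fixed exponent\<close>

lemma continuous_on_abs_powr: "\<kappa> > 0 \<Longrightarrow> continuous_on UNIV (\<lambda>s::real. \<bar>s\<bar> powr \<kappa>)"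
  by (intro continuous_on_powr' continuous_intros) auto

lemma powr_le_1_plus:
  assumes "0 < \<kappa>" "\<kappa> \<le> 1" "t \<ge> 0"
  shows "t powr \<kappa> \<le> 1 + (t::real)"
proof (cases "t \<le> 1")
  case True
  have "t powr \<kappa> \<le> 1 powr \<kappa>" using True assms by (intro powr_mono2) auto
  then show ?thesis using assms by simp
next
  case False
  have "t powr \<kappa> \<le> t powr 1" using False assms by (intro powr_mono) auto
  then show ?thesis using False by simp
qed

text \<open>From t^\<kappa> \<le> 1 + t \<le> (1 + 1/\<epsilon>)(t + \<epsilon>). Boundedness of
  this weight is what lets the weak chain rule apply to its antiderivative.\<close>

lemma cutoff_weight_bound:
  fixes s :: real
  assumes "0 < \<kappa>" "\<kappa> \<le> 1" "\<epsilon> > 0"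
  shows "\<bar>\<bar>s\<bar> powr \<kappa> * (\<epsilon> / (\<bar>s\<bar> + \<epsilon>)\<^sup>2)\<bar> \<le> 1 + 1 / \<epsilon>"
proof -
  define t where "t = \<bar>s\<bar>"
  have t: "t \<ge> 0" "t + \<epsilon> > 0" using assms by (auto simp: t_def)
  have "t powr \<kappa> \<le> 1 + t" by (rule powr_le_1_plus) (use assms t in auto)
  also have "1 + t \<le> (1 + 1 / \<epsilon>) * (t + \<epsilon>)" using assms t by (simp add: field_simps)
  finally have "t powr \<kappa> * (\<epsilon> / (t + \<epsilon>)\<^sup>2) \<le> (1 + 1 / \<epsilon>) * (t + \<epsilon>) * (\<epsilon> / (t + \<epsilon>)\<^sup>2)"
    using assms by (intro mult_right_mono) auto
  also have "\<dots> = (1 + 1 / \<epsilon>) * (\<epsilon> / (t + \<epsilon>))" using t by (simp add: power2_eq_square)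
  also have "\<dots> \<le> (1 + 1 / \<epsilon>) * 1" using t assms by (intro mult_left_mono) auto
  finally show ?thesis using assms by (simp add: t_def)
qed

text \<open>The combination B(s) + s^\<kappa> \<epsilon>/(s + \<epsilon>) is made so that the
  derivatives of the cutoff cancel: subtracted from s^\<kappa>, it leaves a function with derivative
  \<kappa> s^\<kappa>/(s + \<epsilon>) \<ge> 0. On [0,1] this is at most \<kappa>/\<epsilon>; beyond
  1 it is at most \<kappa> s^(\<kappa> - 1), the derivative of s^\<kappa>.\<close>

lemma cutoff_antiderivative:
  fixes \<kappa> \<epsilon> :: real
  assumes \<kappa>: "0 < \<kappa>" "\<kappa> \<le> 1" and \<epsilon>: "\<epsilon> > 0"
  obtains B :: "real \<Rightarrow> real" where
    "\<And>s. s \<ge> 0 \<Longrightarrow> (B has_real_derivative \<bar>s\<bar> powr \<kappa> * (\<epsilon> / (\<bar>s\<bar> + \<epsilon>)\<^sup>2)) (at s)" "B 0 = 0"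
    "\<And>s. s \<ge> 0 \<Longrightarrow> B s + s powr \<kappa> * (\<epsilon> / (s + \<epsilon>)) \<le> s powr \<kappa>"
    "\<And>s. s \<ge> 0 \<Longrightarrow> s powr \<kappa> - (B s + s powr \<kappa> * (\<epsilon> / (s + \<epsilon>))) \<le> \<kappa> / \<epsilon> + max 0 (s powr \<kappa> - 1)"
proof -
  define h where "h s = \<bar>s\<bar> powr \<kappa> * (\<epsilon> / (\<bar>s\<bar> + \<epsilon>)\<^sup>2)" for s
  have hc: "continuous_on UNIV h"
    unfolding h_def using \<epsilon> by (intro continuous_intros continuous_on_abs_powr \<kappa>) (auto simp: add_nonneg_eq_0_iff)
  \<comment> \<open>Integration starts at -1 so that 0 is an interior point and the derivative there
    is two-sided; the absolute values in \<open>h\<close> extend the integrand to negative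
    arguments.\<close>
  define B where "B s = integral {-1..s} h - integral {-1..0} h" for s
  have dB: "(B has_real_derivative h s) (at s)" if "s > -1" for s
  proof -
    have "((\<lambda>x. integral {-1..x} h) has_real_derivative h s) (at s within {-1..s+1})"
      by (rule integral_has_real_derivative) (use that in \<open>auto intro: continuous_on_subset[OF hc]\<close>)
    then have "((\<lambda>x. integral {-1..x} h) has_real_derivative h s) (at s)"
      using that by (subst (asm) at_within_Icc_at) auto
    then show ?thesis unfolding B_def[abs_def] by (auto intro!: derivative_eq_intros)
  qed
  \<comment> \<open>The error committed when s^\<kappa> is replaced by B(s) + s^\<kappa>
    \<epsilon>/(s + \<epsilon>).\<close>
  define D where "D s = s powr \<kappa> * (1 - \<epsilon> / (s + \<epsilon>)) - B s" for s
  have cB: "continuous_on {0..} B"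
    by (rule continuous_at_imp_continuous_on) (use DERIV_isCont[OF dB] in auto)
  have cp: "continuous_on {0..} (\<lambda>s::real. s powr \<kappa>)"
    by (intro continuous_on_powr' continuous_intros) (use \<kappa> in auto)
  have cD: "continuous_on {0..} D"
    unfolding D_def using \<epsilon> by (intro continuous_intros cB cp) auto
  have dD: "(D has_real_derivative \<kappa> * (s powr \<kappa> / (s + \<epsilon>))) (at s)" if s: "s > 0" for s
  proof -
    have ne: "s + \<epsilon> \<noteq> 0" using s \<epsilon> by auto
    have "(D has_real_derivative (\<kappa> * s powr (\<kappa> - 1)) * (1 - \<epsilon> / (s + \<epsilon>)) + s powr \<kappa> * (\<epsilon> / (s + \<epsilon>)\<^sup>2) - h s) (at s)"
      unfolding D_def[abs_def] using s ne
      by (auto intro!: derivative_eq_intros dB has_real_derivative_powr simp: power2_eq_square)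
    moreover have "(\<kappa> * s powr (\<kappa> - 1)) * (1 - \<epsilon> / (s + \<epsilon>)) = \<kappa> * (s powr \<kappa> / (s + \<epsilon>))"
    proof -
      have "1 - \<epsilon> / (s + \<epsilon>) = s / (s + \<epsilon>)" using ne by (simp add: field_simps)
      moreover have "s powr (\<kappa> - 1) * s = s powr \<kappa>" using s by (simp add: powr_diff)
      ultimately show ?thesis by (simp add: mult.assoc times_divide_eq_right)
    qed
    ultimately show ?thesis using s by (simp add: h_def)
  qed
  have D0: "D 0 = 0" by (simp add: D_def B_def)
  have mono: "D s \<le> D t" if "0 \<le> s" "s \<le> t" for s t
  proof (cases "s = t")
    case False
    then show ?thesis using that \<epsilon> \<kappa>
      by (intro DERIV_nonneg_imp_increasing_open[of s t D] continuous_on_subset[OF cD])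
         (auto intro!: exI[of _ "\<kappa> * (_ powr \<kappa> / (_ + \<epsilon>))"] dD)
  qed simp
  have D1: "D s \<le> \<kappa> / \<epsilon>" if s: "0 \<le> s" "s \<le> 1" for s
  proof -
    define E where "E x = \<kappa> / \<epsilon> * x - D x" for x
    have "E 0 \<le> E s"
    proof (cases "s = 0")
      case False
      show ?thesis
      proof (rule DERIV_nonneg_imp_increasing_open[of 0 s E])
        fix x assume x: "0 < x" "x < s"
        have "x powr \<kappa> \<le> 1 powr \<kappa>" using x s \<kappa> by (intro powr_mono2) auto
        then have "x powr \<kappa> / (x + \<epsilon>) \<le> 1 / \<epsilon>" using x \<epsilon> by (intro frac_le) auto
        then have "\<kappa> * (x powr \<kappa> / (x + \<epsilon>)) \<le> \<kappa> * (1 / \<epsilon>)" using \<kappa> by (intro mult_left_mono) auto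
        moreover have "(E has_real_derivative \<kappa> / \<epsilon> - \<kappa> * (x powr \<kappa> / (x + \<epsilon>))) (at x)"
          unfolding E_def[abs_def] using \<epsilon> by (auto intro!: derivative_eq_intros dD x)
        ultimately show "\<exists>y. (E has_real_derivative y) (at x) \<and> y \<ge> 0"
          by (intro exI[of _ "\<kappa> / \<epsilon> - \<kappa> * (x powr \<kappa> / (x + \<epsilon>))"]) auto
      next
        show "continuous_on {0..s} E"
          unfolding E_def by (intro continuous_intros continuous_on_subset[OF cD]) (use \<epsilon> in auto)
      qed (use s in auto)
    qed simp
    then have "D s \<le> \<kappa> / \<epsilon> * s" by (simp add: E_def D0)
    also have "\<dots> \<le> \<kappa> / \<epsilon> * 1" using s \<kappa> \<epsilon> by (intro mult_left_mono) auto
    finally show ?thesis by simp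
  qed
  \<comment> \<open>From 1 on, 1/(s + \<epsilon>) \<le> 1/s, so \<open>D\<close> grows no faster
    than s^\<kappa>; the value at 1 is bounded by \<open>D1\<close>.\<close>
  have D2: "D s \<le> \<kappa> / \<epsilon> + (s powr \<kappa> - 1)" if s: "1 \<le> s" for s
  proof -
    define E where "E x = x powr \<kappa> - D x" for x
    have "E 1 \<le> E s"
    proof (cases "s = 1")
      case False
      show ?thesis
      proof (rule DERIV_nonneg_imp_increasing_open[of 1 s E])
        fix x assume x: "1 < x" "x < s"
        have "x powr \<kappa> / (x + \<epsilon>) \<le> x powr \<kappa> / x" using x \<epsilon> by (intro divide_left_mono) auto
        also have "\<dots> = x powr (\<kappa> - 1)" using x by (simp add: powr_diff)
        finally have "\<kappa> * (x powr \<kappa> / (x + \<epsilon>)) \<le> \<kappa> * x powr (\<kappa> - 1)" using \<kappa> by (intro mult_left_mono) auto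
        moreover have "(E has_real_derivative \<kappa> * x powr (\<kappa> - 1) - \<kappa> * (x powr \<kappa> / (x + \<epsilon>))) (at x)"
          unfolding E_def[abs_def] using x by (auto intro!: derivative_eq_intros dD has_real_derivative_powr)
        ultimately show "\<exists>y. (E has_real_derivative y) (at x) \<and> y \<ge> 0"
          by (intro exI[of _ "\<kappa> * x powr (\<kappa> - 1) - \<kappa> * (x powr \<kappa> / (x + \<epsilon>))"]) auto
      next
        show "continuous_on {1..s} E"
          unfolding E_def by (intro continuous_intros continuous_on_subset[OF cD] continuous_on_subset[OF cp]) auto
      qed (use s in auto)
    qed simp
    then show ?thesis using D1[of 1] by (simp add: E_def)
  qed
  show ?thesis
  proof (rule that[of B])
    show "B 0 = 0" by (simp add: B_def)
    show "(B has_real_derivative \<bar>s\<bar> powr \<kappa> * (\<epsilon> / (\<bar>s\<bar> + \<epsilon>)\<^sup>2)) (at s)" if "s \<ge> 0" for s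
      using dB[of s] that by (simp add: h_def)
    fix s :: real assume s: "s \<ge> 0"
    have eq: "D s = s powr \<kappa> - (B s + s powr \<kappa> * (\<epsilon> / (s + \<epsilon>)))" by (simp add: D_def algebra_simps)
    show "B s + s powr \<kappa> * (\<epsilon> / (s + \<epsilon>)) \<le> s powr \<kappa>"
      using mono[of 0 s] s D0 eq by simp
    show "s powr \<kappa> - (B s + s powr \<kappa> * (\<epsilon> / (s + \<epsilon>))) \<le> \<kappa> / \<epsilon> + max 0 (s powr \<kappa> - 1)"
      using D1[of s] D2[of s] s eq by (cases "s \<le> 1") auto
  qed
qed

text \<open>The equation tested with g(u) \<phi>, g(s) = \<epsilon>/(s + \<epsilon>), obtained as a
  limit of smooth tests. The field \<open>a\<close> holds time and drift together, and
  \<open>Bx\<close> holds the directions of diffusion. Derivatives of g(u) along \<open>a\<close>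
  are integrated to \<open>B\<close>, derivatives of \<open>\<phi>\<close> in the diffusion are
  paired with the antiderivative of g, the logarithm, and the dissipation is dropped by its
  sign.\<close>

lemma level_inequality:
  fixes S :: "'a::euclidean_space set" and u m c :: "'a \<Rightarrow> real" and G a :: "'a \<Rightarrow> 'a"
  assumes S: "open S" and m: "smooth_on S m" "\<And>z. z \<in> S \<Longrightarrow> m z \<ge> 0"
    and a: "\<And>e. e \<in> Basis \<Longrightarrow> smooth_on S (\<lambda>z. a z \<bullet> e)" and c: "continuous_on S c"
    and div_le: "\<And>z. z \<in> S \<Longrightarrow> (\<Sum>e\<in>Basis. pd e (\<lambda>y. a y \<bullet> e) z) \<le> c z"
    and Bx: "Bx \<subseteq> Basis" and \<kappa>: "0 < \<kappa>" "\<kappa> \<le> 1" and \<epsilon>: "\<epsilon> > 0"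
    and u: "L2 u" "\<And>z. u z \<ge> 0" and v: "L2 (\<lambda>z. u z powr \<kappa>)"
    and G: "\<And>e. e \<in> Basis \<Longrightarrow> L2 (\<lambda>z. G z \<bullet> e)"
    and wg: "\<And>\<phi> e. \<phi> \<in> test_functions S \<Longrightarrow> e \<in> Basis \<Longrightarrow>
       (\<integral>z. u z * pd e \<phi> z \<partial>lborel) = - (\<integral>z. (G z \<bullet> e) * \<phi> z \<partial>lborel)"
    and weak: "\<And>\<phi>. \<phi> \<in> test_functions S \<Longrightarrow>
       (\<integral>z. u z powr \<kappa> * ((\<Sum>e\<in>Basis. (a z \<bullet> e) * pd e \<phi> z) + c z * \<phi> z) \<partial>lborel) =
       (\<integral>z. m z * (\<Sum>e\<in>Bx. pd e \<phi> z * (G z \<bullet> e)) \<partial>lborel)"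
    and B: "\<And>s. s \<ge> 0 \<Longrightarrow> (B has_real_derivative \<bar>s\<bar> powr \<kappa> * (\<epsilon> / (\<bar>s\<bar> + \<epsilon>)\<^sup>2)) (at s)" "B 0 = 0"
    and \<phi>: "\<phi> \<in> test_functions S" "\<And>z. \<phi> z \<ge> 0"
  shows "(\<integral>z. (B (u z) + u z powr \<kappa> * (\<epsilon> / (u z + \<epsilon>))) * (\<Sum>e\<in>Basis. pd e (\<lambda>y. \<phi> y * (a y \<bullet> e)) z) \<partial>lborel)
     \<le> - (\<integral>z. \<epsilon> * ln (1 + u z / \<epsilon>) * (\<Sum>e\<in>Bx. pd e (\<lambda>y. m y * pd e \<phi> y) z) \<partial>lborel)"
proof -
  have finB: "finite Bx" and BxB: "\<And>e. e \<in> Bx \<Longrightarrow> e \<in> Basis" using finite_subset[OF Bx finite_Basis] Bx by auto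
  obtain K where K: "compact K" "K \<subseteq> S" "\<And>z. z \<notin> K \<Longrightarrow> \<phi> z = 0"
    using test_functionsD(2)[OF \<phi>(1)] by blast
  note sm\<phi> = test_functionsD(1)[OF \<phi>(1)]
  have sm\<phi>S: "smooth_on S \<phi>" by (rule smooth_on_subset[OF sm\<phi>]) simp
  have pd\<phi>0: "pd e \<phi> z = 0" if "z \<notin> K" for e z by (rule pd_eq_0_outside(1)[OF K(1) K(3) that])
  obtain U u1 and H :: "nat \<Rightarrow> 'a \<Rightarrow> 'a \<Rightarrow> real" and G1 where
    U: "\<And>n. smooth_on UNIV (U n)" "\<And>n z. U n z \<ge> 0" "\<And>n. L2 (U n)"
    and u1: "L2 u1" "\<And>z. z \<in> K \<Longrightarrow> u1 z = u z" "\<And>z. u1 z \<ge> 0"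
    and limU: "(\<lambda>n. \<integral>z. (U n z - u1 z)\<^sup>2 \<partial>lborel) \<longlonglongrightarrow> 0" "AE z in lborel. (\<lambda>n. U n z) \<longlonglongrightarrow> u1 z"
    and H: "\<And>e n. e \<in> Basis \<Longrightarrow> L2 (H n e)" and G1: "\<And>e. e \<in> Basis \<Longrightarrow> L2 (G1 e)"
    "\<And>e z. e \<in> Basis \<Longrightarrow> z \<in> K \<Longrightarrow> G1 e z = G z \<bullet> e"
    and limH: "\<And>e. e \<in> Basis \<Longrightarrow> (\<lambda>n. \<integral>z. (H n e z - G1 e z)\<^sup>2 \<partial>lborel) \<longlonglongrightarrow> 0"
    and pdU: "\<And>e n z. e \<in> Basis \<Longrightarrow> z \<in> K \<Longrightarrow> pd e (U n) z = H n e z"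
    by (rule Sobolev_approximation[OF S K(1,2) u G wg]) (assumption+, (rule that; assumption))
  define g where "g s = \<epsilon> / (\<bar>s\<bar> + \<epsilon>)" for s :: real
  define g' where "g' s = - \<epsilon> / (\<bar>s\<bar> + \<epsilon>)\<^sup>2" for s :: real
  define h where "h s = \<bar>s\<bar> powr \<kappa> * (\<epsilon> / (\<bar>s\<bar> + \<epsilon>)\<^sup>2)" for s :: real
  have ne: "\<bar>s\<bar> + \<epsilon> \<noteq> 0" for s :: real using \<epsilon> by (simp add: add_nonneg_eq_0_iff)
  have gc: "continuous_on UNIV g" and g'c: "continuous_on UNIV g'" and hc: "continuous_on UNIV h"
    unfolding g_def g'_def h_def using ne \<kappa> by (auto intro!: continuous_intros continuous_on_abs_powr)
  have gb: "\<bar>g s\<bar> \<le> 1" for s using \<epsilon> by (simp add: g_def)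
  have g'b: "\<bar>g' s\<bar> \<le> 1 / \<epsilon>" for s
  proof -
    have "\<epsilon>\<^sup>2 \<le> (\<bar>s\<bar> + \<epsilon>)\<^sup>2" using \<epsilon> by (intro power_mono) auto
    then have "\<epsilon> / (\<bar>s\<bar> + \<epsilon>)\<^sup>2 \<le> \<epsilon> / \<epsilon>\<^sup>2" using \<epsilon> ne by (intro divide_left_mono) auto
    then show ?thesis using \<epsilon> by (simp add: g'_def power2_eq_square)
  qed
  have hb: "\<bar>h s\<bar> \<le> 1 + 1 / \<epsilon>" for s unfolding h_def by (rule cutoff_weight_bound[OF \<kappa> \<epsilon>])
  note [measurable] = L2_measurable[OF u(1)] L2_measurable[OF u1(1)] L2_measurable[OF v]
    borel_measurable_continuous_onI[OF gc] borel_measurable_continuous_onI[OF g'c]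
  note ext = continuous_on_zero_extend[OF S K(1,2)]
  have c\<phi>a: "continuous_on UNIV (\<lambda>z. \<phi> z * (a z \<bullet> e))" if "e \<in> Basis" for e
    by (rule ext[OF continuous_on_mult[OF smooth_on_continuous[OF sm\<phi>S] smooth_on_continuous[OF a[OF that]]]]) (simp add: K(3))
  have cm\<phi>: "continuous_on UNIV (\<lambda>z. m z * \<phi> z)"
    by (rule ext[OF continuous_on_mult[OF smooth_on_continuous[OF m(1)] smooth_on_continuous[OF sm\<phi>S]]]) (simp add: K(3))
  have cmp\<phi>: "continuous_on UNIV (\<lambda>z. m z * pd e \<phi> z)" if "e \<in> Basis" for e
    by (rule ext[OF continuous_on_mult[OF smooth_on_continuous[OF m(1)] smooth_on_continuous[OF smooth_on_pd[OF sm\<phi>S that]]]]) (simp add: pd\<phi>0)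
  define w0 where "w0 z = (\<Sum>e\<in>Basis. (a z \<bullet> e) * pd e \<phi> z) + c z * \<phi> z" for z
  have cw0: "continuous_on UNIV w0"
    unfolding w0_def by (rule ext) (auto intro!: continuous_intros smooth_on_continuous[OF a] smooth_on_continuous[OF sm\<phi>S]
        smooth_on_continuous[OF smooth_on_pd[OF sm\<phi>S]] c simp: pd\<phi>0 K(3))
  have w00: "w0 z = 0" if "z \<notin> K" for z using that by (simp add: w0_def pd\<phi>0 K(3))
  \<comment> \<open>Index 1 marks the terms where the derivative hits g(u), index 0 the remaining
    ones: \<open>C1\<close> and \<open>C0\<close> on the transport side, \<open>D1\<close> and
    \<open>D0\<close> on the diffusion side.\<close>
  define C1 where "C1 e z = (\<phi> z * (a z \<bullet> e)) * u z powr \<kappa>" for e z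
  define C0 where "C0 z = w0 z * u z powr \<kappa>" for z
  define D1 where "D1 e z = (m z * \<phi> z) * (G z \<bullet> e)" for e z
  define D0 where "D0 e z = (m z * pd e \<phi> z) * (G z \<bullet> e)" for e z
  have L2k: "L2 (\<lambda>z. k z * f z)" if k: "continuous_on UNIV k" "\<And>z. z \<notin> K \<Longrightarrow> k z = 0" and f: "L2 f" for k f
  proof -
    obtain M where M: "M > 0" "\<And>z. \<bar>k z\<bar> \<le> M" by (rule compact_support_bounded[OF k(1) K(1) k(2)]) (assumption, (rule that; assumption))
    show ?thesis by (rule L2_mult_bounded(1)[OF f borel_measurable_continuous_onI[OF k(1)] M(2)])
  qed
  have Ik: "integrable lborel (\<lambda>z. k z * f z)" if "continuous_on UNIV k" "\<And>z. z \<notin> K \<Longrightarrow> k z = 0" "L2 f" for k f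
    by (rule L2_mult_integrable[OF L2_continuous[OF that(1) K(1) that(2)] that(3)])
  have LC1: "L2 (C1 e)" if "e \<in> Basis" for e unfolding C1_def by (rule L2k[OF c\<phi>a[OF that] _ v]) (simp add: K(3))
  have IC0: "integrable lborel C0" unfolding C0_def by (rule Ik[OF cw0 w00 v])
  have LD1: "L2 (D1 e)" if "e \<in> Basis" for e unfolding D1_def by (rule L2k[OF cm\<phi> _ G[OF that]]) (simp add: K(3))
  have ID0: "integrable lborel (D0 e)" if "e \<in> Basis" for e
    unfolding D0_def by (rule Ik[OF cmp\<phi>[OF that] _ G[OF that]]) (simp add: pd\<phi>0)
  have Iq: "integrable lborel (\<lambda>z. f z * q (w z))" if "integrable lborel f" "continuous_on UNIV q" "\<And>s::real. \<bar>q s\<bar> \<le> C" "w \<in> borel_measurable borel"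
    for f w :: "'a \<Rightarrow> real" and q :: "real \<Rightarrow> real" and C :: real
  proof (rule Bochner_Integration.integrable_bound[of _ "\<lambda>z. C * f z"])
    note [measurable] = borel_measurable_continuous_onI[OF that(2)] that(4) borel_measurable_integrable[OF that(1)]
    show "(\<lambda>z. f z * q (w z)) \<in> borel_measurable lborel" by measurable
    have "\<bar>q s\<bar> \<le> \<bar>C\<bar>" for s using that(3)[of s] by linarith
    then have "\<bar>f z\<bar> * \<bar>q (w z)\<bar> \<le> \<bar>f z\<bar> * \<bar>C\<bar>" for z by (intro mult_left_mono) auto
    then show "AE z in lborel. norm (f z * q (w z)) \<le> norm (C * f z)"
      by (intro AE_I2) (simp add: abs_mult mult.commute[of "\<bar>C\<bar>"])
  qed (use that in simp)
  have Ip: "integrable lborel (\<lambda>z. f z * g' (w z) * F z)" if "L2 f" "L2 F" "w \<in> borel_measurable borel" for f F w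
  proof -
    note [measurable] = that(3)
    show ?thesis by (intro L2_mult_integrable L2_mult_bounded(2)[OF that(1) _ g'b] that(2)) measurable
  qed

  \<comment> \<open>Only the argument of the cutoff is mollified, so the identity is exact for every
    \<open>n\<close>.\<close>
  have test: "(\<Sum>e\<in>Basis. \<integral>z. C1 e z * g' (U n z) * H n e z \<partial>lborel) + (\<integral>z. C0 z * g (U n z) \<partial>lborel)
      = (\<Sum>e\<in>Bx. \<integral>z. D1 e z * g' (U n z) * H n e z \<partial>lborel) + (\<Sum>e\<in>Bx. \<integral>z. D0 e z * g (U n z) \<partial>lborel)" for n
  proof -
    \<comment> \<open>On the nonnegative values of \<open>U n\<close> the cutoff \<open>g\<close>
      equals this expression, which is smooth although \<open>g\<close> contains an absolute
      value.\<close>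
    define \<eta> where "\<eta> = (\<lambda>z. (\<epsilon> * inverse (U n z + \<epsilon>)) * \<phi> z)"
    have dU: "U n differentiable at z" for z using smooth_on_differentiable[OF U(1)] by blast
    have pU: "U n z + \<epsilon> > 0" for z using U(2)[of n z] \<epsilon> by linarith
    have smU: "smooth_on UNIV (\<lambda>z. \<epsilon> * inverse (U n z + \<epsilon>))"
      by (intro smooth_on_mult smooth_on_const smooth_on_compose_real[OF open_UNIV _ smooth_on_inverse] smooth_on_add U(1))
         (use pU in auto)
    have tf: "\<eta> \<in> test_functions S"
      unfolding \<eta>_def
      by (rule test_functionsI[OF _ K(1,2)]) (auto intro!: smooth_on_mult[OF open_UNIV smU sm\<phi>] simp: K(3))
    have pd\<eta>: "pd e \<eta> z = g' (U n z) * pd e (U n) z * \<phi> z + g (U n z) * pd e \<phi> z" for e z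
    proof -
      have "((\<lambda>s. \<epsilon> * inverse (s + \<epsilon>)) has_real_derivative g' (U n z)) (at (U n z))"
        using pU[of z] U(2)[of n z]
        by (auto intro!: derivative_eq_intros simp: g'_def power2_eq_square divide_inverse)
      from pd_compose_real[OF dU this] have 1: "pd e (\<lambda>z. \<epsilon> * inverse (U n z + \<epsilon>)) z = g' (U n z) * pd e (U n) z" .
      show ?thesis
        unfolding \<eta>_def using U(2)[of n z] smooth_on_differentiable[OF smU, of z] smooth_on_differentiable[OF sm\<phi>, of z]
        by (subst pd_mult) (auto simp: 1 g_def divide_inverse)
    qed
    have pd\<eta>': "pd e \<eta> z = g' (U n z) * H n e z * \<phi> z + g (U n z) * pd e \<phi> z" if "e \<in> Basis" for e z
      using pdU[OF that, of z n] K(3)[of z] by (cases "z \<in> K") (auto simp: pd\<eta>)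
    have gU: "\<eta> z = g (U n z) * \<phi> z" for z using U(2)[of n z] by (simp add: \<eta>_def g_def divide_inverse)
    have "u z powr \<kappa> * ((\<Sum>e\<in>Basis. (a z \<bullet> e) * pd e \<eta> z) + c z * \<eta> z) =
       (\<Sum>e\<in>Basis. C1 e z * g' (U n z) * H n e z) + C0 z * g (U n z)" for z
    proof -
      have "(\<Sum>e\<in>Basis. (a z \<bullet> e) * pd e \<eta> z) = (\<Sum>e\<in>Basis. (\<phi> z * (a z \<bullet> e)) * g' (U n z) * H n e z) + g (U n z) * (\<Sum>e\<in>Basis. (a z \<bullet> e) * pd e \<phi> z)"
        unfolding sum_distrib_left sum.distrib[symmetric]
        by (intro sum.cong refl) (simp add: pd\<eta>' algebra_simps)
      then show ?thesis
        by (simp add: C1_def C0_def w0_def gU algebra_simps sum_distrib_left)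
    qed
    moreover have "m z * (\<Sum>e\<in>Bx. pd e \<eta> z * (G z \<bullet> e)) =
       (\<Sum>e\<in>Bx. D1 e z * g' (U n z) * H n e z) + (\<Sum>e\<in>Bx. D0 e z * g (U n z))" for z
      unfolding sum_distrib_left sum.distrib[symmetric]
      by (intro sum.cong refl) (simp add: pd\<eta>' BxB D1_def D0_def algebra_simps)
    ultimately have "(\<integral>z. (\<Sum>e\<in>Basis. C1 e z * g' (U n z) * H n e z) + C0 z * g (U n z) \<partial>lborel) =
       (\<integral>z. (\<Sum>e\<in>Bx. D1 e z * g' (U n z) * H n e z) + (\<Sum>e\<in>Bx. D0 e z * g (U n z)) \<partial>lborel)"
      using weak[OF tf] by simp
    moreover have "integrable lborel (\<lambda>z. C1 e z * g' (U n z) * H n e z)" if "e \<in> Basis" for e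
      by (intro Ip LC1 H that L2_measurable[OF U(3)])
    moreover have "integrable lborel (\<lambda>z. D1 e z * g' (U n z) * H n e z)" if "e \<in> Bx" for e
      by (intro Ip LD1 H BxB that L2_measurable[OF U(3)])
    moreover have "integrable lborel (\<lambda>z. C0 z * g (U n z))"
      by (rule Iq[OF IC0 gc gb L2_measurable[OF U(3)]])
    moreover have "integrable lborel (\<lambda>z. D0 e z * g (U n z))" if "e \<in> Bx" for e
      by (rule Iq[OF ID0[OF BxB[OF that]] gc gb L2_measurable[OF U(3)]])
    ultimately show ?thesis by (simp add: Bochner_Integration.integral_add Bochner_Integration.integral_sum Bochner_Integration.integrable_sum)
  qed
  have "(\<lambda>n. (\<Sum>e\<in>Basis. \<integral>z. C1 e z * g' (U n z) * H n e z \<partial>lborel) + (\<integral>z. C0 z * g (U n z) \<partial>lborel))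
     \<longlonglongrightarrow> (\<Sum>e\<in>Basis. \<integral>z. C1 e z * g' (u1 z) * G1 e z \<partial>lborel) + (\<integral>z. C0 z * g (u1 z) \<partial>lborel)"
    by (intro tendsto_add tendsto_sum integral_product_limit[OF LC1 G1(1) H limH L2_measurable[OF U(3)] L2_measurable[OF u1(1)] limU(2) g'c g'b]
        integral_compose_limit[OF IC0 L2_measurable[OF U(3)] L2_measurable[OF u1(1)] limU(2) gc gb])
  moreover have "(\<lambda>n. (\<Sum>e\<in>Bx. \<integral>z. D1 e z * g' (U n z) * H n e z \<partial>lborel) + (\<Sum>e\<in>Bx. \<integral>z. D0 e z * g (U n z) \<partial>lborel))
     \<longlonglongrightarrow> (\<Sum>e\<in>Bx. \<integral>z. D1 e z * g' (u1 z) * G1 e z \<partial>lborel) + (\<Sum>e\<in>Bx. \<integral>z. D0 e z * g (u1 z) \<partial>lborel)"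
    by (intro tendsto_add tendsto_sum integral_product_limit[OF LD1 G1(1) H limH L2_measurable[OF U(3)] L2_measurable[OF u1(1)] limU(2) g'c g'b]
        integral_compose_limit[OF ID0 L2_measurable[OF U(3)] L2_measurable[OF u1(1)] limU(2) gc gb]) (auto dest: BxB)
  ultimately have main: "(\<Sum>e\<in>Basis. \<integral>z. C1 e z * g' (u1 z) * G1 e z \<partial>lborel) + (\<integral>z. C0 z * g (u1 z) \<partial>lborel)
      = (\<Sum>e\<in>Bx. \<integral>z. D1 e z * g' (u1 z) * G1 e z \<partial>lborel) + (\<Sum>e\<in>Bx. \<integral>z. D0 e z * g (u1 z) \<partial>lborel)"
    unfolding test by (rule LIMSEQ_unique)

  let ?W = "\<lambda>z. \<Sum>e\<in>Basis. pd e (\<lambda>y. \<phi> y * (a y \<bullet> e)) z"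
  let ?W2 = "\<lambda>z. \<Sum>e\<in>Bx. pd e (\<lambda>y. m y * pd e \<phi> y) z"
  let ?L = "\<lambda>s. \<epsilon> * ln (1 + s / \<epsilon>)"
  have sm\<phi>a: "smooth_on S (\<lambda>z. \<phi> z * (a z \<bullet> e))" if "e \<in> Basis" for e
    by (intro smooth_on_mult S sm\<phi>S a that)
  have smmp: "smooth_on S (\<lambda>z. m z * pd e \<phi> z)" if "e \<in> Basis" for e
    by (intro smooth_on_mult S smooth_on_pd sm\<phi>S m that)
  have h': "(B has_real_derivative h s) (at s)" if "s \<ge> 0" for s using B(1)[OF that] by (simp add: h_def)
  \<comment> \<open>\<open>B\<close> has derivative
    \<open>h s = - (\<bar>s\<bar> powr \<kappa> * g' s)\<close>, so the weak chain rule moves the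
    derivative from \<open>u\<close> to \<open>\<phi>\<close> times the field.\<close>
  have E1: "(\<Sum>e\<in>Basis. \<integral>z. C1 e z * g' (u1 z) * G1 e z \<partial>lborel) = (\<integral>z. B (u z) * ?W z \<partial>lborel)"
  proof -
    have "(\<integral>z. C1 e z * g' (u1 z) * G1 e z \<partial>lborel) = (\<integral>z. B (u z) * pd e (\<lambda>y. \<phi> y * (a y \<bullet> e)) z \<partial>lborel)"
      if e: "e \<in> Basis" for e
    proof -
      have "C1 e z * g' (u1 z) * G1 e z = - ((\<phi> z * (a z \<bullet> e)) * h (u z) * (G z \<bullet> e))" for z
        using G1(2)[OF e, of z] u1(2)[of z] u(2)[of z] K(3)[of z] by (cases "z \<in> K") (auto simp: C1_def g'_def h_def)
      then have "(\<integral>z. C1 e z * g' (u1 z) * G1 e z \<partial>lborel) = - (\<integral>z. (\<phi> z * (a z \<bullet> e)) * h (u z) * (G z \<bullet> e) \<partial>lborel)" by simp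
      also have "\<dots> = (\<integral>z. B (u z) * pd e (\<lambda>y. \<phi> y * (a y \<bullet> e)) z \<partial>lborel)"
        by (subst weak_chain_rule(1)[OF S K(1,2) u G wg h' B(2) hc hb sm\<phi>a[OF e] _ e]) (auto simp: K(3))
      finally show ?thesis .
    qed
    then have "(\<Sum>e\<in>Basis. \<integral>z. C1 e z * g' (u1 z) * G1 e z \<partial>lborel) = (\<Sum>e\<in>Basis. \<integral>z. B (u z) * pd e (\<lambda>y. \<phi> y * (a y \<bullet> e)) z \<partial>lborel)"
      by (intro sum.cong refl)
    also have "\<dots> = (\<integral>z. B (u z) * ?W z \<partial>lborel)"
      unfolding sum_distrib_left
      by (subst Bochner_Integration.integral_sum)
         (auto intro!: weak_chain_rule(3)[OF S K(1,2) u G wg h' B(2) hc hb sm\<phi>a] simp: K(3))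
    finally show ?thesis .
  qed
  have IB: "integrable lborel (\<lambda>z. B (u z) * ?W z)"
    unfolding sum_distrib_left
    by (auto intro!: Bochner_Integration.integrable_sum weak_chain_rule(3)[OF S K(1,2) u G wg h' B(2) hc hb sm\<phi>a] simp: K(3))
  have dL: "(?L has_real_derivative g s) (at s)" if "s \<ge> 0" for s
  proof -
    have "1 + s / \<epsilon> > 0" using that \<epsilon> by (simp add: add_pos_nonneg)
    then show ?thesis using that \<epsilon> by (auto intro!: derivative_eq_intros simp: g_def field_simps)
  qed
  have L0: "?L 0 = 0" by simp
  have chL1: "(\<integral>z. (m z * pd e \<phi> z) * g (u z) * (G z \<bullet> e) \<partial>lborel) = - (\<integral>z. ?L (u z) * pd e (\<lambda>y. m y * pd e \<phi> y) z \<partial>lborel)"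
    if e: "e \<in> Basis" for e
    by (rule weak_chain_rule(1)[OF S K(1,2) u G wg dL L0 gc gb smmp[OF e] _ e]) (auto simp: pd\<phi>0)
  have chL3: "integrable lborel (\<lambda>z. ?L (u z) * pd e (\<lambda>y. m y * pd e \<phi> y) z)"
    if e: "e \<in> Basis" for e
    by (rule weak_chain_rule(3)[OF S K(1,2) u G wg dL L0 gc gb smmp[OF e] _ e]) (auto simp: pd\<phi>0)
  have E2: "(\<Sum>e\<in>Bx. \<integral>z. D0 e z * g (u1 z) \<partial>lborel) = - (\<integral>z. ?L (u z) * ?W2 z \<partial>lborel)"
  proof -
    have "(\<integral>z. D0 e z * g (u1 z) \<partial>lborel) = - (\<integral>z. ?L (u z) * pd e (\<lambda>y. m y * pd e \<phi> y) z \<partial>lborel)"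
      if e: "e \<in> Bx" for e
    proof -
      have "D0 e z * g (u1 z) = (m z * pd e \<phi> z) * g (u z) * (G z \<bullet> e)" for z
        using u1(2)[of z] pd\<phi>0[of z e] by (cases "z \<in> K") (auto simp: D0_def)
      then show ?thesis
        using chL1[OF BxB[OF e]] by simp
    qed
    then have "(\<Sum>e\<in>Bx. \<integral>z. D0 e z * g (u1 z) \<partial>lborel) = - (\<Sum>e\<in>Bx. \<integral>z. ?L (u z) * pd e (\<lambda>y. m y * pd e \<phi> y) z \<partial>lborel)"
      by (simp add: sum_negf)
    also have "(\<Sum>e\<in>Bx. \<integral>z. ?L (u z) * pd e (\<lambda>y. m y * pd e \<phi> y) z \<partial>lborel) = (\<integral>z. ?L (u z) * ?W2 z \<partial>lborel)"
      unfolding sum_distrib_left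
    proof (rule Bochner_Integration.integral_sum[symmetric])
      show "integrable lborel (\<lambda>z. ?L (u z) * pd e (\<lambda>y. m y * pd e \<phi> y) z)" if "e \<in> Bx" for e
        by (rule chL3[OF BxB[OF that]])
    qed
    finally show ?thesis .
  qed
  \<comment> \<open>The dissipation: since \<open>g' \<le> 0\<close>, each integrand is a
    nonpositive multiple of the squared derivative \<open>(G z \<bullet> e)\<^sup>2\<close>.\<close>
  have X: "(\<Sum>e\<in>Bx. \<integral>z. D1 e z * g' (u1 z) * G1 e z \<partial>lborel) \<le> 0"
  proof (rule sum_nonpos)
    fix e assume e: "e \<in> Bx"
    have "0 \<le> (\<integral>z. - (D1 e z * g' (u1 z) * G1 e z) \<partial>lborel)"
    proof (rule integral_nonneg_AE, rule AE_I2)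
      fix z
      show "0 \<le> - (D1 e z * g' (u1 z) * G1 e z)"
      proof (cases "z \<in> K")
        case True
        then have "- (D1 e z * g' (u1 z) * G1 e z) = (m z * \<phi> z) * (\<epsilon> / (\<bar>u1 z\<bar> + \<epsilon>)\<^sup>2) * (G z \<bullet> e)\<^sup>2"
          using G1(2)[OF BxB[OF e]] by (simp add: D1_def g'_def power2_eq_square)
        then show ?thesis using True K(2) m(2)[of z] \<phi>(2)[of z] \<epsilon> by auto
      qed (simp add: D1_def K(3))
    qed
    then show "(\<integral>z. D1 e z * g' (u1 z) * G1 e z \<partial>lborel) \<le> 0" by simp
  qed
  have pdW: "pd e (\<lambda>y. \<phi> y * (a y \<bullet> e)) z = \<phi> z * pd e (\<lambda>y. a y \<bullet> e) z + pd e \<phi> z * (a z \<bullet> e)" if "e \<in> Basis" "z \<in> S" for e z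
    by (rule pd_mult[OF smooth_on_differentiable[OF sm\<phi>S that(2)] smooth_on_differentiable[OF a[OF that(1)] that(2)]])
  have W0: "?W z = 0" if "z \<notin> K" for z
    by (intro sum.neutral ballI pd_eq_0_outside(1)[OF K(1) _ that]) (simp add: K(3))
  have cW: "continuous_on UNIV ?W"
    by (rule ext[OF continuous_on_sum[OF smooth_on_continuous[OF smooth_on_pd[OF sm\<phi>a]]] W0])
  have gu: "L2 (\<lambda>z. u z powr \<kappa> * g (u z))"
    by (rule L2_mult_bounded(2)[OF v _ gb]) measurable
  have IV: "integrable lborel (\<lambda>z. ?W z * (u z powr \<kappa> * g (u z)))"
    by (rule Ik[OF cW W0 gu])
  \<comment> \<open>Here the zero-order terms are discarded: the divergence of \<open>a\<close> is
    at most \<open>c\<close>, and it is multiplied by the nonnegative quantities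
    \<open>\<phi>\<close>, u^\<kappa> and g(u).\<close>
  have "(\<integral>z. ?W z * (u z powr \<kappa> * g (u z)) \<partial>lborel) \<le> (\<integral>z. C0 z * g (u1 z) \<partial>lborel)"
  proof (rule integral_mono[OF IV])
    show "integrable lborel (\<lambda>z. C0 z * g (u1 z))"
      by (rule Iq[OF IC0 gc gb L2_measurable[OF u1(1)]])
    fix z
    show "?W z * (u z powr \<kappa> * g (u z)) \<le> C0 z * g (u1 z)"
    proof (cases "z \<in> K")
      case True
      then have zS: "z \<in> S" using K(2) by auto
      have "?W z = \<phi> z * (\<Sum>e\<in>Basis. pd e (\<lambda>y. a y \<bullet> e) z) + (\<Sum>e\<in>Basis. (a z \<bullet> e) * pd e \<phi> z)"
        unfolding sum_distrib_left sum.distrib[symmetric]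
        by (intro sum.cong refl) (simp add: pdW zS mult.commute)
      also have "\<dots> \<le> \<phi> z * c z + (\<Sum>e\<in>Basis. (a z \<bullet> e) * pd e \<phi> z)"
        by (intro add_right_mono mult_left_mono div_le zS \<phi>(2))
      also have "\<dots> = w0 z" by (simp add: w0_def mult.commute)
      finally have "?W z \<le> w0 z" .
      then have "?W z * (u z powr \<kappa> * g (u z)) \<le> w0 z * (u z powr \<kappa> * g (u z))"
        using \<epsilon> by (intro mult_right_mono) (auto simp: g_def)
      then show ?thesis using u1(2)[OF True] by (simp add: C0_def mult.assoc)
    qed (simp add: W0 C0_def w00)
  qed
  then have "(\<integral>z. B (u z) * ?W z \<partial>lborel) + (\<integral>z. ?W z * (u z powr \<kappa> * g (u z)) \<partial>lborel) \<le> - (\<integral>z. ?L (u z) * ?W2 z \<partial>lborel)"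
    using main X unfolding E1 E2 by linarith
  also have "(\<integral>z. B (u z) * ?W z \<partial>lborel) + (\<integral>z. ?W z * (u z powr \<kappa> * g (u z)) \<partial>lborel)
     = (\<integral>z. (B (u z) + u z powr \<kappa> * (\<epsilon> / (u z + \<epsilon>))) * ?W z \<partial>lborel)"
    using u(2) by (subst Bochner_Integration.integral_add[OF IB IV, symmetric]) (simp add: g_def algebra_simps)
  finally show ?thesis .
qed

section \<open>The incompressible limit\<close>

text \<open>Intended instance: \<open>S = QT T\<close>, the space-time field
  \<open>a = drift m b\<close>, \<open>c = m f\<close>, and \<open>Bx\<close> the spatial unit
  vectors, in which case \<open>div_le\<close> is the non-strict form of the congestion
  condition.\<close>

locale degenerate_equation =
  fixes S :: "'a::euclidean_space set" and m c :: "'a \<Rightarrow> real" and a :: "'a \<Rightarrow> 'a" and Bx :: "'a set"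
  assumes S: "open S" and m: "smooth_on S m" "\<And>z. z \<in> S \<Longrightarrow> m z \<ge> 0"
    and a: "\<And>e. e \<in> Basis \<Longrightarrow> smooth_on S (\<lambda>z. a z \<bullet> e)" and c: "continuous_on S c"
    and div_le: "\<And>z. z \<in> S \<Longrightarrow> (\<Sum>e\<in>Basis. pd e (\<lambda>y. a y \<bullet> e) z) \<le> c z"
    and Bx: "Bx \<subseteq> Basis"
begin

text \<open>Here \<open>u = v\<^sup>k\<close>, \<open>\<kappa> = 1/k\<close>, and \<open>G\<close> is the full weak gradient of \<open>u\<close>.\<close>

definition solves :: "real \<Rightarrow> ('a \<Rightarrow> real) \<Rightarrow> ('a \<Rightarrow> 'a) \<Rightarrow> bool" where
  "solves \<kappa> u G \<longleftrightarrow> L2 u \<and> (\<forall>z. u z \<ge> 0) \<and> L2 (\<lambda>z. u z powr \<kappa>) \<and> (\<forall>e\<in>Basis. L2 (\<lambda>z. G z \<bullet> e)) \<and>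
    (\<forall>\<phi>\<in>test_functions S. \<forall>e\<in>Basis.
       (\<integral>z. u z * pd e \<phi> z \<partial>lborel) = - (\<integral>z. (G z \<bullet> e) * \<phi> z \<partial>lborel)) \<and>
    (\<forall>\<phi>\<in>test_functions S.
       (\<integral>z. u z powr \<kappa> * ((\<Sum>e\<in>Basis. (a z \<bullet> e) * pd e \<phi> z) + c z * \<phi> z) \<partial>lborel) =
       (\<integral>z. m z * (\<Sum>e\<in>Bx. pd e \<phi> z * (G z \<bullet> e)) \<partial>lborel))"

text \<open>The level inequality with its left side compared to the limit \<open>v\<close>. The
  bound \<open>v \<le> 1\<close> turns the excess of u^\<kappa> over 1 into the distance from
  u^\<kappa> to \<open>v\<close>; together with the distance itself this gives the factor 2. On the
  right the logarithm is bounded by the pressure.\<close>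

lemma level_estimate:
  assumes sol: "solves \<kappa> u G" and \<kappa>: "0 < \<kappa>" "\<kappa> \<le> 1" and \<epsilon>: "\<epsilon> > 0"
    and v: "integrable lborel v" "AE z in lborel. v z \<le> 1" and Vv: "integrable lborel (\<lambda>z. u z powr \<kappa>)"
    and p: "integrable lborel p" "AE z in lborel. p z \<ge> 0 \<and> \<epsilon> * ln (1 + u z / \<epsilon>) \<le> \<epsilon> * ln (1 + 1 / \<epsilon>) + \<epsilon> * p z"
    and \<phi>: "\<phi> \<in> test_functions S" "\<And>z. \<phi> z \<ge> 0"
    and K: "compact K" "K \<subseteq> S" "\<And>z. z \<notin> K \<Longrightarrow> \<phi> z = 0"
    and M: "\<And>z. \<bar>\<Sum>e\<in>Basis. pd e (\<lambda>y. \<phi> y * (a y \<bullet> e)) z\<bar> \<le> M"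
    and M2: "\<And>z. \<bar>\<Sum>e\<in>Bx. pd e (\<lambda>y. m y * pd e \<phi> y) z\<bar> \<le> M2"
  shows "(\<integral>z. v z * (\<Sum>e\<in>Basis. pd e (\<lambda>y. \<phi> y * (a y \<bullet> e)) z) \<partial>lborel) \<le>
     M * (\<kappa> / \<epsilon> * measure lborel K + 2 * (\<integral>z. \<bar>u z powr \<kappa> - v z\<bar> \<partial>lborel)) +
     M2 * (\<epsilon> * ln (1 + 1 / \<epsilon>) * measure lborel K + \<epsilon> * (\<integral>z. p z \<partial>lborel))"
proof -
  have u: "L2 u" "\<And>z. u z \<ge> 0" and V: "L2 (\<lambda>z. u z powr \<kappa>)" and G: "\<And>e. e \<in> Basis \<Longrightarrow> L2 (\<lambda>z. G z \<bullet> e)"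
    and wg: "\<And>\<phi> e. \<phi> \<in> test_functions S \<Longrightarrow> e \<in> Basis \<Longrightarrow>
       (\<integral>z. u z * pd e \<phi> z \<partial>lborel) = - (\<integral>z. (G z \<bullet> e) * \<phi> z \<partial>lborel)"
    and weak: "\<And>\<phi>. \<phi> \<in> test_functions S \<Longrightarrow>
       (\<integral>z. u z powr \<kappa> * ((\<Sum>e\<in>Basis. (a z \<bullet> e) * pd e \<phi> z) + c z * \<phi> z) \<partial>lborel) =
       (\<integral>z. m z * (\<Sum>e\<in>Bx. pd e \<phi> z * (G z \<bullet> e)) \<partial>lborel)"
    using sol by (auto simp: solves_def)
  obtain B :: "real \<Rightarrow> real" where B:
    "\<And>s. s \<ge> 0 \<Longrightarrow> (B has_real_derivative \<bar>s\<bar> powr \<kappa> * (\<epsilon> / (\<bar>s\<bar> + \<epsilon>)\<^sup>2)) (at s)" "B 0 = 0"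
    "\<And>s. s \<ge> 0 \<Longrightarrow> B s + s powr \<kappa> * (\<epsilon> / (s + \<epsilon>)) \<le> s powr \<kappa>"
    "\<And>s. s \<ge> 0 \<Longrightarrow> s powr \<kappa> - (B s + s powr \<kappa> * (\<epsilon> / (s + \<epsilon>))) \<le> \<kappa> / \<epsilon> + max 0 (s powr \<kappa> - 1)"
    by (rule cutoff_antiderivative[OF \<kappa> \<epsilon>]) (rule that; assumption)
  let ?W = "\<lambda>z. \<Sum>e\<in>Basis. pd e (\<lambda>y. \<phi> y * (a y \<bullet> e)) z"
  let ?W2 = "\<lambda>z. \<Sum>e\<in>Bx. pd e (\<lambda>y. m y * pd e \<phi> y) z"
  define A where "A z = B (u z) + u z powr \<kappa> * (\<epsilon> / (u z + \<epsilon>))" for z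
  have BxB: "e \<in> Basis" if "e \<in> Bx" for e using that Bx by auto
  have sm\<phi>S: "smooth_on S \<phi>" by (rule smooth_on_subset[OF test_functionsD(1)[OF \<phi>(1)]]) simp
  have pd\<phi>0: "pd e \<phi> z = 0" if "z \<notin> K" for e z by (rule pd_eq_0_outside(1)[OF K(1) K(3) that])
  have W0: "?W z = 0" if "z \<notin> K" for z
    by (intro sum.neutral ballI pd_eq_0_outside(1)[OF K(1) _ that]) (simp add: K(3))
  have W20: "?W2 z = 0" if "z \<notin> K" for z
    by (intro sum.neutral ballI pd_eq_0_outside(1)[OF K(1) _ that]) (simp add: pd\<phi>0)
  have sm\<phi>a: "smooth_on S (\<lambda>z. \<phi> z * (a z \<bullet> e))" if "e \<in> Basis" for e
    by (intro smooth_on_mult S sm\<phi>S a that)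
  have smmp: "smooth_on S (\<lambda>z. m z * pd e \<phi> z)" if "e \<in> Bx" for e
    by (intro smooth_on_mult S smooth_on_pd sm\<phi>S m BxB that)
  have cW: "continuous_on UNIV ?W"
    by (rule continuous_on_zero_extend[OF S K(1,2) continuous_on_sum[OF smooth_on_continuous[OF smooth_on_pd[OF sm\<phi>a]]] W0])
  have cW2: "continuous_on UNIV ?W2"
    by (rule continuous_on_zero_extend[OF S K(1,2) continuous_on_sum[OF smooth_on_continuous[OF smooth_on_pd[OF smmp BxB]]] W20])
  note [measurable] = L2_measurable[OF u(1)] L2_measurable[OF V]
    borel_measurable_continuous_onI[OF cW] borel_measurable_continuous_onI[OF cW2]
    borel_measurable_integrable[OF v(1)] borel_measurable_integrable[OF p(1)]
  have [measurable]: "K \<in> sets borel" using K(1) by (simp add: compact_imp_closed borel_closed)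
  have finK: "emeasure lborel K < \<infinity>" by (rule emeasure_bounded_finite[OF compact_imp_bounded[OF K(1)]])
  have Mp: "M \<ge> 0" "M2 \<ge> 0" using M[of undefined] M2[of undefined] by linarith+
  have Wi: "\<bar>?W z\<bar> \<le> M * indicator K z" for z using M[of z] W0[of z] Mp by (cases "z \<in> K") auto
  have W2i: "\<bar>?W2 z\<bar> \<le> M2 * indicator K z" for z using M2[of z] W20[of z] Mp by (cases "z \<in> K") auto
  have Bm [measurable]: "(\<lambda>z. B (u z)) \<in> borel_measurable borel"
  proof -
    have "continuous_on {0..} B"
      by (rule continuous_at_imp_continuous_on) (use DERIV_isCont[OF B(1)] in auto)
    then have "continuous_on UNIV (\<lambda>s. B \<bar>s\<bar>)"
      by (rule continuous_on_compose2) (auto intro!: continuous_intros)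
    from measurable_compose[OF L2_measurable[OF u(1)] borel_measurable_continuous_onI[OF this]]
    show ?thesis using u(2) by simp
  qed
  have [measurable]: "A \<in> borel_measurable borel" unfolding A_def by measurable
  have IV: "integrable lborel (\<lambda>z. \<bar>u z powr \<kappa> - v z\<bar>)" using Vv v by simp
  have IR: "integrable lborel (\<lambda>z. M * (\<kappa> / \<epsilon> * indicator K z + 2 * \<bar>u z powr \<kappa> - v z\<bar>))"
    using IV finK by simp
  have diff: "AE z in lborel. \<bar>(v z - A z) * ?W z\<bar> \<le> M * (\<kappa> / \<epsilon> * indicator K z + 2 * \<bar>u z powr \<kappa> - v z\<bar>)"
    using v(2)
  proof eventually_elim
    case (elim z)
    have "\<bar>v z - A z\<bar> \<le> \<kappa> / \<epsilon> + 2 * \<bar>u z powr \<kappa> - v z\<bar>"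
    proof -
      have "0 \<le> u z powr \<kappa> - A z" using B(3)[OF u(2)] by (simp add: A_def)
      moreover have "u z powr \<kappa> - A z \<le> \<kappa> / \<epsilon> + \<bar>u z powr \<kappa> - v z\<bar>"
      proof (rule order_trans)
        show "u z powr \<kappa> - A z \<le> \<kappa> / \<epsilon> + max 0 (u z powr \<kappa> - 1)"
          using B(4)[OF u(2)] by (simp add: A_def)
        show "\<kappa> / \<epsilon> + max 0 (u z powr \<kappa> - 1) \<le> \<kappa> / \<epsilon> + \<bar>u z powr \<kappa> - v z\<bar>"
          using elim by (intro add_left_mono) auto
      qed
      ultimately have "\<bar>u z powr \<kappa> - A z\<bar> \<le> \<kappa> / \<epsilon> + \<bar>u z powr \<kappa> - v z\<bar>" by simp
      then have "\<bar>u z powr \<kappa> - v z\<bar> + \<bar>u z powr \<kappa> - A z\<bar> \<le> \<kappa> / \<epsilon> + 2 * \<bar>u z powr \<kappa> - v z\<bar>"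
        by simp
      moreover have "\<bar>v z - A z\<bar> \<le> \<bar>u z powr \<kappa> - v z\<bar> + \<bar>u z powr \<kappa> - A z\<bar>" by arith
      ultimately show ?thesis by (rule order_trans[rotated])
    qed
    then have "\<bar>v z - A z\<bar> * \<bar>?W z\<bar> \<le> (\<kappa> / \<epsilon> + 2 * \<bar>u z powr \<kappa> - v z\<bar>) * (M * indicator K z)"
      using Wi[of z] by (intro mult_mono) auto
    also have "\<dots> \<le> M * (\<kappa> / \<epsilon> * indicator K z + 2 * \<bar>u z powr \<kappa> - v z\<bar>)"
      using Mp by (auto simp: indicator_def algebra_simps)
    finally show ?case by (simp add: abs_mult)
  qed
  have I1: "integrable lborel (\<lambda>z. (v z - A z) * ?W z)"
    by (rule Bochner_Integration.integrable_bound[OF IR]) (use diff in \<open>auto intro: order_trans[OF _ abs_ge_self]\<close>)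
  have I2: "integrable lborel (\<lambda>z. v z * ?W z)"
    by (rule integrable_mult_continuous_bounded[OF v(1) cW M])
  have I3: "integrable lborel (\<lambda>z. A z * ?W z)"
    using Bochner_Integration.integrable_diff[OF I2 I1] by (simp add: algebra_simps)
  have "(\<integral>z. v z * ?W z \<partial>lborel) = (\<integral>z. (v z - A z) * ?W z \<partial>lborel) + (\<integral>z. A z * ?W z \<partial>lborel)"
    by (subst Bochner_Integration.integral_add[OF I1 I3, symmetric]) (simp add: algebra_simps)
  also have "(\<integral>z. (v z - A z) * ?W z \<partial>lborel) \<le> (\<integral>z. M * (\<kappa> / \<epsilon> * indicator K z + 2 * \<bar>u z powr \<kappa> - v z\<bar>) \<partial>lborel)"
    by (rule integral_mono_AE[OF I1 IR]) (use diff in \<open>auto elim!: eventually_mono\<close>)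
  also have "\<dots> = M * (\<kappa> / \<epsilon> * measure lborel K + 2 * (\<integral>z. \<bar>u z powr \<kappa> - v z\<bar> \<partial>lborel))"
    using IV finK by simp
  also have "(\<integral>z. A z * ?W z \<partial>lborel) \<le> - (\<integral>z. \<epsilon> * ln (1 + u z / \<epsilon>) * ?W2 z \<partial>lborel)"
    unfolding A_def
    by (rule level_inequality[OF S m a c div_le Bx \<kappa> \<epsilon> u V G wg weak B(1,2) \<phi>])
  also have "- (\<integral>z. \<epsilon> * ln (1 + u z / \<epsilon>) * ?W2 z \<partial>lborel) \<le> (\<integral>z. M2 * (\<epsilon> * ln (1 + 1 / \<epsilon>) * indicator K z + \<epsilon> * p z) \<partial>lborel)"
  proof -
    have J: "integrable lborel (\<lambda>z. M2 * (\<epsilon> * ln (1 + 1 / \<epsilon>) * indicator K z + \<epsilon> * p z))"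
      using p finK by simp
    have b: "AE z in lborel. \<bar>\<epsilon> * ln (1 + u z / \<epsilon>) * ?W2 z\<bar> \<le> M2 * (\<epsilon> * ln (1 + 1 / \<epsilon>) * indicator K z + \<epsilon> * p z)"
      using p(2)
    proof eventually_elim
      case (elim z)
      have l: "0 \<le> \<epsilon> * ln (1 + u z / \<epsilon>)" using \<epsilon> u(2) by (simp add: ln_ge_zero)
      have l1: "0 \<le> \<epsilon> * ln (1 + 1 / \<epsilon>)" using \<epsilon> by (simp add: ln_ge_zero)
      have "\<bar>\<epsilon> * ln (1 + u z / \<epsilon>)\<bar> * \<bar>?W2 z\<bar> \<le> (\<epsilon> * ln (1 + 1 / \<epsilon>) + \<epsilon> * p z) * (M2 * indicator K z)"
        using W2i[of z] elim l l1 by (intro mult_mono) auto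
      also have "\<dots> \<le> M2 * (\<epsilon> * ln (1 + 1 / \<epsilon>) * indicator K z + \<epsilon> * p z)"
        using Mp elim \<epsilon> by (cases "z \<in> K") (auto simp: algebra_simps)
      finally show ?case by (simp add: abs_mult)
    qed
    have J2: "integrable lborel (\<lambda>z. \<epsilon> * ln (1 + u z / \<epsilon>) * ?W2 z)"
      by (rule Bochner_Integration.integrable_bound[OF J]) (use b in \<open>auto elim!: eventually_mono intro: order_trans[OF _ abs_ge_self]\<close>)
    have "- (\<integral>z. \<epsilon> * ln (1 + u z / \<epsilon>) * ?W2 z \<partial>lborel) = (\<integral>z. - (\<epsilon> * ln (1 + u z / \<epsilon>) * ?W2 z) \<partial>lborel)" by simp
    also have "\<dots> \<le> (\<integral>z. M2 * (\<epsilon> * ln (1 + 1 / \<epsilon>) * indicator K z + \<epsilon> * p z) \<partial>lborel)"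
      by (rule integral_mono_AE) (use J J2 b in \<open>auto elim!: eventually_mono\<close>)
    finally show ?thesis .
  qed
  also have "(\<integral>z. M2 * (\<epsilon> * ln (1 + 1 / \<epsilon>) * indicator K z + \<epsilon> * p z) \<partial>lborel) =
     M2 * (\<epsilon> * ln (1 + 1 / \<epsilon>) * measure lborel K + \<epsilon> * (\<integral>z. p z \<partial>lborel))"
    using p finK by simp
  finally show ?thesis by simp
qed

text \<open>Square-root growth suffices to bound \<epsilon> ln (1 + 1/\<epsilon>) by 2 sqrt
  \<epsilon>.\<close>

lemma ln_1_plus_le: "x \<ge> 0 \<Longrightarrow> ln (1 + x) \<le> 2 * sqrt (x::real)"
proof -
  assume x: "x \<ge> 0"
  have "1 + x \<le> (1 + sqrt x)\<^sup>2" using x by (simp add: power2_sum)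
  then have "ln (1 + x) \<le> ln ((1 + sqrt x)\<^sup>2)" using x by (subst ln_le_cancel_iff) (auto intro: add_pos_nonneg)
  also have "\<dots> = 2 * ln (1 + sqrt x)" using x by (simp add: ln_realpow add_pos_nonneg)
  also have "ln (1 + sqrt x) \<le> sqrt x" using x by (intro ln_add_one_self_le_self) auto
  finally show ?thesis by simp
qed

text \<open>\<open>K\<close>, \<open>M\<close> and \<open>M2\<close> depend on \<open>\<phi>\<close>
  and the coefficients alone, so the level estimate is uniform in \<open>n\<close>. The quotient of
  \<open>\<kappa> n\<close> by \<epsilon> disappears for fixed \<epsilon>, and afterwards \<epsilon>
  runs through \<open>1 / real (Suc j)\<close>.\<close>

lemma limit_inequality:
  assumes sol: "\<And>n. solves (\<kappa> n) (u n) (G n)" and \<kappa>: "\<And>n. 0 < \<kappa> n" "\<And>n. \<kappa> n \<le> 1" "\<kappa> \<longlonglongrightarrow> 0"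
    and v: "integrable lborel v" "AE z in lborel. v z \<le> 1" and V: "\<And>n. integrable lborel (\<lambda>z. u n z powr \<kappa> n)"
    and lim: "(\<lambda>n. \<integral>z. \<bar>u n z powr \<kappa> n - v z\<bar> \<partial>lborel) \<longlonglongrightarrow> 0"
    and p: "\<And>n. integrable lborel (p n)" "\<And>n. (\<integral>z. p n z \<partial>lborel) \<le> P" "\<And>n. AE z in lborel. p n z \<ge> 0"
    and up: "\<And>n \<epsilon>. \<epsilon> > 0 \<Longrightarrow> AE z in lborel. \<epsilon> * ln (1 + u n z / \<epsilon>) \<le> \<epsilon> * ln (1 + 1 / \<epsilon>) + \<epsilon> * p n z"
    and \<phi>: "\<phi> \<in> test_functions S" "\<And>z. \<phi> z \<ge> 0"
  shows "(\<integral>z. v z * (\<Sum>e\<in>Basis. pd e (\<lambda>y. \<phi> y * (a y \<bullet> e)) z) \<partial>lborel) \<le> 0"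
proof -
  obtain K where K: "compact K" "K \<subseteq> S" "\<And>z. z \<notin> K \<Longrightarrow> \<phi> z = 0"
    using test_functionsD(2)[OF \<phi>(1)] by blast
  let ?W = "\<lambda>z. \<Sum>e\<in>Basis. pd e (\<lambda>y. \<phi> y * (a y \<bullet> e)) z"
  let ?W2 = "\<lambda>z. \<Sum>e\<in>Bx. pd e (\<lambda>y. m y * pd e \<phi> y) z"
  have BxB: "e \<in> Basis" if "e \<in> Bx" for e using that Bx by auto
  have sm\<phi>S: "smooth_on S \<phi>" by (rule smooth_on_subset[OF test_functionsD(1)[OF \<phi>(1)]]) simp
  have pd\<phi>0: "pd e \<phi> z = 0" if "z \<notin> K" for e z by (rule pd_eq_0_outside(1)[OF K(1) K(3) that])
  have W0: "?W z = 0" if "z \<notin> K" for z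
    by (intro sum.neutral ballI pd_eq_0_outside(1)[OF K(1) _ that]) (simp add: K(3))
  have W20: "?W2 z = 0" if "z \<notin> K" for z
    by (intro sum.neutral ballI pd_eq_0_outside(1)[OF K(1) _ that]) (simp add: pd\<phi>0)
  have sm\<phi>a: "smooth_on S (\<lambda>z. \<phi> z * (a z \<bullet> e))" if "e \<in> Basis" for e
    by (intro smooth_on_mult S sm\<phi>S a that)
  have smmp: "smooth_on S (\<lambda>z. m z * pd e \<phi> z)" if "e \<in> Bx" for e
    by (intro smooth_on_mult S smooth_on_pd sm\<phi>S m BxB that)
  have cW: "continuous_on UNIV ?W"
    by (rule continuous_on_zero_extend[OF S K(1,2) continuous_on_sum[OF smooth_on_continuous[OF smooth_on_pd[OF sm\<phi>a]]] W0])
  have cW2: "continuous_on UNIV ?W2"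
    by (rule continuous_on_zero_extend[OF S K(1,2) continuous_on_sum[OF smooth_on_continuous[OF smooth_on_pd[OF smmp BxB]]] W20])
  obtain M where M: "M > 0" "\<And>z. \<bar>?W z\<bar> \<le> M"
    by (rule compact_support_bounded[OF cW K(1) W0]) (assumption, (rule that; assumption))
  obtain M2 where M2: "M2 > 0" "\<And>z. \<bar>?W2 z\<bar> \<le> M2"
    by (rule compact_support_bounded[OF cW2 K(1) W20]) (assumption, (rule that; assumption))
  let ?\<mu> = "measure lborel K"
  have bound: "(\<integral>z. v z * ?W z \<partial>lborel) \<le> M2 * (\<epsilon> * ln (1 + 1 / \<epsilon>) * ?\<mu> + \<epsilon> * P)" if \<epsilon>: "\<epsilon> > 0" for \<epsilon>
  proof (rule LIMSEQ_le_const)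
    show "(\<lambda>n. M * (\<kappa> n / \<epsilon> * ?\<mu> + 2 * (\<integral>z. \<bar>u n z powr \<kappa> n - v z\<bar> \<partial>lborel)) + M2 * (\<epsilon> * ln (1 + 1 / \<epsilon>) * ?\<mu> + \<epsilon> * P))
       \<longlonglongrightarrow> M2 * (\<epsilon> * ln (1 + 1 / \<epsilon>) * ?\<mu> + \<epsilon> * P)"
    proof -
      have "(\<lambda>n. M * (\<kappa> n / \<epsilon> * ?\<mu> + 2 * (\<integral>z. \<bar>u n z powr \<kappa> n - v z\<bar> \<partial>lborel)) + M2 * (\<epsilon> * ln (1 + 1 / \<epsilon>) * ?\<mu> + \<epsilon> * P))
       \<longlonglongrightarrow> M * (0 / \<epsilon> * ?\<mu> + 2 * 0) + M2 * (\<epsilon> * ln (1 + 1 / \<epsilon>) * ?\<mu> + \<epsilon> * P)"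
        using \<epsilon> by (intro tendsto_intros \<kappa> lim) auto
      then show ?thesis by simp
    qed
    have "(\<integral>z. v z * ?W z \<partial>lborel) \<le>
      M * (\<kappa> n / \<epsilon> * ?\<mu> + 2 * (\<integral>z. \<bar>u n z powr \<kappa> n - v z\<bar> \<partial>lborel)) +
      M2 * (\<epsilon> * ln (1 + 1 / \<epsilon>) * ?\<mu> + \<epsilon> * (\<integral>z. p n z \<partial>lborel))" for n
      by (rule level_estimate[OF sol \<kappa>(1,2) \<epsilon> v V p(1) eventually_conj[OF p(3) up[OF \<epsilon>]] \<phi> K M(2) M2(2)])
    moreover have "M2 * (\<epsilon> * ln (1 + 1 / \<epsilon>) * ?\<mu> + \<epsilon> * (\<integral>z. p n z \<partial>lborel)) \<le> M2 * (\<epsilon> * ln (1 + 1 / \<epsilon>) * ?\<mu> + \<epsilon> * P)" for n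
      using M2 \<epsilon> p(2) by (intro mult_left_mono add_left_mono) auto
    ultimately show "\<exists>N. \<forall>n\<ge>N. (\<integral>z. v z * ?W z \<partial>lborel) \<le>
      M * (\<kappa> n / \<epsilon> * ?\<mu> + 2 * (\<integral>z. \<bar>u n z powr \<kappa> n - v z\<bar> \<partial>lborel)) + M2 * (\<epsilon> * ln (1 + 1 / \<epsilon>) * ?\<mu> + \<epsilon> * P)"
      by (meson add_left_mono order_trans)
  qed
  have "(\<lambda>j. M2 * (2 * sqrt (1 / real (Suc j)) * ?\<mu> + 1 / real (Suc j) * P)) \<longlonglongrightarrow> M2 * (2 * sqrt 0 * ?\<mu> + 0 * P)"
    by (intro tendsto_intros LIMSEQ_Suc[OF lim_1_over_n])
  then have "(\<lambda>j. M2 * (2 * sqrt (1 / real (Suc j)) * ?\<mu> + 1 / real (Suc j) * P)) \<longlonglongrightarrow> 0" by simp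
  note * = LIMSEQ_le_const[OF this]
  have "(\<integral>z. v z * ?W z \<partial>lborel) \<le> M2 * (2 * sqrt (1 / real (Suc j)) * ?\<mu> + 1 / real (Suc j) * P)" for j
  proof -
    define \<epsilon> where "\<epsilon> = 1 / real (Suc j)"
    have \<epsilon>: "\<epsilon> > 0" by (simp add: \<epsilon>_def)
    have "\<epsilon> * ln (1 + 1 / \<epsilon>) \<le> \<epsilon> * (2 * sqrt (1 / \<epsilon>))" using \<epsilon> by (intro mult_left_mono ln_1_plus_le) auto
    also have "\<dots> = 2 * sqrt \<epsilon>" using \<epsilon> by (simp add: real_sqrt_divide field_simps)
    finally have "M2 * (\<epsilon> * ln (1 + 1 / \<epsilon>) * ?\<mu> + \<epsilon> * P) \<le> M2 * (2 * sqrt \<epsilon> * ?\<mu> + \<epsilon> * P)"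
      using M2 by (intro mult_left_mono add_right_mono mult_right_mono) auto
    then show ?thesis using bound[OF \<epsilon>] by (simp add: \<epsilon>_def)
  qed
  then show ?thesis by (intro *) blast
qed

end

section \<open>Mollified transport inequality\<close>

lemma compact_thickening:
  fixes K :: "'a::euclidean_space set"
  assumes "open S" "compact K" "K \<subseteq> S"
  obtains d K' where "d > 0" "compact K'" "K' \<subseteq> S" "\<And>x. x \<in> K \<Longrightarrow> cball x d \<subseteq> K'"
proof -
  obtain d where d: "d > 0" "(\<Union>x\<in>K. cball x d) \<subseteq> S"
    by (metis compact_subset_open_imp_cball_epsilon_subset[OF assms(2,1,3)])
  define K' where "K' = (\<Union>x\<in>K. \<Union>y\<in>cball 0 d. {x + y})"
  have "(x + y) \<in> cball x d" if "y \<in> cball 0 d" for x y :: 'a using that by (simp add: dist_norm)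
  then have "K' \<subseteq> (\<Union>x\<in>K. cball x d)" unfolding K'_def by blast
  then have K'S: "K' \<subseteq> S" using d(2) by (rule order_trans)
  have cb: "cball x d \<subseteq> K'" if "x \<in> K" for x
  proof
    fix z assume "z \<in> cball x d"
    then have "z - x \<in> cball 0 d" by (simp add: dist_norm norm_minus_commute)
    then show "z \<in> K'" unfolding K'_def using that by (intro UN_I[of x] UN_I[of "z - x"]) auto
  qed
  have "compact K'" unfolding K'_def by (rule compact_sums'[OF assms(2) compact_cball])
  then show ?thesis by (rule that[OF d(1) _ K'S cb])
qed

text \<open>The commutator of transport and mollification at \<open>z0\<close> is the integral of \<open>v1\<close> against a kernel of
  integral zero, so that \<open>v1\<close> may be replaced by its increment from \<open>v1 z0\<close>.\<close>

lemma mollified_defect_bound: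
  fixes S :: "'a::euclidean_space set" and \<beta> :: "'a \<Rightarrow> 'a" and r M :: real
  assumes S: "open S" and \<beta>: "\<And>e. e \<in> Basis \<Longrightarrow> smooth_on S (\<lambda>z. \<beta> z \<bullet> e)"
    and v1: "integrable lborel v1" and veq: "\<And>z. z \<in> K' \<Longrightarrow> v1 z = v z"
    and ineq: "\<And>\<psi>. \<psi> \<in> test_functions S \<Longrightarrow> (\<And>z. \<psi> z \<ge> 0) \<Longrightarrow>
      (\<integral>z. v z * (\<Sum>e\<in>Basis. pd e (\<lambda>y. \<psi> y * (\<beta> y \<bullet> e)) z) \<partial>lborel) \<le> 0"
    and \<rho>: "mollifier r \<rho>" and c: "cball z0 r \<subseteq> S" "cball z0 r \<subseteq> K'"
    and M: "\<And>z e i. z \<in> K' \<Longrightarrow> e \<in> Basis \<Longrightarrow> i \<in> Basis \<Longrightarrow> \<bar>pd i (\<lambda>y. \<beta> y \<bullet> e) z\<bar> \<le> M" and r: "r > 0"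
  shows "ennreal (max 0 (- (\<Sum>e\<in>Basis. (\<beta> z0 \<bullet> e) * pd e (moll \<rho> v1) z0))) \<le>
     (\<integral>\<^sup>+y. ennreal (\<bar>v1 (z0 - y) - v1 z0\<bar> * (\<Sum>e\<in>Basis. real DIM('a) * M * r * \<bar>pd e \<rho> y\<bar> + M * \<rho> y)) \<partial>lborel)"
proof -
  note \<rho>D = mollifierD[OF \<rho>]
  note aff = smooth_on_affine[OF \<rho>D(1), where x = z0 and c = "-1", simplified]
  define \<psi> where "\<psi> y = \<rho> (z0 - y)" for y
  have sm\<psi>: "smooth_on UNIV \<psi>" unfolding \<psi>_def by (rule aff(1))
  have pd\<psi>: "pd e \<psi> y = - pd e \<rho> (z0 - y)" for e y unfolding \<psi>_def by (rule aff(2))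
  have out: "z0 - y \<notin> cball 0 r" if "y \<notin> cball z0 r" for y using that by (simp add: dist_norm norm_minus_commute)
  have \<psi>0: "\<psi> y = 0" if "y \<notin> cball z0 r" for y unfolding \<psi>_def by (rule \<rho>D(3)[OF out[OF that]])
  have \<psi>pos: "\<psi> y \<ge> 0" for y by (simp add: \<psi>_def \<rho>D)
  have tf: "\<psi> \<in> test_functions S" by (rule test_functionsI[OF sm\<psi> compact_cball c(1) \<psi>0])
  \<comment> \<open>Freezing the field at \<open>z0\<close> yields minus the derivative of the
    mollification along the field at \<open>z0\<close>. The rest is the divergence of the increment
    of the field times the kernel; its components are compactly supported, so that divergence has
    integral zero.\<close>
  define \<chi>' where "\<chi>' e y = (if y \<in> S then (\<beta> y \<bullet> e + - (\<beta> z0 \<bullet> e)) * \<psi> y else 0)" for e y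
  have tf\<chi>: "\<chi>' e \<in> test_functions S" if "e \<in> Basis" for e
    unfolding \<chi>'_def by (intro test_functions_mult tf S smooth_on_add \<beta> that smooth_on_const)
  have sm\<chi>: "smooth_on UNIV (\<chi>' e)" if "e \<in> Basis" for e by (rule test_functionsD(1)[OF tf\<chi>[OF that]])
  have \<chi>0: "\<chi>' e y = 0" if "y \<notin> cball z0 r" for e y using \<psi>0[OF that] by (simp add: \<chi>'_def)
  define Kr where "Kr y = (\<Sum>e\<in>Basis. pd e (\<chi>' e) y)" for y
  have Kr0: "Kr y = 0" if "y \<notin> cball z0 r" for y
    unfolding Kr_def by (intro sum.neutral ballI pd_eq_0_outside(1)[OF compact_cball \<chi>0 that])
  have cKr: "continuous_on UNIV Kr"
    unfolding Kr_def by (intro continuous_on_sum smooth_on_continuous smooth_on_pd sm\<chi>)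
  have iKr: "integrable lborel Kr" by (rule compact_support_integrable[OF cKr compact_cball Kr0])
  have intKr: "integral\<^sup>L lborel Kr = 0"
  proof -
    have "integrable lborel (pd e (\<chi>' e))" if "e \<in> Basis" for e
      by (rule compact_support_integrable[OF smooth_on_continuous[OF smooth_on_pd[OF sm\<chi>[OF that] that]] compact_cball
          pd_eq_0_outside(1)[OF compact_cball \<chi>0]])
    moreover have "integral\<^sup>L lborel (pd e (\<chi>' e)) = 0" if "e \<in> Basis" for e
      by (rule integral_pd_eq_0[OF smooth_on_differentiable[OF sm\<chi>[OF that]] smooth_on_continuous[OF smooth_on_pd[OF sm\<chi>[OF that]]]
          compact_cball \<chi>0 that]) auto
    ultimately show ?thesis unfolding Kr_def by (subst Bochner_Integration.integral_sum) auto
  qed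
  obtain MK where MK: "MK > 0" "\<And>y. \<bar>Kr y\<bar> \<le> MK"
    by (rule compact_support_bounded[OF cKr compact_cball Kr0]) (assumption, (rule that; assumption))
  have ivK: "integrable lborel (\<lambda>y. v1 y * Kr y)" by (rule integrable_mult_continuous_bounded[OF v1 cKr MK(2)])
  have cp: "continuous_on UNIV (pd e \<psi>)" if "e \<in> Basis" for e
    by (rule smooth_on_continuous[OF smooth_on_pd[OF sm\<psi> that]])
  have ivp: "integrable lborel (\<lambda>y. v1 y * pd e \<psi> y)" if e: "e \<in> Basis" for e
  proof -
    obtain Mp where Mp: "Mp > 0" "\<And>y. \<bar>pd e \<psi> y\<bar> \<le> Mp"
      by (rule compact_support_bounded[OF cp[OF e] compact_cball pd_eq_0_outside(1)[OF compact_cball \<psi>0]])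
        (assumption, assumption, (rule that; assumption))
    show ?thesis by (rule integrable_mult_continuous_bounded[OF v1 cp[OF e] Mp(2)])
  qed
  have split: "pd e (\<lambda>y. \<psi> y * (\<beta> y \<bullet> e)) y = pd e (\<chi>' e) y + (\<beta> z0 \<bullet> e) * pd e \<psi> y" if "e \<in> Basis" for e y
  proof -
    have "\<psi> y * (\<beta> y \<bullet> e) = \<chi>' e y + (\<beta> z0 \<bullet> e) * \<psi> y" for y
    proof (cases "y \<in> S")
      case False
      then have "y \<notin> cball z0 r" using c(1) by blast
      then show ?thesis using \<psi>0 by (simp add: \<chi>'_def)
    qed (simp add: \<chi>'_def algebra_simps)
    then have "(\<lambda>y. \<psi> y * (\<beta> y \<bullet> e)) = (\<lambda>y. \<chi>' e y + (\<beta> z0 \<bullet> e) * \<psi> y)" by auto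
    moreover have "\<psi> differentiable at y" "\<chi>' e differentiable at y"
      using smooth_on_differentiable[OF sm\<psi>] smooth_on_differentiable[OF sm\<chi>[OF that]] by auto
    ultimately show ?thesis by (simp add: pd_add pd_mult)
  qed
  have pd\<psi>0: "pd e \<psi> y = 0" if "y \<notin> cball z0 r" for e y
    by (rule pd_eq_0_outside(1)[OF compact_cball \<psi>0 that])
  have hd: "(moll \<rho> v1 has_derivative (\<lambda>h. moll (pd h \<rho>) v1 z0)) (at z0)"
    by (rule moll_has_derivative[OF v1 \<rho>D(1) compact_cball[of 0 r] \<rho>D(3)])
  have DV: "pd e (moll \<rho> v1) z0 = - (\<integral>y. v1 y * pd e \<psi> y \<partial>lborel)" for e
    unfolding pd_eqI[OF hd] moll_def pd\<psi> by simp
  have "(\<integral>z. v z * (\<Sum>e\<in>Basis. pd e (\<lambda>y. \<psi> y * (\<beta> y \<bullet> e)) z) \<partial>lborel) =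
     (\<integral>y. v1 y * Kr y + (\<Sum>e\<in>Basis. (\<beta> z0 \<bullet> e) * (v1 y * pd e \<psi> y)) \<partial>lborel)"
  proof (rule Bochner_Integration.integral_cong[OF refl])
    fix y
    have eq: "(\<Sum>e\<in>Basis. pd e (\<lambda>y. \<psi> y * (\<beta> y \<bullet> e)) y) = Kr y + (\<Sum>e\<in>Basis. (\<beta> z0 \<bullet> e) * pd e \<psi> y)"
      unfolding Kr_def sum.distrib[symmetric] by (intro sum.cong refl split)
    show "v y * (\<Sum>e\<in>Basis. pd e (\<lambda>y. \<psi> y * (\<beta> y \<bullet> e)) y) = v1 y * Kr y + (\<Sum>e\<in>Basis. (\<beta> z0 \<bullet> e) * (v1 y * pd e \<psi> y))"
    proof (cases "y \<in> cball z0 r")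
      case True
      then have "v1 y = v y" using veq c(2) by auto
      then show ?thesis unfolding eq by (simp add: distrib_left sum_distrib_left mult_ac)
    next
      case False
      then show ?thesis unfolding eq by (simp add: Kr0[OF False] pd\<psi>0[OF False])
    qed
  qed
  also have "\<dots> = (\<integral>y. v1 y * Kr y \<partial>lborel) - (\<Sum>e\<in>Basis. (\<beta> z0 \<bullet> e) * pd e (moll \<rho> v1) z0)"
    using ivK ivp by (simp add: DV sum_negf)
  finally have "- (\<Sum>e\<in>Basis. (\<beta> z0 \<bullet> e) * pd e (moll \<rho> v1) z0) \<le> - (\<integral>y. v1 y * Kr y \<partial>lborel)"
    using ineq[OF tf \<psi>pos] by linarith
  also have "- (\<integral>y. v1 y * Kr y \<partial>lborel) = - (\<integral>y. (v1 y - v1 z0) * Kr y \<partial>lborel)"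
    using ivK iKr by (simp add: left_diff_distrib intKr)
  also have "\<dots> \<le> (\<integral>y. \<bar>(v1 y - v1 z0) * Kr y\<bar> \<partial>lborel)"
    using integral_abs_bound[of lborel "\<lambda>y. (v1 y - v1 z0) * Kr y"] by linarith
  finally have "max 0 (- (\<Sum>e\<in>Basis. (\<beta> z0 \<bullet> e) * pd e (moll \<rho> v1) z0)) \<le> (\<integral>y. \<bar>(v1 y - v1 z0) * Kr y\<bar> \<partial>lborel)"
    by simp
  then have "ennreal (max 0 (- (\<Sum>e\<in>Basis. (\<beta> z0 \<bullet> e) * pd e (moll \<rho> v1) z0))) \<le> ennreal (\<integral>y. \<bar>(v1 y - v1 z0) * Kr y\<bar> \<partial>lborel)"
    by (rule ennreal_leI)
  also have "\<dots> = (\<integral>\<^sup>+y. ennreal \<bar>(v1 y - v1 z0) * Kr y\<bar> \<partial>lborel)"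
    using ivK iKr by (intro nn_integral_eq_integral[symmetric]) (auto simp: left_diff_distrib)
  also have "\<dots> \<le> (\<integral>\<^sup>+y. ennreal (\<bar>v1 y - v1 z0\<bar> * (\<Sum>e\<in>Basis. real DIM('a) * M * r * \<bar>pd e \<rho> (z0 - y)\<bar> + M * \<rho> (z0 - y))) \<partial>lborel)"
  proof (rule nn_integral_mono, rule ennreal_leI)
    fix y
    have "\<bar>Kr y\<bar> \<le> (\<Sum>e\<in>Basis. real DIM('a) * M * r * \<bar>pd e \<rho> (z0 - y)\<bar> + M * \<rho> (z0 - y))"
    proof (cases "y \<in> cball z0 r")
      case True
      have yS: "y \<in> S" and yK: "y \<in> K'" using True c by auto
      have "\<bar>pd e (\<chi>' e) y\<bar> \<le> real DIM('a) * M * r * \<bar>pd e \<rho> (z0 - y)\<bar> + M * \<rho> (z0 - y)" if e: "e \<in> Basis" for e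
      proof -
        have "pd e (\<chi>' e) y = pd e (\<lambda>y. (\<beta> y \<bullet> e + - (\<beta> z0 \<bullet> e)) * \<psi> y) y"
          by (rule fun_cong[OF frechet_derivative_cong_open[OF S yS]]) (simp add: \<chi>'_def)
        also have "\<dots> = (\<beta> y \<bullet> e - \<beta> z0 \<bullet> e) * pd e \<psi> y + pd e (\<lambda>y. \<beta> y \<bullet> e) y * \<psi> y"
        proof -
          have d1: "(\<lambda>y. \<beta> y \<bullet> e) differentiable at y" by (rule smooth_on_differentiable[OF \<beta>[OF e] yS])
          have dd: "(\<lambda>y. \<beta> y \<bullet> e + - (\<beta> z0 \<bullet> e)) differentiable at y"
            by (rule differentiable_add[OF d1 differentiable_const])
          have d2: "\<psi> differentiable at y" by (rule smooth_on_differentiable[OF sm\<psi>]) simp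
          have "pd e (\<lambda>y. \<beta> y \<bullet> e + - (\<beta> z0 \<bullet> e)) y = pd e (\<lambda>y. \<beta> y \<bullet> e) y"
            unfolding pd_add[OF d1 differentiable_const] pd_const by simp
          then show ?thesis unfolding pd_mult[OF dd d2] by simp
        qed
        finally have "\<bar>pd e (\<chi>' e) y\<bar> \<le> \<bar>\<beta> y \<bullet> e - \<beta> z0 \<bullet> e\<bar> * \<bar>pd e \<rho> (z0 - y)\<bar> + \<bar>pd e (\<lambda>y. \<beta> y \<bullet> e) y\<bar> * \<rho> (z0 - y)"
          using \<psi>pos[of y] abs_triangle_ineq[of "(\<beta> y \<bullet> e - \<beta> z0 \<bullet> e) * pd e \<psi> y" "pd e (\<lambda>y. \<beta> y \<bullet> e) y * \<psi> y"]
          by (simp add: abs_mult pd\<psi> \<psi>_def)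
        \<comment> \<open>Over the ball the field changes by at most a multiple of \<open>r\<close>,
          which balances the 1/r in the L^1 norm of the kernel gradient.\<close>
        moreover have "\<bar>\<beta> y \<bullet> e - \<beta> z0 \<bullet> e\<bar> \<le> real DIM('a) * M * r"
        proof -
          have "norm (\<beta> y \<bullet> e - \<beta> z0 \<bullet> e) \<le> real DIM('a) * M * norm (y - z0)"
            by (rule lipschitz_of_pd_bound[of "cball z0 r" "\<lambda>y. \<beta> y \<bullet> e" M y z0])
               (use c M e r True in \<open>auto intro!: smooth_on_differentiable[OF \<beta>[OF e]] simp: subset_iff\<close>)
          also have "\<dots> \<le> real DIM('a) * M * r"
            using True M[OF yK e e] by (intro mult_left_mono) (auto simp: dist_norm norm_minus_commute)
          finally show ?thesis by simp
        qed
        ultimately show ?thesis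
          using mult_right_mono[OF M[OF yK e e] \<rho>D(2)[of "z0 - y"]]
            mult_right_mono[of "\<bar>\<beta> y \<bullet> e - \<beta> z0 \<bullet> e\<bar>" "real DIM('a) * M * r" "\<bar>pd e \<rho> (z0 - y)\<bar>"] by linarith
      qed
      then show ?thesis unfolding Kr_def by (intro order_trans[OF sum_abs] sum_mono) auto
    next
      case False
      have "z0 \<in> K'" using c(2) r by auto
      from M[OF this SOME_Basis SOME_Basis] have "0 \<le> M" by linarith
      then show ?thesis using Kr0[OF False] r \<rho>D(2) by (auto intro!: sum_nonneg add_nonneg_nonneg mult_nonneg_nonneg)
    qed
    then show "\<bar>(v1 y - v1 z0) * Kr y\<bar> \<le> \<bar>v1 y - v1 z0\<bar> * (\<Sum>e\<in>Basis. real DIM('a) * M * r * \<bar>pd e \<rho> (z0 - y)\<bar> + M * \<rho> (z0 - y))"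
      unfolding abs_mult by (intro mult_left_mono) auto
  qed
  also have "\<dots> = (\<integral>\<^sup>+y. ennreal (\<bar>v1 (z0 - y) - v1 z0\<bar> * (\<Sum>e\<in>Basis. real DIM('a) * M * r * \<bar>pd e \<rho> y\<bar> + M * \<rho> y)) \<partial>lborel)"
  proof -
    have [measurable]: "v1 \<in> borel_measurable borel" "\<rho> \<in> borel_measurable borel"
      using v1 \<rho>D(6) by auto
    have [measurable]: "e \<in> Basis \<Longrightarrow> pd e \<rho> \<in> borel_measurable borel" for e
      by (rule borel_measurable_continuous_onI[OF smooth_on_continuous[OF smooth_on_pd[OF \<rho>D(1)]]])
    have "(\<lambda>y. ennreal (\<bar>v1 (z0 - y) - v1 z0\<bar> * (\<Sum>e\<in>Basis. real DIM('a) * M * r * \<bar>pd e \<rho> y\<bar> + M * \<rho> y))) \<in> borel_measurable borel"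
      by measurable
    from nn_integral_reflect[OF this, of z0] show ?thesis by simp
  qed
  finally show ?thesis .
qed

text \<open>Both errors, the distance to \<open>v\<close> and the negative part of the derivative
  along the field, are averages of translation increments of \<open>v1\<close>: the first under the
  mollifier, the second under a commutator kernel whose mass is bounded independently of the radius.
  Continuity of translations in L^1 makes both small.\<close>

lemma mollified_monotone:
  fixes S K :: "'a::euclidean_space set" and \<beta> :: "'a \<Rightarrow> 'a"
  assumes S: "open S" and K: "compact K" "K \<subseteq> S"
    and \<beta>: "\<And>e. e \<in> Basis \<Longrightarrow> smooth_on S (\<lambda>z. \<beta> z \<bullet> e)" and v: "integrable lborel v"
    and ineq: "\<And>\<psi>. \<psi> \<in> test_functions S \<Longrightarrow> (\<And>z. \<psi> z \<ge> 0) \<Longrightarrow>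
      (\<integral>z. v z * (\<Sum>e\<in>Basis. pd e (\<lambda>y. \<psi> y * (\<beta> y \<bullet> e)) z) \<partial>lborel) \<le> 0"
    and \<epsilon>: "\<epsilon> > 0"
  shows "\<exists>V. smooth_on UNIV V \<and> (\<integral>\<^sup>+z. indicator K z *
      (ennreal \<bar>V z - v z\<bar> + ennreal (max 0 (- (\<Sum>e\<in>Basis. (\<beta> z \<bullet> e) * pd e V z)))) \<partial>lborel) \<le> ennreal \<epsilon>"
proof -
  obtain d K' where d: "d > 0" and K': "compact K'" "K' \<subseteq> S" "\<And>x. x \<in> K \<Longrightarrow> cball x d \<subseteq> K'"
    by (rule compact_thickening[OF S K]) (rule that; assumption)
  have KK': "K \<subseteq> K'" using K'(3) d by force
  have [measurable]: "K' \<in> sets borel" "K \<in> sets borel"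
    using K'(1) K(1) by (auto simp: compact_imp_closed borel_closed)
  define v1 where "v1 z = indicator K' z * v z" for z
  have v1: "integrable lborel v1"
    unfolding v1_def using integrable_mult_indicator[OF _ v, of K'] by simp
  have [measurable]: "v1 \<in> borel_measurable borel" "v \<in> borel_measurable borel" using v1 v by auto
  have "\<exists>M. \<forall>z\<in>K'. \<bar>pd i (\<lambda>y. \<beta> y \<bullet> e) z\<bar> \<le> M" if "e \<in> Basis" "i \<in> Basis" for e i
  proof -
    have "continuous_on K' (pd i (\<lambda>y. \<beta> y \<bullet> e))"
      by (rule continuous_on_subset[OF smooth_on_continuous[OF smooth_on_pd[OF \<beta>[OF that(1)] that(2)]] K'(2)])
    then have "bounded (pd i (\<lambda>y. \<beta> y \<bullet> e) ` K')"
      using K'(1) compact_continuous_image compact_imp_bounded by blast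
    then show ?thesis by (auto simp: bounded_iff)
  qed
  then obtain m where m: "\<And>e i z. e \<in> Basis \<Longrightarrow> i \<in> Basis \<Longrightarrow> z \<in> K' \<Longrightarrow> \<bar>pd i (\<lambda>y. \<beta> y \<bullet> e) z\<bar> \<le> m e i"
    by metis
  define M where "M = (\<Sum>e\<in>Basis. \<Sum>i\<in>Basis. \<bar>m e i\<bar>)"
  have M0: "M \<ge> 0" unfolding M_def by (intro sum_nonneg) auto
  have M: "\<bar>pd i (\<lambda>y. \<beta> y \<bullet> e) z\<bar> \<le> M" if "z \<in> K'" "e \<in> Basis" "i \<in> Basis" for z e i
  proof -
    have "\<bar>m e i\<bar> \<le> (\<Sum>i\<in>Basis. \<bar>m e i\<bar>)" using that by (intro member_le_sum) auto
    also have "\<dots> \<le> M" unfolding M_def using that by (intro member_le_sum[of e Basis "\<lambda>e. \<Sum>i\<in>Basis. \<bar>m e i\<bar>"]) (auto intro: sum_nonneg)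
    finally show ?thesis using m[OF that(2,3,1)] by linarith
  qed
  have v1p: "integrable lborel (\<lambda>x. \<bar>v1 x\<bar> ^ 1)" using v1 by simp
  obtain C \<rho> r where \<rho>: "\<And>n. 0 < r n" "\<And>n. r n \<le> d" "\<And>n. mollifier (r n) (\<rho> n :: 'a \<Rightarrow> real)"
    "\<And>n e. e \<in> Basis \<Longrightarrow> (\<integral>x. \<bar>pd e (\<rho> n) x\<bar> \<partial>lborel) \<le> C / r n"
    "\<And>n i y. i \<in> {()} \<Longrightarrow> norm y \<le> r n \<Longrightarrow> (\<integral>\<^sup>+x. \<bar>v1 (x - y) - v1 x\<bar> ^ 1 \<partial>lborel) \<le> ennreal (1 / real (Suc n))"
    by (rule mollifier_sequence[where I = "{()}" and F = "\<lambda>_. v1" and p = 1 and d = d])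
      (simp, simp, rule v1p, simp, rule d, (rule that; assumption))
  \<comment> \<open>The 1 pays for the distance of \<open>V\<close> to \<open>v\<close>; the rest
    bounds the mass of the commutator kernel, in which \<open>r n\<close> cancels against
    \<open>C / r n\<close>.\<close>
  define B where "B = 1 + real DIM('a) * (real DIM('a) * M * \<bar>C\<bar> + M)"
  have Bp: "B > 0" unfolding B_def using M0 by (intro add_pos_nonneg mult_nonneg_nonneg add_nonneg_nonneg) auto
  have Bp1: "B - 1 \<ge> 0" unfolding B_def using M0 by (simp add: add_nonneg_nonneg)
  obtain n where n: "B / \<epsilon> < real n" using reals_Archimedean2 by blast
  define \<tau> where "\<tau> = 1 / real (Suc n)"
  have \<tau>: "\<tau> > 0" "\<tau> * B \<le> \<epsilon>"
  proof -
    show "\<tau> > 0" by (simp add: \<tau>_def)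
    have "B < real n * \<epsilon>" using n \<epsilon> by (simp add: pos_divide_less_eq)
    also have "\<dots> \<le> real (Suc n) * \<epsilon>" using \<epsilon> by (intro mult_right_mono) auto
    finally have "B \<le> \<epsilon> * real (Suc n)" by (simp only: mult.commute)
    then show "\<tau> * B \<le> \<epsilon>" unfolding \<tau>_def times_divide_eq_left mult_1_left
      by (subst pos_divide_le_eq) auto
  qed
  define V where "V = moll (\<rho> n) v1"
  note \<rho>D = mollifierD[OF \<rho>(3)[of n]]
  have tr: "(\<integral>\<^sup>+x. \<bar>v1 (x - y) - v1 x\<bar> ^ 1 \<partial>lborel) \<le> ennreal \<tau>" if "norm y \<le> r n" for y
    using \<rho>(5)[OF _ that] by (simp add: \<tau>_def)
  have V: "smooth_on UNIV V" unfolding V_def by (rule smooth_on_moll[OF v1 \<rho>D(1) compact_cball \<rho>D(3)])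
  have [measurable]: "V \<in> borel_measurable borel" "\<rho> n \<in> borel_measurable borel"
    using borel_measurable_continuous_onI[OF smooth_on_continuous[OF V]] \<rho>D(6) by auto
  have pdm [measurable]: "e \<in> Basis \<Longrightarrow> pd e (\<rho> n) \<in> borel_measurable borel" for e
    by (rule borel_measurable_continuous_onI[OF smooth_on_continuous[OF smooth_on_pd[OF \<rho>D(1)]]])
  have pV: "(\<integral>\<^sup>+z. ennreal \<bar>V z - v1 z\<bar> \<partial>lborel) \<le> ennreal \<tau>"
    using moll_Lp_estimate[OF _ v1 v1p \<rho>(3)[of n] _ tr] by (simp add: V_def)
  define \<kappa> where "\<kappa> y = (\<Sum>e\<in>Basis. real DIM('a) * M * r n * \<bar>pd e (\<rho> n) y\<bar> + M * \<rho> n y)" for y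
  have [measurable]: "\<kappa> \<in> borel_measurable borel" unfolding \<kappa>_def by measurable
  have \<kappa>0: "\<kappa> y \<ge> 0" for y
    unfolding \<kappa>_def using M0 \<rho>(1)[of n] \<rho>D(2)
    by (intro sum_nonneg add_nonneg_nonneg mult_nonneg_nonneg) (auto intro: less_imp_le)
  have \<kappa>z: "\<kappa> y = 0" if "y \<notin> cball 0 (r n)" for y
    unfolding \<kappa>_def using \<rho>D(3)[OF that] pd_eq_0_outside(1)[OF compact_cball \<rho>D(3) that] by simp
  have pdi: "integrable lborel (\<lambda>y. \<bar>pd e (\<rho> n) y\<bar>)" if "e \<in> Basis" for e
    by (intro integrable_abs compact_support_integrable[OF smooth_on_continuous[OF smooth_on_pd[OF \<rho>D(1) that]] compact_cball
          pd_eq_0_outside(1)[OF compact_cball \<rho>D(3)]])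
  have \<kappa>i: "integrable lborel \<kappa>" unfolding \<kappa>_def using pdi \<rho>D(7) by auto
  have \<kappa>int: "integral\<^sup>L lborel \<kappa> \<le> B - 1"
  proof -
    have "integral\<^sup>L lborel \<kappa> = (\<Sum>e\<in>Basis. real DIM('a) * M * r n * (\<integral>y. \<bar>pd e (\<rho> n) y\<bar> \<partial>lborel) + M)"
      unfolding \<kappa>_def using pdi \<rho>D(7) by (simp add: \<rho>D(4))
    also have "\<dots> \<le> (\<Sum>e\<in>(Basis::'a set). real DIM('a) * M * \<bar>C\<bar> + M)"
    proof (intro sum_mono add_right_mono)
      fix e :: 'a assume e: "e \<in> Basis"
      have "real DIM('a) * M * r n * (\<integral>y. \<bar>pd e (\<rho> n) y\<bar> \<partial>lborel) \<le> real DIM('a) * M * r n * (C / r n)"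
        using \<rho>(1)[of n] M0 by (intro mult_left_mono \<rho>(4) e) auto
      also have "\<dots> = real DIM('a) * M * C" using \<rho>(1)[of n] by simp
      also have "\<dots> \<le> real DIM('a) * M * \<bar>C\<bar>" using M0 by (intro mult_left_mono) auto
      finally show "real DIM('a) * M * r n * (\<integral>y. \<bar>pd e (\<rho> n) y\<bar> \<partial>lborel) \<le> real DIM('a) * M * \<bar>C\<bar>" .
    qed
    also have "\<dots> = B - 1" by (simp add: B_def)
    finally show ?thesis .
  qed
  let ?D = "\<lambda>z. max 0 (- (\<Sum>e\<in>Basis. (\<beta> z \<bullet> e) * pd e V z))"
  have pw: "indicator K z * (ennreal \<bar>V z - v z\<bar> + ennreal (?D z)) \<le>
     ennreal \<bar>V z - v1 z\<bar> + (\<integral>\<^sup>+y. ennreal (\<bar>v1 (z - y) - v1 z\<bar> * \<kappa> y) \<partial>lborel)" for z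
  proof (cases "z \<in> K")
    case True
    have "cball z (r n) \<subseteq> cball z d" by (rule subset_cball[OF \<rho>(2)])
    then have c: "cball z (r n) \<subseteq> K'" "cball z (r n) \<subseteq> S" using K'(2) K'(3)[OF True] by auto
    have "v1 z = v z" using True KK' by (auto simp: v1_def)
    moreover have "ennreal (?D z) \<le> (\<integral>\<^sup>+y. ennreal (\<bar>v1 (z - y) - v1 z\<bar> * \<kappa> y) \<partial>lborel)"
      unfolding V_def \<kappa>_def
      by (rule mollified_defect_bound[OF S \<beta> v1 _ ineq \<rho>(3) c(2,1) M \<rho>(1)]) (auto simp: v1_def)
    ultimately show ?thesis using True by (simp add: add_left_mono)
  qed simp
  have "(\<integral>\<^sup>+z. indicator K z * (ennreal \<bar>V z - v z\<bar> + ennreal (?D z)) \<partial>lborel) \<le>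
     (\<integral>\<^sup>+z. ennreal \<bar>V z - v1 z\<bar> + (\<integral>\<^sup>+y. ennreal (\<bar>v1 (z - y) - v1 z\<bar> * \<kappa> y) \<partial>lborel) \<partial>lborel)"
    by (rule nn_integral_mono) (rule pw)
  also have "\<dots> = (\<integral>\<^sup>+z. ennreal \<bar>V z - v1 z\<bar> \<partial>lborel) + (\<integral>\<^sup>+z. \<integral>\<^sup>+y. ennreal (\<bar>v1 (z - y) - v1 z\<bar> * \<kappa> y) \<partial>lborel \<partial>lborel)"
    by (rule nn_integral_add) measurable
  also have "(\<integral>\<^sup>+z. \<integral>\<^sup>+y. ennreal (\<bar>v1 (z - y) - v1 z\<bar> * \<kappa> y) \<partial>lborel \<partial>lborel) =
      (\<integral>\<^sup>+y. \<integral>\<^sup>+z. ennreal (\<bar>v1 (z - y) - v1 z\<bar> * \<kappa> y) \<partial>lborel \<partial>lborel)"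
    by (rule lborel_pair.Fubini') measurable
  also have "\<dots> \<le> (\<integral>\<^sup>+y. ennreal \<tau> * ennreal (\<kappa> y) \<partial>lborel)"
  proof (rule nn_integral_mono)
    fix y
    have "(\<integral>\<^sup>+z. ennreal (\<bar>v1 (z - y) - v1 z\<bar> * \<kappa> y) \<partial>lborel) = (\<integral>\<^sup>+z. ennreal \<bar>v1 (z - y) - v1 z\<bar> \<partial>lborel) * ennreal (\<kappa> y)"
      using \<kappa>0 by (simp add: ennreal_mult nn_integral_multc)
    also have "\<dots> \<le> ennreal \<tau> * ennreal (\<kappa> y)"
    proof (cases "norm y \<le> r n")
      case True
      then show ?thesis using tr[OF True] by (intro mult_right_mono) auto
    next
      case False
      then show ?thesis using \<kappa>z[of y] by simp
    qed
    finally show "(\<integral>\<^sup>+z. ennreal (\<bar>v1 (z - y) - v1 z\<bar> * \<kappa> y) \<partial>lborel) \<le> ennreal \<tau> * ennreal (\<kappa> y)" .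
  qed
  also have "\<dots> = ennreal \<tau> * (\<integral>\<^sup>+y. ennreal (\<kappa> y) \<partial>lborel)" by (rule nn_integral_cmult) measurable
  also have "(\<integral>\<^sup>+y. ennreal (\<kappa> y) \<partial>lborel) = ennreal (integral\<^sup>L lborel \<kappa>)"
    using \<kappa>i \<kappa>0 by (intro nn_integral_eq_integral) auto
  finally have "(\<integral>\<^sup>+z. indicator K z * (ennreal \<bar>V z - v z\<bar> + ennreal (?D z)) \<partial>lborel) \<le> ennreal \<tau> + ennreal \<tau> * ennreal (B - 1)"
    using add_mono[OF pV mult_left_mono[OF ennreal_leI[OF \<kappa>int], of "ennreal \<tau>"]] by (simp add: order_trans)
  also have "\<dots> = ennreal (\<tau> * B)"
    using \<tau> Bp1
    by (simp add: ennreal_mult[symmetric] ennreal_plus[symmetric] algebra_simps del: ennreal_plus)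
  also have "\<dots> \<le> ennreal \<epsilon>" by (rule ennreal_leI) (rule \<tau>)
  finally show ?thesis using V by blast
qed

section \<open>Maps with Lipschitz inverse\<close>

lemma nn_integral_le_of_emeasure_le:
  assumes sets: "sets M = sets N" and le: "\<And>A. A \<in> sets N \<Longrightarrow> emeasure M A \<le> c * emeasure N A"
    and f: "f \<in> borel_measurable N"
  shows "(\<integral>\<^sup>+x. f x \<partial>M) \<le> c * (\<integral>\<^sup>+x. f x \<partial>N)"
  using f
proof (induct rule: borel_measurable_induct)
  case (cong f g)
  moreover have "(\<integral>\<^sup>+x. f x \<partial>M) = (\<integral>\<^sup>+x. g x \<partial>M)" "(\<integral>\<^sup>+x. f x \<partial>N) = (\<integral>\<^sup>+x. g x \<partial>N)"
    using cong(3) sets_eq_imp_space_eq[OF sets] by (auto intro!: nn_integral_cong)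
  ultimately show ?case by simp
next
  case (set A)
  then show ?case using le[OF set] sets by simp
next
  case (mult u d)
  have [measurable]: "u \<in> borel_measurable M" using mult(2) by (simp add: measurable_cong_sets[OF sets refl])
  show ?case
    using mult(2) mult_left_mono[OF mult(4), of d] by (simp add: nn_integral_cmult mult_ac)
next
  case (add u v)
  have m: "u \<in> borel_measurable M" "v \<in> borel_measurable M"
    using add(1,4) by (simp_all add: measurable_cong_sets[OF sets refl])
  show ?case
    using add_mono[OF add(3,7)] by (simp add: nn_integral_add m add(1,4) distrib_left add.commute)
next
  case (seq U)
  have m: "U i \<in> borel_measurable M" for i using seq(1) by (simp add: measurable_cong_sets[OF sets refl])
  have "(\<integral>\<^sup>+x. (SUP i. U i) x \<partial>M) = (SUP i. \<integral>\<^sup>+x. U i x \<partial>M)"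
    unfolding SUP_apply by (rule nn_integral_monotone_convergence_SUP[OF seq(4) m])
  also have "\<dots> \<le> c * (\<integral>\<^sup>+x. (SUP i. U i) x \<partial>N)"
  proof (rule SUP_least)
    fix i
    have "(\<integral>\<^sup>+x. U i x \<partial>M) \<le> c * (\<integral>\<^sup>+x. U i x \<partial>N)" by (rule seq(3))
    also have "\<dots> \<le> c * (\<integral>\<^sup>+x. (SUP i. U i) x \<partial>N)"
      by (intro mult_left_mono nn_integral_mono) (auto simp: SUP_apply intro: SUP_upper)
    finally show "(\<integral>\<^sup>+x. U i x \<partial>M) \<le> \<dots>" .
  qed
  finally show ?case by (simp add: image_comp)
qed

text \<open>In a cube of side s two points differ in norm by at most DIM s, so two points of the
  preimage differ by at most \<Lambda> DIM s. Hence a cube of twice that side, centred at any point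
  of the preimage, contains it.\<close>

lemma emeasure_preimage_cube_le:
  fixes \<Psi> :: "'a::euclidean_space \<Rightarrow> 'a"
  assumes \<Lambda>: "\<Lambda> \<ge> 0" "\<And>p q. p \<in> D \<Longrightarrow> q \<in> D \<Longrightarrow> norm (p - q) \<le> \<Lambda> * norm (\<Psi> p - \<Psi> q)"
    and s: "s \<ge> 0" "\<And>i. i \<in> Basis \<Longrightarrow> v \<bullet> i - u \<bullet> i = s"
  shows "emeasure lborel (D \<inter> \<Psi> -` cbox u v) \<le> ennreal ((2 * \<Lambda> * DIM('a)) ^ DIM('a)) * emeasure lborel (cbox u v)"
proof (cases "D \<inter> \<Psi> -` cbox u v = {}")
  case False
  then obtain p where p: "p \<in> D" "\<Psi> p \<in> cbox u v" by auto
  define R where "R = \<Lambda> * (DIM('a) * s)"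
  have R: "R \<ge> 0" using \<Lambda> s by (simp add: R_def)
  have "D \<inter> \<Psi> -` cbox u v \<subseteq> cbox (p - R *\<^sub>R One) (p + R *\<^sub>R One)"
  proof
    fix q assume q: "q \<in> D \<inter> \<Psi> -` cbox u v"
    have "norm (\<Psi> p - \<Psi> q) \<le> (\<Sum>i\<in>Basis. \<bar>(\<Psi> p - \<Psi> q) \<bullet> i\<bar>)" by (rule norm_le_l1)
    also have "\<dots> \<le> (\<Sum>i\<in>(Basis::'a set). s)"
    proof (rule sum_mono)
      fix i :: 'a assume i: "i \<in> Basis"
      have "u \<bullet> i \<le> \<Psi> p \<bullet> i" "\<Psi> p \<bullet> i \<le> v \<bullet> i" "u \<bullet> i \<le> \<Psi> q \<bullet> i" "\<Psi> q \<bullet> i \<le> v \<bullet> i"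
        using p q i by (auto simp: mem_box)
      then show "\<bar>(\<Psi> p - \<Psi> q) \<bullet> i\<bar> \<le> s" using s(2)[OF i] by (simp add: inner_diff_left)
    qed
    finally have "norm (\<Psi> p - \<Psi> q) \<le> DIM('a) * s" by simp
    then have "\<Lambda> * norm (\<Psi> p - \<Psi> q) \<le> R" unfolding R_def using \<Lambda>(1) by (intro mult_left_mono)
    then have n: "norm (q - p) \<le> R" using \<Lambda>(2)[of p q] p q by (simp add: norm_minus_commute)
    show "q \<in> cbox (p - R *\<^sub>R One) (p + R *\<^sub>R One)"
      unfolding mem_box
    proof
      fix i :: 'a assume i: "i \<in> Basis"
      have "\<bar>(q - p) \<bullet> i\<bar> \<le> R" using Basis_le_norm[OF i, of "q - p"] n by linarith
      then show "(p - R *\<^sub>R One) \<bullet> i \<le> q \<bullet> i \<and> q \<bullet> i \<le> (p + R *\<^sub>R One) \<bullet> i"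
        using i by (auto simp: inner_diff_left inner_add_left)
    qed
  qed
  then have "emeasure lborel (D \<inter> \<Psi> -` cbox u v) \<le> emeasure lborel (cbox (p - R *\<^sub>R One) (p + R *\<^sub>R One))"
    by (rule emeasure_mono) simp
  also have "\<dots> = ennreal (\<Prod>i\<in>(Basis::'a set). 2 * R)"
    using R by (subst emeasure_lborel_cbox) (auto simp: inner_diff_left inner_add_left intro!: arg_cong[where f = ennreal] prod.cong)
  also have "(\<Prod>i\<in>(Basis::'a set). 2 * R) = (2 * \<Lambda> * DIM('a)) ^ DIM('a) * s ^ DIM('a)"
    by (simp add: R_def power_mult_distrib mult_ac)
  also have "ennreal \<dots> = ennreal ((2 * \<Lambda> * DIM('a)) ^ DIM('a)) * ennreal (s ^ DIM('a))"
    using \<Lambda> s by (intro ennreal_mult) auto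
  also have "ennreal (s ^ DIM('a)) = emeasure lborel (cbox u v)"
  proof -
    have "emeasure lborel (cbox u v) = ennreal (\<Prod>i\<in>Basis. (v - u) \<bullet> i)"
    proof (rule emeasure_lborel_cbox)
      show "u \<bullet> i \<le> v \<bullet> i" if "i \<in> Basis" for i using s(1) s(2)[OF that] by linarith
    qed
    also have "(\<Prod>i\<in>Basis. (v - u) \<bullet> i) = s ^ DIM('a)"
      using s(2) by (simp add: inner_diff_left)
    finally show ?thesis by simp
  qed
  finally show ?thesis .
qed simp

text \<open>\<open>A\<close> is covered by countably many cubes with disjoint interiors inside an
  open set of almost the same measure. Cubes are essential: the distortion estimate would fail for
  elongated boxes. The argument needs no differentiability of the map.\<close>

lemma emeasure_preimage_bounded_le:
  fixes \<Psi> :: "'a::euclidean_space \<Rightarrow> 'a"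
  assumes meas: "\<And>A. A \<in> sets borel \<Longrightarrow> D \<inter> \<Psi> -` A \<in> sets borel"
    and \<Lambda>: "\<Lambda> \<ge> 0" "\<And>p q. p \<in> D \<Longrightarrow> q \<in> D \<Longrightarrow> norm (p - q) \<le> \<Lambda> * norm (\<Psi> p - \<Psi> q)"
    and A: "A \<in> sets borel" "bounded A"
  shows "emeasure lborel (D \<inter> \<Psi> -` A) \<le> ennreal ((2 * \<Lambda> * DIM('a)) ^ DIM('a)) * emeasure lborel A"
proof -
  define C where "C = ennreal ((2 * \<Lambda> * DIM('a)) ^ DIM('a))"
  obtain R where R: "R > 0" "A \<subseteq> cball 0 R"
    using A(2) unfolding bounded_pos by (metis mem_cball_0 subsetI)
  \<comment> \<open>The covering lemma yields dyadic copies of the initial box, so starting from a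
    cube yields cubes.\<close>
  have AR: "A \<subseteq> cbox (- R *\<^sub>R One) (R *\<^sub>R One)"
  proof
    fix x assume "x \<in> A"
    then have "norm x \<le> R" using R by auto
    then show "x \<in> cbox (- R *\<^sub>R One) (R *\<^sub>R One)"
      using Basis_le_norm[of _ x] by (fastforce simp: mem_box abs_le_iff)
  qed
  have step: "emeasure lborel (D \<inter> \<Psi> -` A) \<le> C * (emeasure lborel A + ennreal e)" if e: "e > 0" for e
  proof -
    obtain U where U: "open U" "A \<subseteq> U" "emeasure lborel (U - A) < ennreal e"
      by (rule outer_regular_lborel[OF A(1) e]) (rule that; assumption)
    have ne: "box (- R *\<^sub>R One) (R *\<^sub>R One :: 'a) \<noteq> {}" using R by (simp add: box_ne_empty)
    \<comment> \<open>Every piece of the cover has a tag in \<open>A\<close>, so this gauge confines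
      it to \<open>U\<close>.\<close>
    have g: "gauge (\<lambda>x. if x \<in> U then U else UNIV)" using U(1) by (auto simp: gauge_def)
    obtain \<D> where D: "countable \<D>" "\<And>K. K \<in> \<D> \<Longrightarrow> interior K \<noteq> {} \<and> (\<exists>c d. K = cbox c d)"
      "pairwise (\<lambda>A B. interior A \<inter> interior B = {}) \<D>"
      "\<And>K. K \<in> \<D> \<Longrightarrow> \<exists>x \<in> A \<inter> K. K \<subseteq> (if x \<in> U then U else UNIV)"
      "\<And>u v. cbox u v \<in> \<D> \<Longrightarrow> \<exists>n. \<forall>i \<in> Basis. v \<bullet> i - u \<bullet> i = ((R *\<^sub>R One :: 'a) \<bullet> i - (- R *\<^sub>R One :: 'a) \<bullet> i) / 2^n"
      "A \<subseteq> \<Union>\<D>"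
      by (rule covering_lemma[OF AR ne g]) (rule that; assumption)
    have KU: "K \<subseteq> U" if "K \<in> \<D>" for K using D(4)[OF that] U(2) by (auto split: if_splits)
    have Kb: "K \<in> sets borel" if "K \<in> \<D>" for K using D(2)[OF that] by auto
    have cube: "emeasure lborel (D \<inter> \<Psi> -` K) \<le> C * emeasure lborel (interior K)" if K: "K \<in> \<D>" for K
    proof -
      obtain u v where uv: "K = cbox u v" using D(2)[OF K] by auto
      obtain n where n: "\<forall>i \<in> Basis. v \<bullet> i - u \<bullet> i = ((R *\<^sub>R One :: 'a) \<bullet> i - (- R *\<^sub>R One :: 'a) \<bullet> i) / 2^n"
        using D(5) K uv by blast
      have "v \<bullet> i - u \<bullet> i = 2 * R / 2 ^ n" if "i \<in> Basis" for i
        using n that by (simp add: inner_add_left)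
      then have "emeasure lborel (D \<inter> \<Psi> -` cbox u v) \<le> C * emeasure lborel (cbox u v)"
        unfolding C_def using R by (intro emeasure_preimage_cube_le[OF \<Lambda>, of D "2 * R / 2 ^ n"]) auto
      moreover have "emeasure lborel (cbox u v) = emeasure lborel (box u v)"
        by (simp add: emeasure_lborel_cbox_eq emeasure_lborel_box_eq)
      ultimately show ?thesis by (simp add: uv interior_cbox)
    qed
    have "emeasure lborel (D \<inter> \<Psi> -` A) = (\<integral>\<^sup>+p. indicator (D \<inter> \<Psi> -` A) p \<partial>lborel)"
      using meas[OF A(1)] by simp
    \<comment> \<open>The countable sum over the cubes is written as an integral over
      \<open>count_space\<close>, so that it can be exchanged with the integral over
      \<open>p\<close>.\<close>
    also have "\<dots> \<le> (\<integral>\<^sup>+p. \<integral>\<^sup>+K. indicator (D \<inter> \<Psi> -` K) p \<partial>count_space \<D> \<partial>lborel)"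
    proof (rule nn_integral_mono)
      fix p
      show "indicator (D \<inter> \<Psi> -` A) p \<le> (\<integral>\<^sup>+K. indicator (D \<inter> \<Psi> -` K) p \<partial>count_space \<D> :: ennreal)"
      proof (cases "p \<in> D \<inter> \<Psi> -` A")
        case True
        then obtain K where K: "K \<in> \<D>" "\<Psi> p \<in> K" using D(6) by auto
        have "(\<lambda>K. indicator (D \<inter> \<Psi> -` K) p :: ennreal) K \<le> (\<integral>\<^sup>+K. indicator (D \<inter> \<Psi> -` K) p \<partial>count_space \<D>)"
          by (rule nn_integral_ge_point[OF K(1)])
        then show ?thesis using True K(2) by simp
      qed simp
    qed
    also have "\<dots> = (\<integral>\<^sup>+K. \<integral>\<^sup>+p. indicator (D \<inter> \<Psi> -` K) p \<partial>lborel \<partial>count_space \<D>)"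
      using meas[OF Kb] by (intro nn_integral_count_space_nn_integral D(1)) auto
    also have "\<dots> \<le> (\<integral>\<^sup>+K. C * emeasure lborel (interior K) \<partial>count_space \<D>)"
      using cube meas[OF Kb] by (intro nn_integral_mono) simp
    also have "\<dots> = C * (\<integral>\<^sup>+K. emeasure lborel (interior K) \<partial>count_space \<D>)"
      by (rule nn_integral_cmult) simp
    also have "(\<integral>\<^sup>+K. emeasure lborel (interior K) \<partial>count_space \<D>) = emeasure lborel (\<Union>(interior ` \<D>))"
      using D(1,3) by (intro emeasure_UN_countable[symmetric]) (auto simp: disjoint_family_on_def pairwise_def)
    also have "\<dots> \<le> emeasure lborel U"
    proof (rule emeasure_mono)
      show "\<Union>(interior ` \<D>) \<subseteq> U"
      proof (rule UN_least)
        show "interior K \<subseteq> U" if "K \<in> \<D>" for K using KU[OF that] interior_subset[of K] by (rule order_trans[rotated])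
      qed
    qed (use U(1) in simp)
    also have "emeasure lborel U = emeasure lborel A + emeasure lborel (U - A)"
      using U A(1) by (subst plus_emeasure) (auto simp: Un_absorb1)
    also have "C * \<dots> \<le> C * (emeasure lborel A + ennreal e)"
      using U(3) by (intro mult_left_mono add_left_mono) auto
    finally show ?thesis by (simp add: mult_left_mono)
  qed
  have fin: "emeasure lborel A < \<infinity>" by (rule emeasure_bounded_finite[OF A(2)])
  have "emeasure lborel (D \<inter> \<Psi> -` A) \<le> C * emeasure lborel A"
  proof (rule ennreal_le_epsilon)
    fix e :: real assume e: "e > 0"
    define c where "c = (2 * \<Lambda> * DIM('a)) ^ DIM('a)"
    have c: "c \<ge> 0" unfolding c_def using \<Lambda> by simp
    \<comment> \<open>Dividing by \<open>c + 1\<close> instead of \<open>c\<close> also covers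
      \<open>\<Lambda> = 0\<close>.\<close>
    have "emeasure lborel (D \<inter> \<Psi> -` A) \<le> C * (emeasure lborel A + ennreal (e / (c + 1)))"
      using c e by (intro step) auto
    also have "\<dots> = C * emeasure lborel A + ennreal c * ennreal (e / (c + 1))"
      by (simp only: C_def c_def[symmetric] distrib_left)
    also have "ennreal c * ennreal (e / (c + 1)) = ennreal (c * (e / (c + 1)))"
      using c e by (intro ennreal_mult[symmetric]) auto
    also have "c * (e / (c + 1)) \<le> e" using c e by (simp add: field_simps)
    finally show "emeasure lborel (D \<inter> \<Psi> -` A) \<le> C * emeasure lborel A + ennreal e"
      by (simp add: add_left_mono ennreal_leI order_trans)
  qed
  then show ?thesis by (simp add: C_def)
qed

lemma emeasure_preimage_le:
  fixes \<Psi> :: "'a::euclidean_space \<Rightarrow> 'a"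
  assumes meas: "\<And>A. A \<in> sets borel \<Longrightarrow> D \<inter> \<Psi> -` A \<in> sets borel"
    and \<Lambda>: "\<Lambda> \<ge> 0" "\<And>p q. p \<in> D \<Longrightarrow> q \<in> D \<Longrightarrow> norm (p - q) \<le> \<Lambda> * norm (\<Psi> p - \<Psi> q)"
    and A: "A \<in> sets borel"
  shows "emeasure lborel (D \<inter> \<Psi> -` A) \<le> ennreal ((2 * \<Lambda> * DIM('a)) ^ DIM('a)) * emeasure lborel A"
proof -
  let ?A = "\<lambda>n::nat. A \<inter> cball 0 (real n)"
  have b: "?A n \<in> sets borel" for n using A by auto
  have "incseq (\<lambda>n. D \<inter> \<Psi> -` ?A n)" by (auto simp: incseq_def)
  then have "emeasure lborel (\<Union>n. D \<inter> \<Psi> -` ?A n) = (SUP n. emeasure lborel (D \<inter> \<Psi> -` ?A n))"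
    using meas[OF b] by (intro SUP_emeasure_incseq[symmetric]) auto
  also have "(\<Union>n. D \<inter> \<Psi> -` ?A n) = D \<inter> \<Psi> -` A"
    by (auto intro: real_arch_simple)
  also have "(SUP n. emeasure lborel (D \<inter> \<Psi> -` ?A n)) \<le> ennreal ((2 * \<Lambda> * DIM('a)) ^ DIM('a)) * emeasure lborel A"
  proof (rule SUP_least)
    fix n
    have "bounded (?A n)" using bounded_cball bounded_subset by blast
    from emeasure_preimage_bounded_le[OF meas \<Lambda> b this]
    have "emeasure lborel (D \<inter> \<Psi> -` ?A n) \<le> ennreal ((2 * \<Lambda> * DIM('a)) ^ DIM('a)) * emeasure lborel (?A n)" .
    also have "\<dots> \<le> ennreal ((2 * \<Lambda> * DIM('a)) ^ DIM('a)) * emeasure lborel A"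
      using A by (intro mult_left_mono emeasure_mono) auto
    finally show "emeasure lborel (D \<inter> \<Psi> -` ?A n) \<le> \<dots>" .
  qed
  finally show ?thesis .
qed

text \<open>The push-forward of Lebesgue measure on \<open>D\<close> is dominated by a multiple of
  Lebesgue measure, so a change of variables holds as an inequality. With \<open>f\<close> an
  indicator it pulls null sets back to null sets.\<close>

lemma nn_integral_preimage_le:
  fixes \<Psi> :: "'a::euclidean_space \<Rightarrow> 'a" and f :: "'a \<Rightarrow> ennreal"
  assumes D: "D \<in> sets borel" "continuous_on D \<Psi>"
    and \<Lambda>: "\<Lambda> \<ge> 0" "\<And>p q. p \<in> D \<Longrightarrow> q \<in> D \<Longrightarrow> norm (p - q) \<le> \<Lambda> * norm (\<Psi> p - \<Psi> q)"
    and f: "f \<in> borel_measurable borel"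
  shows "(\<lambda>p. indicator D p * f (\<Psi> p)) \<in> borel_measurable borel"
    and "(\<integral>\<^sup>+p. indicator D p * f (\<Psi> p) \<partial>lborel) \<le> ennreal ((2 * \<Lambda> * DIM('a)) ^ DIM('a)) * (\<integral>\<^sup>+z. f z \<partial>lborel)"
proof -
  have \<Psi>: "\<Psi> \<in> borel_measurable (restrict_space borel D)"
    by (rule borel_measurable_continuous_on_restrict[OF D(2)])
  have meas: "D \<inter> \<Psi> -` A \<in> sets borel" if "A \<in> sets borel" for A
  proof -
    have "\<Psi> -` A \<inter> space (restrict_space borel D) \<in> sets (restrict_space borel D)"
      by (rule measurable_sets[OF \<Psi> that])
    then show ?thesis using D(1) by (simp add: sets_restrict_space_iff space_restrict_space Int_commute)
  qed
  let ?M = "restrict_space lborel D"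
  have \<Psi>': "\<Psi> \<in> measurable ?M borel"
    using \<Psi> by (simp add: measurable_def space_restrict_space sets_restrict_space)
  have fm: "(\<lambda>p. f (\<Psi> p)) \<in> borel_measurable ?M" by (rule measurable_compose[OF \<Psi>' f])
  have eq: "(\<lambda>p. indicator D p * f (\<Psi> p)) = (\<lambda>p. f (\<Psi> p) * indicator D p)" by (simp add: mult.commute)
  show "(\<lambda>p. indicator D p * f (\<Psi> p)) \<in> borel_measurable borel"
    using fm D(1) unfolding eq by (subst (asm) borel_measurable_restrict_space_iff_ennreal) auto
  have "(\<integral>\<^sup>+p. indicator D p * f (\<Psi> p) \<partial>lborel) = (\<integral>\<^sup>+p. f (\<Psi> p) \<partial>?M)"
    using D(1) unfolding eq by (subst nn_integral_restrict_space) auto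
  also have "\<dots> = (\<integral>\<^sup>+z. f z \<partial>distr ?M borel \<Psi>)"
    by (rule nn_integral_distr[OF \<Psi>', symmetric]) (use f in simp)
  also have "\<dots> \<le> ennreal ((2 * \<Lambda> * DIM('a)) ^ DIM('a)) * (\<integral>\<^sup>+z. f z \<partial>lborel)"
  proof (rule nn_integral_le_of_emeasure_le)
    fix A :: "'a set" assume "A \<in> sets lborel"
    then have A: "A \<in> sets borel" by simp
    have "emeasure (distr ?M borel \<Psi>) A = emeasure ?M (\<Psi> -` A \<inter> D)"
      using A by (subst emeasure_distr[OF \<Psi>']) (auto simp: space_restrict_space)
    also have "\<dots> = emeasure lborel (D \<inter> \<Psi> -` A)"
      using D(1) by (subst emeasure_restrict_space) (auto simp: Int_commute)
    also have "\<dots> \<le> ennreal ((2 * \<Lambda> * DIM('a)) ^ DIM('a)) * emeasure lborel A"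
      by (rule emeasure_preimage_le[OF meas \<Lambda> A])
    finally show "emeasure (distr ?M borel \<Psi>) A \<le> \<dots>" .
  qed (use f in auto)
  finally show "(\<integral>\<^sup>+p. indicator D p * f (\<Psi> p) \<partial>lborel) \<le> \<dots>" .
qed

section \<open>Streamlines\<close>

text \<open>Gronwall's inequality: multiplied by the exponential weight, \<open>g\<close> is
  non-decreasing.\<close>

lemma mono_of_exp_weight:
  fixes g g' :: "real \<Rightarrow> real"
  assumes "0 < s" "s < T" "continuous_on {0..s} g"
    and d: "\<And>t. 0 < t \<Longrightarrow> t < T \<Longrightarrow> (g has_real_derivative g' t) (at t)"
    and le: "\<And>t. 0 < t \<Longrightarrow> t < T \<Longrightarrow> - c * g t \<le> g' t"
  shows "g 0 \<le> g s * exp (c * s)"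
proof -
  have "g 0 * exp (c * 0) \<le> g s * exp (c * s)"
  proof (rule DERIV_nonneg_imp_increasing_open[of 0 s "\<lambda>t. g t * exp (c * t)"])
    fix t assume t: "0 < t" "t < s"
    have "((\<lambda>t. g t * exp (c * t)) has_real_derivative g' t * exp (c * t) + g t * (exp (c * t) * c)) (at t)"
      using t assms(2) by (auto intro!: derivative_eq_intros d)
    moreover have "g' t * exp (c * t) + g t * (exp (c * t) * c) = (g' t + c * g t) * exp (c * t)"
      by (simp add: algebra_simps)
    moreover have "0 \<le> g' t + c * g t" using le[of t] t assms(2) by simp
    ultimately show "\<exists>y. ((\<lambda>t. g t * exp (c * t)) has_real_derivative y) (at t) \<and> 0 \<le> y"
      by (intro exI[of _ "(g' t + c * g t) * exp (c * t)"]) simp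
  qed (use assms in \<open>auto intro!: continuous_intros\<close>)
  then show ?thesis by simp
qed

lemma streamlines_D:
  assumes "streamlines T b X" "0 \<le> t" "t < T"
  shows "((\<lambda>s. X s x) has_vector_derivative - b (X t x, t)) (at t within {0..<T})" "X 0 x = x"
proof -
  have "\<forall>x. X 0 x = x \<and> (\<forall>t\<in>{0..<T}. ((\<lambda>s. X s x) has_vector_derivative - b (X t x, t)) (at t within {0..<T}))"
    using assms(1) unfolding streamlines_def .
  then show "((\<lambda>s. X s x) has_vector_derivative - b (X t x, t)) (at t within {0..<T})" "X 0 x = x"
    using assms(2,3) by simp_all
qed

lemma streamlines_at:
  assumes "streamlines T b X" "0 < t" "t < T"
  shows "((\<lambda>s. X s x) has_vector_derivative - b (X t x, t)) (at t)"
proof -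
  have "((\<lambda>s. X s x) has_vector_derivative - b (X t x, t)) (at t within {0<..<T})"
    by (rule has_vector_derivative_within_subset[OF streamlines_D(1)[OF assms(1)]]) (use assms in auto)
  moreover have "at t within {0<..<T} = at t" using assms by (intro at_within_open) auto
  ultimately show ?thesis by simp
qed

lemma streamlines_continuous:
  assumes "streamlines T b X" "s < T"
  shows "continuous_on {0..s} (\<lambda>t. X t x)"
  unfolding continuous_on_eq_continuous_within
proof
  fix t assume t: "t \<in> {0..s}"
  have "((\<lambda>s. X s x) has_vector_derivative - b (X t x, t)) (at t within {0..s})"
    by (rule has_vector_derivative_within_subset[OF streamlines_D(1)[OF assms(1)]]) (use assms t in auto)
  then show "continuous (at t within {0..s}) (\<lambda>t. X t x)" by (rule has_vector_derivative_continuous)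
qed

text \<open>Gronwall for the squared distance of two streamlines, which unlike the distance is
  differentiable when they meet. The lower bound on its derivative gives the first claim, the upper
  bound, applied to the negative, the second.\<close>

lemma streamlines_bilipschitz:
  fixes X :: "real \<Rightarrow> real^'n \<Rightarrow> real^'n"
  assumes sl: "streamlines T b X"
    and lip: "\<And>t x y. 0 < t \<Longrightarrow> t < T \<Longrightarrow> norm (b (x, t) - b (y, t)) \<le> L * norm (x - y)" and s: "0 < s" "s < T"
  shows "norm (x - y) \<le> exp (L * s) * norm (X s x - X s y)"
    and "norm (X s x - X s y) \<le> exp (L * s) * norm (x - y)"
proof -
  define w where "w t = X t x - X t y" for t
  define g where "g t = w t \<bullet> w t" for t
  define g' where "g' t = 2 * (w t \<bullet> (b (X t y, t) - b (X t x, t)))" for t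
  have dg: "(g has_real_derivative g' t) (at t)" if t: "0 < t" "t < T" for t
  proof -
    have "(w has_vector_derivative (- b (X t x, t) - - b (X t y, t))) (at t)"
      unfolding w_def by (intro has_vector_derivative_diff streamlines_at[OF sl t])
    then have dw: "(w has_derivative (\<lambda>h. h *\<^sub>R (b (X t y, t) - b (X t x, t)))) (at t)"
      by (simp add: has_vector_derivative_def)
    have "(g has_derivative (\<lambda>h. w t \<bullet> (h *\<^sub>R (b (X t y, t) - b (X t x, t))) + (h *\<^sub>R (b (X t y, t) - b (X t x, t))) \<bullet> w t)) (at t)"
      unfolding g_def[abs_def] by (rule has_derivative_inner[OF dw dw])
    moreover have "(\<lambda>h. w t \<bullet> (h *\<^sub>R (b (X t y, t) - b (X t x, t))) + (h *\<^sub>R (b (X t y, t) - b (X t x, t))) \<bullet> w t) = (*) (g' t)"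
      by (auto simp: g'_def inner_commute algebra_simps)
    ultimately show ?thesis by (simp add: has_field_derivative_def)
  qed
  have bd: "\<bar>g' t\<bar> \<le> 2 * L * g t" if t: "0 < t" "t < T" for t
  proof -
    have "\<bar>w t \<bullet> (b (X t y, t) - b (X t x, t))\<bar> \<le> norm (w t) * norm (b (X t y, t) - b (X t x, t))"
      by (rule Cauchy_Schwarz_ineq2)
    also have "\<dots> \<le> norm (w t) * (L * norm (w t))"
      using lip[OF t, of "X t y" "X t x"] by (intro mult_left_mono) (auto simp: w_def norm_minus_commute)
    also have "\<dots> = L * g t" by (simp add: g_def dot_square_norm power2_eq_square)
    finally show ?thesis by (simp add: g'_def abs_mult)
  qed
  have cg: "continuous_on {0..s} g"
    unfolding g_def w_def by (intro continuous_intros streamlines_continuous[OF sl s(2)])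
  have cg': "continuous_on {0..s} (\<lambda>t. - g t)" by (intro continuous_intros cg)
  have w0: "w 0 = x - y" using streamlines_D(2)[OF sl, of 0] s by (simp add: w_def)
  have sq: "(exp (L * s))\<^sup>2 = exp (2 * L * s)" by (simp add: power2_eq_square exp_add[symmetric])
  have "g 0 \<le> g s * exp (2 * L * s)"
  proof (rule mono_of_exp_weight[OF s cg dg])
    show "- (2 * L) * g t \<le> g' t" if "0 < t" "t < T" for t using bd[OF that] by linarith
  qed
  moreover have "g 0 = (norm (x - y))\<^sup>2" unfolding g_def w0 by (rule dot_square_norm)
  moreover have gs: "g s = (norm (X s x - X s y))\<^sup>2" unfolding g_def w_def by (rule dot_square_norm)
  ultimately have "(norm (x - y))\<^sup>2 \<le> (exp (L * s) * norm (X s x - X s y))\<^sup>2"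
    unfolding power_mult_distrib sq by (simp only: mult.commute)
  then show "norm (x - y) \<le> exp (L * s) * norm (X s x - X s y)"
    by (rule power2_le_imp_le) simp
  have "- g 0 \<le> - g s * exp (- (2 * L) * s)"
  proof (rule mono_of_exp_weight[OF s cg', where g' = "\<lambda>t. - g' t"])
    show "((\<lambda>t. - g t) has_real_derivative - g' t) (at t)" if "0 < t" "t < T" for t
      by (intro DERIV_minus dg that)
    show "- (- (2 * L)) * - g t \<le> - g' t" if "0 < t" "t < T" for t using bd[OF that] by simp
  qed
  then have "g s * exp (- (2 * L) * s) * exp (2 * L * s) \<le> g 0 * exp (2 * L * s)"
    by (intro mult_right_mono) auto
  then have "g s \<le> g 0 * exp (2 * L * s)" by (simp add: mult.assoc exp_add[symmetric])
  moreover have "g 0 = (norm (x - y))\<^sup>2" unfolding g_def w0 by (rule dot_square_norm)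
  ultimately have "(norm (X s x - X s y))\<^sup>2 \<le> (exp (L * s) * norm (x - y))\<^sup>2"
    unfolding power_mult_distrib sq using gs by (simp only: mult.commute)
  then show "norm (X s x - X s y) \<le> exp (L * s) * norm (x - y)"
    by (rule power2_le_imp_le) simp
qed

lemma streamlines_time_lipschitz:
  fixes X :: "real \<Rightarrow> real^'n \<Rightarrow> real^'n"
  assumes sl: "streamlines T b X" and M: "\<And>z. z \<in> QT T \<Longrightarrow> norm (b z) \<le> M"
    and s: "s \<in> {0<..<T}" and t: "t \<in> {0<..<T}"
  shows "norm (X s x - X t x) \<le> M * \<bar>s - t\<bar>"
proof -
  have "norm (X s x - X t x) \<le> M * norm (s - t)"
  proof (rule differentiable_bound[of "{0<..<T}" "\<lambda>t. X t x" "\<lambda>t h. h *\<^sub>R - b (X t x, t)"])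
    show "((\<lambda>t. X t x) has_derivative (\<lambda>h. h *\<^sub>R - b (X t x, t))) (at t within {0<..<T})" if "t \<in> {0<..<T}" for t
    proof -
      have "0 < t" "t < T" using that by auto
      from has_derivative_at_withinI[OF streamlines_at[OF sl this, unfolded has_vector_derivative_def]]
      show ?thesis .
    qed
    show "onorm (\<lambda>h. h *\<^sub>R - b (X t x, t)) \<le> M" if "t \<in> {0<..<T}" for t
    proof (rule onorm_le)
      fix h :: real
      have "norm (b (X t x, t)) \<le> M" using M[of "(X t x, t)"] that by (simp add: QT_def)
      then show "norm (h *\<^sub>R - b (X t x, t)) \<le> M * norm h"
        using mult_right_mono[of "norm (b (X t x, t))" M "\<bar>h\<bar>"] by (simp add: mult.commute)
    qed
  qed (use s t in auto)
  then show ?thesis by simp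
qed

text \<open>The curve \<open>s \<mapsto> (X s x, s)\<close> has velocity (-b, 1), so
  \<open>V\<close> changes along it by the integral of its derivative in that direction. Only the
  negative part can make it decrease.\<close>

lemma streamline_defect:
  fixes X :: "real \<Rightarrow> real^'n \<Rightarrow> real^'n" and V :: "(real^'n) \<times> real \<Rightarrow> real"
    and b :: "(real^'n) \<times> real \<Rightarrow> real^'n"
  defines "D \<equiv> \<lambda>z. max 0 (- (\<Sum>e\<in>Basis. ((- b z, 1) \<bullet> e) * pd e V z))"
  assumes sl: "streamlines T b X" and V: "smooth_on UNIV V" and b: "continuous_on (QT T) b"
    and t: "0 < t1" "t1 < t2" "t2 < T"
  shows "ennreal (V (X t1 x, t1) - V (X t2 x, t2)) \<le> (\<integral>\<^sup>+s. indicator {t1..t2} s * ennreal (D (X s x, s)) \<partial>lborel)"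
proof -
  define \<gamma> where "\<gamma> s = (X s x, s)" for s
  define f' where "f' s = (\<Sum>e\<in>Basis. ((- b (\<gamma> s), 1) \<bullet> e) * pd e V (\<gamma> s))" for s
  have d\<gamma>: "(\<gamma> has_vector_derivative (- b (\<gamma> s), 1)) (at s)" if "0 < s" "s < T" for s
  proof -
    have "((\<lambda>s. (X s x, s)) has_derivative (\<lambda>h. (h *\<^sub>R - b (X s x, s), h))) (at s)"
      by (rule has_derivative_Pair[OF streamlines_at[OF sl that, unfolded has_vector_derivative_def] has_derivative_ident])
    moreover have "(\<lambda>h. (h *\<^sub>R - b (X s x, s), h)) = (\<lambda>h. h *\<^sub>R (- b (X s x, s), 1))"
      by (rule ext) simp
    ultimately show ?thesis unfolding has_vector_derivative_def \<gamma>_def by (simp only:)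
  qed
  have df: "((\<lambda>s. V (\<gamma> s)) has_vector_derivative f' s) (at s)" if "0 < s" "s < T" for s
  proof -
    have dV: "V differentiable at (\<gamma> s)" by (rule smooth_on_differentiable[OF V]) simp
    have "((\<lambda>s. V (\<gamma> s)) has_derivative (\<lambda>h. pd (h *\<^sub>R (- b (\<gamma> s), 1)) V (\<gamma> s))) (at s)"
      by (rule has_derivative_compose[OF d\<gamma>[OF that, unfolded has_vector_derivative_def] differentiable_has_derivative[OF dV]])
    moreover have "pd (h *\<^sub>R (- b (\<gamma> s), 1)) V (\<gamma> s) = h *\<^sub>R f' s" for h
      unfolding linear_cmul[OF linear_frechet_derivative[OF dV]]
      by (subst pd_linear_expand[OF dV]) (simp add: f'_def)
    ultimately show ?thesis by (simp add: has_vector_derivative_def)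
  qed
  have c\<gamma>: "continuous_on {t1..t2} \<gamma>"
  proof (rule continuous_at_imp_continuous_on, rule ballI)
    fix s assume "s \<in> {t1..t2}"
    then have "0 < s" "s < T" using t by auto
    from has_vector_derivative_continuous[OF d\<gamma>[OF this]] show "isCont \<gamma> s" .
  qed
  have \<gamma>Q: "\<gamma> s \<in> QT T" if "s \<in> {t1..t2}" for s using that t by (auto simp: \<gamma>_def QT_def)
  have cb: "continuous_on {t1..t2} (\<lambda>s. b (\<gamma> s))"
    by (rule continuous_on_compose2[OF b c\<gamma>]) (use \<gamma>Q in auto)
  have cp: "continuous_on {t1..t2} (\<lambda>s. pd e V (\<gamma> s))" if "e \<in> Basis" for e
    by (rule continuous_on_compose2[OF smooth_on_continuous[OF smooth_on_pd[OF V that]] c\<gamma>]) auto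
  have cf': "continuous_on {t1..t2} f'"
    unfolding f'_def by (intro continuous_intros cb cp)
  have i1: "(f' has_integral (V (\<gamma> t2) - V (\<gamma> t1))) {t1..t2}"
    by (rule fundamental_theorem_of_calculus) (use t df in \<open>auto intro: has_vector_derivative_at_within\<close>)
  have cD: "continuous_on {t1..t2} (\<lambda>s. max 0 (- f' s))" by (intro continuous_intros cf')
  then obtain R where R: "((\<lambda>s. max 0 (- f' s)) has_integral R) {t1..t2}"
    using integrable_continuous_interval[OF cD] unfolding integrable_on_def by blast
  have "- (V (\<gamma> t2) - V (\<gamma> t1)) \<le> R"
    by (rule has_integral_le[OF has_integral_neg[OF i1] R]) auto
  then have "ennreal (V (\<gamma> t1) - V (\<gamma> t2)) \<le> ennreal R" by (intro ennreal_leI) simp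
  also have "\<dots> = (\<integral>\<^sup>+s. ennreal (indicator {t1..t2} s * max 0 (- f' s)) \<partial>lborel)"
    by (rule nn_integral_has_integral_lebesgue[OF _ R, symmetric]) simp
  also have "\<dots> = (\<integral>\<^sup>+s. indicator {t1..t2} s * ennreal (D (X s x, s)) \<partial>lborel)"
    by (intro nn_integral_cong) (auto simp: D_def f'_def \<gamma>_def indicator_def)
  finally show ?thesis by (simp add: \<gamma>_def)
qed

section \<open>Integrals and null sets under the space-time flow\<close>

lemma ennreal_suminf_terms:
  fixes f :: "nat \<Rightarrow> ennreal"
  assumes "(\<Sum>n. f n) < \<infinity>"
  shows "f n < \<infinity>" "(\<lambda>n. enn2real (f n)) \<longlonglongrightarrow> 0"
proof -
  have fin: "f n < \<infinity>" for n
  proof (rule ccontr)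
    assume "\<not> f n < \<infinity>"
    then have "f n = \<infinity>" by (metis infinity_ennreal_def top.not_eq_extremum)
    moreover have "f n \<le> (\<Sum>n. f n)" using sum_le_suminf[of f "{n}"] by simp
    ultimately show False using assms by simp
  qed
  then show "f n < \<infinity>" .
  have "f n = ennreal (enn2real (f n))" for n using fin[of n] by simp
  then have "(\<Sum>n. ennreal (enn2real (f n))) \<noteq> top" using assms by simp
  then have "summable (\<lambda>n. enn2real (f n))" by (intro summable_suminf_not_top) auto
  then show "(\<lambda>n. enn2real (f n)) \<longlonglongrightarrow> 0" by (rule summable_LIMSEQ_zero)
qed

lemma open_QT: "open (QT T)"
  unfolding QT_def by (intro open_Times) auto

locale regular_flow =
  fixes T L M :: real and b :: "(real^'n) \<times> real \<Rightarrow> real^'n" and X :: "real \<Rightarrow> real^'n \<Rightarrow> real^'n"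
  assumes sl: "streamlines T b X" and L: "L \<ge> 0" and M: "M \<ge> 0" and T: "T > 0"
    and lip: "\<And>t x y. 0 < t \<Longrightarrow> t < T \<Longrightarrow> norm (b (x, t) - b (y, t)) \<le> L * norm (x - y)"
    and bd: "\<And>z. z \<in> QT T \<Longrightarrow> norm (b z) \<le> M"
begin

text \<open>Time is kept as a coordinate, so that one estimate on the slab treats all times at once
  and Tonelli then passes to single streamlines.\<close>

definition flow :: "(real^'n) \<times> real \<Rightarrow> (real^'n) \<times> real" where
  "flow p = (X (snd p) (fst p), snd p)"

text \<open>The summand \<open>exp (L * T) * (1 + M)\<close> bounds the distance of the starting
  points and 1 the difference of times; \<open>M\<close> enters because the two streamlines must
  first be compared at the same time.\<close>

definition \<Lambda> :: real where "\<Lambda> = exp (L * T) * (1 + M) + 1"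

lemma \<Lambda>: "\<Lambda> \<ge> 0" unfolding \<Lambda>_def using M by simp

lemma flow_in: "p \<in> QT T \<Longrightarrow> flow p \<in> QT T"
  by (auto simp: flow_def QT_def)

lemma flow_expansive:
  assumes "p \<in> QT T" "q \<in> QT T"
  shows "norm (p - q) \<le> \<Lambda> * norm (flow p - flow q)"
proof -
  obtain x t y s where pq: "p = (x, t)" "q = (y, s)" by fastforce
  have t: "t \<in> {0<..<T}" and s: "s \<in> {0<..<T}" using assms by (auto simp: pq QT_def)
  define a where "a = norm (flow p - flow q)"
  have a1: "norm (X t x - X s y) \<le> a" "\<bar>t - s\<bar> \<le> a"
    using norm_fst_le[of "X t x - X s y" "t - s"] norm_snd_le[of "t - s" "X t x - X s y"]
    by (simp_all add: a_def flow_def pq)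
  have "norm (X s y - X t y) \<le> M * \<bar>s - t\<bar>" by (rule streamlines_time_lipschitz[OF sl bd s t])
  also have "\<dots> \<le> M * a" using M a1 by (intro mult_left_mono) auto
  finally have a2: "norm (X t x - X t y) \<le> a + M * a"
    using a1(1) norm_triangle_ineq[of "X t x - X s y" "X s y - X t y"] by simp
  have "norm (x - y) \<le> exp (L * t) * norm (X t x - X t y)"
    using t by (intro streamlines_bilipschitz(1)[OF sl lip]) auto
  also have "\<dots> \<le> exp (L * T) * (a + M * a)"
    using a2 t L by (intro mult_mono) (auto intro: mult_left_mono)
  finally have "norm (x - y) \<le> exp (L * T) * (1 + M) * a" by (simp add: algebra_simps)
  moreover have "norm (p - q) \<le> norm (x - y) + \<bar>t - s\<bar>"
    using norm_Pair_le[of "x - y" "t - s"] by (simp add: pq)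
  ultimately show ?thesis using a1(2) unfolding \<Lambda>_def a_def[symmetric] by (simp add: distrib_right)
qed

lemma flow_continuous: "continuous_on (QT T) flow"
proof (rule lipschitz_on_continuous_on)
  show "(exp (L * T) + M + 1)-lipschitz_on (QT T) flow"
  proof (rule lipschitz_onI)
    show "0 \<le> exp (L * T) + M + 1" using M by (intro add_nonneg_nonneg) auto
    fix p q :: "(real^'n) \<times> real" assume "p \<in> QT T" "q \<in> QT T"
    moreover obtain x t y s where pq: "p = (x, t)" "q = (y, s)" by fastforce
    ultimately have t: "t \<in> {0<..<T}" and s: "s \<in> {0<..<T}" by (auto simp: QT_def)
    have n: "norm (x - y) \<le> norm (p - q)" "\<bar>t - s\<bar> \<le> norm (p - q)"
      using norm_fst_le[of "x - y" "t - s"] norm_snd_le[of "t - s" "x - y"] by (simp_all add: pq)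
    have "norm (X t x - X t y) \<le> exp (L * t) * norm (x - y)"
      using t by (intro streamlines_bilipschitz(2)[OF sl lip]) auto
    also have "\<dots> \<le> exp (L * T) * norm (p - q)"
      using n t L by (intro mult_mono) (auto intro: mult_left_mono)
    finally have 1: "norm (X t x - X t y) \<le> exp (L * T) * norm (p - q)" .
    have "norm (X t y - X s y) \<le> M * \<bar>t - s\<bar>" by (rule streamlines_time_lipschitz[OF sl bd t s])
    also have "\<dots> \<le> M * norm (p - q)" using M n by (intro mult_left_mono) auto
    finally have "norm (X t x - X s y) \<le> (exp (L * T) + M) * norm (p - q)"
      using 1 norm_triangle_ineq[of "X t x - X t y" "X t y - X s y"] by (simp add: distrib_right)
    moreover have "norm (flow p - flow q) \<le> norm (X t x - X s y) + \<bar>t - s\<bar>"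
      using norm_Pair_le[of "X t x - X s y" "t - s"] by (simp add: pq flow_def)
    ultimately show "dist (flow p) (flow q) \<le> (exp (L * T) + M + 1) * dist p q"
      using n(2) unfolding dist_norm by (simp add: distrib_right)
  qed
qed

text \<open>Not a Jacobian determinant but an upper bound for the distortion of measure, from
  \<open>nn_integral_preimage_le\<close>.\<close>

definition Jac :: real where "Jac = (2 * \<Lambda> * DIM((real^'n) \<times> real)) ^ DIM((real^'n) \<times> real)"

lemma Jac: "Jac \<ge> 0" unfolding Jac_def using \<Lambda> by simp

lemma flow_nn_integral:
  fixes f :: "(real^'n) \<times> real \<Rightarrow> ennreal"
  assumes "f \<in> borel_measurable borel"
  shows "(\<lambda>p. indicator (QT T) p * f (flow p)) \<in> borel_measurable borel"
    and "(\<integral>\<^sup>+p. indicator (QT T) p * f (flow p) \<partial>lborel) \<le> ennreal Jac * (\<integral>\<^sup>+z. f z \<partial>lborel)"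
  unfolding Jac_def
  by (rule nn_integral_preimage_le[OF borel_open[OF open_QT] flow_continuous \<Lambda> flow_expansive assms]; assumption)+

lemma AE_pair_lborel:
  fixes f :: "(real^'n) \<times> real \<Rightarrow> ennreal"
  assumes f: "f \<in> borel_measurable borel" and fin: "(\<integral>\<^sup>+p. f p \<partial>lborel) < \<infinity>"
  shows "AE x in lborel. (\<integral>\<^sup>+t. f (x, t) \<partial>lborel) < \<infinity>"
proof -
  have m: "f \<in> borel_measurable ((lborel :: (real^'n) measure) \<Otimes>\<^sub>M (lborel :: real measure))"
    using f by (simp add: lborel_prod)
  have "(\<integral>\<^sup>+x. \<integral>\<^sup>+t. f (x, t) \<partial>lborel \<partial>lborel) = (\<integral>\<^sup>+p. f p \<partial>lborel)"
    using lborel.nn_integral_fst[OF m] by (simp add: lborel_prod)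
  moreover have "(\<lambda>x. \<integral>\<^sup>+t. f (x, t) \<partial>lborel) \<in> borel_measurable lborel"
    using lborel.borel_measurable_nn_integral_fst[OF m] by simp
  ultimately have "AE x in lborel. (\<integral>\<^sup>+t. f (x, t) \<partial>lborel) \<noteq> \<infinity>"
    using fin by (intro nn_integral_PInf_AE) auto
  then show ?thesis by (simp add: less_top)
qed

text \<open>The preimage of a null set under the space-time flow is null. By Tonelli it is null on
  almost every line of constant starting point, that is, along almost every streamline.\<close>

lemma flow_avoids_null:
  assumes N: "N \<in> null_sets lborel"
  shows "AE x in lborel. AE t in lborel. t \<in> {0<..<T} \<longrightarrow> (X t x, t) \<notin> N"
proof -
  have [measurable]: "N \<in> sets borel" using N by auto
  let ?f = "\<lambda>p. indicator (QT T) p * indicator N (flow p) :: ennreal"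
  have m: "?f \<in> borel_measurable borel" by (rule flow_nn_integral(1)) measurable
  have "(\<integral>\<^sup>+p. ?f p \<partial>lborel) \<le> ennreal Jac * (\<integral>\<^sup>+z. indicator N z \<partial>lborel)"
    by (rule flow_nn_integral(2)) measurable
  also have "\<dots> = 0" using N by (simp add: null_sets_def)
  finally have z: "(\<integral>\<^sup>+p. ?f p \<partial>lborel) = 0" by simp
  have m': "?f \<in> borel_measurable ((lborel :: (real^'n) measure) \<Otimes>\<^sub>M (lborel :: real measure))"
    using m by (simp add: lborel_prod)
  have "(\<integral>\<^sup>+x. \<integral>\<^sup>+t. ?f (x, t) \<partial>lborel \<partial>lborel) = 0"
    using lborel.nn_integral_fst[OF m'] z by (simp add: lborel_prod)
  moreover have "(\<lambda>x. \<integral>\<^sup>+t. ?f (x, t) \<partial>lborel) \<in> borel_measurable lborel"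
    using lborel.borel_measurable_nn_integral_fst[OF m'] by simp
  ultimately have "AE x in lborel. (\<integral>\<^sup>+t. ?f (x, t) \<partial>lborel) = 0"
    by (subst (asm) nn_integral_0_iff_AE) auto
  then show ?thesis
  proof eventually_elim
    case (elim x)
    have "(\<lambda>t. ?f (x, t)) \<in> borel_measurable lborel"
      by (rule measurable_compose[OF _ m]) (auto intro!: borel_measurable_continuous_onI continuous_intros)
    then have "AE t in lborel. ?f (x, t) = 0" using elim by (subst (asm) nn_integral_0_iff_AE) auto
    then show ?case
      by eventually_elim (auto simp: QT_def flow_def indicator_def split: if_splits)
  qed
qed

text \<open>Starting points in a ball and times away from 0 and \<open>T\<close> keep the curves in
  a compact subset of the slab, where mollification works. The good times depend on the starting
  point, hence a predicate \<open>P\<close> for each \<open>x\<close>.\<close>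

lemma monotone_along_flow_box:
  fixes N :: nat
  assumes smb: "\<And>e. e \<in> Basis \<Longrightarrow> smooth_on (QT T) (\<lambda>z. (- b z, 1::real) \<bullet> e)" and cb: "continuous_on (QT T) b"
    and v: "integrable lborel v"
    and ineq: "\<And>\<psi>. \<psi> \<in> test_functions (QT T) \<Longrightarrow> (\<And>z. \<psi> z \<ge> 0) \<Longrightarrow>
      (\<integral>z. v z * (\<Sum>e\<in>Basis. pd e (\<lambda>y. \<psi> y * ((- b y, 1) \<bullet> e)) z) \<partial>lborel) \<le> 0"
  defines "I \<equiv> {1 / (real N + 1) .. T - 1 / (real N + 1)}"
  shows "AE x in lborel. \<exists>P. (AE t in lborel. P t) \<and> (norm x \<le> real N \<longrightarrow>
     (\<forall>t1 t2. P t1 \<longrightarrow> P t2 \<longrightarrow> t1 \<in> I \<longrightarrow> t2 \<in> I \<longrightarrow> t1 < t2 \<longrightarrow> v (X t1 x, t1) \<le> v (X t2 x, t2)))"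
proof -
  define Q where "Q = cball (0::real^'n) (real N) \<times> I"
  have IT: "t \<in> {0<..<T}" if "t \<in> I" for t
  proof -
    have "0 < 1 / (real N + 1)" by simp
    then show ?thesis using that unfolding I_def atLeastAtMost_iff greaterThanLessThan_iff by linarith
  qed
  have Qsub: "Q \<subseteq> QT T" using IT by (auto simp: Q_def QT_def)
  have Qc: "compact Q" unfolding Q_def I_def by (intro compact_Times) auto
  define K where "K = flow ` Q"
  have K: "compact K" "K \<subseteq> QT T"
    unfolding K_def using compact_continuous_image[OF continuous_on_subset[OF flow_continuous Qsub] Qc] Qsub flow_in by auto
  have Kb [measurable]: "K \<in> sets borel" using K(1) by (simp add: compact_imp_closed borel_closed)
  have [measurable]: "v \<in> borel_measurable borel" using v by auto
  let ?D = "\<lambda>V z. max 0 (- (\<Sum>e\<in>Basis. ((- b z, 1) \<bullet> e) * pd e V z))"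
  \<comment> \<open>Geometrically small errors are summable. After pulling back, their sum is finite
    almost everywhere, so they vanish in the limit with no subsequence depending on the
    streamline.\<close>
  have "\<forall>n::nat. \<exists>V. smooth_on UNIV V \<and> (\<integral>\<^sup>+z. indicator K z * (ennreal \<bar>V z - v z\<bar> + ennreal (?D V z)) \<partial>lborel) \<le> ennreal ((1/2)^n)"
    by (intro allI mollified_monotone[OF open_QT K smb v ineq]) auto
  then obtain V where V': "\<forall>n::nat. smooth_on UNIV (V n) \<and>
    (\<integral>\<^sup>+z. indicator K z * (ennreal \<bar>V n z - v z\<bar> + ennreal (?D (V n) z)) \<partial>lborel) \<le> ennreal ((1/2)^n)"
    by (rule choice[THEN exE])
  then have V: "\<And>n. smooth_on UNIV (V n)"
    "\<And>n::nat. (\<integral>\<^sup>+z. indicator K z * (ennreal \<bar>V n z - v z\<bar> + ennreal (?D (V n) z)) \<partial>lborel) \<le> ennreal ((1/2)^n)"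
    by blast+
  \<comment> \<open>The indicator stands on the defect itself, in scaled form, because
    \<open>b\<close> is continuous on the slab only; measurability of the defect is derived from its
    continuity on \<open>K\<close>.\<close>
  define e where "e n z = ennreal (indicator K z * \<bar>V n z - v z\<bar> + indicator K z *\<^sub>R ?D (V n) z)" for n z
  have [measurable]: "V n \<in> borel_measurable borel" for n
    by (rule borel_measurable_continuous_onI[OF smooth_on_continuous[OF V(1)]])
  have Dm [measurable]: "(\<lambda>z. indicator K z *\<^sub>R ?D (V n) z) \<in> borel_measurable borel" for n
  proof (rule borel_measurable_continuous_on_indicator[OF Kb])
    have "continuous_on K (pd i (V n))" if "i \<in> Basis" for i
      by (rule continuous_on_subset[OF smooth_on_continuous[OF smooth_on_pd[OF V(1) that]]]) auto
    then show "continuous_on K (?D (V n))"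
      by (intro continuous_intros continuous_on_subset[OF cb K(2)])
  qed
  have em [measurable]: "e n \<in> borel_measurable borel" for n unfolding e_def by measurable
  have ee: "e n z = indicator K z * (ennreal \<bar>V n z - v z\<bar> + ennreal (?D (V n) z))" for n z
    by (auto simp: e_def indicator_def ennreal_plus)
  define F where "F n p = indicator (QT T) p * e n (flow p)" for n p
  have Fm [measurable]: "F n \<in> borel_measurable borel" for n
    unfolding F_def[abs_def] by (rule flow_nn_integral(1)[OF em])
  have "(\<integral>\<^sup>+p. F n p \<partial>lborel) \<le> ennreal (Jac * (1/2)^n)" for n
  proof -
    have "(\<integral>\<^sup>+p. F n p \<partial>lborel) \<le> ennreal Jac * (\<integral>\<^sup>+z. e n z \<partial>lborel)"
      unfolding F_def by (rule flow_nn_integral(2)[OF em])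
    also have "\<dots> \<le> ennreal Jac * ennreal ((1/2)^n)"
      using V(2)[of n] unfolding ee by (rule mult_left_mono) simp
    also have "\<dots> = ennreal (Jac * (1/2)^n)" using Jac by (intro ennreal_mult[symmetric]) auto
    finally show ?thesis .
  qed
  then have "(\<Sum>n. \<integral>\<^sup>+p. F n p \<partial>lborel) \<le> (\<Sum>n. ennreal (Jac * (1/2)^n))"
    by (intro suminf_le) auto
  also have "\<dots> = ennreal (Jac * 2)"
    by (rule suminf_ennreal_eq) (use Jac sums_mult[OF geometric_sums[of "1/2::real"], of Jac] in auto)
  also have "\<dots> < \<infinity>" by simp
  finally have "(\<integral>\<^sup>+p. (\<Sum>n. F n p) \<partial>lborel) < \<infinity>"
    by (subst nn_integral_suminf) auto
  then have "AE x in lborel. (\<integral>\<^sup>+t. (\<Sum>n. F n (x, t)) \<partial>lborel) < \<infinity>"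
    by (intro AE_pair_lborel) auto
  then show ?thesis
  proof eventually_elim
    case (elim x)
    have Fx [measurable]: "(\<lambda>t. F n (x, t)) \<in> borel_measurable borel" for n
      by (rule measurable_compose[OF _ Fm]) (auto intro!: borel_measurable_continuous_onI continuous_intros)
    \<comment> \<open>A finite sum of errors at \<open>(x, t)\<close> forces \<open>V n\<close> to
      converge to \<open>v\<close> at the corresponding point of the streamline.\<close>
    define P where "P t \<longleftrightarrow> (\<Sum>n. F n (x, t)) < \<infinity>" for t
    have "AE t in lborel. (\<Sum>n. F n (x, t)) \<noteq> \<infinity>"
      using elim by (intro nn_integral_PInf_AE) auto
    then have AEP: "AE t in lborel. P t" by (simp add: P_def less_top)
    have suminf: "(\<Sum>n. \<integral>\<^sup>+t. F n (x, t) \<partial>lborel) < \<infinity>"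
      using elim by (subst nn_integral_suminf[symmetric]) auto
    define a where "a n = enn2real (\<integral>\<^sup>+t. F n (x, t) \<partial>lborel)" for n
    have a0: "a \<longlonglongrightarrow> 0" unfolding a_def by (rule ennreal_suminf_terms(2)[OF suminf])
    have afin: "(\<integral>\<^sup>+t. F n (x, t) \<partial>lborel) = ennreal (a n)" for n
      using ennreal_suminf_terms(1)[OF suminf, of n] by (simp add: a_def)
    show ?case
    proof (intro exI[of _ P] conjI AEP impI allI)
      fix t1 t2 assume x: "norm x \<le> real N" and P: "P t1" "P t2" and t: "t1 \<in> I" "t2 \<in> I" "t1 < t2"
      have inK: "(X t x, t) \<in> K" if "t \<in> I" for t
      proof -
        have "(x, t) \<in> Q" using that x by (auto simp: Q_def)
        then have "flow (x, t) \<in> K" unfolding K_def by (rule imageI)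
        then show ?thesis by (simp add: flow_def)
      qed
      have Feq: "F n (x, t) = ennreal (\<bar>V n (X t x, t) - v (X t x, t)\<bar> + ?D (V n) (X t x, t))" if "t \<in> I" for n t
        using inK[OF that] IT[OF that] by (simp add: F_def e_def flow_def QT_def)
      have conv: "(\<lambda>n. V n (X t x, t)) \<longlonglongrightarrow> v (X t x, t)" if "t \<in> I" "P t" for t
      proof (rule LIM_zero_cancel, rule tendsto_rabs_zero_cancel, rule tendsto_sandwich[OF _ _ tendsto_const])
        have "(\<Sum>n. F n (x, t)) < \<infinity>" using that(2) by (simp add: P_def)
        from ennreal_suminf_terms(2)[OF this]
        have l: "(\<lambda>n. enn2real (F n (x, t))) \<longlonglongrightarrow> 0" .
        have "enn2real (F n (x, t)) = \<bar>V n (X t x, t) - v (X t x, t)\<bar> + ?D (V n) (X t x, t)" for n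
          unfolding Feq[OF that(1)] by (rule enn2real_ennreal) (intro add_nonneg_nonneg; simp)
        then show "(\<lambda>n. \<bar>V n (X t x, t) - v (X t x, t)\<bar> + ?D (V n) (X t x, t)) \<longlonglongrightarrow> 0"
          using l by (simp only:)
      qed (auto intro!: always_eventually)
      \<comment> \<open>\<open>V n\<close> decreases between the two times by no more than its
        accumulated defect, which is part of the total error \<open>a n\<close> on this
        streamline.\<close>
      have "V n (X t1 x, t1) - V n (X t2 x, t2) \<le> a n" for n
      proof -
        have "ennreal (V n (X t1 x, t1) - V n (X t2 x, t2)) \<le> (\<integral>\<^sup>+s. indicator {t1..t2} s * ennreal (?D (V n) (X s x, s)) \<partial>lborel)"
          by (rule streamline_defect[OF sl V(1) cb]) (use IT[OF t(1)] IT[OF t(2)] t(3) in auto)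
        also have "\<dots> \<le> (\<integral>\<^sup>+s. F n (x, s) \<partial>lborel)"
        proof (rule nn_integral_mono)
          fix s
          show "indicator {t1..t2} s * ennreal (?D (V n) (X s x, s)) \<le> F n (x, s)"
          proof (cases "s \<in> {t1..t2}")
            case True
            then have "s \<in> I" using t by (auto simp: I_def)
            then show ?thesis using True by (simp add: Feq ennreal_leI)
          qed simp
        qed
        also have "\<dots> = ennreal (a n)" by (rule afin)
        finally show ?thesis by (rule ennreal_le_iff[THEN iffD1, rotated]) (simp add: a_def)
      qed
      then have "v (X t1 x, t1) - v (X t2 x, t2) \<le> 0"
        by (intro LIMSEQ_le[OF tendsto_diff[OF conv[OF t(1) P(1)] conv[OF t(2) P(2)]] a0]) auto
      then show "v (X t1 x, t1) \<le> v (X t2 x, t2)" by simp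
    qed
  qed
qed

lemma monotone_along_flow:
  assumes smb: "\<And>e. e \<in> Basis \<Longrightarrow> smooth_on (QT T) (\<lambda>z. (- b z, 1::real) \<bullet> e)" and cb: "continuous_on (QT T) b"
    and v: "integrable lborel v"
    and ineq: "\<And>\<psi>. \<psi> \<in> test_functions (QT T) \<Longrightarrow> (\<And>z. \<psi> z \<ge> 0) \<Longrightarrow>
      (\<integral>z. v z * (\<Sum>e\<in>Basis. pd e (\<lambda>y. \<psi> y * ((- b y, 1) \<bullet> e)) z) \<partial>lborel) \<le> 0"
  shows "AE x in lborel. \<exists>P. (AE t in lborel. P t) \<and>
     (\<forall>t1 t2. P t1 \<longrightarrow> P t2 \<longrightarrow> 0 < t1 \<longrightarrow> t1 < t2 \<longrightarrow> t2 < T \<longrightarrow> v (X t1 x, t1) \<le> v (X t2 x, t2))"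
proof -
  let ?I = "\<lambda>N::nat. {1 / (real N + 1) .. T - 1 / (real N + 1)}"
  have "AE x in lborel. \<forall>N::nat. \<exists>P. (AE t in lborel. P t) \<and> (norm x \<le> real N \<longrightarrow>
     (\<forall>t1 t2. P t1 \<longrightarrow> P t2 \<longrightarrow> t1 \<in> ?I N \<longrightarrow> t2 \<in> ?I N \<longrightarrow> t1 < t2 \<longrightarrow> v (X t1 x, t1) \<le> v (X t2 x, t2)))"
    unfolding AE_all_countable by (intro allI monotone_along_flow_box[OF smb cb v ineq])
  then show ?thesis
  proof eventually_elim
    case (elim x)
    then obtain P where P: "\<And>N. AE t in lborel. P N t"
      "\<And>N t1 t2. norm x \<le> real N \<Longrightarrow> P N t1 \<Longrightarrow> P N t2 \<Longrightarrow> t1 \<in> ?I N \<Longrightarrow> t2 \<in> ?I N \<Longrightarrow> t1 < t2 \<Longrightarrow>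
         v (X t1 x, t1) \<le> v (X t2 x, t2)"
      by metis
    show ?case
    proof (intro exI[of _ "\<lambda>t. \<forall>N. P N t"] conjI allI impI)
      show "AE t in lborel. \<forall>N. P N t" unfolding AE_all_countable using P(1) by blast
      fix t1 t2 assume t: "\<forall>N. P N t1" "\<forall>N. P N t2" "0 < t1" "t1 < t2" "t2 < T"
      define c where "c = min t1 (T - t2)"
      have c: "c > 0" using t by (simp add: c_def)
      obtain N :: nat where N: "max (norm x) (1 / c) \<le> real N" using real_arch_simple by blast
      have "1 / c \<le> real N + 1" using N by simp
      then have "1 / (real N + 1) \<le> c" using c by (simp add: field_simps)
      then have "t1 \<in> ?I N" "t2 \<in> ?I N" using t unfolding c_def by auto
      then show "v (X t1 x, t1) \<le> v (X t2 x, t2)" using P(2)[of N t1 t2] N t by auto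
    qed
  qed
qed

end

section \<open>Passage from Lebesgue to Borel representatives\<close>

lemma open_lebesgue: "open S \<Longrightarrow> S \<inter> space lebesgue \<in> sets lebesgue"
  by simp

text \<open>The hypotheses of the problem speak of Lebesgue measure on the slab, the analysis of
  Borel functions on the whole space that vanish outside. This moves integrals and integrability
  between the two.\<close>

lemma lebesgue_on_transfer:
  fixes h h' :: "'a::euclidean_space \<Rightarrow> real"
  assumes S: "open S" and h': "h' \<in> borel_measurable borel" "\<And>z. z \<notin> S \<Longrightarrow> h' z = 0"
    and ae: "AE z in lebesgue_on S. h z = h' z"
  shows "(LINT z|lebesgue_on S. h z) = (\<integral>z. h' z \<partial>lborel)"
    and "integrable (lebesgue_on S) h \<longleftrightarrow> integrable lborel h'"
proof -
  have m: "h' \<in> borel_measurable lebesgue" using h'(1) by (intro measurable_completion) simp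
  have "AE z in lebesgue. z \<in> S \<longrightarrow> h z = h' z"
    using ae AE_restrict_space_iff[OF open_lebesgue[OF S]] by simp
  then have ae': "AE z in lebesgue. h' z = indicator S z *\<^sub>R h z"
    by eventually_elim (use h'(2) in \<open>auto simp: indicator_def\<close>)
  \<comment> \<open>Measurability of \<open>h\<close> is inherited from \<open>h'\<close> by
    completeness of Lebesgue measure.\<close>
  have m2: "(\<lambda>z. indicator S z *\<^sub>R h z) \<in> borel_measurable lebesgue"
    by (rule borel_measurable_AE[OF m ae'])
  have "(LINT z|lebesgue_on S. h z) = (LINT z|lebesgue. indicator S z *\<^sub>R h z)"
    by (rule integral_restrict_space[OF open_lebesgue[OF S]])
  also have "\<dots> = (LINT z|lebesgue. h' z)"
    by (rule integral_cong_AE[OF m2 m]) (use ae' in \<open>auto elim: eventually_mono\<close>)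
  also have "\<dots> = (\<integral>z. h' z \<partial>lborel)" by (rule integral_completion) (use h' in simp)
  finally show "(LINT z|lebesgue_on S. h z) = (\<integral>z. h' z \<partial>lborel)" .
  have "integrable (lebesgue_on S) h \<longleftrightarrow> integrable lebesgue (\<lambda>z. indicator S z *\<^sub>R h z)"
    by (rule integrable_restrict_space[OF open_lebesgue[OF S]])
  also have "\<dots> \<longleftrightarrow> integrable lebesgue h'"
    by (rule integrable_cong_AE[OF m2 m]) (use ae' in \<open>auto elim: eventually_mono\<close>)
  also have "\<dots> \<longleftrightarrow> integrable lborel h'" by (rule integrable_completion) (use h' in simp)
  finally show "integrable (lebesgue_on S) h \<longleftrightarrow> integrable lborel h'" .
qed

lemma borel_representative:
  fixes g :: "'a::euclidean_space \<Rightarrow> real"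
  assumes S: "open S" and g: "g \<in> borel_measurable (lebesgue_on S)"
  obtains g' where "g' \<in> borel_measurable borel" "\<And>z. z \<notin> S \<Longrightarrow> g' z = 0"
    "AE z in lebesgue_on S. g z = g' z"
proof -
  have "(\<lambda>z. g z * indicator S z) \<in> borel_measurable lebesgue"
    using borel_measurable_restrict_space_iff[OF open_lebesgue[OF S], of g] g by (simp add: mult.commute)
  then obtain k where k: "k \<in> borel_measurable lborel" "AE z in lborel. g z * indicator S z = k z"
    using completion_ex_borel_measurable_real by blast
  have [measurable]: "k \<in> borel_measurable borel" "S \<in> sets borel" using k(1) S by auto
  show ?thesis
  proof (rule that[of "\<lambda>z. indicator S z * k z"])
    show "(\<lambda>z. indicator S z * k z) \<in> borel_measurable borel" by measurable
    have "AE z in lebesgue. g z * indicator S z = k z" by (rule AE_completion[OF k(2)])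
    then have "AE z in lebesgue. z \<in> S \<longrightarrow> g z = indicator S z * k z"
      by eventually_elim (auto simp: indicator_def)
    then show "AE z in lebesgue_on S. g z = indicator S z * k z"
      using AE_restrict_space_iff[OF open_lebesgue[OF S]] by simp
  qed auto
qed

lemma AE_lebesgue_on_lborel:
  assumes "open S" "AE z in lebesgue_on S. P z"
  shows "AE z in lborel. z \<in> S \<longrightarrow> P z"
  using assms(2) unfolding AE_restrict_space_iff[OF open_lebesgue[OF assms(1)]] AE_completion_iff .

section \<open>Space and time derivatives\<close>

lemma smooth_on_inner:
  assumes "open S" "smooth_on S u"
  shows "smooth_on S (\<lambda>x. u x \<bullet> w)"
proof -
  have "Cdiff n S u \<Longrightarrow> Cdiff n S (\<lambda>x. u x \<bullet> w)" for n and u :: "'a \<Rightarrow> 'b"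
  proof (induction n arbitrary: u)
    case (Suc n)
    have hd: "((\<lambda>x. u x \<bullet> w) has_derivative (\<lambda>e. pd e u x \<bullet> w)) (at x)" if "x \<in> S" for x
      using Suc.prems that by (intro has_derivative_inner_left differentiable_has_derivative) auto
    have "Cdiff n S (pd e (\<lambda>x. u x \<bullet> w))" if "e \<in> Basis" for e
    proof (subst Cdiff_cong[OF assms(1)])
      show "pd e (\<lambda>x. u x \<bullet> w) x = pd e u x \<bullet> w" if "x \<in> S" for x by (rule pd_eqI[OF hd[OF that]])
      show "Cdiff n S (\<lambda>x. pd e u x \<bullet> w)" by (rule Suc.IH) (use Suc.prems that in auto)
    qed
    moreover have "(\<lambda>x. u x \<bullet> w) differentiable at x" if "x \<in> S" for x
      using hd[OF that] unfolding differentiable_def by blast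
    ultimately show ?case by simp
  qed simp
  then show ?thesis using assms(2) by (simp add: smooth_on_iff_Cdiff)
qed

lemma pd_space:
  fixes u :: "(real^'n) \<times> real \<Rightarrow> 'b::real_normed_vector"
  assumes "u differentiable at (x, t)"
  shows "frechet_derivative (\<lambda>y. u (y, t)) (at x) h = pd (h, 0) u (x, t)"
proof -
  have "((\<lambda>y. (y, t)) has_derivative (\<lambda>h. (h, 0))) (at x)"
    by (auto intro!: derivative_eq_intros)
  from has_derivative_compose[OF this differentiable_has_derivative[OF assms]]
  show ?thesis by (rule pd_eqI)
qed

lemma pd_time:
  fixes u :: "(real^'n) \<times> real \<Rightarrow> real"
  assumes "u differentiable at z"
  shows "time_deriv u z = pd (0, 1) u z"
proof -
  obtain x t where z: "z = (x, t)" by fastforce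
  have "((\<lambda>s. (x, s)) has_derivative (\<lambda>h. (0, h))) (at t)"
    by (auto intro!: derivative_eq_intros)
  from has_derivative_compose[OF this differentiable_has_derivative[OF assms[unfolded z]]]
  have "((\<lambda>s. u (x, s)) has_derivative (\<lambda>h. pd (0, h) u (x, t))) (at t)" .
  moreover have "(\<lambda>h. pd (0, h) u (x, t)) = (*) (pd (0, 1) u (x, t))"
  proof
    show "pd (0, h) u (x, t) = pd (0, 1) u (x, t) * h" for h
      using linear_cmul[OF linear_frechet_derivative[OF assms[unfolded z]], of h "(0, 1)"] by simp
  qed
  ultimately have "((\<lambda>s. u (x, s)) has_real_derivative pd (0, 1) u (x, t)) (at t)"
    by (simp only: has_field_derivative_def)
  then show ?thesis by (simp add: z time_deriv_def DERIV_imp_deriv)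
qed

lemma space_grad_inner:
  fixes u :: "(real^'n) \<times> real \<Rightarrow> real"
  assumes "u differentiable at z"
  shows "space_grad u z \<bullet> w = (\<Sum>i\<in>UNIV. pd (axis i 1, 0) u z * w $ i)"
proof -
  obtain x t where z: "z = (x, t)" by fastforce
  show ?thesis
    using pd_space[OF assms[unfolded z]] by (simp add: z space_grad_def inner_vec_def)
qed

lemma space_div_eq:
  fixes F :: "(real^'n) \<times> real \<Rightarrow> real^'n"
  assumes "F differentiable at z"
  shows "space_div F z = (\<Sum>i\<in>UNIV. pd (axis i 1, 0) (\<lambda>y. F y $ i) z)"
proof -
  obtain x t where z: "z = (x, t)" by fastforce
  have "pd e F z $ i = pd e (\<lambda>y. F y $ i) z" for e i
    by (rule pd_eqI[symmetric, OF bounded_linear.has_derivative[OF bounded_linear_vec_nth differentiable_has_derivative[OF assms]]])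
  then show ?thesis
    using pd_space[OF assms[unfolded z]] by (simp add: z space_div_def)
qed

definition space_basis :: "((real^'n) \<times> real) set" where
  "space_basis = (\<lambda>i. (axis i 1, 0)) ` UNIV"

lemma Basis_spacetime: "(Basis :: ((real^'n) \<times> real) set) = insert (0, 1) space_basis"
  by (auto simp: Basis_prod_def Basis_vec_def space_basis_def)

lemma sum_space_basis: "(\<Sum>e\<in>(space_basis :: ((real^'n) \<times> real) set). g e) = (\<Sum>i\<in>UNIV. g (axis i 1, 0))"
proof -
  have "inj (\<lambda>i::'n. (axis i (1::real), 0::real))" by (auto simp: inj_def axis_eq_axis)
  then show ?thesis unfolding space_basis_def by (simp add: sum.reindex)
qed

lemma sum_Basis_spacetime:
  "(\<Sum>e\<in>(Basis :: ((real^'n) \<times> real) set). g e) = g (0, 1) + (\<Sum>i\<in>UNIV. g (axis i 1, 0))"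
proof -
  have "(0, 1) \<notin> (space_basis :: ((real^'n) \<times> real) set)" by (auto simp: space_basis_def axis_eq_0_iff)
  moreover have "finite (space_basis :: ((real^'n) \<times> real) set)" by (simp add: space_basis_def)
  ultimately show ?thesis by (simp add: Basis_spacetime sum_space_basis)
qed

lemma convex_QT: "convex (QT T)"
  unfolding QT_def by (intro convex_Times) auto

text \<open>The slab is convex, so bounds on the first partial derivatives give one Lipschitz
  constant on all of it, as the flow estimates require.\<close>

lemma bounded_derivs_lipschitz:
  fixes u :: "(real^'n) \<times> real \<Rightarrow> 'b::real_normed_vector"
  assumes "smooth_on (QT T) u" "bounded_derivs_on (QT T) u"
  obtains L M where "L \<ge> 0" "M \<ge> 0" "\<And>z. z \<in> QT T \<Longrightarrow> norm (u z) \<le> M"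
    "\<And>z w. z \<in> QT T \<Longrightarrow> w \<in> QT T \<Longrightarrow> norm (u z - u w) \<le> L * norm (z - w)"
proof -
  have "bounded (iter_partial [] u ` QT T)" using assms(2) unfolding bounded_derivs_on_def by (metis empty_set empty_subsetI)
  then obtain M where M: "\<And>z. z \<in> QT T \<Longrightarrow> norm (u z) \<le> M" by (auto simp: bounded_iff)
  have "\<exists>M. \<forall>z\<in>QT T. norm (pd e u z) \<le> M" if "e \<in> Basis" for e
  proof -
    have "bounded (iter_partial [e] u ` QT T)" using assms(2)[unfolded bounded_derivs_on_def, rule_format, of "[e]"] that by simp
    then show ?thesis by (auto simp: bounded_iff)
  qed
  then obtain N where N: "\<And>e z. e \<in> Basis \<Longrightarrow> z \<in> QT T \<Longrightarrow> norm (pd e u z) \<le> N e" by metis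
  define K where "K = (\<Sum>e\<in>Basis. \<bar>N e\<bar>)"
  have K0: "K \<ge> 0" unfolding K_def by (intro sum_nonneg) auto
  have K: "norm (pd e u z) \<le> K" if "e \<in> Basis" "z \<in> QT T" for e z
  proof -
    have "\<bar>N e\<bar> \<le> K" unfolding K_def using that by (intro member_le_sum) auto
    then show ?thesis using N[OF that] by linarith
  qed
  show ?thesis
  proof (rule that[of "real DIM((real^'n) \<times> real) * K" "\<bar>M\<bar>"])
    show "norm (u z - u w) \<le> real DIM((real^'n) \<times> real) * K * norm (z - w)" if "z \<in> QT T" "w \<in> QT T" for z w
      by (rule lipschitz_of_pd_bound[OF convex_QT smooth_on_differentiable[OF assms(1)] K that])
    show "norm (u z) \<le> \<bar>M\<bar>" if "z \<in> QT T" for z using M[OF that] by linarith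
  qed (use K0 in auto)
qed

text \<open>Tests supported in the open slab are admissible and remove the initial datum from the
  weak formulation.\<close>

lemma test_functions_QT:
  fixes \<phi> :: "(real^'n) \<times> real \<Rightarrow> real"
  assumes "\<phi> \<in> test_functions (QT T)"
  shows "\<phi> \<in> test_functions (UNIV \<times> {..<T})" "\<phi> (x, 0) = 0"
proof -
  obtain K where K: "compact K" "K \<subseteq> QT T" "\<forall>x. x \<notin> K \<longrightarrow> \<phi> x = 0"
    using test_functionsD(2)[OF assms] by blast
  show "\<phi> \<in> test_functions (UNIV \<times> {..<T})"
    by (rule test_functionsI[OF test_functionsD(1)[OF assms] K(1)]) (use K in \<open>auto simp: QT_def\<close>)
  have "(x, 0) \<notin> K" using K(2) by (auto simp: QT_def)
  then show "\<phi> (x, 0) = 0" using K(3) by blast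
qed

text \<open>The bad pairs lie in two strips over a null set of the line, and such strips are null in
  the plane.\<close>

lemma AE_lebesgue_pairI:
  fixes P :: "real \<Rightarrow> bool"
  assumes "AE t in lborel. P t"
  shows "AE (t1, t2) in lebesgue. P t1 \<and> P t2"
proof -
  obtain N where N: "N \<in> null_sets lborel" "{t. \<not> P t} \<subseteq> N"
    using assms unfolding eventually_ae_filter by auto
  have [measurable]: "N \<in> sets borel" using N(1) by auto
  have "N \<times> UNIV \<in> null_sets (lborel \<Otimes>\<^sub>M (lborel :: real measure))"
    using N(1) by (auto simp: null_sets_def lborel.emeasure_pair_measure_Times)
  moreover have "UNIV \<times> N \<in> null_sets ((lborel :: real measure) \<Otimes>\<^sub>M lborel)"
    using N(1) by (auto simp: null_sets_def lborel.emeasure_pair_measure_Times)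
  ultimately have n: "N \<times> UNIV \<union> UNIV \<times> N \<in> null_sets (lborel :: (real \<times> real) measure)"
    by (simp add: lborel_prod null_sets.Un)
  have "AE p in (lborel :: (real \<times> real) measure). p \<notin> N \<times> UNIV \<union> UNIV \<times> N"
    by (rule AE_not_in[OF n])
  then have "AE p in (lborel :: (real \<times> real) measure). case p of (t1, t2) \<Rightarrow> P t1 \<and> P t2"
    by eventually_elim (use N(2) in auto)
  then show ?thesis by (rule AE_completion)
qed

section \<open>The weak formulation in terms of \<open>v\<^sup>k\<close>\<close>

abbreviation drift :: "((real^'n) \<times> real \<Rightarrow> real) \<Rightarrow> ((real^'n) \<times> real \<Rightarrow> real^'n) \<Rightarrow> (real^'n) \<times> real \<Rightarrow> (real^'n) \<times> real" where
  "drift m b z \<equiv> m z *\<^sub>R (- b z, 1)"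

lemma coefficient_smooth:
  assumes "coefficient_assumption T \<delta> m f b"
  shows "smooth_on (QT T) m" "smooth_on (QT T) f" "smooth_on (QT T) b" "\<delta> > 0" "\<And>z. z \<in> QT T \<Longrightarrow> m z \<ge> \<delta>"
    "bounded_derivs_on (QT T) b"
  using assms by (auto simp: coefficient_assumption_def smooth_coefficient_def)

lemma smooth_velocity:
  assumes "smooth_on (QT T) b" "e \<in> Basis"
  shows "smooth_on (QT T) (\<lambda>z. (- b z, 1::real) \<bullet> e)"
proof -
  obtain e1 e2 where e: "e = (e1, e2)" by fastforce
  have "smooth_on (QT T) (\<lambda>z. (-1) * (b z \<bullet> e1) + e2)"
    by (intro smooth_on_add smooth_on_mult open_QT smooth_on_const smooth_on_inner assms)
  then show ?thesis by (simp add: e)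
qed

text \<open>The space-time divergence of m (-b, 1) is the time derivative of m minus the spatial
  divergence of m b. Its bound by m f is therefore the congestion condition.\<close>

lemma degenerate_equation_interp:
  assumes ca: "coefficient_assumption T \<delta> m f b" and cc: "congestion_condition T m f b"
  shows "degenerate_equation (QT T) m (\<lambda>z. m z * f z) (drift m b) space_basis"
proof
  note cs = coefficient_smooth[OF ca]
  show "open (QT T)" by (rule open_QT)
  show "smooth_on (QT T) m" by (rule cs)
  show "m z \<ge> 0" if "z \<in> QT T" for z using cs(4) cs(5)[OF that] by simp
  show sa: "smooth_on (QT T) (\<lambda>z. drift m b z \<bullet> e)" if "e \<in> Basis" for e
    unfolding inner_scaleR_left by (intro smooth_on_mult open_QT cs smooth_velocity that)
  show "continuous_on (QT T) (\<lambda>z. m z * f z)"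
    by (intro continuous_intros smooth_on_continuous cs)
  show "space_basis \<subseteq> Basis" by (auto simp: Basis_spacetime)
  fix z :: "(real^'a) \<times> real" assume z: "z \<in> QT T"
  have dm: "m differentiable at z" and db: "b differentiable at z"
    using smooth_on_differentiable[OF cs(1) z] smooth_on_differentiable[OF cs(3) z] by auto
  have dF: "(\<lambda>w. m w *\<^sub>R b w) differentiable at z" by (intro differentiable_scaleR dm db)
  have dFi: "(\<lambda>y. (m y *\<^sub>R b y) $ i) differentiable at z" for i
    using bounded_linear.has_derivative[OF bounded_linear_vec_nth differentiable_has_derivative[OF dF]]
    unfolding differentiable_def by blast
  have "pd (axis i 1, 0) (\<lambda>y. drift m b y \<bullet> (axis i 1, 0)) z = - pd (axis i 1, 0) (\<lambda>y. (m y *\<^sub>R b y) $ i) z" for i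
  proof -
    have "(\<lambda>y. drift m b y \<bullet> (axis i 1, 0)) = (\<lambda>y. (-1) * (m y *\<^sub>R b y) $ i)"
      by (auto simp: inner_axis)
    moreover have "pd (axis i 1, 0) (\<lambda>y. (-1) * (m y *\<^sub>R b y) $ i) z
       = (-1) * pd (axis i 1, 0) (\<lambda>y. (m y *\<^sub>R b y) $ i) z + pd (axis i 1, 0) (\<lambda>_. -1) z * (m z *\<^sub>R b z) $ i"
      by (rule pd_mult[OF differentiable_const dFi])
    ultimately show ?thesis by simp
  qed
  moreover have "pd (0, 1) (\<lambda>y. drift m b y \<bullet> (0, 1)) z = time_deriv m z"
    using pd_time[OF dm] by simp
  ultimately have "(\<Sum>e\<in>Basis. pd e (\<lambda>y. drift m b y \<bullet> e) z) = time_deriv m z - space_div (\<lambda>w. m w *\<^sub>R b w) z"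
    unfolding sum_Basis_spacetime space_div_eq[OF dF] by (simp add: sum_negf)
  then show "(\<Sum>e\<in>Basis. pd e (\<lambda>y. drift m b y \<bullet> e) z) \<le> m z * f z"
    using cc z unfolding congestion_condition_def by fastforce
qed

text \<open>Borel representatives of \<rho>, \<open>u\<close> and the gradient are chosen. As \<rho>
  is nonnegative almost everywhere, the k-th root of \<open>u\<close> recovers \<rho>/m, so the weak
  formulation can be written with u^\<kappa>; square integrability of \<rho> passes to it through
  \<open>m \<ge> \<delta>\<close>.\<close>

lemma weak_solution_solves:
  fixes b :: "(real^'n) \<times> real \<Rightarrow> real^'n"
  assumes ca: "coefficient_assumption T \<delta> m f b" and k: "k > 1" and ws: "weak_solution T m f b k \<rho>0 \<rho>"
    and de: "degenerate_equation (QT T) m (\<lambda>z. m z * f z) (drift m b) space_basis"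
  obtains u G where "degenerate_equation.solves (QT T) m (\<lambda>z. m z * f z) (drift m b) space_basis (1 / k) u G"
    "\<And>z. z \<notin> QT T \<Longrightarrow> u z = 0"
    "AE z in lebesgue_on (QT T). \<rho> z \<ge> 0 \<and> u z = (\<rho> z / m z) powr k \<and> u z powr (1 / k) = \<rho> z / m z"
proof -
  let ?S = "QT T :: ((real^'n) \<times> real) set"
  note cs = coefficient_smooth[OF ca]
  have S: "open ?S" by (rule open_QT)
  define W where "W z = (\<rho> z / m z) powr k" for z
  obtain G where \<rho>0: "AE z in lebesgue_on ?S. \<rho> z \<ge> 0" and \<rho>2: "Lp_on 2 ?S \<rho>" and W1: "sobolev_W1_on 2 ?S W G"
    and weak: "\<And>\<phi>. \<phi> \<in> test_functions (UNIV \<times> {..<T}) \<Longrightarrow>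
           (LINT z|lebesgue_on ?S. - (\<rho> z * time_deriv \<phi> z)) =
           (LINT x|lebesgue. \<phi> (x, 0) * \<rho>0 x) +
           (LINT z|lebesgue_on ?S. - (m z * (space_grad \<phi> z \<bullet> fst (G z))) - \<rho> z * (space_grad \<phi> z \<bullet> b z) + f z * \<phi> z * \<rho> z)"
    using ws unfolding weak_solution_def W_def[abs_def] by blast
  have WLp: "Lp_on 2 ?S W" and GLp: "Lp_on 2 ?S G" and wgW: "weak_gradient_on ?S W G"
    using W1 by (auto simp: sobolev_W1_on_def)
  have Wm: "W \<in> borel_measurable (lebesgue_on ?S)" and \<rho>m: "\<rho> \<in> borel_measurable (lebesgue_on ?S)"
    using WLp \<rho>2 by (auto simp: Lp_on_def)
  obtain u0 where u0: "u0 \<in> borel_measurable borel" "\<And>z. z \<notin> ?S \<Longrightarrow> u0 z = 0" "AE z in lebesgue_on ?S. W z = u0 z"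
    by (rule borel_representative[OF S Wm]) (rule that; assumption)
  obtain \<rho>' where \<rho>': "\<rho>' \<in> borel_measurable borel" "\<And>z. z \<notin> ?S \<Longrightarrow> \<rho>' z = 0" "AE z in lebesgue_on ?S. \<rho> z = \<rho>' z"
    by (rule borel_representative[OF S \<rho>m]) (rule that; assumption)
  \<comment> \<open>Nonnegativity is wanted at every point; the absolute value changes
    \<open>u0\<close> on a null set at most, since a power is nonnegative.\<close>
  define u where "u z = \<bar>u0 z\<bar>" for z
  have um [measurable]: "u \<in> borel_measurable borel" unfolding u_def using u0(1) by measurable
  have u0': "u z \<ge> 0" for z by (simp add: u_def)
  have uz: "u z = 0" if "z \<notin> ?S" for z using u0(2)[OF that] by (simp add: u_def)
  have uW: "AE z in lebesgue_on ?S. W z = u z"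
    using u0(3) by eventually_elim (metis W_def abs_of_nonneg powr_ge_zero u_def)
  have AES: "AE z in lebesgue_on ?S. z \<in> ?S" by (rule AE_I2) (simp add: space_restrict_space)
  have vae: "AE z in lebesgue_on ?S. u z powr (1 / k) = \<rho> z / m z"
    using uW \<rho>0 AES
  proof eventually_elim
    case (elim z)
    have "0 < m z" using cs(4) cs(5)[OF elim(3)] by simp
    then show ?case using k elim(2) by (simp add: elim(1)[symmetric] W_def powr_powr)
  qed
  have L2u: "L2 u"
    unfolding L2_def
  proof
    have "integrable (lebesgue_on ?S) (\<lambda>z. norm (W z) powr 2) \<longleftrightarrow> integrable lborel (\<lambda>z. (u z)\<^sup>2)"
    proof (rule lebesgue_on_transfer(2)[OF S])
      show "AE z in lebesgue_on ?S. norm (W z) powr 2 = (u z)\<^sup>2"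
        using uW by eventually_elim (simp add: u0')
    qed (auto simp: uz)
    then show "integrable lborel (\<lambda>z. (u z)\<^sup>2)" using WLp by (simp add: Lp_on_def)
  qed measurable
  have L2v: "L2 (\<lambda>z. u z powr (1 / k))"
    unfolding L2_def
  proof
    have "integrable (lebesgue_on ?S) (\<lambda>z. norm (\<rho> z) powr 2) \<longleftrightarrow> integrable lborel (\<lambda>z. (\<rho>' z)\<^sup>2)"
    proof (rule lebesgue_on_transfer(2)[OF S])
      show "AE z in lebesgue_on ?S. norm (\<rho> z) powr 2 = (\<rho>' z)\<^sup>2"
        using \<rho>'(3) by eventually_elim simp
      show "(\<lambda>z. (\<rho>' z)\<^sup>2) \<in> borel_measurable borel" using \<rho>'(1) by measurable
    qed (auto simp: \<rho>'(2))
    then have i: "integrable lborel (\<lambda>z. (\<rho>' z)\<^sup>2 / \<delta>\<^sup>2)" using \<rho>2 by (simp add: Lp_on_def)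
    show "integrable lborel (\<lambda>z. (u z powr (1 / k))\<^sup>2)"
    proof (rule Bochner_Integration.integrable_bound[OF i])
      show "(\<lambda>z. (u z powr (1 / k))\<^sup>2) \<in> borel_measurable lborel" by measurable
      have "AE z in lborel. z \<in> ?S \<longrightarrow> u z powr (1 / k) = \<rho> z / m z \<and> \<rho> z = \<rho>' z"
        by (rule AE_lebesgue_on_lborel[OF S]) (use vae \<rho>'(3) in eventually_elim, simp)
      then show "AE z in lborel. norm ((u z powr (1 / k))\<^sup>2) \<le> norm ((\<rho>' z)\<^sup>2 / \<delta>\<^sup>2)"
      proof eventually_elim
        case (elim z)
        show ?case
        proof (cases "z \<in> ?S")
          case True
          have "\<bar>\<rho>' z / m z\<bar> \<le> \<bar>\<rho>' z\<bar> / \<delta>"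
            using cs(4) cs(5)[OF True] unfolding abs_divide by (intro divide_left_mono) auto
          then have "\<bar>\<rho>' z / m z\<bar>\<^sup>2 \<le> (\<bar>\<rho>' z\<bar> / \<delta>)\<^sup>2" by (intro power_mono) auto
          then show ?thesis using elim True by (simp add: power_divide)
        qed (simp add: uz)
      qed
    qed
  qed measurable
  have "\<forall>e. \<exists>g. g \<in> borel_measurable borel \<and> (\<forall>z. z \<notin> ?S \<longrightarrow> g z = 0) \<and> (AE z in lebesgue_on ?S. G z \<bullet> e = g z)"
  proof
    fix e
    have "(\<lambda>z. G z \<bullet> e) \<in> borel_measurable (lebesgue_on ?S)"
      using GLp by (intro borel_measurable_inner) (auto simp: Lp_on_def)
    then obtain g where "g \<in> borel_measurable borel" "\<And>z. z \<notin> ?S \<Longrightarrow> g z = 0" "AE z in lebesgue_on ?S. G z \<bullet> e = g z"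
      by (rule borel_representative[OF S]) (rule that; assumption)
    then show "\<exists>g. g \<in> borel_measurable borel \<and> (\<forall>z. z \<notin> ?S \<longrightarrow> g z = 0) \<and> (AE z in lebesgue_on ?S. G z \<bullet> e = g z)"
      by blast
  qed
  from choice[OF this] obtain g where g0:
    "\<forall>e. g e \<in> borel_measurable borel \<and> (\<forall>z. z \<notin> ?S \<longrightarrow> g e z = 0) \<and> (AE z in lebesgue_on ?S. G z \<bullet> e = g e z)" ..
  then have g: "\<And>e. g e \<in> borel_measurable borel" "\<And>e z. z \<notin> ?S \<Longrightarrow> g e z = 0"
    "\<And>e. AE z in lebesgue_on ?S. G z \<bullet> e = g e z"
    by blast+
  \<comment> \<open>The components were given Borel representatives one at a time and are
    reassembled here.\<close>
  define G' where "G' z = (\<Sum>e\<in>Basis. g e z *\<^sub>R e)" for z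
  have G'e: "G' z \<bullet> e = g e z" if "e \<in> Basis" for z e
    using that by (simp add: G'_def)
  have L2g: "L2 (g e)" if e: "e \<in> Basis" for e
    unfolding L2_def
  proof
    have "integrable (lebesgue_on ?S) (\<lambda>z. (G z \<bullet> e)\<^sup>2) \<longleftrightarrow> integrable lborel (\<lambda>z. (g e z)\<^sup>2)"
    proof (rule lebesgue_on_transfer(2)[OF S])
      show "AE z in lebesgue_on ?S. (G z \<bullet> e)\<^sup>2 = (g e z)\<^sup>2"
        using g(3)[of e] by eventually_elim simp
      show "(\<lambda>z. (g e z)\<^sup>2) \<in> borel_measurable borel" using g(1)[of e] by measurable
    qed (auto simp: g(2))
    moreover have "integrable (lebesgue_on ?S) (\<lambda>z. (G z \<bullet> e)\<^sup>2)"
    proof (rule Bochner_Integration.integrable_bound)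
      show "integrable (lebesgue_on ?S) (\<lambda>z. norm (G z) powr 2)" using GLp by (simp add: Lp_on_def)
      have [measurable]: "G \<in> borel_measurable (lebesgue_on ?S)" using GLp by (simp add: Lp_on_def)
      show "(\<lambda>z. (G z \<bullet> e)\<^sup>2) \<in> borel_measurable (lebesgue_on ?S)" by measurable
      show "AE z in lebesgue_on ?S. norm ((G z \<bullet> e)\<^sup>2) \<le> norm (norm (G z) powr 2)"
      proof (rule AE_I2)
        fix z
        have "\<bar>G z \<bullet> e\<bar>\<^sup>2 \<le> (norm (G z))\<^sup>2" by (intro power_mono Basis_le_norm e) auto
        then show "norm ((G z \<bullet> e)\<^sup>2) \<le> norm (norm (G z) powr 2)" by simp
      qed
    qed
    ultimately show "integrable lborel (\<lambda>z. (g e z)\<^sup>2)" by simp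
  qed (rule g)
  show ?thesis
  proof (rule that[of u G'])
    show "degenerate_equation.solves ?S m (\<lambda>z. m z * f z) (drift m b) space_basis (1 / k) u G'"
      unfolding degenerate_equation.solves_def[OF de]
    proof (intro conjI ballI allI)
      show "L2 u" "L2 (\<lambda>z. u z powr (1 / k))" "u z \<ge> 0" for z by (rule L2u L2v u0')+
      show "L2 (\<lambda>z. G' z \<bullet> e)" if "e \<in> Basis" for e using L2g[OF that] by (simp add: G'e[OF that])
    next
      fix \<phi> :: "(real^'n) \<times> real \<Rightarrow> real" and e :: "(real^'n) \<times> real"
      assume \<phi>: "\<phi> \<in> test_functions ?S" and e: "e \<in> Basis"
      have [measurable]: "\<phi> \<in> borel_measurable borel" "pd e \<phi> \<in> borel_measurable borel"
        using smooth_on_continuous[OF test_functionsD(1)[OF \<phi>]] smooth_on_continuous[OF smooth_on_pd[OF test_functionsD(1)[OF \<phi>] e]]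
        by (auto intro: borel_measurable_continuous_onI)
      have [measurable]: "g e \<in> borel_measurable borel" by (rule g)
      have "(LINT z|lebesgue_on ?S. W z * pd e \<phi> z) = (\<integral>z. u z * pd e \<phi> z \<partial>lborel)"
        by (rule lebesgue_on_transfer(1)[OF S]) (use uW in \<open>auto simp: uz elim: eventually_mono\<close>)
      moreover have "(LINT z|lebesgue_on ?S. (G z \<bullet> e) * \<phi> z) = (\<integral>z. g e z * \<phi> z \<partial>lborel)"
        by (rule lebesgue_on_transfer(1)[OF S]) (use g(3)[of e] in \<open>auto simp: g(2) elim: eventually_mono\<close>)
      ultimately show "(\<integral>z. u z * pd e \<phi> z \<partial>lborel) = - (\<integral>z. (G' z \<bullet> e) * \<phi> z \<partial>lborel)"
        using wgW \<phi> e unfolding weak_gradient_on_def G'e[OF e] by simp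
    next
      fix \<phi> :: "(real^'n) \<times> real \<Rightarrow> real" assume \<phi>: "\<phi> \<in> test_functions ?S"
      obtain K where K: "compact K" "K \<subseteq> ?S" "\<And>z. z \<notin> K \<Longrightarrow> \<phi> z = 0"
        using test_functionsD(2)[OF \<phi>] by blast
      note sm\<phi> = test_functionsD(1)[OF \<phi>]
      have sm\<phi>S: "smooth_on ?S \<phi>" by (rule smooth_on_subset[OF sm\<phi>]) simp
      have d\<phi>: "\<phi> differentiable at z" for z by (rule smooth_on_differentiable[OF sm\<phi>]) simp
      have pd\<phi>0: "pd e \<phi> z = 0" if "z \<notin> K" for e z by (rule pd_eq_0_outside(1)[OF K(1) K(3) that])
      let ?e = "\<lambda>i. (axis i 1, 0) :: (real^'n) \<times> real"
      have eB: "?e i \<in> Basis" "(0, 1) \<in> (Basis :: ((real^'n) \<times> real) set)" for i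
        by (auto simp: Basis_spacetime space_basis_def)
      note ext = continuous_on_zero_extend[OF S K(1,2)]
      define k1 where "k1 z = m z * pd (0, 1) \<phi> z" for z
      define kg where "kg i z = m z * pd (?e i) \<phi> z" for i z
      define k2 where "k2 z = (\<Sum>i\<in>UNIV. m z * (pd (?e i) \<phi> z * b z $ i))" for z
      define k3 where "k3 z = m z * (f z * \<phi> z)" for z
      note con = smooth_on_continuous[OF cs(1)] smooth_on_continuous[OF cs(2)] smooth_on_continuous[OF cs(3)]
        smooth_on_continuous[OF sm\<phi>S] smooth_on_continuous[OF smooth_on_pd[OF sm\<phi>S eB(1)]] smooth_on_continuous[OF smooth_on_pd[OF sm\<phi>S eB(2)]]
      have z0: "k1 z = 0" "kg i z = 0" "k2 z = 0" "k3 z = 0" if "z \<notin> K" for i z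
        using pd\<phi>0[OF that] K(3)[OF that] by (simp_all add: k1_def kg_def k2_def k3_def)
      have c1: "continuous_on UNIV k1"
        by (rule ext[OF _ z0(1)]) (unfold k1_def, intro continuous_intros con)
      have cg: "continuous_on UNIV (kg i)" for i
        by (rule ext[OF _ z0(2)]) (unfold kg_def, intro continuous_intros con)
      have c2: "continuous_on UNIV k2"
        by (rule ext[OF _ z0(3)]) (unfold k2_def, intro continuous_intros con)
      have c3: "continuous_on UNIV k3"
        by (rule ext[OF _ z0(4)]) (unfold k3_def, intro continuous_intros con)
      have [measurable]: "k1 \<in> borel_measurable borel" "kg i \<in> borel_measurable borel" "k2 \<in> borel_measurable borel" "k3 \<in> borel_measurable borel" for i
        using c1 cg c2 c3 by (auto intro: borel_measurable_continuous_onI)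
      let ?v = "\<lambda>z. u z powr (1 / k)"
      have i1: "integrable lborel (\<lambda>z. ?v z * k1 z)" by (rule L2_mult_integrable[OF L2v L2_continuous[OF c1 K(1) z0(1)]])
      have i2: "integrable lborel (\<lambda>z. ?v z * k2 z)" by (rule L2_mult_integrable[OF L2v L2_continuous[OF c2 K(1) z0(3)]])
      have i3: "integrable lborel (\<lambda>z. ?v z * k3 z)" by (rule L2_mult_integrable[OF L2v L2_continuous[OF c3 K(1) z0(4)]])
      have ig: "integrable lborel (\<lambda>z. \<Sum>i\<in>UNIV. kg i z * g (?e i) z)"
        by (intro Bochner_Integration.integrable_sum L2_mult_integrable[OF L2_continuous[OF cg K(1) z0(2)] L2g[OF eB(1)]])
      have gm [measurable]: "g e \<in> borel_measurable borel" for e by (rule g)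
      have m0: "m z \<noteq> 0" if "z \<in> ?S" for z using cs(4) cs(5)[OF that] by auto
      have vae': "AE z in lebesgue_on ?S. \<rho> z = m z * ?v z"
        using vae AES by eventually_elim (simp add: m0)
      have e1: "(LINT z|lebesgue_on ?S. - (\<rho> z * time_deriv \<phi> z)) = (\<integral>z. - (?v z * k1 z) \<partial>lborel)"
      proof (rule lebesgue_on_transfer(1)[OF S])
        show "(\<lambda>z. - (?v z * k1 z)) \<in> borel_measurable borel" by measurable
        show "AE z in lebesgue_on ?S. - (\<rho> z * time_deriv \<phi> z) = - (?v z * k1 z)"
          using vae' by eventually_elim (simp add: k1_def pd_time[OF d\<phi>] mult_ac)
      qed (simp add: uz)
      have "AE z in lebesgue_on ?S. \<forall>i. G z \<bullet> ?e i = g (?e i) z"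
        by (intro eventually_all_finite g(3))
      then have e2: "(LINT z|lebesgue_on ?S. - (m z * (space_grad \<phi> z \<bullet> fst (G z))) - \<rho> z * (space_grad \<phi> z \<bullet> b z) + f z * \<phi> z * \<rho> z)
        = (\<integral>z. - (\<Sum>i\<in>UNIV. kg i z * g (?e i) z) - ?v z * k2 z + ?v z * k3 z \<partial>lborel)"
      proof (intro lebesgue_on_transfer(1)[OF S])
        assume ae: "AE z in lebesgue_on ?S. \<forall>i. G z \<bullet> ?e i = g (?e i) z"
        show "AE z in lebesgue_on ?S. - (m z * (space_grad \<phi> z \<bullet> fst (G z))) - \<rho> z * (space_grad \<phi> z \<bullet> b z) + f z * \<phi> z * \<rho> z
           = - (\<Sum>i\<in>UNIV. kg i z * g (?e i) z) - ?v z * k2 z + ?v z * k3 z"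
          using ae vae'
        proof eventually_elim
          case (elim z)
          have "fst (G z) $ i = g (?e i) z" for i
          proof -
            have "G z \<bullet> ?e i = fst (G z) $ i" by (cases "G z") (simp add: inner_axis)
            then show ?thesis using elim(1) by simp
          qed
          then have 1: "m z * (space_grad \<phi> z \<bullet> fst (G z)) = (\<Sum>i\<in>UNIV. kg i z * g (?e i) z)"
            by (simp add: space_grad_inner[OF d\<phi>] kg_def sum_distrib_left mult_ac)
          have 2: "\<rho> z * (space_grad \<phi> z \<bullet> b z) = ?v z * k2 z"
            by (simp add: space_grad_inner[OF d\<phi>] k2_def sum_distrib_left elim(2) mult_ac)
          have 3: "f z * \<phi> z * \<rho> z = ?v z * k3 z" by (simp add: k3_def elim(2) mult_ac)
          show ?case by (simp only: 1 2 3)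
        qed
        show "(\<lambda>z. - (\<Sum>i\<in>UNIV. kg i z * g (?e i) z) - ?v z * k2 z + ?v z * k3 z) \<in> borel_measurable borel"
          by measurable
      qed (auto simp: uz g(2))
      have "(LINT x|lebesgue. \<phi> (x, 0) * \<rho>0 x) = 0"
        by (simp add: test_functions_QT(2)[OF \<phi>])
      with weak[OF test_functions_QT(1)[OF \<phi>]] have eq:
        "(\<integral>z. - (?v z * k1 z) \<partial>lborel) = (\<integral>z. - (\<Sum>i\<in>UNIV. kg i z * g (?e i) z) - ?v z * k2 z + ?v z * k3 z \<partial>lborel)"
        unfolding e1 e2 by simp
      have "(\<integral>z. ?v z * ((\<Sum>e\<in>Basis. (drift m b z \<bullet> e) * pd e \<phi> z) + m z * f z * \<phi> z) \<partial>lborel)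
         = (\<integral>z. ?v z * k1 z - ?v z * k2 z + ?v z * k3 z \<partial>lborel)"
      proof (rule Bochner_Integration.integral_cong[OF refl])
        fix z
        have *: "(\<Sum>e\<in>Basis. (drift m b z \<bullet> e) * pd e \<phi> z) = k1 z - k2 z"
          unfolding sum_Basis_spacetime by (simp add: k1_def k2_def inner_axis sum_negf mult_ac)
        show "?v z * ((\<Sum>e\<in>Basis. (drift m b z \<bullet> e) * pd e \<phi> z) + m z * f z * \<phi> z) = ?v z * k1 z - ?v z * k2 z + ?v z * k3 z"
          unfolding * by (simp add: k3_def algebra_simps)
      qed
      also have "\<dots> = (\<integral>z. (\<Sum>i\<in>UNIV. kg i z * g (?e i) z) \<partial>lborel)"
        using eq i1 i2 i3 ig by simp
      also have "\<dots> = (\<integral>z. m z * (\<Sum>e\<in>space_basis. pd e \<phi> z * (G' z \<bullet> e)) \<partial>lborel)"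
        unfolding sum_space_basis by (simp add: kg_def G'e[OF eB(1)] sum_distrib_left mult_ac)
      finally show "(\<integral>z. ?v z * ((\<Sum>e\<in>Basis. (drift m b z \<bullet> e) * pd e \<phi> z) + m z * f z * \<phi> z) \<partial>lborel) =
         (\<integral>z. m z * (\<Sum>e\<in>space_basis. pd e \<phi> z * (G' z \<bullet> e)) \<partial>lborel)" .
    qed
    show "AE z in lebesgue_on ?S. \<rho> z \<ge> 0 \<and> u z = (\<rho> z / m z) powr k \<and> u z powr (1 / k) = \<rho> z / m z"
      using uW \<rho>0 vae by eventually_elim (simp add: W_def)
  qed (rule uz)
qed

text \<open>For \<open>w > 1\<close> the factor w^k is taken out of the logarithm and leaves k ln w.
  This is at most the pressure by ln y < y with y = w^(k-1), the factor k/(k-1) being exactly the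
  one in \<open>pressure\<close>.\<close>

lemma log_le_pressure:
  assumes k: "k > 1" and w: "w \<ge> 0" and \<epsilon>: "\<epsilon> > 0"
  shows "\<epsilon> * ln (1 + w powr k / \<epsilon>) \<le> \<epsilon> * ln (1 + 1 / \<epsilon>) + \<epsilon> * pressure k w"
proof -
  have p0: "0 \<le> pressure k w" using k by (simp add: pressure_def)
  have "ln (1 + w powr k / \<epsilon>) \<le> ln (1 + 1 / \<epsilon>) + pressure k w"
  proof (cases "w \<le> 1")
    case True
    have "w powr k \<le> 1" using True w k by (simp add: powr_le1)
    then have "w powr k / \<epsilon> \<le> 1 / \<epsilon>" using \<epsilon> by (simp add: divide_right_mono)
    moreover have "0 \<le> w powr k / \<epsilon>" using \<epsilon> by simp
    ultimately have "ln (1 + w powr k / \<epsilon>) \<le> ln (1 + 1 / \<epsilon>)" by (intro ln_mono) linarith+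
    then show ?thesis using p0 by linarith
  next
    case False
    then have w1: "w > 1" by simp
    then have u1: "1 \<le> w powr k" using k by (simp add: ge_one_powr_ge_zero)
    have "ln (1 + w powr k / \<epsilon>) \<le> ln ((1 + 1 / \<epsilon>) * w powr k)"
    proof (rule ln_mono)
      show "1 + w powr k / \<epsilon> \<le> (1 + 1 / \<epsilon>) * w powr k" using u1 by (simp add: distrib_right)
      show "0 < 1 + w powr k / \<epsilon>" using \<epsilon> by (simp add: add_pos_nonneg)
    qed
    also have "\<dots> = ln (1 + 1 / \<epsilon>) + k * ln w"
    proof -
      have "0 < 1 + 1 / \<epsilon>" using \<epsilon> by (simp add: add_pos_pos)
      then show ?thesis using w1 by (subst ln_mult_pos) (auto simp: ln_powr)
    qed
    also have "k * ln w \<le> pressure k w"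
    proof -
      have "(k - 1) * ln w = ln (w powr (k - 1))" using w1 by (simp add: ln_powr)
      also have "\<dots> \<le> w powr (k - 1)" using ln_le_minus_one[of "w powr (k - 1)"] w1 by simp
      finally have "k / (k - 1) * ((k - 1) * ln w) \<le> k / (k - 1) * w powr (k - 1)"
        using k by (intro mult_left_mono) auto
      then show ?thesis using k by (simp add: pressure_def)
    qed
    finally show ?thesis by simp
  qed
  then have "\<epsilon> * ln (1 + w powr k / \<epsilon>) \<le> \<epsilon> * (ln (1 + 1 / \<epsilon>) + pressure k w)"
    using \<epsilon> by (intro mult_left_mono) auto
  then show ?thesis by (simp add: distrib_left)
qed

text \<open>Bernoulli's inequality with exponent \<open>n - 1\<close>. As the pressures are bounded
  in L^1, the factor 1/n makes the excess over 1 vanish in the limit, which yields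
  \<open>v \<le> 1\<close>.\<close>

lemma excess_le_pressure:
  fixes n :: nat
  assumes n: "n \<ge> 2" and w: "w \<ge> 0"
  shows "w - 1 \<le> 1 / real n * pressure (real n) w"
proof (cases "w = 0")
  case False
  then have w0: "w > 0" using w by simp
  have "1 + real (n - 1) * (w - 1) \<le> (1 + (w - 1)) ^ (n - 1)"
    by (rule Bernoulli_inequality) (use w in simp)
  also have "\<dots> = w powr (real n - 1)"
    using powr_realpow[OF w0, of "n - 1"] n by (simp add: of_nat_diff)
  finally have "(real n - 1) * (w - 1) \<le> w powr (real n - 1)" using n by (simp add: of_nat_diff)
  then have "w - 1 \<le> w powr (real n - 1) / (real n - 1)" using n by (simp add: pos_le_divide_eq mult.commute)
  also have "\<dots> = 1 / real n * pressure (real n) w" using n by (simp add: pressure_def)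
  finally show ?thesis .
qed (use n in \<open>simp add: pressure_def\<close>)

lemma Lp_on_1_iff:
  fixes u :: "'a::euclidean_space \<Rightarrow> real"
  shows "Lp_on 1 S u \<longleftrightarrow> integrable (lebesgue_on S) u"
  unfolding Lp_on_def by (auto simp: integrable_abs_iff)

text \<open>The test \<psi>/m absorbs the weight of the drift and leaves the field (-b, 1). It is
  again a test function because m is smooth and positive on the slab.\<close>

lemma transport_test_function:
  fixes b :: "(real^'n) \<times> real \<Rightarrow> real^'n"
  assumes ca: "coefficient_assumption T \<delta> m f b" and \<psi>: "\<psi> \<in> test_functions (QT T)" "\<And>z. \<psi> z \<ge> 0"
  obtains \<phi> where "\<phi> \<in> test_functions (QT T)" "\<And>z. \<phi> z \<ge> 0"
    "\<And>z e. \<phi> z * (drift m b z \<bullet> e) = \<psi> z * ((- b z, 1) \<bullet> e)"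
proof -
  let ?S = "QT T :: ((real^'n) \<times> real) set"
  note cs = coefficient_smooth[OF ca]
  have mp: "m z > 0" if "z \<in> ?S" for z using cs(4) cs(5)[OF that] by simp
  have "smooth_on ?S (\<lambda>z. inverse (m z))"
    by (rule smooth_on_compose_real[OF open_QT cs(1) smooth_on_inverse]) (use mp in auto)
  from test_functions_mult[OF \<psi>(1) open_QT this]
  have 1: "(\<lambda>z. if z \<in> ?S then inverse (m z) * \<psi> z else 0) \<in> test_functions ?S" .
  have 2: "0 \<le> (if z \<in> ?S then inverse (m z) * \<psi> z else 0)" for z
    using mult_nonneg_nonneg[of "inverse (m z)" "\<psi> z"] mp[of z] \<psi>(2)[of z] by auto
  have "\<psi> z = 0" if "z \<notin> ?S" for z using test_functionsD(2)[OF \<psi>(1)] that by blast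
  moreover have "drift m b z \<bullet> e = m z * ((- b z, 1) \<bullet> e)" for z e by (rule inner_scaleR_left)
  ultimately have 3: "(if z \<in> ?S then inverse (m z) * \<psi> z else 0) * (drift m b z \<bullet> e) = \<psi> z * ((- b z, 1) \<bullet> e)" for z e
    using mp[of z] by (cases "z \<in> ?S") (simp_all del: scaleR_Pair inner_Pair)
  show ?thesis by (rule that[OF 1 2 3])
qed

text \<open>The limit is taken along integer exponents, to which Bernoulli's inequality applies.
  Convergence of the pressures in L^1 supplies the uniform bound \<open>P\<close> that controls both
  the logarithm and the excess over 1.\<close>

lemma limit_transport_inequality:
  fixes b :: "(real^'n) \<times> real \<Rightarrow> real^'n"
  assumes ca: "coefficient_assumption T \<delta> m f b" and cc: "congestion_condition T m f b"
    and ws: "\<And>k. k > 1 \<Longrightarrow> weak_solution T m f b k (\<rho>0 k) (\<rho> k)"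
    and pr: "\<And>k z. k > 1 \<Longrightarrow> z \<in> QT T \<Longrightarrow> p k z = pressure k (\<rho> k z / m z)"
    and \<rho>lim: "L1_limit_on (QT T) \<rho> \<rho>lim" and plim: "L1_limit_on (QT T) p plim"
  obtains v where "integrable lborel v" "AE z in lborel. z \<in> QT T \<longrightarrow> \<rho>lim z / m z = v z"
    "\<And>\<psi>. \<psi> \<in> test_functions (QT T) \<Longrightarrow> (\<And>z. \<psi> z \<ge> 0) \<Longrightarrow>
       (\<integral>z. v z * (\<Sum>e\<in>Basis. pd e (\<lambda>y. \<psi> y * ((- b y, 1) \<bullet> e)) z) \<partial>lborel) \<le> 0"
proof -
  let ?S = "QT T :: ((real^'n) \<times> real) set"
  have S: "open ?S" by (rule open_QT)
  note cs = coefficient_smooth[OF ca]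
  note de = degenerate_equation_interp[OF ca cc]
  interpret E: degenerate_equation ?S m "\<lambda>z. m z * f z" "drift m b" space_basis by (rule de)
  have mp: "m z > 0" if "z \<in> ?S" for z using cs(4) cs(5)[OF that] by simp
  have mm: "m \<in> borel_measurable (lebesgue_on ?S)"
    by (rule continuous_imp_measurable_on_sets_lebesgue[OF smooth_on_continuous[OF cs(1)]]) (use open_lebesgue[OF S] in simp)
  have quot: "integrable (lebesgue_on ?S) (\<lambda>z. g z / m z)"
      "(LINT z|lebesgue_on ?S. \<bar>g z / m z\<bar>) \<le> (LINT z|lebesgue_on ?S. \<bar>g z\<bar>) / \<delta>"
    if g: "integrable (lebesgue_on ?S) g" for g
  proof -
    have gm: "g \<in> borel_measurable (lebesgue_on ?S)" using g by auto
    have le: "\<bar>g z / m z\<bar> \<le> \<bar>g z\<bar> / \<delta>" if "z \<in> ?S" for z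
      using cs(4) cs(5)[OF that] unfolding abs_divide by (intro divide_left_mono) auto
    have i: "integrable (lebesgue_on ?S) (\<lambda>z. \<bar>g z\<bar> / \<delta>)" using g by auto
    show 1: "integrable (lebesgue_on ?S) (\<lambda>z. g z / m z)"
    proof (rule Bochner_Integration.integrable_bound[OF i])
      show "(\<lambda>z. g z / m z) \<in> borel_measurable (lebesgue_on ?S)" using gm mm by measurable
      show "AE z in lebesgue_on ?S. norm (g z / m z) \<le> norm (\<bar>g z\<bar> / \<delta>)"
        by (rule AE_I2) (use le cs(4) in \<open>simp add: space_restrict_space\<close>)
    qed
    have "(LINT z|lebesgue_on ?S. \<bar>g z / m z\<bar>) \<le> (LINT z|lebesgue_on ?S. \<bar>g z\<bar> / \<delta>)"
      using 1 i le by (intro integral_mono integrable_abs) (auto simp: space_restrict_space)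
    then show "(LINT z|lebesgue_on ?S. \<bar>g z / m z\<bar>) \<le> (LINT z|lebesgue_on ?S. \<bar>g z\<bar>) / \<delta>" by simp
  qed
  have \<rho>li: "integrable (lebesgue_on ?S) \<rho>lim" and pli: "integrable (lebesgue_on ?S) plim"
    and \<rho>t: "((\<lambda>k. LINT x|lebesgue_on ?S. \<bar>\<rho> k x - \<rho>lim x\<bar>) \<longlongrightarrow> 0) at_top"
    and pt: "((\<lambda>k. LINT x|lebesgue_on ?S. \<bar>p k x - plim x\<bar>) \<longlongrightarrow> 0) at_top"
    and ev: "eventually (\<lambda>k. integrable (lebesgue_on ?S) (\<rho> k)) at_top" "eventually (\<lambda>k. integrable (lebesgue_on ?S) (p k)) at_top"
    using \<rho>lim plim unfolding L1_limit_on_def Lp_on_1_iff by auto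
  have "eventually (\<lambda>k. integrable (lebesgue_on ?S) (\<rho> k) \<and> integrable (lebesgue_on ?S) (p k) \<and>
      (LINT x|lebesgue_on ?S. \<bar>p k x - plim x\<bar>) < 1) at_top"
    using ev order_tendstoD(2)[OF pt, of 1] by (auto simp: eventually_conj_iff)
  then obtain N where N: "\<And>k. k \<ge> N \<Longrightarrow> integrable (lebesgue_on ?S) (\<rho> k) \<and> integrable (lebesgue_on ?S) (p k) \<and>
      (LINT x|lebesgue_on ?S. \<bar>p k x - plim x\<bar>) < 1"
    unfolding eventually_at_top_linorder by blast
  \<comment> \<open>Beyond \<open>N\<close> the densities and pressures are integrable and the
    pressures lie within 1 of their limit; the offset 2 ensures an exponent of at least 2.\<close>
  define N0 where "N0 = nat \<lceil>N\<rceil> + 2"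
  define k where "k n = real (n + N0)" for n
  have kN: "k n \<ge> N" for n unfolding k_def N0_def by linarith
  have k1: "k n > 1" for n unfolding k_def N0_def by simp
  have k0: "k n > 0" for n using k1[of n] by simp
  have kt: "filterlim k at_top sequentially"
    unfolding k_def by (rule filterlim_compose[OF filterlim_real_sequentially filterlim_add_const_nat_at_top])
  have \<kappa>: "(\<lambda>n. 1 / k n) \<longlonglongrightarrow> 0"
    by (rule tendsto_divide_0[OF tendsto_const filterlim_at_top_imp_at_infinity[OF kt]])
  have \<rho>i: "integrable (lebesgue_on ?S) (\<rho> (k n))" and p_i: "integrable (lebesgue_on ?S) (p (k n))"
    and p1: "(LINT x|lebesgue_on ?S. \<bar>p (k n) x - plim x\<bar>) < 1" for n
    using N[OF kN[of n]] by auto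
  have "\<forall>n. \<exists>uG. E.solves (1 / k n) (fst uG) (snd uG) \<and> (\<forall>z. z \<notin> ?S \<longrightarrow> fst uG z = 0) \<and>
     (AE z in lebesgue_on ?S. \<rho> (k n) z \<ge> 0 \<and> fst uG z = (\<rho> (k n) z / m z) powr k n \<and> fst uG z powr (1 / k n) = \<rho> (k n) z / m z)"
  proof
    fix n
    obtain u G where "E.solves (1 / k n) u G" "\<And>z. z \<notin> ?S \<Longrightarrow> u z = 0"
      "AE z in lebesgue_on ?S. \<rho> (k n) z \<ge> 0 \<and> u z = (\<rho> (k n) z / m z) powr k n \<and> u z powr (1 / k n) = \<rho> (k n) z / m z"
      by (rule weak_solution_solves[OF ca k1 ws[OF k1] de]) (rule that; assumption)
    then show "\<exists>uG. E.solves (1 / k n) (fst uG) (snd uG) \<and> (\<forall>z. z \<notin> ?S \<longrightarrow> fst uG z = 0) \<and>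
     (AE z in lebesgue_on ?S. \<rho> (k n) z \<ge> 0 \<and> fst uG z = (\<rho> (k n) z / m z) powr k n \<and> fst uG z powr (1 / k n) = \<rho> (k n) z / m z)"
      by (intro exI[of _ "(u, G)"]) simp
  qed
  from choice[OF this] obtain uG where uG: "\<forall>n. E.solves (1 / k n) (fst (uG n)) (snd (uG n)) \<and> (\<forall>z. z \<notin> ?S \<longrightarrow> fst (uG n) z = 0) \<and>
     (AE z in lebesgue_on ?S. \<rho> (k n) z \<ge> 0 \<and> fst (uG n) z = (\<rho> (k n) z / m z) powr k n \<and> fst (uG n) z powr (1 / k n) = \<rho> (k n) z / m z)" ..
  define u where "u n = fst (uG n)" for n
  define G where "G n = snd (uG n)" for n
  have sol: "E.solves (1 / k n) (u n) (G n)" for n unfolding u_def G_def using uG by blast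
  have uz: "u n z = 0" if "z \<notin> ?S" for n z unfolding u_def using uG that by blast
  have uae: "AE z in lebesgue_on ?S. \<rho> (k n) z \<ge> 0 \<and> u n z = (\<rho> (k n) z / m z) powr k n \<and> u n z powr (1 / k n) = \<rho> (k n) z / m z" for n
    unfolding u_def using uG by blast
  have um [measurable]: "u n \<in> borel_measurable borel" for n
    using sol[of n] unfolding E.solves_def L2_def by simp
  have "(\<lambda>z. \<rho>lim z / m z) \<in> borel_measurable (lebesgue_on ?S)" using quot(1)[OF \<rho>li] by auto
  then obtain v where v: "v \<in> borel_measurable borel" "\<And>z. z \<notin> ?S \<Longrightarrow> v z = 0" "AE z in lebesgue_on ?S. \<rho>lim z / m z = v z"
    by (rule borel_representative[OF S]) (rule that; assumption)
  note vm [measurable] = v(1)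
  have vi: "integrable lborel v" using lebesgue_on_transfer(2)[OF S v] quot(1)[OF \<rho>li] by simp
  have uV: "AE z in lebesgue_on ?S. \<rho> (k n) z / m z = u n z powr (1 / k n)" for n
    using uae[of n] by eventually_elim (elim conjE, rule sym)
  have Vi: "integrable lborel (\<lambda>z. u n z powr (1 / k n))" for n
  proof -
    have "integrable (lebesgue_on ?S) (\<lambda>z. \<rho> (k n) z / m z) \<longleftrightarrow> integrable lborel (\<lambda>z. u n z powr (1 / k n))"
      by (rule lebesgue_on_transfer(2)[OF S _ _ uV]) (auto simp: uz)
    then show ?thesis using quot(1)[OF \<rho>i] by simp
  qed
  have Vle: "(\<integral>z. \<bar>u n z powr (1 / k n) - v z\<bar> \<partial>lborel) \<le> (LINT x|lebesgue_on ?S. \<bar>\<rho> (k n) x - \<rho>lim x\<bar>) / \<delta>" for n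
  proof -
    have "(LINT z|lebesgue_on ?S. \<bar>(\<rho> (k n) z - \<rho>lim z) / m z\<bar>) = (\<integral>z. \<bar>u n z powr (1 / k n) - v z\<bar> \<partial>lborel)"
    proof (rule lebesgue_on_transfer(1)[OF S])
      show "AE z in lebesgue_on ?S. \<bar>(\<rho> (k n) z - \<rho>lim z) / m z\<bar> = \<bar>u n z powr (1 / k n) - v z\<bar>"
        using uV[of n] v(3) by eventually_elim (simp add: diff_divide_distrib)
    qed (auto simp: uz v(2))
    moreover have "integrable (lebesgue_on ?S) (\<lambda>z. \<rho> (k n) z - \<rho>lim z)" using \<rho>i \<rho>li by auto
    ultimately show ?thesis using quot(2)[of "\<lambda>z. \<rho> (k n) z - \<rho>lim z"] by (simp only:)
  qed
  have lim: "(\<lambda>n. \<integral>z. \<bar>u n z powr (1 / k n) - v z\<bar> \<partial>lborel) \<longlonglongrightarrow> 0"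
  proof (rule tendsto_sandwich[OF _ _ tendsto_const])
    show "\<forall>\<^sub>F n in sequentially. 0 \<le> (\<integral>z. \<bar>u n z powr (1 / k n) - v z\<bar> \<partial>lborel)" by simp
    show "\<forall>\<^sub>F n in sequentially. (\<integral>z. \<bar>u n z powr (1 / k n) - v z\<bar> \<partial>lborel) \<le> (LINT x|lebesgue_on ?S. \<bar>\<rho> (k n) x - \<rho>lim x\<bar>) / \<delta>"
      using Vle by simp
    show "(\<lambda>n. (LINT x|lebesgue_on ?S. \<bar>\<rho> (k n) x - \<rho>lim x\<bar>) / \<delta>) \<longlonglongrightarrow> 0"
      using tendsto_divide[OF filterlim_compose[OF \<rho>t kt] tendsto_const[of \<delta>]] cs(4) by simp
  qed
  have "\<forall>n. \<exists>q. q \<in> borel_measurable borel \<and> (\<forall>z. z \<notin> ?S \<longrightarrow> q z = 0) \<and> (AE z in lebesgue_on ?S. p (k n) z = q z)"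
  proof
    fix n
    have "p (k n) \<in> borel_measurable (lebesgue_on ?S)" using p_i[of n] by auto
    then obtain q where "q \<in> borel_measurable borel" "\<And>z. z \<notin> ?S \<Longrightarrow> q z = 0" "AE z in lebesgue_on ?S. p (k n) z = q z"
      by (rule borel_representative[OF S]) (rule that; assumption)
    then show "\<exists>q. q \<in> borel_measurable borel \<and> (\<forall>z. z \<notin> ?S \<longrightarrow> q z = 0) \<and> (AE z in lebesgue_on ?S. p (k n) z = q z)"
      by blast
  qed
  from choice[OF this] obtain q where q0: "\<forall>n. q n \<in> borel_measurable borel \<and> (\<forall>z. z \<notin> ?S \<longrightarrow> q n z = 0) \<and> (AE z in lebesgue_on ?S. p (k n) z = q n z)" ..
  then have q: "\<And>n. q n \<in> borel_measurable borel" "\<And>n z. z \<notin> ?S \<Longrightarrow> q n z = 0" "\<And>n. AE z in lebesgue_on ?S. p (k n) z = q n z"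
    by blast+
  \<comment> \<open>The 1 is the L^1 distance to \<open>plim\<close> permitted by the choice of
    \<open>N\<close>.\<close>
  define P where "P = (LINT x|lebesgue_on ?S. \<bar>plim x\<bar>) + 1"
  have qi: "integrable lborel (q n)" for n using lebesgue_on_transfer(2)[OF S q] p_i by blast
  have qP: "(\<integral>z. q n z \<partial>lborel) \<le> P" for n
  proof -
    have "(\<integral>z. q n z \<partial>lborel) = (LINT x|lebesgue_on ?S. p (k n) x)" using lebesgue_on_transfer(1)[OF S q] by simp
    also have "\<dots> \<le> (LINT x|lebesgue_on ?S. \<bar>plim x\<bar> + \<bar>p (k n) x - plim x\<bar>)"
      using p_i[of n] pli by (intro integral_mono) auto
    also have "\<dots> = (LINT x|lebesgue_on ?S. \<bar>plim x\<bar>) + (LINT x|lebesgue_on ?S. \<bar>p (k n) x - plim x\<bar>)"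
      using p_i[of n] pli by simp
    also have "\<dots> \<le> P" unfolding P_def using p1[of n] by simp
    finally show ?thesis .
  qed
  \<comment> \<open>At almost every point of the slab one number \<open>w\<close>, the normalized
    density, determines \<open>u\<close>, its root and the pressure; outside the slab both
    \<open>u\<close> and the pressure are zero. All pointwise inequalities below reduce to this
    alternative.\<close>
  have pointwise: "AE z in lborel. (z \<notin> ?S \<and> u n z = 0 \<and> q n z = 0) \<or>
      (\<exists>w\<ge>0. u n z = w powr k n \<and> u n z powr (1 / k n) = w \<and> q n z = pressure (k n) w)" for n
  proof -
    have "AE z in lborel. z \<in> ?S \<longrightarrow> (\<rho> (k n) z \<ge> 0 \<and> u n z = (\<rho> (k n) z / m z) powr k n \<and> u n z powr (1 / k n) = \<rho> (k n) z / m z) \<and> p (k n) z = q n z"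
      by (rule AE_lebesgue_on_lborel[OF S]) (use uae[of n] q(3)[of n] in eventually_elim, blast)
    then show ?thesis
    proof eventually_elim
      case (elim z)
      show ?case
      proof (cases "z \<in> ?S")
        case True
        have e: "\<rho> (k n) z \<ge> 0" "u n z = (\<rho> (k n) z / m z) powr k n" "u n z powr (1 / k n) = \<rho> (k n) z / m z" "p (k n) z = q n z"
          using elim True by blast+
        have "0 \<le> \<rho> (k n) z / m z" using e(1) mp[OF True] by simp
        moreover have "q n z = pressure (k n) (\<rho> (k n) z / m z)" using pr[OF k1 True, of n] e(4) by simp
        ultimately show ?thesis using e(2,3) by blast
      qed (use uz q(2) in simp)
    qed
  qed
  have p0: "0 \<le> pressure (k n) w" for n w using k1[of n] by (simp add: pressure_def)
  have q_nonneg: "AE z in lborel. q n z \<ge> 0" for n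
    using pointwise[of n] by eventually_elim (use p0 in auto)
  have up: "AE z in lborel. \<epsilon> * ln (1 + u n z / \<epsilon>) \<le> \<epsilon> * ln (1 + 1 / \<epsilon>) + \<epsilon> * q n z" if \<epsilon>: "\<epsilon> > 0" for \<epsilon> n
    using pointwise[of n]
  proof eventually_elim
    case (elim z)
    then show ?case
    proof
      assume "z \<notin> ?S \<and> u n z = 0 \<and> q n z = 0"
      then show ?thesis using \<epsilon> by simp
    next
      assume "\<exists>w\<ge>0. u n z = w powr k n \<and> u n z powr (1 / k n) = w \<and> q n z = pressure (k n) w"
      then obtain w where w: "w \<ge> 0" "u n z = w powr k n" "q n z = pressure (k n) w" by blast
      show ?thesis unfolding w(2,3) by (rule log_le_pressure[OF k1 w(1) \<epsilon>])
    qed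
  qed
  \<comment> \<open>The excess of \<open>v\<close> over 1 is at most its distance to the
    approximating density plus 1/k times the pressure. Both have integrals tending to 0.\<close>
  have v1: "AE z in lborel. v z \<le> 1"
  proof -
    have mi: "integrable lborel (\<lambda>z. max 0 (v z - 1))"
    proof (rule Bochner_Integration.integrable_bound[OF vi])
      show "AE z in lborel. norm (max 0 (v z - 1)) \<le> norm (v z)" by (rule AE_I2) (auto simp: max_def)
    qed measurable
    have le: "(\<integral>z. max 0 (v z - 1) \<partial>lborel) \<le> (\<integral>z. \<bar>u n z powr (1 / k n) - v z\<bar> \<partial>lborel) + 1 / k n * P" for n
    proof -
      have "AE z in lborel. max 0 (v z - 1) \<le> \<bar>u n z powr (1 / k n) - v z\<bar> + 1 / k n * q n z"
        using pointwise[of n] q_nonneg[of n]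
      proof eventually_elim
        case (elim z)
        have "0 \<le> 1 / k n * q n z" using k0[of n] elim(2) by simp
        moreover have "u n z powr (1 / k n) - 1 \<le> 1 / k n * q n z"
          using elim(1)
        proof
          assume "z \<notin> ?S \<and> u n z = 0 \<and> q n z = 0"
          then show ?thesis by simp
        next
          assume "\<exists>w\<ge>0. u n z = w powr k n \<and> u n z powr (1 / k n) = w \<and> q n z = pressure (k n) w"
          then obtain w where w: "w \<ge> 0" "u n z powr (1 / k n) = w" "q n z = pressure (k n) w" by blast
          have "w - 1 \<le> 1 / k n * pressure (k n) w"
            unfolding k_def by (rule excess_le_pressure[OF _ w(1)]) (simp add: N0_def)
          then show ?thesis unfolding w(2,3) .
        qed
        ultimately show ?case by linarith
      qed
      then have "(\<integral>z. max 0 (v z - 1) \<partial>lborel) \<le> (\<integral>z. \<bar>u n z powr (1 / k n) - v z\<bar> + 1 / k n * q n z \<partial>lborel)"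
        using mi Vi[of n] vi qi[of n] by (intro integral_mono_AE) auto
      also have "\<dots> = (\<integral>z. \<bar>u n z powr (1 / k n) - v z\<bar> \<partial>lborel) + 1 / k n * (\<integral>z. q n z \<partial>lborel)"
        using Vi[of n] vi qi[of n] by (subst Bochner_Integration.integral_add) auto
      also have "\<dots> \<le> (\<integral>z. \<bar>u n z powr (1 / k n) - v z\<bar> \<partial>lborel) + 1 / k n * P"
        using k0[of n] qP[of n] by (intro add_left_mono mult_left_mono) auto
      finally show ?thesis .
    qed
    have "(\<lambda>n. (\<integral>z. \<bar>u n z powr (1 / k n) - v z\<bar> \<partial>lborel) + 1 / k n * P) \<longlonglongrightarrow> 0 + 0 * P"
      by (intro tendsto_intros lim \<kappa>)
    then have "(\<integral>z. max 0 (v z - 1) \<partial>lborel) \<le> 0"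
      using le by (intro LIMSEQ_le_const[of _ 0]) auto
    moreover have "0 \<le> (\<integral>z. max 0 (v z - 1) \<partial>lborel)" by simp
    ultimately have "(\<integral>z. max 0 (v z - 1) \<partial>lborel) = 0" by simp
    then have "AE z in lborel. max 0 (v z - 1) = 0"
      using integral_nonneg_eq_0_iff_AE[OF mi] by simp
    then show ?thesis by eventually_elim (simp add: max_def split: if_splits)
  qed
  show ?thesis
  proof (rule that[of v])
    show "AE z in lborel. z \<in> ?S \<longrightarrow> \<rho>lim z / m z = v z" by (rule AE_lebesgue_on_lborel[OF S v(3)])
    fix \<psi> :: "(real^'n) \<times> real \<Rightarrow> real"
    assume \<psi>: "\<psi> \<in> test_functions ?S" "\<And>z. \<psi> z \<ge> 0"
    obtain \<phi> where \<phi>: "\<phi> \<in> test_functions ?S" "\<And>z. \<phi> z \<ge> 0" "\<And>z e. \<phi> z * (drift m b z \<bullet> e) = \<psi> z * ((- b z, 1) \<bullet> e)"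
      by (rule transport_test_function[OF ca \<psi>]) (rule that; assumption)
    have "(\<integral>z. v z * (\<Sum>e\<in>Basis. pd e (\<lambda>y. \<phi> y * (drift m b y \<bullet> e)) z) \<partial>lborel) \<le> 0"
    proof (rule E.limit_inequality[where \<kappa> = "\<lambda>n. 1 / k n" and u = u and G = G and p = q and P = P])
      show "1 / k n \<le> 1" "0 < 1 / k n" for n using k1[of n] by simp_all
    qed (rule sol \<kappa> vi v1 Vi lim qi qP q_nonneg up \<phi>(1) \<phi>(2); assumption?)+
    then show "(\<integral>z. v z * (\<Sum>e\<in>Basis. pd e (\<lambda>y. \<psi> y * ((- b y, 1) \<bullet> e)) z) \<partial>lborel) \<le> 0"
      unfolding \<phi>(3) .
  qed (rule vi)
qed

section \<open>Monotonicity of the limit density along almost every streamline\<close>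

theorem lemma7p3:
  shows "\<exists>\<epsilon> :: real \<Rightarrow> real. (\<forall>\<delta>>0. \<epsilon> \<delta> > 0) \<and>
    (\<forall>(T :: real) (\<delta> :: real)
       (m :: (real^'n) \<times> real \<Rightarrow> real) (f :: (real^'n) \<times> real \<Rightarrow> real)
       (b :: (real^'n) \<times> real \<Rightarrow> real^'n)
       (\<rho>0 :: real \<Rightarrow> real^'n \<Rightarrow> real)
       (\<rho> :: real \<Rightarrow> (real^'n) \<times> real \<Rightarrow> real) (p :: real \<Rightarrow> (real^'n) \<times> real \<Rightarrow> real)
       (\<rho>lim :: (real^'n) \<times> real \<Rightarrow> real) (plim :: (real^'n) \<times> real \<Rightarrow> real)
       (vlim :: (real^'n) \<times> real \<Rightarrow> real)
       (X :: real \<Rightarrow> real^'n \<Rightarrow> real^'n).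
       T > 0 \<and>
       coefficient_assumption T \<delta> m f b \<and>
       initial_data_assumption m \<rho>0 \<and>
       hard_constraint_restriction T (\<epsilon> \<delta>) m \<and>
       congestion_condition T m f b \<and>
       (\<forall>k>1. weak_solution T m f b k (\<rho>0 k) (\<rho> k)) \<and>
       (\<forall>k>1. \<forall>z\<in>QT T. p k z = pressure k (\<rho> k z / m z)) \<and>
       L1_limit_on (QT T) \<rho> \<rho>lim \<and>
       L1_limit_on (QT T) p plim \<and>
       (\<forall>z\<in>QT T. vlim z = \<rho>lim z / m z) \<and>
       streamlines T b X
       \<longrightarrow> (AE x0 in lebesgue. AE (t1, t2) in lebesgue.
              0 < t1 \<and> t1 < t2 \<and> t2 < T \<longrightarrow> vlim (X t1 x0, t1) \<le> vlim (X t2 x0, t2)))"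
proof (intro exI[of _ "\<lambda>_. 1"] conjI allI impI)
  fix T \<delta> :: real and m f :: "(real^'n) \<times> real \<Rightarrow> real" and b :: "(real^'n) \<times> real \<Rightarrow> real^'n"
    and \<rho>0 :: "real \<Rightarrow> real^'n \<Rightarrow> real" and \<rho> p :: "real \<Rightarrow> (real^'n) \<times> real \<Rightarrow> real"
    and \<rho>lim plim vlim :: "(real^'n) \<times> real \<Rightarrow> real" and X :: "real \<Rightarrow> real^'n \<Rightarrow> real^'n"
  assume a: "T > 0 \<and> coefficient_assumption T \<delta> m f b \<and> initial_data_assumption m \<rho>0 \<and>
       hard_constraint_restriction T 1 m \<and> congestion_condition T m f b \<and>
       (\<forall>k>1. weak_solution T m f b k (\<rho>0 k) (\<rho> k)) \<and>
       (\<forall>k>1. \<forall>z\<in>QT T. p k z = pressure k (\<rho> k z / m z)) \<and>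
       L1_limit_on (QT T) \<rho> \<rho>lim \<and> L1_limit_on (QT T) p plim \<and>
       (\<forall>z\<in>QT T. vlim z = \<rho>lim z / m z) \<and> streamlines T b X"
  have T: "T > 0" and ca: "coefficient_assumption T \<delta> m f b" and cc: "congestion_condition T m f b"
    and ws: "\<And>k. k > 1 \<Longrightarrow> weak_solution T m f b k (\<rho>0 k) (\<rho> k)"
    and pr: "\<And>k z. k > 1 \<Longrightarrow> z \<in> QT T \<Longrightarrow> p k z = pressure k (\<rho> k z / m z)"
    and \<rho>lim: "L1_limit_on (QT T) \<rho> \<rho>lim" and plim: "L1_limit_on (QT T) p plim"
    and vlim: "\<And>z. z \<in> QT T \<Longrightarrow> vlim z = \<rho>lim z / m z" and sl: "streamlines T b X"
    using a by blast+
  note cs = coefficient_smooth[OF ca]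
  obtain v where vi: "integrable lborel v" and ve: "AE z in lborel. z \<in> QT T \<longrightarrow> \<rho>lim z / m z = v z"
    and ineq: "\<And>\<psi>. \<psi> \<in> test_functions (QT T) \<Longrightarrow> (\<And>z. \<psi> z \<ge> 0) \<Longrightarrow>
       (\<integral>z. v z * (\<Sum>e\<in>Basis. pd e (\<lambda>y. \<psi> y * ((- b y, 1) \<bullet> e)) z) \<partial>lborel) \<le> 0"
  proof (rule limit_transport_inequality[OF ca cc ws pr \<rho>lim plim])
    fix v assume 1: "integrable lborel v" and 2: "AE z in lborel. z \<in> QT T \<longrightarrow> \<rho>lim z / m z = v z"
      and 3: "\<And>\<psi>. \<psi> \<in> test_functions (QT T) \<Longrightarrow> (\<And>z. \<psi> z \<ge> 0) \<Longrightarrow>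
       (\<integral>z. v z * (\<Sum>e\<in>Basis. pd e (\<lambda>y. \<psi> y * ((- b y, 1) \<bullet> e)) z) \<partial>lborel) \<le> 0"
    show thesis by (rule that[OF 1 2]) (rule 3; blast)
  qed
  obtain L M where LM: "L \<ge> 0" "M \<ge> 0" "\<And>z. z \<in> QT T \<Longrightarrow> norm (b z) \<le> M"
    "\<And>z w. z \<in> QT T \<Longrightarrow> w \<in> QT T \<Longrightarrow> norm (b z - b w) \<le> L * norm (z - w)"
    by (rule bounded_derivs_lipschitz[OF cs(3,6)]) (rule that; assumption)
  interpret regular_flow T L M b X
  proof
    fix t x y assume "0 < t" "t < T"
    then show "norm (b (x, t) - b (y, t)) \<le> L * norm (x - y)"
      using LM(4)[of "(x, t)" "(y, t)"] by (simp add: QT_def norm_Pair)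
  qed (use sl LM T in auto)
  \<comment> \<open>The inequality is known for the Borel representative \<open>v\<close>; off this
    null set it coincides with the given quotient, and almost every streamline meets the null set
    only at a null set of times.\<close>
  obtain N where N: "N \<in> null_sets lborel" "{z. \<not> (z \<in> QT T \<longrightarrow> \<rho>lim z / m z = v z)} \<subseteq> N"
    using ve unfolding eventually_ae_filter by auto
  have mono: "AE x in lborel. \<exists>P. (AE t in lborel. P t) \<and>
     (\<forall>t1 t2. P t1 \<longrightarrow> P t2 \<longrightarrow> 0 < t1 \<longrightarrow> t1 < t2 \<longrightarrow> t2 < T \<longrightarrow> v (X t1 x, t1) \<le> v (X t2 x, t2))"
    by (rule monotone_along_flow[OF smooth_velocity[OF cs(3)] smooth_on_continuous[OF cs(3)] vi ineq])
  have "AE x in lborel. AE (t1, t2) in lebesgue.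
              0 < t1 \<and> t1 < t2 \<and> t2 < T \<longrightarrow> vlim (X t1 x, t1) \<le> vlim (X t2 x, t2)"
    using flow_avoids_null[OF N(1)] mono
  proof eventually_elim
    case (elim x)
    then obtain P where P: "AE t in lborel. P t"
      "\<And>t1 t2. P t1 \<Longrightarrow> P t2 \<Longrightarrow> 0 < t1 \<Longrightarrow> t1 < t2 \<Longrightarrow> t2 < T \<Longrightarrow> v (X t1 x, t1) \<le> v (X t2 x, t2)"
      by blast
    have e: "vlim (X t x, t) = v (X t x, t)" if "t \<in> {0<..<T} \<longrightarrow> (X t x, t) \<notin> N" "0 < t" "t < T" for t
    proof -
      have "(X t x, t) \<in> QT T" using that by (simp add: QT_def)
      then show ?thesis using vlim N(2) that by auto
    qed
    \<comment> \<open>One set of good times serves for \<open>t1\<close> and \<open>t2\<close>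
      alike, which gives the claim for almost every pair.\<close>
    have "AE t in lborel. P t \<and> (t \<in> {0<..<T} \<longrightarrow> (X t x, t) \<notin> N)"
      using P(1) elim(1) by eventually_elim simp
    from AE_lebesgue_pairI[OF this] show ?case
    proof (eventually_elim, clarify)
      fix t1 t2 :: real assume t: "0 < t1" "t1 < t2" "t2 < T" and "P t1" "P t2"
        and 1: "t1 \<in> {0<..<T} \<longrightarrow> (X t1 x, t1) \<notin> N" and 2: "t2 \<in> {0<..<T} \<longrightarrow> (X t2 x, t2) \<notin> N"
      then show "vlim (X t1 x, t1) \<le> vlim (X t2 x, t2)"
        using P(2)[of t1 t2] e[OF 1] e[OF 2] by simp
    qed
  qed
  then show "AE x in lebesgue. AE (t1, t2) in lebesgue.
              0 < t1 \<and> t1 < t2 \<and> t2 < T \<longrightarrow> vlim (X t1 x, t1) \<le> vlim (X t2 x, t2)"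
    by (rule AE_completion)
qed simp

end
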